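(* Let $s\in(0,1)$, let $\Omega\subset\mathbb{R}^n$ be a $C^{1,1}$ domain, and let $L$ be a stable operator of order $2s$ on $\mathbb{R}^n$ with ellipticity constants $0<\lambda\le\Lambda<\infty$. Let $u$ be a weak solution to $$\begin{cases}\partial_tu-Lu=f&\text{in }(-1,0)\times(\Omega\cap B_1)\\ u=0&\text{in }(-1,0)\times(B_1\setminus\Omega).\end{cases}$$ Then $$\|u\|_{C^{\frac12,s}_{t,x}\left(\left(-\frac12,0\right)\times B_{1/2}\right)}\le C\left(\|f\|_{L^\infty((-1,0)\times(\Omega\cap B_1))}+\|u\|_{L^\infty((-1,0)\times\mathbb{R}^n)}\right),$$ where $C$ depends only on $n$, $s$, $\Omega$, $\lambda$ and $\Lambda$.
   Context: $B_r\subset\mathbb{R}^n$ is the ball of radius $r$ centred at the origin. A stable operator of order $2s$ with ellipticity constants $0<\lambda\le\Lambda<\infty$ is an operator of the form $$Lw(t,x)=\int_{S^{n-1}}\int_{-\infty}^{\infty}\bigl(w(t,x+\theta r)+w(t,x-\theta r)-2w(t,x)\bigr)\frac{dr}{|r|^{1+2s}}\,d\mu(\theta),$$ where the spectral measure $\mu$ is a nonnegative measure on $S^{n-1}$ (possibly singular) with $$\lambda\le\inf_{\nu\in S^{n-1}}\int_{S^{n-1}}|\nu\cdot\theta|^{2s}\,d\mu(\theta),\qquad \int_{S^{n-1}}d\mu\le\Lambda .$$ Weak solution: $\partial_tu-Lu=f$ in $I\times D$ means $\int_{I\times\mathbb{R}^n}u(-\partial_t\eta-L\eta)\,dx\,dt=\int_{I\times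 D}f\eta\,dx\,dt$ for all $\eta\in C_c^\infty(I\times D)$. Regularity of $u$ is understood after modification on a null set. Norm: for $\alpha,\beta\in(0,1)$, $\|u\|_{C^{\beta,\alpha}_{t,x}(I\times D)}=\|u\|_{L^\infty(I\times D)}+\sup\frac{|u(t,x)-u(t',x')|}{|t-t'|^\beta+|x-x'|^\alpha}$, the supremum over distinct points $(t,x),(t',x')\in I\times D$. *)

theory Defs
  imports "HOL-Probability.Probability"
begin

text \<open>
  Functions of time and space are functions on \<^typ>\<open>real \<times> 'a\<close>, with points \<^term>\<open>(t, x)\<close>.
  A function that is only given on a set \<open>S\<close> is represented by a total function whose values
  outside \<open>S\<close> play no role; measurability, almost-everywhere statements and integrals
  refer to the Lebesgue measure restricted to \<open>S\<close>.
\<close>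

subsection \<open>Domains of class \<open>C\<^sup>1\<^sup>,\<^sup>1\<close>\<close>

definition C11_function :: "('a::euclidean_space \<Rightarrow> real) \<Rightarrow> bool" where
  "C11_function \<gamma> \<longleftrightarrow>
     (\<exists>G K. (\<forall>y. (\<gamma> has_derivative (\<lambda>h. G y \<bullet> h)) (at y)) \<and> K-lipschitz_on UNIV G)"

text \<open>
  In a neighbourhood of every boundary point, the domain is the part lying above the graph of a
  \<open>C\<^sup>1\<^sup>,\<^sup>1\<close> function in some orthonormal frame. The unit vector \<open>e\<close> is the vertical direction and
  \<^term>\<open>x - (x \<bullet> e) *\<^sub>R e\<close> is the horizontal part of \<open>x\<close>, so only the values of \<open>\<gamma>\<close> on the
  hyperplane orthogonal to \<open>e\<close> matter.
\<close>

definition C11_domain :: "'a::euclidean_space set \<Rightarrow> bool" where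
  "C11_domain \<Omega> \<longleftrightarrow>
     open \<Omega> \<and> connected \<Omega> \<and> \<Omega> \<noteq> {} \<and>
     (\<forall>x0 \<in> frontier \<Omega>. \<exists>r > 0. \<exists>e \<gamma>. norm e = 1 \<and> C11_function \<gamma> \<and>
        \<Omega> \<inter> ball x0 r = {x \<in> ball x0 r. x \<bullet> e > \<gamma> (x - (x \<bullet> e) *\<^sub>R e)})"

subsection \<open>Stable operators\<close>

definition spectral_measure ::
    "real \<Rightarrow> real \<Rightarrow> real \<Rightarrow> 'a::euclidean_space measure \<Rightarrow> bool" where
  "spectral_measure s lam Lam \<mu> \<longleftrightarrow>
     sets \<mu> = sets (restrict_space borel (sphere 0 1)) \<and>
     emeasure \<mu> (sphere 0 1) \<le> ennreal Lam \<and>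
     lam \<le> (INF \<nu> \<in> sphere 0 1. \<integral>\<theta>. \<bar>\<nu> \<bullet> \<theta>\<bar> powr (2 * s) \<partial>\<mu>)"

definition stable_operator ::
    "real \<Rightarrow> 'a::euclidean_space measure \<Rightarrow> (real \<times> 'a \<Rightarrow> real) \<Rightarrow> real \<times> 'a \<Rightarrow> real" where
  "stable_operator s \<mu> w = (\<lambda>(t, x).
     \<integral>\<theta>. (\<integral>r. (w (t, x + r *\<^sub>R \<theta>) + w (t, x - r *\<^sub>R \<theta>) - 2 * w (t, x)) / \<bar>r\<bar> powr (1 + 2 * s)
        \<partial>lborel) \<partial>\<mu>)"

subsection \<open>Weak solutions\<close>

primrec C_k :: "nat \<Rightarrow> ('b::euclidean_space \<Rightarrow> real) \<Rightarrow> bool" where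
  "C_k 0 g \<longleftrightarrow> continuous_on UNIV g"
| "C_k (Suc k) g \<longleftrightarrow>
     (\<forall>z. g differentiable (at z)) \<and> (\<forall>v. C_k k (\<lambda>z. frechet_derivative g (at z) v))"

definition test_function :: "'b::euclidean_space set \<Rightarrow> ('b \<Rightarrow> real) \<Rightarrow> bool" where
  "test_function U \<eta> \<longleftrightarrow>
     (\<forall>k. C_k k \<eta>) \<and> compact (closure {z. \<eta> z \<noteq> 0}) \<and> closure {z. \<eta> z \<noteq> 0} \<subseteq> U"

definition time_deriv :: "(real \<times> 'a \<Rightarrow> real) \<Rightarrow> real \<times> 'a \<Rightarrow> real" where
  "time_deriv \<eta> = (\<lambda>(t, x). deriv (\<lambda>\<tau>. \<eta> (\<tau>, x)) t)"

text \<open>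
  Weak solutions of \<open>\<partial>\<^sub>t u - L u = f\<close> in \<open>I \<times> D\<close>. That the two integrals exist is part of the
  definition, because the integral of a non-integrable function is \<open>0\<close> by convention; it is
  automatic when \<open>u\<close> and \<open>f\<close> are bounded.
\<close>

definition weak_solution ::
    "real \<Rightarrow> 'a::euclidean_space measure \<Rightarrow> real set \<Rightarrow> 'a set \<Rightarrow>
     (real \<times> 'a \<Rightarrow> real) \<Rightarrow> (real \<times> 'a \<Rightarrow> real) \<Rightarrow> bool" where
  "weak_solution s \<mu> I D u f \<longleftrightarrow>
     u \<in> borel_measurable (lebesgue_on (I \<times> UNIV)) \<and>
     f \<in> borel_measurable (lebesgue_on (I \<times> D)) \<and>
     (\<forall>\<eta>. test_function (I \<times> D) \<eta> \<longrightarrow>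
        integrable (lebesgue_on (I \<times> UNIV))
          (\<lambda>z. u z * (- time_deriv \<eta> z - stable_operator s \<mu> \<eta> z)) \<and>
        integrable (lebesgue_on (I \<times> D)) (\<lambda>z. f z * \<eta> z) \<and>
        (\<integral>z. u z * (- time_deriv \<eta> z - stable_operator s \<mu> \<eta> z) \<partial>lebesgue_on (I \<times> UNIV))
          = (\<integral>z. f z * \<eta> z \<partial>lebesgue_on (I \<times> D)))"

subsection \<open>Norms\<close>

text \<open>Norms take values in \<open>[0, \<infinity>]\<close>.\<close>

definition Linfty_norm :: "'b::euclidean_space set \<Rightarrow> ('b \<Rightarrow> real) \<Rightarrow> ennreal" where
  "Linfty_norm S g = esssup (lebesgue_on S) (\<lambda>z. ennreal \<bar>g z\<bar>)"

definition Hoelder_seminorm ::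
    "real \<Rightarrow> real \<Rightarrow> (real \<times> 'a::euclidean_space) set \<Rightarrow> (real \<times> 'a \<Rightarrow> real) \<Rightarrow> ennreal" where
  "Hoelder_seminorm \<beta> \<alpha> Q u =
     (SUP (p, q) \<in> {(p, q). p \<in> Q \<and> q \<in> Q \<and> p \<noteq> q}.
        ennreal (\<bar>u p - u q\<bar> /
          (\<bar>fst p - fst q\<bar> powr \<beta> + norm (snd p - snd q) powr \<alpha>)))"

definition Hoelder_norm ::
    "real \<Rightarrow> real \<Rightarrow> (real \<times> 'a::euclidean_space) set \<Rightarrow> (real \<times> 'a \<Rightarrow> real) \<Rightarrow> ennreal" where
  "Hoelder_norm \<beta> \<alpha> Q u = Linfty_norm Q u + Hoelder_seminorm \<beta> \<alpha> Q u"

end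

theory Submission
  imports Defs "HOL-Real_Asymp.Real_Asymp"
begin

text \<open>
  After normalisation \<open>u\<close> and \<open>f\<close> are bounded by \<open>1\<close>. The mollified solution satisfies the equation
  pointwise up to an error of size \<open>1\<close>, so it can be compared with barriers: where it touches a
  barrier, its second differences in every direction are at most those of the barrier, and
  integration over the directions charged by \<open>\<mu>\<close> contradicts the equation. Nothing is lost if the
  mollification parameter tends to \<open>0\<close>.

  At the boundary, the jumps leaving \<open>\<Omega>\<close> first force \<open>u\<close> to vanish there. If \<open>g\<close> defines the
  boundary, the barrier \<open>g\<^sup>s - g\<^sup>p\<close> with \<open>p\<close> slightly larger than \<open>s\<close> then gives \<open>|u| \<le> A g\<^sup>s\<close>:
  along every line the fractional Laplacian of order \<open>2s\<close> annihilates the one-sided power with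
  exponent \<open>s\<close> and is positive on the one with exponent \<open>p\<close>. In space, \<open>u(t, x) - u(t, y)\<close> is compared
  with \<open>M \<phi>(x - y)\<close>, where \<open>\<phi>\<close> is comparable to \<open>|z|\<^sup>s\<close> and, at every point, concave in one of \<open>n\<close>
  independent directions charged by \<open>\<mu>\<close>; the jumps at \<open>x\<close> and \<open>y\<close> are coupled so that only these
  directions matter. In time, regularity in space bounds \<open>u(t\<^sub>0, x)\<close> by \<open>u(t\<^sub>0, x\<^sub>0)\<close> plus a
  regularised multiple of \<open>|x - x\<^sub>0|\<^sup>s\<close>, which serves as initial datum of a barrier growing linearly
  in time.
\<close>

subsection \<open>Elementary inequalities for powers\<close>

text \<open>The spectral measure may be singular, so no pointwise kernel bound is available:
  estimates are one-dimensional integrals along lines, integrated over directions, and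
  \<open>\<mu>\<close> enters the constants only through \<open>lam\<close> and \<open>Lam\<close>.
  The mollified function satisfies the equation at a point only if the ball of radius
  \<open>e\<close> around it stays in the domain. Each comparison therefore has to exclude touching
  points within \<open>e\<close> of the complement. For the barrier this takes smallness of the
  solution near the boundary, hence the vanishing without rate that precedes it; the two later
  comparisons use the rate that the barrier provides. The exponent \<open>p\<close> is close to
  \<open>s\<close> because the curvature of the boundary costs a term of order
  \<open>a powr - \<sigma>\<close> with \<open>\<sigma> = p - s\<close>, while the gain is of order
  \<open>a powr (\<sigma> - s)\<close>. The time exponent comes from scaling: regularising the power
  at scale \<open>\<rho>\<close> costs \<open>\<rho> powr s\<close> and bounds its image under the
  operator by a multiple of \<open>\<rho> powr (- s)\<close>; over a time \<open>h\<close> the two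
  balance when \<open>\<rho> powr (2 * s) = h\<close>, both giving
  \<open>h powr (1/2)\<close>.\<close>

lemma powr_le_affine:
  fixes x q :: real
  assumes "0 \<le> x" "0 \<le> q" "q \<le> 1"
  shows "x powr q \<le> 1 + q * (x - 1)"
proof (cases "x = 0")
  case False
  \<comment> \<open>Convexity of \<open>exp\<close> at the points 0 and \<open>ln x\<close> with
    weights \<open>1 - q\<close> and \<open>q\<close>.\<close>
  have "exp ((1 - q) * 0 + q * ln x) \<le> (1 - q) * exp 0 + q * exp (ln x)"
    using exp_convex[unfolded convex_on_def] assms
    by (metis UNIV_I diff_add_cancel diff_ge_0_iff_ge real_scaleR_def)
  then show ?thesis using False assms by (simp add: powr_def algebra_simps)
qed (use assms in auto)

text \<open>The shares of \<open>x\<close> and \<open>y\<close> in the total lie in [0, 1] and add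
  up to 1, and a number in [0, 1] is at most its power with an exponent at most 1.\<close>

lemma powr_add_le:
  fixes x y p :: real
  assumes "0 \<le> x" "0 \<le> y" "0 \<le> p" "p \<le> 1"
  shows "(x + y) powr p \<le> x powr p + y powr p"
proof (cases "x + y = 0")
  case True
  then show ?thesis by (simp add: True)
next
  case False
  then have pos: "x + y > 0" using assms by auto
  have *: "z / (x + y) \<le> (z / (x+y)) powr p" if "0 \<le> z" "z \<le> x + y" for z
  proof (cases "z = 0")
    case False
    have "(z / (x+y)) powr 1 \<le> (z / (x+y)) powr p"
      by (rule powr_mono') (use that assms pos in auto)
    then show ?thesis using that pos by auto
  qed auto
  have "1 = x / (x + y) + y / (x + y)" using pos by (simp add: add_divide_distrib[symmetric])
  also have "\<dots> \<le> (x / (x+y)) powr p + (y / (x+y)) powr p"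
    using *[of x] *[of y] assms by auto
  also have "\<dots> = (x powr p + y powr p) / (x + y) powr p"
    using assms by (simp add: powr_divide add_divide_distrib)
  finally show ?thesis using pos by (simp add: field_simps)
qed

lemma powr_add_le_tangent:
  fixes x d q :: real
  assumes "0 < x" "- x \<le> d" "0 \<le> q" "q \<le> 1"
  shows "(x + d) powr q \<le> x powr q + q * x powr (q - 1) * d"
proof -
  have "(x + d) powr q = x powr q * ((x + d) / x) powr q"
    using assms by (simp add: powr_divide)
  also have "\<dots> \<le> x powr q * (1 + q * ((x + d) / x - 1))"
    by (intro mult_left_mono powr_le_affine) (use assms in auto)
  also have "\<dots> = x powr q + q * x powr (q - 1) * d"
    using assms by (simp add: powr_diff field_simps)
  finally show ?thesis .
qed

text \<open>Concavity with the sharp constant: \<open>q * (1 - q)\<close> is the second-order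
  coefficient at 0. The deficit \<open>f\<close> vanishes at 0 and has derivative
  \<open>q * h\<close>; in turn \<open>h\<close> vanishes at 0 and increases, because
  \<open>A * B \<ge> 1\<close> forces \<open>A + B \<ge> 2\<close>.\<close>

lemma powr_symmetric_sum_le:
  fixes q t :: real
  assumes q: "0 < q" "q < 1" and t: "\<bar>t\<bar> \<le> 1"
  shows "(1 + t) powr q + (1 - t) powr q \<le> 2 - q * (1 - q) * t\<^sup>2"
proof -
  have main: "(1 + t) powr q + (1 - t) powr q \<le> 2 - q * (1 - q) * t\<^sup>2" if t: "0 \<le> t" "t < 1" for t
  proof -
    define c where "c = 1 - q"
    have c: "0 < c" "c < 1" using q by (auto simp: c_def)
    define h where "h = (\<lambda>t::real. (1 - t) powr (-c) - (1 + t) powr (-c) - 2 * c * t)"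
    have h: "h t \<ge> 0" if "0 \<le> t" "t < 1" for t
    proof -
      have "\<exists>y. DERIV h x :> y \<and> 0 \<le> y" if "0 \<le> x" "x \<le> t" for x
      proof (intro exI conjI)
        have x: "x < 1" "x \<ge> 0" using that \<open>t < 1\<close> by auto
        show "DERIV h x :> c * (1 - x) powr (-c-1) + c * (1 + x) powr (-c-1) - 2 * c"
          unfolding h_def using x by (auto intro!: derivative_eq_intros)
        define A where "A = (1 - x) powr (-c-1)"
        define B where "B = (1 + x) powr (-c-1)"
        have "A * B = (1 - x\<^sup>2) powr (-c-1)"
          unfolding A_def B_def using x by (simp add: powr_mult[symmetric] power2_eq_square algebra_simps)
        also have "\<dots> \<ge> 1"
        proof -
          have "x\<^sup>2 < 1" using x by (simp add: power2_less_1_iff abs_if)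
          then have "(1 - x\<^sup>2) powr 0 \<le> (1 - x\<^sup>2) powr (-c-1)"
            by (intro powr_mono') (use c in auto)
          then show ?thesis using \<open>x\<^sup>2 < 1\<close> by simp
        qed
        finally have AB: "A * B \<ge> 1" .
        have "A > 0" "B > 0" using x by (auto simp: A_def B_def)
        have "(A + B)\<^sup>2 \<ge> 4 * (A * B)"
          using zero_le_power2[of "A - B"] by (simp add: power2_eq_square algebra_simps)
        then have "(A + B)\<^sup>2 \<ge> 2\<^sup>2" using AB by auto
        then have "A + B \<ge> 2" using \<open>A > 0\<close> \<open>B > 0\<close> by (smt (verit) power2_le_imp_le)
        then have "c * (A + B) \<ge> c * 2" using c by (intro mult_left_mono) auto
        then show "0 \<le> c * (1 - x) powr (-c-1) + c * (1 + x) powr (-c-1) - 2 * c"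
          by (simp add: A_def B_def algebra_simps)
      qed
      then have "h 0 \<le> h t" by (rule DERIV_nonneg_imp_nondecreasing[OF \<open>0 \<le> t\<close>])
      then show ?thesis by (simp add: h_def)
    qed
    define f where "f = (\<lambda>t::real. 2 - q * (1 - q) * t\<^sup>2 - (1 + t) powr q - (1 - t) powr q)"
    have "\<exists>y. DERIV f x :> y \<and> 0 \<le> y" if "0 \<le> x" "x \<le> t" for x
    proof (intro exI conjI)
      have x: "x < 1" "x \<ge> 0" using that \<open>t < 1\<close> by auto
      show "DERIV f x :> - 2 * q * (1 - q) * x - q * (1 + x) powr (q - 1) + q * (1 - x) powr (q - 1)"
        unfolding f_def using x by (auto intro!: derivative_eq_intros simp: algebra_simps)
      have "0 \<le> q * h x" using h[of x] x q by auto
      then show "0 \<le> - 2 * q * (1 - q) * x - q * (1 + x) powr (q - 1) + q * (1 - x) powr (q - 1)"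
        by (simp add: h_def c_def algebra_simps)
    qed
    then have "f 0 \<le> f t" by (rule DERIV_nonneg_imp_nondecreasing[OF \<open>0 \<le> t\<close>])
    then show ?thesis by (simp add: f_def)
  qed
  \<comment> \<open>At 1 the power of \<open>1 - t\<close> is not differentiable; the inequality is
    carried there as a limit from the left.\<close>
  have main1: "2 powr q \<le> 2 - q * (1 - q)"
  proof (rule tendsto_le[OF trivial_limit_at_left_real[of 1]])
    show "((\<lambda>t. 2 - q * (1 - q) * t\<^sup>2) \<longlongrightarrow> 2 - q * (1 - q)) (at_left 1)"
      by (auto intro!: tendsto_eq_intros)
    have "((\<lambda>t. (1 + t) powr q + (1 - t) powr q) \<longlongrightarrow> (1+1) powr q + 0) (at_left 1)"
      by (intro tendsto_intros tendsto_add) (use q in \<open>auto intro!: tendsto_eq_intros simp: eventually_at_filter\<close>)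
    then show "((\<lambda>t. (1 + t) powr q + (1 - t) powr q) \<longlongrightarrow> 2 powr q) (at_left 1)" by simp
    have "\<forall>\<^sub>F t::real in at_left 1. t > 0" by (simp add: eventually_at_left_field) (use zero_less_one in blast)
    then show "\<forall>\<^sub>F t in at_left 1. (1 + t) powr q + (1 - t) powr q \<le> 2 - q * (1 - q) * t\<^sup>2"
      by (auto simp: eventually_at_filter elim!: eventually_mono intro!: main)
  qed
  have "(1 + \<bar>t\<bar>) powr q + (1 - \<bar>t\<bar>) powr q \<le> 2 - q * (1 - q) * \<bar>t\<bar>\<^sup>2"
    using main[of "\<bar>t\<bar>"] main1 t by (cases "\<bar>t\<bar> = 1") auto
  then show ?thesis by (auto simp: abs_if split: if_splits)
qed

text \<open>The arithmetic mean of the two powers is at least their geometric mean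
  \<open>(1 - r\<^sup>2) powr (p/2)\<close>, which is at least \<open>1 - r\<^sup>2\<close> because
  the base lies in [0, 1].\<close>

lemma powr_symmetric_sum_ge:
  fixes p r :: real
  assumes p: "0 < p" "p \<le> 1" and r: "0 \<le> r" "r \<le> 1"
  shows "(1 + r) powr p + (1 - r) powr p \<ge> 2 - 2 * r\<^sup>2"
proof (cases "r = 1")
  case False
  then have r1: "r < 1" using r by auto
  define X where "X = (1 + r) powr (p/2)"
  define Y where "Y = (1 - r) powr (p/2)"
  have "X * Y = (1 - r\<^sup>2) powr (p/2)"
    unfolding X_def Y_def using r r1 by (simp add: powr_mult[symmetric] power2_eq_square algebra_simps)
  also have "\<dots> \<ge> (1 - r\<^sup>2) powr 1"
    by (intro powr_mono') (use r r1 p in \<open>auto simp: power_le_one\<close>)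
  finally have XY: "X * Y \<ge> 1 - r\<^sup>2" using r by (simp add: power_le_one)
  have "X\<^sup>2 + Y\<^sup>2 \<ge> 2 * (X * Y)" using zero_le_power2[of "X - Y"] by (simp add: power2_eq_square algebra_simps)
  moreover have "X\<^sup>2 = (1 + r) powr p" "Y\<^sup>2 = (1 - r) powr p"
    unfolding X_def Y_def power2_eq_square by (simp_all flip: powr_add)
  ultimately show ?thesis using XY by auto
qed (use p in auto)

subsection \<open>Integrals of powers\<close>

lemma has_bochner_integral_indicator_nonneg:
  fixes f :: "real \<Rightarrow> real"
  assumes "f \<in> borel_measurable borel" "S \<in> sets borel" "\<And>x. x \<in> S \<Longrightarrow> 0 \<le> f x" "(f has_integral I) S"
  shows "has_bochner_integral lborel (\<lambda>x. indicator S x * f x) I"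
proof (rule has_bochner_integral_nn_integral)
  show "(\<lambda>x. indicator S x * f x) \<in> borel_measurable lborel" using assms by simp
  show "AE x in lborel. 0 \<le> indicator S x * f x" using assms by (auto simp: indicator_def)
  show "0 \<le> I" using assms has_integral_nonneg by blast
  show "(\<integral>\<^sup>+ x. ennreal (indicator S x * f x) \<partial>lborel) = ennreal I"
    using nn_integral_has_integral_lebesgue[of S f I] assms by auto
qed

lemma has_bochner_integral_powr_0:
  fixes e R :: real
  assumes "e > -1" "0 < R"
  shows "has_bochner_integral lborel (\<lambda>r. indicator {0<..<R} r * (r::real) powr e) (R powr (e + 1) / (e + 1))"
proof (rule has_bochner_integral_indicator_nonneg)
  have "((\<lambda>x. x powr e) has_integral (R powr (e + 1) / (e + 1))) {0..R}"
    using has_integral_powr_from_0[of e R] assms by auto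
  then show "((\<lambda>x. x powr e) has_integral (R powr (e + 1) / (e + 1))) {0<..<R}"
    by (simp add: has_integral_Icc_iff_Ioo)
qed auto

lemma has_bochner_integral_powr_inf:
  fixes e R :: real
  assumes "e < -1" "0 < R"
  shows "has_bochner_integral lborel (\<lambda>r. indicator {R..} r * (r::real) powr e) (R powr (e + 1) / (- e - 1))"
proof (rule has_bochner_integral_indicator_nonneg)
  have "((\<lambda>x. x powr e) has_integral (- (R powr (e + 1)) / (e + 1))) {R..}"
    using has_integral_powr_to_inf[of e R] assms by auto
  moreover have "- (R powr (e + 1)) / (e + 1) = R powr (e + 1) / (- e - 1)"
    using assms by (simp add: field_simps)
  ultimately show "((\<lambda>x. x powr e) has_integral (R powr (e + 1) / (- e - 1))) {R..}" by simp
qed auto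

subsection \<open>The fractional Laplacian of a one-sided power\<close>

text \<open>Second difference with step \<open>r \<ge> 0\<close>, at the point 1, of the one-sided
  power that is 0 on the negative half-line.\<close>

definition pow_diff :: "real \<Rightarrow> real \<Rightarrow> real" where
  "pow_diff p r = (1 + r) powr p + (max 0 (1 - r)) powr p - 2"

lemma pow_diff_bounds:
  assumes "0 < p" "p \<le> 1" "0 \<le> r"
  shows "r \<le> 1 \<Longrightarrow> pow_diff p r \<le> 0" "r \<le> 1 \<Longrightarrow> - (2 * r\<^sup>2) \<le> pow_diff p r"
    "1 \<le> r \<Longrightarrow> pow_diff p r \<le> r powr p" "- 2 \<le> pow_diff p r"
proof -
  show "r \<le> 1 \<Longrightarrow> pow_diff p r \<le> 0"
    unfolding pow_diff_def using powr_le_affine[of "1+r" p] powr_le_affine[of "1-r" p] assms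
    by (auto simp: algebra_simps)
  show "r \<le> 1 \<Longrightarrow> - (2 * r\<^sup>2) \<le> pow_diff p r"
    unfolding pow_diff_def using powr_symmetric_sum_ge[of p r] assms by auto
  show "1 \<le> r \<Longrightarrow> pow_diff p r \<le> r powr p"
    unfolding pow_diff_def using powr_add_le[of 1 r p] assms by auto
  show "- 2 \<le> pow_diff p r" unfolding pow_diff_def by auto
qed

lemma pow_diff_measurable [measurable]: "pow_diff p \<in> borel_measurable borel"
  unfolding pow_diff_def by measurable

text \<open>Near 0 the second difference is of order \<open>r\<^sup>2\<close>, at infinity of order
  \<open>r powr p\<close>; the weight integrates the former because \<open>s < 1\<close> and the
  latter because \<open>p < 2 * s\<close>.\<close>

lemma pow_diff_integrable:
  assumes "0 < p" "p \<le> 1" "p < 2 * s" "0 < s" "s < 1"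
  shows "integrable lborel (\<lambda>r. indicator {0<..} r * (pow_diff p r * r powr (- 1 - 2 * s)))"
proof (rule Bochner_Integration.integrable_bound)
  let ?g = "\<lambda>r. 2 * (indicator {0<..<1} r * r powr (1 - 2 * s)) + 2 * (indicator {1..} r * r powr (- 1 - 2 * s))
      + indicator {1..} r * (r::real) powr (p - 1 - 2 * s)"
  show "integrable lborel ?g"
    using has_bochner_integral_powr_0[of "1 - 2 * s" 1] has_bochner_integral_powr_inf[of "- 1 - 2 * s" 1]
      has_bochner_integral_powr_inf[of "p - 1 - 2 * s" 1] assms
    by (intro Bochner_Integration.integrable_add integrable_mult_right) (auto simp: has_bochner_integral_iff)
  show "AE r in lborel. norm (indicator {0<..} r * (pow_diff p r * r powr (- 1 - 2 * s))) \<le> norm (?g r)"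
  proof (rule AE_I2)
    fix r :: real
    consider "r \<le> 0" | "0 < r" "r < 1" | "1 \<le> r" by linarith
    then show "norm (indicator {0<..} r * (pow_diff p r * r powr (- 1 - 2 * s))) \<le> norm (?g r)"
    proof cases
      case 2
      have "\<bar>pow_diff p r\<bar> * r powr (- 1 - 2 * s) \<le> 2 * r\<^sup>2 * r powr (- 1 - 2 * s)"
        using pow_diff_bounds[of p r] assms 2 by (intro mult_right_mono) auto
      also have "\<dots> = 2 * r powr (1 - 2 * s)"
        using 2 by (simp add: powr_add[symmetric] flip: powr_numeral)
      finally show ?thesis using 2 by (simp add: abs_mult)
    next
      case 3
      have "\<bar>pow_diff p r\<bar> * r powr (- 1 - 2 * s) \<le> (2 + r powr p) * r powr (- 1 - 2 * s)"
      proof (rule mult_right_mono)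
        have "pow_diff p r \<le> r powr p" "- 2 \<le> pow_diff p r" "0 \<le> r powr p"
          using pow_diff_bounds(3,4)[of p r] assms 3 by auto
        then show "\<bar>pow_diff p r\<bar> \<le> 2 + r powr p" by linarith
      qed auto
      also have "\<dots> = 2 * r powr (- 1 - 2 * s) + r powr (p - 1 - 2 * s)"
        using 3 by (simp add: distrib_right powr_add[symmetric] diff_diff_eq add_diff_eq)
      finally show ?thesis using 3 by (simp add: abs_mult abs_of_nonneg)
    qed auto
  qed
qed simp

text \<open>Up to normalisation, half of the fractional Laplacian of order \<open>2 * s\<close> of
  the one-sided power at the point 1, with the sign of the operators here. Second differences are
  even in the step, so the half-line carries all the information.\<close>

definition pow_const :: "real \<Rightarrow> real \<Rightarrow> real" where
  "pow_const s p = (\<integral>r. indicator {0<..} r * (pow_diff p r * r powr (- 1 - 2 * s)) \<partial>lborel)"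

text \<open>
  The substitution \<open>r \<mapsto> r / (1 + r)\<close> folds the part of the integral with \<open>1 - r\<close> onto the one with
  \<open>1 + r\<close>; the sum of the two has the primitive \<open>((1 + r)\<^sup>s - 1)\<^sup>2 r\<^sup>-\<^sup>2\<^sup>s / (2 s)\<close>.
\<close>

lemma pow_const_aux:
  fixes s d Q :: real
  assumes s: "0 < s" "s < 1" and d: "0 < d" "d < Q"
  defines "a \<equiv> \<lambda>r::real. ((1 + r) powr s - 1) * r powr (- 1 - 2 * s)"
    and "b \<equiv> \<lambda>r::real. ((1 - r) powr s - 1) * r powr (- 1 - 2 * s)"
    and "N \<equiv> \<lambda>r::real. ((1 + r) powr s - 1)\<^sup>2 * r powr (- 2 * s) / (2 * s)"
  shows "integral {d..Q} a + integral {d / (1 + d)..Q / (1 + Q)} b = N Q - N d"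
proof -
  define g where "g = (\<lambda>r::real. r / (1 + r))"
  have gm: "g d \<le> g Q" "0 < g d" "g Q < 1" using d by (auto simp: g_def field_simps)
  have gi: "g x \<in> {g d..g Q}" "0 < g x" "g x < 1" if "x \<in> {d..Q}" for x
    using d that by (auto simp: g_def field_simps)
  have cb: "continuous_on {g d..g Q} b"
    unfolding b_def using gm by (intro continuous_intros) auto
  have ca: "continuous_on {d..Q} a"
    unfolding a_def using d by (intro continuous_intros) auto
  have 1: "((\<lambda>x. (1 / (1 + x)\<^sup>2) *\<^sub>R b (g x)) has_integral (integral {g d..g Q} b)) {d..Q}"
  proof (rule has_integral_substitution[where c = "g d" and d = "g Q"])
    show "(g has_field_derivative 1 / (1 + x)\<^sup>2) (at x within {d..Q})" if "x \<in> {d..Q}" for x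
      unfolding g_def using that d
      by (auto intro!: derivative_eq_intros simp: field_simps power2_eq_square)
  qed (use cb d gm gi in auto)
  have 2: "(a has_integral integral {d..Q} a) {d..Q}"
    using ca integrable_continuous_real by blast
  have 3: "((\<lambda>x. a x + (1 / (1 + x)\<^sup>2) *\<^sub>R b (g x)) has_integral (N Q - N d)) {d..Q}"
  proof (rule fundamental_theorem_of_calculus)
    fix x assume x: "x \<in> {d..Q}"
    then have x0: "x > 0" using d by auto
    define X where "X = (1 + x) powr s"
    have X0: "X > 0" using x0 by (simp add: X_def)
    have sm: "(1 + x) powr (s - 1) = X / (1 + x)" using x0 by (simp add: X_def powr_diff)
    define Z where "Z = x powr (- 1 - 2 * s)"
    have Z: "x powr (- 2 * s) = Z * x" "x powr (- 2 * s - 1) = Z"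
    proof -
      have "Z * x = x powr (- 1 - 2 * s) * x powr 1" using x0 by (simp add: Z_def)
      also have "\<dots> = x powr (- 2 * s)" unfolding powr_add[symmetric] by simp
      finally show "x powr (- 2 * s) = Z * x" by simp
      show "x powr (- 2 * s - 1) = Z" unfolding Z_def by (rule arg_cong[where f = "(powr) x"]) simp
    qed
    \<comment> \<open>The point of the substitution: \<open>1 - g x\<close> is the reciprocal of
      \<open>1 + x\<close>, so both parts become expressions in \<open>X\<close>.\<close>
    have "1 - g x = 1 / (1 + x)" using x0 by (simp add: g_def field_simps)
    then have bX: "(1 - g x) powr s = 1 / X" using x0 by (simp add: X_def powr_divide)
    have gZ: "(g x) powr (- 1 - 2 * s) = Z * ((1 + x) * X\<^sup>2)"
    proof -
      have "(g x) powr (- 1 - 2 * s) = Z / (1 + x) powr (- 1 - 2 * s)"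
        by (simp only: g_def Z_def powr_divide)
      also have "(1 + x) powr (- 1 - 2 * s) = 1 / ((1 + x) * X\<^sup>2)"
      proof -
        have "(1 + x) powr (- 1 - 2 * s) = (1 + x) powr (- (1 + s + s))"
          by (rule arg_cong[where f = "(powr) (1 + x)"]) simp
        also have "\<dots> = 1 / ((1 + x) powr 1 * X * X)"
          by (simp only: powr_minus_divide powr_add X_def)
        finally show ?thesis using x0 by (simp add: power2_eq_square)
      qed
      finally show ?thesis by simp
    qed
    have dF: "((\<lambda>r. (1 + r) powr s - 1) has_real_derivative s * (1 + x) powr (s - 1)) (at x)"
      using x0 by (auto intro!: derivative_eq_intros)
    have dG: "((\<lambda>r. r powr (- 2 * s)) has_real_derivative - 2 * s * x powr (- 2 * s - 1)) (at x)"
      using x0 by (auto intro!: derivative_eq_intros)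
    have "(N has_real_derivative
       (2 * (X - 1) * (s * (1 + x) powr (s - 1)) * x powr (- 2 * s) +
        (X - 1)\<^sup>2 * (- 2 * s * x powr (- 2 * s - 1))) / (2 * s)) (at x)"
      unfolding N_def by (rule DERIV_cong[OF DERIV_cdivide[OF DERIV_mult'[OF DERIV_power[OF dF, of 2] dG]]])
        (simp add: X_def mult_ac add.commute)
    also have "(2 * (X - 1) * (s * (1 + x) powr (s - 1)) * x powr (- 2 * s) +
        (X - 1)\<^sup>2 * (- 2 * s * x powr (- 2 * s - 1))) / (2 * s) = (X - 1) * (X / (1 + x) * x - (X - 1)) * Z"
      unfolding sm Z using s by (simp add: field_simps power2_eq_square)
    also have "\<dots> = a x + (1 / (1 + x)\<^sup>2) *\<^sub>R b (g x)"
    proof -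
      define w where "w = 1 + x"
      have w: "w > 0" "x = w - 1" using x0 by (auto simp: w_def)
      have "a x = (X - 1) * Z" by (simp add: a_def X_def Z_def)
      moreover have "b (g x) = (1 / X - 1) * (Z * (w * X\<^sup>2))" by (simp only: b_def bX gZ w_def)
      moreover have "(1 / w\<^sup>2) * ((1 / X - 1) * (Z * (w * X\<^sup>2))) = Z * (X - X\<^sup>2) / w"
        using w X0 by (simp add: field_simps power2_eq_square)
      moreover have "(X - 1) * (X / w * (w - 1) - (X - 1)) * Z = (X - 1) * Z + Z * (X - X\<^sup>2) / w"
        using w(1) by (simp add: field_simps power2_eq_square)
      ultimately show ?thesis by (simp add: w_def)
    qed
    finally show "(N has_vector_derivative a x + (1 / (1 + x)\<^sup>2) *\<^sub>R b (g x)) (at x within {d..Q})"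
      by (simp add: has_real_derivative_iff_has_vector_derivative[symmetric] has_field_derivative_at_within)
  qed (use d in auto)
  have "integral {d..Q} a + integral {g d..g Q} b = N Q - N d"
    using has_integral_unique[OF 3 has_integral_add[OF 2 1]] by simp
  then show ?thesis by (simp add: g_def)
qed

text \<open>Cut off at \<open>d\<close> and \<open>Q\<close>, the two folded parts give a difference
  of values of \<open>N\<close>, up to two short intervals. In the limit only \<open>N Q\<close>
  survives, tending to \<open>1 / (2 * s)\<close>; it is cancelled by the steps
  \<open>r > 1\<close>, whose backward point lies where the power is 0.\<close>

lemma pow_const_self:
  assumes s: "0 < s" "s < 1"
  shows "pow_const s s = 0"
proof -
  define a where "a = (\<lambda>r::real. ((1 + r) powr s - 1) * r powr (- 1 - 2 * s))"
  define b where "b = (\<lambda>r::real. ((max 0 (1 - r)) powr s - 1) * r powr (- 1 - 2 * s))"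
  define b' where "b' = (\<lambda>r::real. ((1 - r) powr s - 1) * r powr (- 1 - 2 * s))"
  define N where "N = (\<lambda>r::real. ((1 + r) powr s - 1)\<^sup>2 * r powr (- 2 * s) / (2 * s))"
  define f where "f = (\<lambda>r. pow_diff s r * r powr (- 1 - 2 * s))"
  define F where "F = (\<lambda>r. indicator {0<..} r * f r)"
  have intF: "integrable lborel F"
    unfolding F_def f_def by (rule pow_diff_integrable) (use s in auto)
  have ff: "f = (\<lambda>r. a r + b r)"
    by (simp add: fun_eq_iff f_def a_def b_def pow_diff_def algebra_simps)
  \<comment> \<open>The shift by 2 makes the end points satisfy \<open>d < 1 < Q\<close> for every
    \<open>n\<close>, including 0.\<close>
  define K where "K = (\<lambda>n::nat. {1 / real (n+2)..real (n+2)})"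
  have lim1: "(\<lambda>n. \<integral>r. indicator (K n) r * F r \<partial>lborel) \<longlonglongrightarrow> integral\<^sup>L lborel F"
  proof (rule integral_dominated_convergence[where w = "\<lambda>r. norm (F r)"])
    show "AE x in lborel. (\<lambda>n. indicator (K n) x * F x) \<longlonglongrightarrow> F x"
    proof (rule AE_I2)
      fix x :: real
      show "(\<lambda>n. indicator (K n) x * F x) \<longlonglongrightarrow> F x"
      proof (cases "x > 0")
        case True
        have "\<forall>\<^sub>F n in sequentially. 1 / real (n+2) < x" using True by real_asymp
        moreover have "\<forall>\<^sub>F n in sequentially. x < real (n+2)" by real_asymp
        ultimately have "\<forall>\<^sub>F n in sequentially. indicator (K n) x * F x = F x"
          by eventually_elim (auto simp: K_def)
        then show ?thesis by (rule tendsto_eventually)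
      qed (auto simp: F_def)
    qed
  qed (use intF in \<open>auto simp: K_def indicator_def\<close>)
  have val: "(\<integral>r. indicator (K n) r * F r \<partial>lborel) = integral (K n) f" for n
  proof -
    have "integrable lborel (\<lambda>r. indicator (K n) r *\<^sub>R F r)"
      using intF by (intro integrable_mult_indicator) (auto simp: K_def)
    then have "set_integrable lborel (K n) F" by (simp add: set_integrable_def)
    from set_borel_integral_eq_integral(2)[OF this]
    have "(\<integral>r. indicator (K n) r * F r \<partial>lborel) = integral (K n) F"
      by (simp add: set_lebesgue_integral_def)
    also have "\<dots> = integral (K n) f"
    proof (rule integral_cong)
      fix x assume x: "x \<in> K n"
      have "0 < 1 / real (n+2)" by simp
      also have "\<dots> \<le> x" using x by (simp add: K_def)
      finally show "F x = f x" by (simp add: F_def)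
    qed
    finally show ?thesis .
  qed
  have ca: "continuous_on {d..Q} a" if "0 < d" for d Q
    unfolding a_def using that by (intro continuous_intros) auto
  have cb: "continuous_on {d..Q} b" if "0 < d" for d Q
    unfolding b_def using that s
    by (intro continuous_intros continuous_on_powr' continuous_on_mult) (auto simp: max_def)
  have bb: "\<bar>b r\<bar> \<le> r * r powr (- 1 - 2 * s)" if "0 < r" "r \<le> 1" for r
  proof -
    have "1 - r \<le> (1 - r) powr s"
      using that s powr_mono'[of s 1 "1 - r"] by (cases "r = 1") auto
    moreover have "(1 - r) powr s \<le> 1"
      using that s powr_mono2[of s "1-r" 1] by auto
    ultimately have "\<bar>(1 - r) powr s - 1\<bar> \<le> r" using that by auto
    then show ?thesis unfolding b_def using that by (auto simp: abs_mult intro!: mult_right_mono)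
  qed
  \<comment> \<open>The substitution moves the end points \<open>d\<close> and \<open>Q\<close> to
    \<open>d / (1 + d)\<close> and \<open>Q / (1 + Q)\<close>; \<open>E1\<close> and
    \<open>E2\<close> are the integrals over the gaps next to 0 and to 1.\<close>
  define E1 where "E1 = (\<lambda>d. integral {d / (1 + d)..d} b)"
  define E2 where "E2 = (\<lambda>Q. integral {Q / (1 + Q)..1} b)"
  have eq: "integral {d..Q} f = N Q - N d - E1 d + E2 Q - (1 - Q powr (- 2 * s)) / (2 * s)"
    if d: "0 < d" "d < 1" "1 < Q" for d Q
  proof -
    have io: "b integrable_on {x..y}" if "0 < x" for x y
      using cb[OF that] integrable_continuous_real by blast
    have "integral {d..Q} f = integral {d..Q} a + integral {d..Q} b"
      unfolding ff
      by (rule integral_add[OF integrable_continuous_real[OF ca[OF d(1)]] integrable_continuous_real[OF cb[OF d(1)]]])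
    moreover have "integral {d..Q} b = integral {d..1} b + integral {1..Q} b"
      using Henstock_Kurzweil_Integration.integral_combine[where a=d and c=1 and b=Q and f=b] io[OF d(1)] d by auto
    moreover have "integral {1..Q} b = - ((1 - Q powr (- 2 * s)) / (2 * s))"
    proof -
      have "((\<lambda>r. - (r powr (- 1 - 2 * s))) has_integral (Q powr (-2 * s) / (2 * s) - 1 powr (-2 * s) / (2 * s))) {1..Q}"
      proof (rule fundamental_theorem_of_calculus)
        fix x assume "x \<in> {1..Q}"
        then have "((\<lambda>r. r powr (-2 * s) / (2 * s)) has_real_derivative - (x powr (- 1 - 2 * s))) (at x within {1..Q})"
          using s by (auto intro!: derivative_eq_intros simp: minus_diff_commute)
        then show "((\<lambda>r. r powr (-2 * s) / (2 * s)) has_vector_derivative - (x powr (- 1 - 2 * s))) (at x within {1..Q})"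
          by (simp add: has_real_derivative_iff_has_vector_derivative)
      qed (use d in auto)
      moreover have "integral {1..Q} b = integral {1..Q} (\<lambda>r. - (r powr (- 1 - 2 * s)))"
        by (rule integral_cong) (use s in \<open>auto simp: b_def max_def\<close>)
      ultimately show ?thesis using s by (auto dest!: integral_unique simp: field_simps)
    qed
    moreover have "integral {d..1} b = integral {d / (1 + d)..Q / (1 + Q)} b - E1 d + E2 Q"
    proof -
      have "d / (1 + d) > 0" using d by auto
      have "integral {d/(1+d)..1} b = E1 d + integral {d..1} b"
        unfolding E1_def using d io[OF \<open>d / (1 + d) > 0\<close>] Henstock_Kurzweil_Integration.integral_combine[where a="d/(1+d)" and c=d and b=1 and f=b]
        by (auto simp: field_simps)
      moreover have "integral {d/(1+d)..1} b = integral {d / (1 + d)..Q / (1 + Q)} b + E2 Q"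
        unfolding E2_def using d io[OF \<open>d / (1 + d) > 0\<close>] Henstock_Kurzweil_Integration.integral_combine[where a="d/(1+d)" and c="Q/(1+Q)" and b=1 and f=b]
        by (auto simp: field_simps)
      ultimately show ?thesis by simp
    qed
    moreover have "integral {d / (1 + d)..Q / (1 + Q)} b = integral {d / (1 + d)..Q / (1 + Q)} b'"
    proof (rule integral_cong)
      fix x assume "x \<in> {d / (1 + d)..Q / (1 + Q)}"
      then have "x \<le> 1" using d by (smt (verit, best) atLeastAtMost_iff divide_le_eq_1_pos)
      then show "b x = b' x" by (simp add: b_def b'_def)
    qed
    moreover have "integral {d..Q} a + integral {d / (1 + d)..Q / (1 + Q)} b' = N Q - N d"
      unfolding a_def b'_def N_def by (rule pow_const_aux) (use s d in auto)
    ultimately show ?thesis by simp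
  qed
  \<comment> \<open>The gap has length at most \<open>d\<^sup>2\<close>, so its contribution is of
    order \<open>d powr (2 - 2 * s)\<close> and vanishes in the limit because
    \<open>s < 1\<close>.\<close>
  have E1: "\<bar>E1 d\<bar> \<le> (d / 2) powr (- 2 * s) * d\<^sup>2" if d: "0 < d" "d < 1" for d
  proof -
    have pos: "0 < d / (1 + d)" "d / 2 \<le> d / (1+d)" "d / (1 + d) \<le> d" using d by (auto simp: field_simps)
    have "norm (integral {d / (1 + d)..d} b) \<le> (d / 2) powr (- 2 * s) * (d - d / (1 + d))"
    proof (rule integral_bound)
      fix r assume r: "r \<in> {d / (1 + d)..d}"
      have r0: "0 < r" "d / 2 \<le> r" "r \<le> 1"
        using order_trans[OF pos(2), of r] less_le_trans[OF pos(1), of r] r d by auto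
      have "\<bar>b r\<bar> \<le> r * r powr (- 1 - 2 * s)" using bb r0 by auto
      also have "\<dots> = r powr (- 2 * s)" using r0 by (simp add: powr_mult_base)
      also have "\<dots> \<le> (d / 2) powr (- 2 * s)" by (rule powr_mono2') (use r0 s d in auto)
      finally show "norm (b r) \<le> (d / 2) powr (- 2 * s)" by simp
    qed (use pos cb in auto)
    also have "\<dots> \<le> (d / 2) powr (- 2 * s) * d\<^sup>2"
      by (rule mult_left_mono) (use d in \<open>auto simp: field_simps power2_eq_square\<close>)
    finally show ?thesis by (simp add: E1_def)
  qed
  have E2: "\<bar>E2 Q\<bar> \<le> 2 powr (1 + 2 * s) * (1 / (1 + Q))" if Q: "1 < Q" for Q
  proof -
    have pos: "1 / 2 \<le> Q / (1 + Q)" "Q / (1 + Q) \<le> 1" using Q by (auto simp: field_simps)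
    have c: "continuous_on {Q / (1 + Q)..1} b" by (rule cb) (use Q in auto)
    have "norm (integral {Q / (1 + Q)..1} b) \<le> 2 powr (1 + 2 * s) * (1 - Q / (1 + Q))"
    proof (rule integral_bound)
      fix r assume r: "r \<in> {Q / (1 + Q)..1}"
      have r0: "0 < r" "1 / 2 \<le> r" "r \<le> 1"
        using order_trans[OF pos(1), of r] r by auto
      have "\<bar>b r\<bar> \<le> r * r powr (- 1 - 2 * s)" using bb r0 by auto
      also have "\<dots> \<le> 1 * r powr (- 1 - 2 * s)"
        by (rule mult_right_mono) (use r0 in auto)
      also have "\<dots> \<le> 1 * (1 / 2) powr (- 1 - 2 * s)"
        by (intro mult_left_mono powr_mono2') (use r0 s in auto)
      also have "\<dots> = 2 powr (1 + 2 * s)"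
        using powr_minus_divide[of 2 "- 1 - 2 * s"] by (simp add: powr_divide add.commute)
      finally show "norm (b r) \<le> 2 powr (1 + 2 * s)" by simp
    qed (use pos c in auto)
    also have "1 - Q / (1 + Q) = 1 / (1 + Q)" using Q by (simp add: field_simps)
    finally show ?thesis by (simp add: E2_def)
  qed
  have "(\<lambda>n. integral (K n) f) \<longlonglongrightarrow> 1 / (2 * s) - 0 - 0 + 0 - (1 - 0) / (2 * s)"
  proof -
    have t1: "(\<lambda>n. N (real (n+2))) \<longlonglongrightarrow> 1 / (2 * s)"
    proof -
      have "(\<lambda>n. N (real (n+2))) \<longlonglongrightarrow> inverse s / 2"
        unfolding N_def using s by real_asymp
      then show ?thesis by (simp add: inverse_eq_divide mult.commute)
    qed
    have t2: "(\<lambda>n. N (1 / real (n+2))) \<longlonglongrightarrow> 0"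
    proof (rule tendsto_sandwich)
      show "\<forall>\<^sub>F n in sequentially. 0 \<le> N (1 / real (n + 2))" unfolding N_def using s by auto
      show "\<forall>\<^sub>F n in sequentially. N (1 / real (n + 2)) \<le> (1 / real (n+2))\<^sup>2 * (1 / real (n+2)) powr (- 2 * s) / (2 * s)"
      proof (rule always_eventually, rule allI)
        fix n
        define d where "d = 1 / real (n+2)"
        have d: "d > 0" by (simp add: d_def)
        have "0 \<le> (1 + d) powr s - 1" using ge_one_powr_ge_zero[of "1+d" s] d s by auto
        moreover have "(1 + d) powr s - 1 \<le> d" using powr_le_affine[of "1+d" s] d s
          by (smt (verit) mult_left_le_one_le)
        ultimately have "((1 + d) powr s - 1)\<^sup>2 \<le> d\<^sup>2" by (intro power_mono) auto
        then show "N d \<le> d\<^sup>2 * d powr (- 2 * s) / (2 * s)"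
          unfolding N_def using s by (intro divide_right_mono mult_right_mono) auto
      qed
      show "(\<lambda>n. (1 / real (n+2))\<^sup>2 * (1 / real (n+2)) powr (- 2 * s) / (2 * s)) \<longlonglongrightarrow> 0"
        using s by real_asymp
    qed auto
    have t3: "(\<lambda>n. E1 (1 / real (n+2))) \<longlonglongrightarrow> 0"
    proof (rule Lim_null_comparison)
      show "\<forall>\<^sub>F n in sequentially. norm (E1 (1 / real (n+2))) \<le>
          (1 / real (n+2) / 2) powr (- 2 * s) * (1 / real (n+2))\<^sup>2"
        by (intro always_eventually allI, unfold real_norm_def, rule E1) simp_all
      show "(\<lambda>n. (1 / real (n+2) / 2) powr (- 2 * s) * (1 / real (n+2))\<^sup>2) \<longlonglongrightarrow> 0"
        using s by real_asymp
    qed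
    have t4: "(\<lambda>n. E2 (real (n+2))) \<longlonglongrightarrow> 0"
    proof (rule Lim_null_comparison)
      show "\<forall>\<^sub>F n in sequentially. norm (E2 (real (n+2))) \<le> 2 powr (1 + 2 * s) * (1 / (1 + real (n+2)))"
        by (intro always_eventually allI, unfold real_norm_def, rule E2) simp_all
      show "(\<lambda>n. 2 powr (1 + 2 * s) * (1 / (1 + real (n+2)))) \<longlonglongrightarrow> 0"
        by real_asymp
    qed
    have t5: "(\<lambda>n. real (n+2) powr (- 2 * s)) \<longlonglongrightarrow> 0" using s by real_asymp
    have "integral (K n) f = N (real (n+2)) - N (1 / real (n+2)) - E1 (1 / real (n+2)) + E2 (real (n+2))
        - (1 - real (n+2) powr (- 2 * s)) / (2 * s)" for n
      unfolding K_def by (rule eq) (auto simp: field_simps)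
    moreover have "(\<lambda>n. N (real (n+2)) - N (1 / real (n+2)) - E1 (1 / real (n+2)) + E2 (real (n+2))
        - (1 - real (n+2) powr (- 2 * s)) / (2 * s)) \<longlonglongrightarrow> 1 / (2 * s) - 0 - 0 + 0 - (1 - 0) / (2 * s)"
      by (intro tendsto_intros t1 t2 t3 t4 t5) (use s in auto)
    ultimately show ?thesis by simp
  qed
  then have "(\<lambda>n. integral (K n) f) \<longlonglongrightarrow> 0" by simp
  then have "integral\<^sup>L lborel F = 0" by (rule LIMSEQ_unique[OF lim1[unfolded val]])
  then show ?thesis by (simp add: pow_const_def F_def f_def)
qed

text \<open>With \<open>k = s / p < 1\<close> the power with exponent \<open>s\<close> is a concave
  function of the one with exponent \<open>p\<close>, and the tangent at 1 bounds
  \<open>pow_diff s\<close> by \<open>k * pow_diff p\<close>. For \<open>r \<ge> 1\<close> there is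
  a surplus of \<open>1 - k\<close>, as the backward value 0 is far from the point of tangency.
  Integration and \<open>pow_const_self\<close> give positivity.\<close>

lemma pow_const_pos:
  assumes s: "0 < s" "s < 1" and p: "s < p" "p \<le> 1" "p < 2 * s"
  shows "pow_const s p > 0"
proof -
  let ?f = "\<lambda>p r. indicator {0<..} r * (pow_diff p r * r powr (- 1 - 2 * s))"
  define k where "k = s / p"
  have k: "0 < k" "k < 1" "k * p = s" using s p by (auto simp: k_def)
  let ?g = "\<lambda>r. k * ?f p r - (1 - k) * (indicator {1..} r * (r::real) powr (- 1 - 2 * s))"
  have hb: "has_bochner_integral lborel (\<lambda>r. indicator {1..} r * (r::real) powr (- 1 - 2 * s)) (1 powr (- 1 - 2 * s + 1) / (- (- 1 - 2 * s) - 1))"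
    by (rule has_bochner_integral_powr_inf) (use s in auto)
  have ip: "integrable lborel (?f p)" by (rule pow_diff_integrable) (use s p in auto)
  have is0: "integrable lborel (?f s)" by (rule pow_diff_integrable) (use s p in auto)
  have "pow_const s s \<le> integral\<^sup>L lborel ?g"
    unfolding pow_const_def
  proof (rule integral_mono)
    fix r :: real
    have X: "X powr s \<le> 1 + k * (X powr p - 1)" for X :: real
      using powr_le_affine[of "X powr p" k] k by (simp add: powr_powr mult.commute)
    have "pow_diff s r \<le> k * pow_diff p r - (1 - k) * indicator {1..} r" if "r > 0"
    proof (cases "r < 1")
      case True
      then show ?thesis using X[of "1+r"] X[of "1-r"] by (simp add: pow_diff_def algebra_simps)
    next
      case False
      then show ?thesis using X[of "1+r"] by (simp add: pow_diff_def algebra_simps)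
    qed
    then have "pow_diff s r * r powr (- 1 - 2 * s)
        \<le> (k * pow_diff p r - (1 - k) * indicator {1..} r) * r powr (- 1 - 2 * s)" if "r > 0"
      using that by (intro mult_right_mono) auto
    then show "?f s r \<le> ?g r"
      by (cases "r > 0") (auto simp: algebra_simps)
  qed (use ip is0 hb in \<open>auto simp: has_bochner_integral_iff\<close>)
  also have "integral\<^sup>L lborel ?g = k * pow_const s p - (1 - k) * (1 / (2 * s))"
    using ip hb by (simp add: has_bochner_integral_iff pow_const_def)
  finally have "k * pow_const s p \<ge> (1 - k) * (1 / (2 * s))" by (simp add: pow_const_self s)
  moreover have "(1 - k) * (1 / (2 * s)) > 0" using k s by auto
  ultimately show ?thesis using k by (metis mult_pos_pos less_le_trans zero_less_mult_pos)
qed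

subsection \<open>Stable operators on functions with bounded second differences\<close>

text \<open>A relation between a bound and its integral, so that integrability travels with the
  value and the pieces of a piecewise bound can be added.\<close>

definition frac_integral :: "real \<Rightarrow> (real \<Rightarrow> real) \<Rightarrow> real \<Rightarrow> bool" where
  "frac_integral s B I \<longleftrightarrow>
     has_bochner_integral lborel (\<lambda>r. indicator {0<..} r * (B r * r powr (- 1 - 2 * s))) I"

lemma frac_integral_add:
  "frac_integral s A I \<Longrightarrow> frac_integral s B J \<Longrightarrow> frac_integral s (\<lambda>r. A r + B r) (I + J)"
  unfolding frac_integral_def
  by (drule (1) has_bochner_integral_add) (simp add: algebra_simps)

lemma frac_integral_cmult:
  "frac_integral s A I \<Longrightarrow> frac_integral s (\<lambda>r. c * A r) (c * I)"
  unfolding frac_integral_def has_bochner_integral_iff mult.assoc mult.left_commute[of _ c] by simp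

lemma frac_integral_inner:
  assumes "2 * s < e" "0 < R"
  shows "frac_integral s (\<lambda>r. indicator {0<..<R} r * r powr e) (R powr (e - 2 * s) / (e - 2 * s))"
proof -
  have "has_bochner_integral lborel (\<lambda>r. indicator {0<..<R} r * (r::real) powr (e - 1 - 2 * s))
      (R powr (e - 1 - 2 * s + 1) / (e - 1 - 2 * s + 1))"
    by (rule has_bochner_integral_powr_0) (use assms in auto)
  also have "(\<lambda>r. indicator {0<..<R} r * (r::real) powr (e - 1 - 2 * s)) =
      (\<lambda>r. indicator {0<..} r * (indicator {0<..<R} r * r powr e * r powr (- 1 - 2 * s)))"
    by (auto simp: fun_eq_iff indicator_def powr_add[symmetric] algebra_simps)
  finally show ?thesis by (simp add: frac_integral_def)
qed

lemma frac_integral_outer: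
  assumes "e < 2 * s" "0 < R"
  shows "frac_integral s (\<lambda>r. indicator {R..} r * r powr e) (R powr (e - 2 * s) / (2 * s - e))"
proof -
  have "has_bochner_integral lborel (\<lambda>r. indicator {R..} r * (r::real) powr (e - 1 - 2 * s))
      (R powr (e - 1 - 2 * s + 1) / (- (e - 1 - 2 * s) - 1))"
    by (rule has_bochner_integral_powr_inf) (use assms in auto)
  also have "(\<lambda>r. indicator {R..} r * (r::real) powr (e - 1 - 2 * s)) =
      (\<lambda>r. indicator {0<..} r * (indicator {R..} r * r powr e * r powr (- 1 - 2 * s)))"
    using assms by (auto simp: fun_eq_iff indicator_def powr_add[symmetric] algebra_simps)
  finally show ?thesis by (simp add: frac_integral_def algebra_simps)
qed

lemma frac_integral_outer_const:
  assumes "0 < s" "0 < R"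
  shows "frac_integral s (indicator {R..}) (R powr (- 2 * s) / (2 * s))"
proof -
  have "frac_integral s (\<lambda>r. indicator {R..} r * r powr 0) (R powr (0 - 2 * s) / (2 * s - 0))"
    by (rule frac_integral_outer) (use assms in auto)
  also have "(\<lambda>r. indicator {R..} r * r powr 0) = (indicator {R..} :: real \<Rightarrow> real)"
    using assms by (auto simp: fun_eq_iff indicator_def)
  finally show ?thesis by simp
qed

lemma frac_integral_inner_square:
  assumes "0 < s" "s < 1" "0 < R"
  shows "frac_integral s (\<lambda>r. indicator {0<..<R} r * r\<^sup>2) (R powr (2 - 2 * s) / (2 - 2 * s))"
proof -
  have "frac_integral s (\<lambda>r. indicator {0<..<R} r * r powr 2) (R powr (2 - 2 * s) / (2 - 2 * s))"
    by (rule frac_integral_inner) (use assms in auto)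
  also have "(\<lambda>r. indicator {0<..<R} r * r powr 2) = (\<lambda>r. indicator {0<..<R} r * r\<^sup>2 :: real)"
    by (auto simp: fun_eq_iff indicator_def)
  finally show ?thesis .
qed

lemma frac_integral_pow_diff:
  assumes "0 < p" "p \<le> 1" "p < 2 * s" "0 < s" "s < 1"
  shows "frac_integral s (pow_diff p) (pow_const s p)"
  unfolding frac_integral_def pow_const_def has_bochner_integral_iff
  using pow_diff_integrable[OF assms] by simp

text \<open>Evenness folds the line onto the half-line. The two-sided bounds by \<open>C\<close>
  give integrability; the function \<open>B\<close> of the last conclusion is an upper bound only,
  as a touching point provides nothing else.\<close>

lemma even_integral_half_line:
  fixes S :: "real \<Rightarrow> real"
  assumes s: "0 < s" "s < 1" and [measurable]: "S \<in> borel_measurable borel"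
    and even: "\<And>r. S (- r) = S r" and C: "\<And>r. \<bar>S r\<bar> \<le> C * r\<^sup>2" "\<And>r. \<bar>S r\<bar> \<le> C"
  shows "integrable lborel (\<lambda>r. S r / \<bar>r\<bar> powr (1 + 2 * s))"
    and "\<bar>\<integral>r. S r / \<bar>r\<bar> powr (1 + 2 * s) \<partial>lborel\<bar> \<le> 2 * C * (1 / (2 - 2 * s) + 1 / (2 * s))"
    and "(\<And>r. 0 < r \<Longrightarrow> S r \<le> B r) \<Longrightarrow> frac_integral s B I \<Longrightarrow>
      (\<integral>r. S r / \<bar>r\<bar> powr (1 + 2 * s) \<partial>lborel) \<le> 2 * I"
proof -
  have C0: "0 \<le> C" using C(2)[of 0] by linarith
  define f where "f = (\<lambda>r. S r / \<bar>r\<bar> powr (1 + 2 * s))"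
  define g where "g = (\<lambda>r. indicator {0<..} r * (S r * r powr (- 1 - 2 * s)))"
  have [measurable]: "f \<in> borel_measurable borel" unfolding f_def by measurable
  have fg: "g r = indicator {0<..} r * f r" for r
    unfolding g_def f_def using powr_minus_divide[of r "1 + 2 * s"] by (auto simp: indicator_def algebra_simps)
  define G where "G = (\<lambda>r. C * (indicator {0<..<1} r * r\<^sup>2) + C * indicator {1..} r :: real)"
  have G: "frac_integral s G (C * (1 / (2 - 2 * s)) + C * (1 / (2 * s)))"
    unfolding G_def
    using frac_integral_add[OF frac_integral_cmult[OF frac_integral_inner_square, of s 1 C]
        frac_integral_cmult[OF frac_integral_outer_const, of s 1 C]] s by simp
  have SG: "\<bar>S r\<bar> \<le> G r" if "0 < r" for r
    using C[of r] that C0 by (auto simp: G_def indicator_def)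
  define GG where "GG = (\<lambda>r. indicator {0<..} r * (G r * r powr (- 1 - 2 * s)))"
  have GG: "integrable lborel GG" "integral\<^sup>L lborel GG = C * (1 / (2 - 2 * s)) + C * (1 / (2 * s))"
    using G by (auto simp: frac_integral_def has_bochner_integral_iff GG_def)
  have gGG: "\<bar>g r\<bar> \<le> GG r" for r
    unfolding g_def GG_def using SG[of r] by (auto simp: indicator_def abs_mult intro!: mult_right_mono)
  have gi: "integrable lborel g"
    by (rule Bochner_Integration.integrable_bound[OF GG(1)])
      (use gGG in \<open>auto simp: fg[abs_def] intro: order_trans[OF _ abs_ge_self]\<close>)
  have gi': "integrable lborel (\<lambda>r. g (- r))"
    using lborel_integrable_real_affine[OF gi, of "-1" 0] by simp
  have gint: "(\<integral>r. g (- r) \<partial>lborel) = integral\<^sup>L lborel g"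
    using lborel_integral_real_affine[of "-1" g 0] by simp
  \<comment> \<open>The origin belongs to neither half and is a null set.\<close>
  have feq: "AE r in lborel. f r = g r + g (- r)"
  proof -
    have "AE r in lborel. r \<noteq> (0::real)" by (rule AE_lborel_singleton)
    then show ?thesis
    proof eventually_elim
      case (elim r)
      have "f (- r) = f r" by (simp add: f_def even)
      then show ?case using elim by (auto simp: fg indicator_def)
    qed
  qed
  have "integrable lborel (\<lambda>r. g r + g (- r))" using gi gi' by simp
  then show int: "integrable lborel (\<lambda>r. S r / \<bar>r\<bar> powr (1 + 2 * s))"
    using feq integrable_cong_AE[of f lborel "\<lambda>r. g r + g (- r)"]
    by (simp add: f_def[symmetric] fg)
  have val: "integral\<^sup>L lborel f = 2 * integral\<^sup>L lborel g"
  proof -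
    have "integral\<^sup>L lborel f = (\<integral>r. g r + g (- r) \<partial>lborel)"
      by (rule integral_cong_AE) (use feq in \<open>auto simp: fg\<close>)
    also have "\<dots> = 2 * integral\<^sup>L lborel g" using gi gi' gint by simp
    finally show ?thesis .
  qed
  have "\<bar>integral\<^sup>L lborel g\<bar> \<le> integral\<^sup>L lborel GG"
    by (rule order_trans[OF integral_abs_bound]) (use gi GG(1) gGG in \<open>auto intro!: integral_mono\<close>)
  then have "\<bar>integral\<^sup>L lborel f\<bar> \<le> 2 * (C * (1 / (2 - 2 * s)) + C * (1 / (2 * s)))"
    unfolding val GG(2) abs_mult abs_numeral by (rule mult_left_mono) simp
  also have "\<dots> = 2 * C * (1 / (2 - 2 * s) + 1 / (2 * s))" by (simp only: distrib_left mult.assoc)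
  finally show "\<bar>\<integral>r. S r / \<bar>r\<bar> powr (1 + 2 * s) \<partial>lborel\<bar> \<le> 2 * C * (1 / (2 - 2 * s) + 1 / (2 * s))"
    by (simp only: f_def)
  show "(\<integral>r. S r / \<bar>r\<bar> powr (1 + 2 * s) \<partial>lborel) \<le> 2 * I"
    if SB: "\<And>r. 0 < r \<Longrightarrow> S r \<le> B r" and B: "frac_integral s B I"
  proof -
    have "integral\<^sup>L lborel g \<le> (\<integral>r. indicator {0<..} r * (B r * r powr (- 1 - 2 * s)) \<partial>lborel)"
      by (rule integral_mono[OF gi])
        (use B SB in \<open>auto simp: frac_integral_def has_bochner_integral_iff g_def indicator_def intro!: mult_right_mono\<close>)
    then show ?thesis using B val by (auto simp: frac_integral_def has_bochner_integral_iff f_def)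
  qed
qed

lemma spectral_measureD:
  fixes \<mu> :: "'a::euclidean_space measure"
  assumes "spectral_measure s lam Lam \<mu>" "0 \<le> Lam"
  shows "space \<mu> = sphere 0 1" "finite_measure \<mu>" "measure \<mu> (space \<mu>) \<le> Lam"
    "(\<lambda>x. x) \<in> measurable \<mu> borel"
    "\<And>A. A \<in> sets borel \<Longrightarrow> A \<inter> sphere 0 1 \<in> sets \<mu>"
    "\<And>\<nu>. 0 < s \<Longrightarrow> norm \<nu> = 1 \<Longrightarrow> lam \<le> (\<integral>\<theta>. \<bar>\<nu> \<bullet> \<theta>\<bar> powr (2 * s) \<partial>\<mu>)"
proof -
  have sets: "sets \<mu> = sets (restrict_space borel (sphere 0 1))"
    and em: "emeasure \<mu> (sphere 0 1) \<le> ennreal Lam"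
    and lam: "lam \<le> (INF \<nu> \<in> sphere 0 1. \<integral>\<theta>. \<bar>\<nu> \<bullet> \<theta>\<bar> powr (2 * s) \<partial>\<mu>)"
    using assms by (auto simp: spectral_measure_def)
  show sp: "space \<mu> = sphere 0 1" using sets_eq_imp_space_eq[OF sets] by (simp add: space_restrict_space)
  show fin: "finite_measure \<mu>"
    using em by (intro finite_measureI) (auto simp: sp top_unique)
  show "measure \<mu> (space \<mu>) \<le> Lam"
    using em assms(2) unfolding measure_def sp by (intro enn2real_leI) auto
  show "(\<lambda>x. x) \<in> measurable \<mu> borel"
    by (subst measurable_cong_sets[OF sets refl]) (rule measurable_restrict_space1, simp)
  show "A \<inter> sphere 0 1 \<in> sets \<mu>" if "A \<in> sets borel" for A
    unfolding sets using that by (auto simp: sets_restrict_space)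
  show "lam \<le> (\<integral>\<theta>. \<bar>\<nu> \<bullet> \<theta>\<bar> powr (2 * s) \<partial>\<mu>)" if "0 < s" "norm \<nu> = 1" for \<nu>
  proof (rule order_trans[OF lam], rule cINF_lower)
    show "bdd_below ((\<lambda>\<nu>. \<integral>\<theta>. \<bar>\<nu> \<bullet> \<theta>\<bar> powr (2 * s) \<partial>\<mu>) ` sphere 0 1)"
      by (rule bdd_belowI[of _ 0]) auto
  qed (use that in auto)
qed

definition stable_at :: "real \<Rightarrow> 'a::euclidean_space measure \<Rightarrow> ('a \<Rightarrow> real) \<Rightarrow> 'a \<Rightarrow> real" where
  "stable_at s \<mu> v x =
     (\<integral>\<theta>. (\<integral>r. (v (x + r *\<^sub>R \<theta>) + v (x - r *\<^sub>R \<theta>) - 2 * v x) / \<bar>r\<bar> powr (1 + 2 * s) \<partial>lborel) \<partial>\<mu>)"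

lemma stable_operator_eq: "stable_operator s \<mu> w (t, x) = stable_at s \<mu> (\<lambda>y. w (t, y)) x"
  by (simp add: stable_operator_def stable_at_def)

text \<open>The class of mollified functions at fixed time. The quadratic bound makes the kernel
  integrable near 0, the supremum bound at infinity; one constant serves both.\<close>

definition bdd_second_diff :: "real \<Rightarrow> ('a::euclidean_space \<Rightarrow> real) \<Rightarrow> bool" where
  "bdd_second_diff C v \<longleftrightarrow> continuous_on UNIV v \<and> (\<forall>x. \<bar>v x\<bar> \<le> C) \<and>
     (\<forall>x y. \<bar>v (x + y) + v (x - y) - 2 * v x\<bar> \<le> C * (norm y)\<^sup>2)"

text \<open>The third conclusion is the form in which every comparison below ends: at a touching
  point the second differences are bounded direction by direction by some \<open>B \<theta>\<close>,
  and only the integrals \<open>\<beta> \<theta>\<close> enter.\<close>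

lemma stable_at_integrable:
  fixes v :: "'a::euclidean_space \<Rightarrow> real"
  assumes s: "0 < s" "s < 1" and mu: "spectral_measure s lam Lam \<mu>" "0 \<le> Lam" and v: "bdd_second_diff C v"
  shows "\<theta> \<in> sphere 0 1 \<Longrightarrow>
      integrable lborel (\<lambda>r. (v (x + r *\<^sub>R \<theta>) + v (x - r *\<^sub>R \<theta>) - 2 * v x) / \<bar>r\<bar> powr (1 + 2 * s))"
    and "integrable \<mu> (\<lambda>\<theta>. \<integral>r. (v (x + r *\<^sub>R \<theta>) + v (x - r *\<^sub>R \<theta>) - 2 * v x) / \<bar>r\<bar> powr (1 + 2 * s) \<partial>lborel)"
    and "(\<And>\<theta> r. \<theta> \<in> sphere 0 1 \<Longrightarrow> 0 < r \<Longrightarrow> v (x + r *\<^sub>R \<theta>) + v (x - r *\<^sub>R \<theta>) - 2 * v x \<le> B \<theta> r) \<Longrightarrow>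
      (\<And>\<theta>. \<theta> \<in> sphere 0 1 \<Longrightarrow> frac_integral s (B \<theta>) (\<beta> \<theta>)) \<Longrightarrow> integrable \<mu> \<beta> \<Longrightarrow>
      stable_at s \<mu> v x \<le> 2 * integral\<^sup>L \<mu> \<beta>"
proof -
  note mu' = spectral_measureD[OF mu]
  interpret finite_measure \<mu> by (rule mu')
  have [measurable]: "v \<in> borel_measurable borel"
    using v by (auto simp: bdd_second_diff_def intro: borel_measurable_continuous_onI)
  have [measurable]: "(\<lambda>x. x) \<in> measurable \<mu> borel" by (rule mu')
  let ?S = "\<lambda>\<theta> r. v (x + r *\<^sub>R \<theta>) + v (x - r *\<^sub>R \<theta>) - 2 * v x"
  have C0: "0 \<le> C" using v unfolding bdd_second_diff_def by (meson abs_ge_zero order_trans)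
  \<comment> \<open>The factor 4 comes from the three values in a second difference; it is used for
    both bounds so that they share a constant.\<close>
  have b: "\<bar>?S \<theta> r\<bar> \<le> 4 * C * r\<^sup>2" "\<bar>?S \<theta> r\<bar> \<le> 4 * C" if "\<theta> \<in> sphere 0 1" for \<theta> r
  proof -
    have "\<bar>?S \<theta> r\<bar> \<le> C * r\<^sup>2"
      using v that unfolding bdd_second_diff_def
      by (elim conjE allE[of _ x] allE[of _ "r *\<^sub>R \<theta>"]) simp
    moreover have "0 \<le> C * r\<^sup>2" using C0 by auto
    ultimately show "\<bar>?S \<theta> r\<bar> \<le> 4 * C * r\<^sup>2" by linarith
    have "\<bar>v y\<bar> \<le> C" for y using v by (auto simp: bdd_second_diff_def)
    from this[of x] this[of "x + r *\<^sub>R \<theta>"] this[of "x - r *\<^sub>R \<theta>"] show "\<bar>?S \<theta> r\<bar> \<le> 4 * C" by linarith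
  qed
  have m: "(\<lambda>r. ?S \<theta> r) \<in> borel_measurable borel" for \<theta> by measurable
  have e: "?S \<theta> (- r) = ?S \<theta> r" for \<theta> r by simp
  note E = even_integral_half_line[OF s m e b]
  show "integrable lborel (\<lambda>r. ?S \<theta> r / \<bar>r\<bar> powr (1 + 2 * s))" if "\<theta> \<in> sphere 0 1" for \<theta>
    by (rule E(1)[OF that that])
  show int: "integrable \<mu> (\<lambda>\<theta>. \<integral>r. ?S \<theta> r / \<bar>r\<bar> powr (1 + 2 * s) \<partial>lborel)"
  proof (rule integrable_const_bound[where B = "2 * (4 * C) * (1 / (2 - 2 * s) + 1 / (2 * s))"])
    show "AE \<theta> in \<mu>. norm (\<integral>r. ?S \<theta> r / \<bar>r\<bar> powr (1 + 2 * s) \<partial>lborel) \<le> 2 * (4 * C) * (1 / (2 - 2 * s) + 1 / (2 * s))"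
      by (rule AE_I2) (use E(2) in \<open>auto simp: mu'(1)\<close>)
    show "(\<lambda>\<theta>. \<integral>r. ?S \<theta> r / \<bar>r\<bar> powr (1 + 2 * s) \<partial>lborel) \<in> borel_measurable \<mu>"
      by measurable
  qed
  show "stable_at s \<mu> v x \<le> 2 * integral\<^sup>L \<mu> \<beta>"
    if "\<And>\<theta> r. \<theta> \<in> sphere 0 1 \<Longrightarrow> 0 < r \<Longrightarrow> ?S \<theta> r \<le> B \<theta> r"
      "\<And>\<theta>. \<theta> \<in> sphere 0 1 \<Longrightarrow> frac_integral s (B \<theta>) (\<beta> \<theta>)" "integrable \<mu> \<beta>"
  proof -
    have "stable_at s \<mu> v x \<le> (\<integral>\<theta>. 2 * \<beta> \<theta> \<partial>\<mu>)"
      unfolding stable_at_def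
    proof (rule integral_mono[OF int])
      fix \<theta> assume "\<theta> \<in> space \<mu>"
      then have th: "\<theta> \<in> sphere 0 1" by (simp add: mu'(1))
      show "(\<integral>r. ?S \<theta> r / \<bar>r\<bar> powr (1 + 2 * s) \<partial>lborel) \<le> 2 * \<beta> \<theta>"
        by (rule E(3)[OF th th that(1)[OF th] that(2)[OF th]])
    qed (use that in auto)
    then show ?thesis using that by simp
  qed
qed

subsection \<open>A smooth bump\<close>

text \<open>The powers in the denominator make the family closed under differentiation, which gives
  all derivatives of the flat function \<open>flat_exp 0\<close> at once.\<close>

definition flat_exp :: "nat \<Rightarrow> real \<Rightarrow> real" where
  "flat_exp j y = (if y > 0 then exp (- 1 / y) / y ^ j else 0)"

lemma flat_nonneg: "0 \<le> flat_exp j y" by (simp add: flat_exp_def)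

text \<open>A single term of the exponential series at \<open>1 / y\<close> is at most its
  sum.\<close>

lemma flat_le: "flat_exp j y \<le> fact j"
proof (cases "y > 0")
  case True
  have sm: "summable (\<lambda>n. inverse (fact n) * (1 / y) ^ n)" by (rule summable_exp)
  have "(\<Sum>n\<in>{j}. inverse (fact n) * (1 / y) ^ n) \<le> (\<Sum>n. inverse (fact n) * (1 / y) ^ n)"
    by (rule sum_le_suminf[OF sm]) (use True in auto)
  also have "\<dots> = exp (1 / y)" by (simp add: exp_def)
  finally have "fact j * (inverse (fact j) * (1 / y) ^ j) \<le> fact j * exp (1 / y)"
    by (intro mult_left_mono) auto
  moreover have "fact j * (inverse (fact j) * (1 / y) ^ j) = (1 / y) ^ j" by simp
  ultimately have "(1 / y) ^ j \<le> fact j * exp (1 / y)" by metis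
  then have "(1 / y) ^ j * exp (- (1 / y)) \<le> fact j * exp (1 / y) * exp (- (1 / y))"
    by (intro mult_right_mono) auto
  also have "\<dots> = fact j" by (simp add: exp_minus)
  finally show ?thesis using True by (simp add: flat_exp_def power_inverse divide_inverse mult.commute)
qed (simp add: flat_exp_def)

lemma flat_shift: "y \<noteq> 0 \<Longrightarrow> flat_exp j y = y * flat_exp (Suc j) y"
  by (simp add: flat_exp_def)

lemma flat_has_derivative:
  "(flat_exp j has_real_derivative (flat_exp (j + 2) y - j * flat_exp (j + 1) y)) (at y)"
proof -
  consider "y > 0" | "y < 0" | "y = 0" by linarith
  then show ?thesis
  proof cases
    case 1
    have d1: "((\<lambda>y. exp (- inverse y)) has_real_derivative exp (- inverse y) * (inverse y)\<^sup>2) (at y)"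
      using 1 by (auto intro!: derivative_eq_intros simp: power2_eq_square)
    have d2: "((\<lambda>y. inverse y ^ j) has_real_derivative (of_nat j * (inverse y)\<^sup>2 * - (inverse y ^ (j - Suc 0)))) (at y)"
      using DERIV_power[OF DERIV_inverse[of y], of j] 1 by (simp add: power2_eq_square mult_ac)
    have D: "((\<lambda>y. exp (- 1 / y) / y ^ j) has_real_derivative (flat_exp (j + 2) y - j * flat_exp (j + 1) y)) (at y)"
    proof (rule DERIV_cong)
      show "((\<lambda>y. exp (- 1 / y) / y ^ j) has_real_derivative
          exp (- inverse y) * (of_nat j * (inverse y)\<^sup>2 * - (inverse y ^ (j - Suc 0))) +
          exp (- inverse y) * (inverse y)\<^sup>2 * inverse y ^ j) (at y)"
        using DERIV_mult'[OF d1 d2] by (simp add: divide_inverse power_inverse)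
      show "exp (- inverse y) * (of_nat j * (inverse y)\<^sup>2 * - (inverse y ^ (j - Suc 0))) +
          exp (- inverse y) * (inverse y)\<^sup>2 * inverse y ^ j = flat_exp (j + 2) y - j * flat_exp (j + 1) y"
        using 1 by (cases j) (simp_all add: flat_exp_def divide_inverse power_inverse[symmetric] power2_eq_square algebra_simps)
    qed
    have ev: "\<forall>\<^sub>F x in nhds y. exp (- 1 / x) / x ^ j = flat_exp j x"
      using eventually_nhds_in_open[of "{0<..}" y] 1 by (auto elim!: eventually_mono simp: flat_exp_def)
    show ?thesis using DERIV_cong_ev[OF refl ev refl] D by blast
  next
    case 2
    have D: "((\<lambda>y. 0) has_real_derivative (flat_exp (j + 2) y - j * flat_exp (j + 1) y)) (at y)"
      using 2 by (auto simp: flat_exp_def)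
    have ev: "\<forall>\<^sub>F x in nhds y. 0 = flat_exp j x"
      using eventually_nhds_in_open[of "{..<0}" y] 2 by (auto elim!: eventually_mono simp: flat_exp_def)
    show ?thesis using DERIV_cong_ev[OF refl ev refl] D by blast
  next
    case 3
    \<comment> \<open>At 0 the difference quotient of \<open>flat_exp j\<close> is
      \<open>flat_exp (Suc j)\<close>, which equals \<open>h\<close> times a bounded function of the
      same family.\<close>
    have lim: "(\<lambda>h. flat_exp (Suc j) h) \<midarrow>0\<rightarrow> 0"
    proof (rule Lim_null_comparison)
      show "\<forall>\<^sub>F h in at 0. norm (flat_exp (Suc j) h) \<le> fact (j + 2) * \<bar>h\<bar>"
      proof (rule always_eventually, rule allI)
        fix h :: real
        show "norm (flat_exp (Suc j) h) \<le> fact (j + 2) * \<bar>h\<bar>"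
        proof (cases "h = 0")
          case False
          have "\<bar>flat_exp (Suc j) h\<bar> = \<bar>h\<bar> * flat_exp (Suc (Suc j)) h"
            using flat_shift[OF False, of "Suc j"] flat_nonneg[of "Suc (Suc j)" h] by (simp add: abs_mult)
          also have "\<dots> \<le> \<bar>h\<bar> * fact (j + 2)"
            using flat_le[of "Suc (Suc j)" h] by (intro mult_left_mono) auto
          finally show ?thesis by (simp add: mult.commute)
        qed (simp add: flat_exp_def)
      qed
      show "(\<lambda>h. fact (j + 2) * \<bar>h\<bar> :: real) \<midarrow>0\<rightarrow> 0" by (auto intro!: tendsto_eq_intros)
    qed
    have "(\<lambda>h. (flat_exp j (0 + h) - flat_exp j 0) / h) \<midarrow>0\<rightarrow> 0"
    proof (rule Lim_transform_eventually[OF lim])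
      show "\<forall>\<^sub>F h in at 0. flat_exp (Suc j) h = (flat_exp j (0 + h) - flat_exp j 0) / h"
        by (auto simp: eventually_at_filter flat_exp_def)
    qed
    then show ?thesis using 3 by (simp add: DERIV_def flat_exp_def)
  qed
qed

text \<open>A class that contains the bump and is closed under directional derivatives, by the form
  of the derivative of \<open>flat_exp\<close>. Membership therefore yields every \<open>C_k\<close>
  by induction on \<open>k\<close>, without computing higher derivatives.\<close>

inductive smooth :: "('b::euclidean_space \<Rightarrow> real) \<Rightarrow> bool" where
  smooth_const: "smooth (\<lambda>_. c)"
| smooth_inner: "smooth (\<lambda>z. z \<bullet> v)"
| smooth_flat: "smooth (\<lambda>z. flat_exp j (A - (z - z0) \<bullet> (z - z0)))"
| smooth_add: "smooth f \<Longrightarrow> smooth g \<Longrightarrow> smooth (\<lambda>z. f z + g z)"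
| smooth_mult: "smooth f \<Longrightarrow> smooth g \<Longrightarrow> smooth (\<lambda>z. f z * g z)"

lemma flat_quadratic_has_derivative:
  fixes z z0 :: "'b::euclidean_space"
  shows "((\<lambda>z. flat_exp j (A - (z - z0) \<bullet> (z - z0))) has_derivative
     (\<lambda>v. (flat_exp (j + 2) (A - (z - z0) \<bullet> (z - z0)) + (- real j) * flat_exp (j + 1) (A - (z - z0) \<bullet> (z - z0))) *
        ((- 2) * (z \<bullet> v) + 2 * (z0 \<bullet> v)))) (at z)"
proof -
  have "((\<lambda>z. A - (z - z0) \<bullet> (z - z0)) has_derivative (\<lambda>v. - ((z - z0) \<bullet> v + v \<bullet> (z - z0)))) (at z)"
    by (auto intro!: derivative_eq_intros)
  also have "(\<lambda>v. - ((z - z0) \<bullet> v + v \<bullet> (z - z0))) = (\<lambda>v. (- 2) * (z \<bullet> v) + 2 * (z0 \<bullet> v))"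
    by (simp add: fun_eq_iff inner_diff_left inner_diff_right inner_commute[of _ z] inner_commute[of _ z0])
  finally have "((\<lambda>z. A - (z - z0) \<bullet> (z - z0)) has_derivative (\<lambda>v. (- 2) * (z \<bullet> v) + 2 * (z0 \<bullet> v))) (at z)" .
  from has_derivative_compose[OF this flat_has_derivative[THEN has_field_derivative_imp_has_derivative]]
  show ?thesis by simp
qed

lemma smooth_has_derivative:
  "smooth f \<Longrightarrow> \<exists>D. (\<forall>z. (f has_derivative (\<lambda>v. D v z)) (at z)) \<and> (\<forall>v. smooth (D v))"
proof (induction rule: smooth.induct)
  case (smooth_const c)
  show ?case by (rule exI[of _ "\<lambda>v z. 0"]) (auto intro: smooth.intros)
next
  case (smooth_inner v)
  show ?case
    by (rule exI[of _ "\<lambda>w z. w \<bullet> v"]) (auto intro!: smooth.intros derivative_eq_intros)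
next
  case (smooth_flat j A z0)
  show ?case
    by (rule exI, rule conjI, rule allI, rule flat_quadratic_has_derivative) (intro allI smooth.intros)
next
  case (smooth_add f g)
  then obtain D E where "\<forall>z. (f has_derivative (\<lambda>v. D v z)) (at z)" "\<forall>v. smooth (D v)"
    "\<forall>z. (g has_derivative (\<lambda>v. E v z)) (at z)" "\<forall>v. smooth (E v)" by auto
  then show ?case
    by (intro exI[of _ "\<lambda>v z. D v z + E v z"]) (auto intro!: has_derivative_add smooth.intros)
next
  case (smooth_mult f g)
  then obtain D E where "\<forall>z. (f has_derivative (\<lambda>v. D v z)) (at z)" "\<forall>v. smooth (D v)"
    "\<forall>z. (g has_derivative (\<lambda>v. E v z)) (at z)" "\<forall>v. smooth (E v)" by auto
  then show ?case using smooth_mult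
    by (intro exI[of _ "\<lambda>v z. f z * E v z + D v z * g z"]) (auto intro!: has_derivative_mult smooth.intros)
qed

lemma smooth_imp_C_k: "smooth f \<Longrightarrow> C_k k f"
proof (induction k arbitrary: f)
  case 0
  then obtain D where "\<forall>z. (f has_derivative (\<lambda>v. D v z)) (at z)" using smooth_has_derivative by blast
  then show ?case by (auto intro!: continuous_at_imp_continuous_on has_derivative_continuous)
next
  case (Suc k)
  then obtain D where D: "\<forall>z. (f has_derivative (\<lambda>v. D v z)) (at z)" "\<forall>v. smooth (D v)"
    using smooth_has_derivative by blast
  then have "frechet_derivative f (at z) v = D v z" for z v
    by (metis frechet_derivative_at)
  then show ?case using D Suc.IH by (auto simp: differentiable_def)
qed

definition bump :: "real \<Rightarrow> 'b::euclidean_space \<Rightarrow> real" where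
  "bump e w = flat_exp 0 (e\<^sup>2 - w \<bullet> w)"

lemma bump_nonneg: "0 \<le> bump e w" and bump_le_1: "bump e w \<le> 1"
  using flat_nonneg flat_le[of 0] by (auto simp: bump_def)

lemma bump_pos_iff:
  assumes "0 < e" shows "0 < bump e w \<longleftrightarrow> norm w < e"
proof -
  have "0 < bump e w \<longleftrightarrow> (norm w)\<^sup>2 < e\<^sup>2"
    by (simp add: bump_def flat_exp_def dot_square_norm)
  also have "\<dots> \<longleftrightarrow> norm w < e"
    using assms power_strict_mono[of "norm w" e 2] power_mono[of e "norm w" 2] by (auto simp: not_less[symmetric])
  finally show ?thesis .
qed

lemma bump_eq_0: "0 < e \<Longrightarrow> e \<le> norm w \<Longrightarrow> bump e w = 0"
  using bump_pos_iff[of e w] bump_nonneg[of e w] by linarith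

lemma bump_even: "bump e (- w) = bump e w" by (simp add: bump_def)

lemma smooth_bump: "smooth (\<lambda>w. bump e (w - z0))"
  unfolding bump_def by (rule smooth_flat)

definition bump_deriv :: "real \<Rightarrow> 'b::euclidean_space \<Rightarrow> 'b \<Rightarrow> real" where
  "bump_deriv e y w = flat_exp 2 (e\<^sup>2 - w \<bullet> w) * (- 2 * (w \<bullet> y))"

text \<open>Taylor's formula along the segment. On the support \<open>l\<close> is at most
  \<open>e * norm y\<close> in absolute value, and the flat functions of orders 2, 3 and 4 are at
  most 2, 6 and 24; this bounds the second derivative by
  \<open>(4 + 144 * e\<^sup>2) * (norm y)\<^sup>2\<close>, of which the formula takes half.\<close>

lemma bump_taylor:
  fixes w y :: "'b::euclidean_space"
  assumes e: "0 < e"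
  shows "\<bar>bump e (w + y) - bump e w - bump_deriv e y w\<bar> \<le> (2 + 72 * e\<^sup>2) * (norm y)\<^sup>2"
proof -
  define q where "q = (\<lambda>t. e\<^sup>2 - (w + t *\<^sub>R y) \<bullet> (w + t *\<^sub>R y))"
  define l where "l = (\<lambda>t. (w + t *\<^sub>R y) \<bullet> y)"
  define d where "d = (\<lambda>n::nat. if n = 0 then (\<lambda>t. flat_exp 0 (q t)) else if n = 1 then (\<lambda>t. flat_exp 2 (q t) * (- 2 * l t))
     else (\<lambda>t. (flat_exp 4 (q t) - 2 * flat_exp 3 (q t)) * (4 * (l t)\<^sup>2) - 2 * (y \<bullet> y) * flat_exp 2 (q t)))"
  have lt: "l t = w \<bullet> y + t * (y \<bullet> y)" for t by (simp add: l_def inner_add_left)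
  have qt: "q t = e\<^sup>2 - w \<bullet> w - 2 * (w \<bullet> y) * t - (y \<bullet> y) * t\<^sup>2" for t
    by (simp add: q_def inner_add_left inner_add_right inner_commute[of y w] power2_eq_square distrib_left mult_ac)
  have dq: "(q has_real_derivative (- 2 * l t)) (at t)" for t
    unfolding qt[abs_def] lt by (auto intro!: derivative_eq_intros)
  have dl: "(l has_real_derivative (y \<bullet> y)) (at t)" for t
    unfolding lt[abs_def] by (auto intro!: derivative_eq_intros)
  have d0: "(d 0 has_real_derivative d 1 t) (at t)" for t
    using DERIV_chain2[OF flat_has_derivative[of 0 "q t"] dq[of t]]
    by (simp add: d_def numeral_2_eq_2)
  have d1: "(d 1 has_real_derivative d 2 t) (at t)" for t
  proof -
    have "((\<lambda>t. flat_exp 2 (q t)) has_real_derivative (flat_exp 4 (q t) - 2 * flat_exp 3 (q t)) * (- 2 * l t)) (at t)"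
      using DERIV_chain2[OF flat_has_derivative[of 2 "q t"] dq[of t]]
      by (simp add: eval_nat_numeral)
    from DERIV_mult[OF this DERIV_cmult[OF dl, of "-2"]]
    have "((\<lambda>t. flat_exp 2 (q t) * (- 2 * l t)) has_real_derivative
      ((flat_exp 4 (q t) - 2 * flat_exp 3 (q t)) * (- 2 * l t) * (- 2 * l t) + - 2 * (y \<bullet> y) * flat_exp 2 (q t))) (at t)" .
    then show ?thesis by (simp add: d_def power2_eq_square algebra_simps)
  qed
  have "\<exists>t>0. t < 1 \<and> d 0 1 = (\<Sum>m<2. d m 0 / fact m * 1 ^ m) + d 2 t / fact 2 * 1 ^ 2"
  proof (rule Maclaurin)
    show "\<forall>m t. m < 2 \<and> 0 \<le> t \<and> t \<le> 1 \<longrightarrow> DERIV (d m) t :> d (Suc m) t"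
    proof (intro allI impI)
      fix m :: nat and t :: real assume "m < 2 \<and> 0 \<le> t \<and> (t::real) \<le> 1"
      then have "m = 0 \<or> m = 1" by auto
      then show "DERIV (d m) t :> d (Suc m) t"
        using d0[of t] d1[of t] by (auto simp only: One_nat_def numeral_2_eq_2)
    qed
  qed auto
  then obtain t where t: "d 0 1 = d 0 0 + d 1 0 + d 2 t / 2" by (auto simp: numeral_2_eq_2)
  have "\<bar>d 2 t\<bar> \<le> (4 + 144 * e\<^sup>2) * (norm y)\<^sup>2"
  proof (cases "q t > 0")
    case True
    have "(norm (w + t *\<^sub>R y))\<^sup>2 \<le> e\<^sup>2" using True by (simp add: q_def dot_square_norm)
    moreover have "(l t)\<^sup>2 \<le> (norm (w + t *\<^sub>R y))\<^sup>2 * (norm y)\<^sup>2"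
      unfolding l_def power_mult_distrib[symmetric] by (simp add: Cauchy_Schwarz_ineq2 power2_le_iff_abs_le)
    ultimately have l: "(l t)\<^sup>2 \<le> e\<^sup>2 * (norm y)\<^sup>2"
      by (meson mult_right_mono order_trans zero_le_power2)
    have "\<bar>flat_exp 4 (q t) - 2 * flat_exp 3 (q t)\<bar> \<le> 36"
      using flat_nonneg[of 4 "q t"] flat_nonneg[of 3 "q t"] flat_le[of 4 "q t"] flat_le[of 3 "q t"]
      by (simp add: fact_numeral)
    then have "\<bar>(flat_exp 4 (q t) - 2 * flat_exp 3 (q t)) * (4 * (l t)\<^sup>2)\<bar> \<le> 36 * (4 * (e\<^sup>2 * (norm y)\<^sup>2))"
      unfolding abs_mult using l by (intro mult_mono) auto
    moreover have "\<bar>2 * (y \<bullet> y) * flat_exp 2 (q t)\<bar> \<le> 2 * (norm y)\<^sup>2 * 2"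
      unfolding abs_mult using flat_nonneg[of 2 "q t"] flat_le[of 2 "q t"]
      by (intro mult_mono) (auto simp: dot_square_norm fact_numeral)
    ultimately show ?thesis by (simp add: d_def algebra_simps)
  qed (simp add: d_def flat_exp_def)
  then show ?thesis using t by (simp add: d_def bump_def bump_deriv_def q_def l_def algebra_simps)
qed

lemma bump_second_diff:
  fixes w y :: "'b::euclidean_space"
  assumes e: "0 < e"
  shows "\<bar>bump e (w + y) + bump e (w - y) - 2 * bump e w\<bar> \<le> (4 + 144 * e\<^sup>2) * (norm y)\<^sup>2"
  using bump_taylor[OF e, of w y] bump_taylor[OF e, of w "- y"]
  by (simp add: bump_deriv_def algebra_simps)

lemma bump_deriv_bound:
  fixes w y :: "'b::euclidean_space"
  assumes e: "0 < e"
  shows "\<bar>bump_deriv e y w\<bar> \<le> 4 * e * norm y * indicator (cball 0 e) w"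
proof (cases "norm w \<le> e")
  case True
  have "\<bar>flat_exp 2 (e\<^sup>2 - w \<bullet> w)\<bar> \<le> 2" using flat_le[of 2] flat_nonneg[of 2] by (simp add: fact_numeral)
  moreover have "\<bar>w \<bullet> y\<bar> \<le> e * norm y"
    using Cauchy_Schwarz_ineq2[of w y] mult_right_mono[OF True norm_ge_zero[of y]] by linarith
  ultimately have "\<bar>flat_exp 2 (e\<^sup>2 - w \<bullet> w)\<bar> * (2 * \<bar>w \<bullet> y\<bar>) \<le> 2 * (2 * (e * norm y))"
    by (intro mult_mono) auto
  then show ?thesis using True by (simp add: bump_deriv_def abs_mult)
next
  case False
  then have "e\<^sup>2 < w \<bullet> w" using e by (simp add: dot_square_norm power_strict_mono)
  then show ?thesis using e by (simp add: bump_deriv_def flat_exp_def)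
qed

lemma continuous_on_bump [continuous_intros]: "continuous_on S (bump e)"
proof -
  have "C_k 0 (\<lambda>w. bump e (w - 0))" by (rule smooth_imp_C_k[OF smooth_bump])
  then show ?thesis by (auto intro: continuous_on_subset)
qed

lemma bump_measurable [measurable]: "bump e \<in> borel_measurable borel"
  by (intro borel_measurable_continuous_onI continuous_intros)

lemma bump_deriv_measurable [measurable]: "bump_deriv e y \<in> borel_measurable borel"
proof -
  have "flat_exp 2 \<in> borel_measurable borel" unfolding flat_exp_def by measurable
  then show ?thesis unfolding bump_deriv_def by measurable
qed

subsection \<open>Mollification\<close>

definition moll_kernel :: "real \<Rightarrow> 'b::euclidean_space \<Rightarrow> real" where
  "moll_kernel e w = bump e w / (\<integral>v. bump e (v :: 'b) \<partial>lborel)"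

definition moll :: "real \<Rightarrow> ('b::euclidean_space \<Rightarrow> real) \<Rightarrow> 'b \<Rightarrow> real" where
  "moll e u z = (\<integral>w. u w * moll_kernel e (z - w) \<partial>lborel)"

lemma bounded_support_integral:
  fixes u k :: "'b::euclidean_space \<Rightarrow> real"
  assumes [measurable]: "u \<in> borel_measurable borel" "k \<in> borel_measurable borel"
    and u: "\<And>w. \<bar>u w\<bar> \<le> 1" and k: "\<And>w. \<bar>k w\<bar> \<le> M * indicator (cball c R) w"
  shows "integrable lborel (\<lambda>w. u w * k w)" "\<bar>\<integral>w. u w * k w \<partial>lborel\<bar> \<le> M * measure lborel (cball c R)"
proof -
  have fin: "emeasure lborel (cball c R) < \<infinity>" using emeasure_bounded_finite[OF bounded_cball[of c R]] by simp
  have i: "integrable lborel (\<lambda>w. M * indicator (cball c R) w :: real)"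
    using fin by (intro integrable_mult_right integrable_real_indicator) auto
  have b: "\<bar>u w * k w\<bar> \<le> M * indicator (cball c R) w" for w
    using mult_mono[OF u[of w] k[of w]] by (simp add: abs_mult)
  show int: "integrable lborel (\<lambda>w. u w * k w)"
    by (rule Bochner_Integration.integrable_bound[OF i]) (use b in \<open>auto intro: order_trans[OF _ abs_ge_self]\<close>)
  have "\<bar>\<integral>w. u w * k w \<partial>lborel\<bar> \<le> (\<integral>w. \<bar>u w * k w\<bar> \<partial>lborel)" by (rule integral_abs_bound)
  also have "\<dots> \<le> (\<integral>w. M * indicator (cball c R) w \<partial>lborel)"
    by (intro integral_mono integrable_abs int i b)
  also have "\<dots> = M * measure lborel (cball c R)" by simp
  finally show "\<bar>\<integral>w. u w * k w \<partial>lborel\<bar> \<le> M * measure lborel (cball c R)" .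
qed

lemma integrable_bump:
  assumes "0 < e" shows "integrable lborel (bump e :: 'b::euclidean_space \<Rightarrow> real)"
proof -
  have "\<bar>bump e w\<bar> \<le> 1 * indicator (cball 0 e) w" for w :: 'b
    using bump_nonneg[of e w] bump_le_1[of e w] bump_eq_0[OF assms, of w] by (auto simp: indicator_def)
  then have "integrable lborel (\<lambda>w::'b. 1 * bump e w)"
    by (intro bounded_support_integral(1)[where M = 1 and c = 0 and R = e]) auto
  then show ?thesis by simp
qed

lemma bump_mass_pos:
  assumes "0 < e" shows "0 < (\<integral>v. bump e (v :: 'b::euclidean_space) \<partial>lborel)"
proof -
  have "(\<integral>v. bump e (v :: 'b) \<partial>lborel) \<noteq> 0"
  proof
    assume "(\<integral>v. bump e (v :: 'b) \<partial>lborel) = 0"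
    then have "AE v in lborel. bump e (v :: 'b) = 0"
      using integral_nonneg_eq_0_iff_AE[OF integrable_bump[OF assms]] bump_nonneg by auto
    then have "AE v in lborel. v \<notin> ball (0::'b) e"
      by (rule eventually_mono) (auto simp: bump_pos_iff[OF assms, symmetric])
    then have "ball (0::'b) e \<in> null_sets lborel" by (subst AE_iff_null_sets) auto
    then have "negligible (ball (0::'b) e)" by (simp add: negligible_iff_null_sets null_sets_completionI)
    then show False using assms open_not_negligible[of "ball (0::'b) e"] by auto
  qed
  moreover have "0 \<le> (\<integral>v. bump e (v :: 'b) \<partial>lborel)" by (simp add: bump_nonneg)
  ultimately show ?thesis by linarith
qed

lemma moll_kernel_nonneg: "0 \<le> moll_kernel e w"
  unfolding moll_kernel_def by (simp add: bump_nonneg)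

lemma moll_kernel_measurable [measurable]: "moll_kernel e \<in> borel_measurable borel"
  unfolding moll_kernel_def[abs_def] by measurable

lemma moll_kernel_minus: "moll_kernel e (- w) = moll_kernel e w" by (simp add: moll_kernel_def bump_even)

lemma moll_kernel_swap: "moll_kernel e (z - w) = moll_kernel e (w - z)" using moll_kernel_minus[of e "z - w"] by simp

lemma integral_shift_minus:
  fixes k :: "'b::euclidean_space \<Rightarrow> real"
  assumes "\<And>w. k (- w) = k w" "integrable lborel k"
  shows "integrable lborel (\<lambda>w. k (z - w))" "(\<integral>w. k (z - w) \<partial>lborel) = integral\<^sup>L lborel k"
proof -
  have eq: "(\<lambda>w. k (z - w)) = (\<lambda>w. k (- z + w))"
    using assms(1)[of "z - w" for w] by (auto simp: fun_eq_iff)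
  have d: "lborel = distr lborel borel ((+) (- z))" using lborel_distr_plus[of "- z"] by simp
  have "integrable (distr lborel borel ((+) (- z))) k" using assms d by simp
  then show "integrable lborel (\<lambda>w. k (z - w))" unfolding eq
    by (subst (asm) integrable_distr_eq) (use assms in auto)
  have "integral\<^sup>L lborel k = integral\<^sup>L (distr lborel borel ((+) (- z))) k" using d by simp
  also have "\<dots> = (\<integral>w. k (- z + w) \<partial>lborel)" by (rule integral_distr) (use assms in auto)
  finally show "(\<integral>w. k (z - w) \<partial>lborel) = integral\<^sup>L lborel k" by (simp add: eq)
qed

lemma moll_kernel_integral:
  assumes "0 < e"
  shows "integrable lborel (\<lambda>w::'b::euclidean_space. moll_kernel e (z - w))" "(\<integral>w. moll_kernel e (z - (w::'b)) \<partial>lborel) = 1"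
proof -
  have "integrable lborel (moll_kernel e :: 'b \<Rightarrow> real)" "integral\<^sup>L lborel (moll_kernel e :: 'b \<Rightarrow> real) = 1"
    using integrable_bump[OF assms, where ?'b = 'b] bump_mass_pos[OF assms, where ?'b = 'b]
    by (simp_all add: moll_kernel_def[abs_def])
  then show "integrable lborel (\<lambda>w::'b. moll_kernel e (z - w))" "(\<integral>w. moll_kernel e (z - (w::'b)) \<partial>lborel) = 1"
    using integral_shift_minus[of "moll_kernel e :: 'b \<Rightarrow> real"] moll_kernel_minus by auto
qed

lemma moll_kernel_eq_0: "0 < e \<Longrightarrow> e \<le> norm w \<Longrightarrow> moll_kernel e w = 0"
  by (simp add: moll_kernel_def bump_eq_0)

lemma moll_kernel_bounds:
  assumes e: "0 < e"
  obtains C where "0 < C" "\<And>w :: 'b::euclidean_space. moll_kernel e w \<le> C"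
    "\<And>w y :: 'b. \<bar>moll_kernel e (w + y) - moll_kernel e w - bump_deriv e y w / (\<integral>v. bump e (v :: 'b) \<partial>lborel)\<bar> \<le> C * (norm y)\<^sup>2"
    "\<And>w y :: 'b. \<bar>bump_deriv e y w / (\<integral>v. bump e (v :: 'b) \<partial>lborel)\<bar> \<le> C * norm y * indicator (cball 0 e) w"
    "\<And>w y :: 'b. \<bar>moll_kernel e (w + y) + moll_kernel e (w - y) - 2 * moll_kernel e w\<bar> \<le> C * (norm y)\<^sup>2"
proof -
  define m where "m = (\<integral>v. bump e (v :: 'b) \<partial>lborel)"
  have m: "m > 0" unfolding m_def by (rule bump_mass_pos[OF e])
  define C where "C = (4 + 144 * e\<^sup>2 + 4 * e) / m"
  have C: "C > 0" unfolding C_def using m e by (intro divide_pos_pos add_pos_pos add_pos_nonneg) auto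
  have k: "moll_kernel e w = bump e w / m" for w :: 'b by (simp add: moll_kernel_def m_def)
  show thesis
  proof (rule that[OF C])
    fix w y :: 'b
    have "bump e w / m \<le> C" unfolding C_def using bump_le_1[of e w] e m
      by (intro divide_right_mono) (auto intro: order_trans)
    then show "moll_kernel e w \<le> C" by (simp add: k)
    have le: "X / m \<le> C * Y" if X: "X \<le> c * Y" "0 \<le> Y" "c \<le> 4 + 144 * e\<^sup>2 + 4 * e" for X Y c
    proof -
      have "X \<le> (4 + 144 * e\<^sup>2 + 4 * e) * Y" using X mult_right_mono[OF X(3,2)] by linarith
      then have "X / m \<le> (4 + 144 * e\<^sup>2 + 4 * e) * Y / m" by (rule divide_right_mono) (use m in auto)
      then show ?thesis by (simp add: C_def)
    qed
    have "\<bar>bump e (w + y) - bump e w - bump_deriv e y w\<bar> / m \<le> C * (norm y)\<^sup>2"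
      by (rule le[OF bump_taylor[OF e]]) (use e in auto)
    then show "\<bar>moll_kernel e (w + y) - moll_kernel e w - bump_deriv e y w / (\<integral>v. bump e (v :: 'b) \<partial>lborel)\<bar> \<le> C * (norm y)\<^sup>2"
      using m by (simp add: k m_def[symmetric] diff_divide_distrib[symmetric])
    have "\<bar>bump_deriv e y w\<bar> / m \<le> C * (norm y * indicator (cball 0 e) w)"
      by (rule le[of _ "4 * e"]) (use e bump_deriv_bound[OF e, of y w] in \<open>auto simp: mult.assoc\<close>)
    then show "\<bar>bump_deriv e y w / (\<integral>v. bump e (v :: 'b) \<partial>lborel)\<bar> \<le> C * norm y * indicator (cball 0 e) w"
      using m by (simp add: m_def[symmetric] mult.assoc)
    have "\<bar>bump e (w + y) + bump e (w - y) - 2 * bump e w\<bar> / m \<le> C * (norm y)\<^sup>2"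
      by (rule le[OF bump_second_diff[OF e]]) (use e in auto)
    then show "\<bar>moll_kernel e (w + y) + moll_kernel e (w - y) - 2 * moll_kernel e w\<bar> \<le> C * (norm y)\<^sup>2"
      using m by (simp add: k diff_divide_distrib[symmetric] add_divide_distrib[symmetric])
  qed
qed

text \<open>The bound holds at every point, not just almost everywhere; a representative of this
  kind is chosen at the end, and no exceptional set has to be carried through the
  convolutions.\<close>

locale bounded_fun =
  fixes u :: "'b::euclidean_space \<Rightarrow> real"
  assumes u_measurable [measurable]: "u \<in> borel_measurable borel"
    and u_le_1: "\<bar>u w\<bar> \<le> 1"
begin

lemma moll_integrable: "0 < e \<Longrightarrow> integrable lborel (\<lambda>w. u w * moll_kernel e (z - w))"
  by (rule Bochner_Integration.integrable_bound[OF moll_kernel_integral(1)[of e z]])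
    (use u_le_1 moll_kernel_nonneg in \<open>auto simp: abs_mult mult_left_le_one_le\<close>)

lemma moll_minus: "moll e (\<lambda>w. - u w) z = - moll e u z"
  by (simp add: moll_def)

lemma moll_mono_AE:
  assumes e: "0 < e" and ae: "AE w in lborel. dist z w < e \<longrightarrow> u w \<le> m"
  shows "moll e u z \<le> m"
proof -
  have "moll e u z \<le> (\<integral>w. m * moll_kernel e (z - w) \<partial>lborel)"
    unfolding moll_def
  proof (rule integral_mono_AE)
    show "AE w in lborel. u w * moll_kernel e (z - w) \<le> m * moll_kernel e (z - w)"
      using ae
    proof eventually_elim
      case (elim w)
      then show ?case using moll_kernel_nonneg[of e "z - w"] moll_kernel_eq_0[OF e, of "z - w"]
        by (cases "dist z w < e") (auto simp: dist_norm intro: mult_right_mono)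
    qed
  qed (use e moll_integrable moll_kernel_integral in auto)
  also have "\<dots> = m" using moll_kernel_integral[OF e, of z] by simp
  finally show ?thesis .
qed

lemma moll_ge_AE:
  assumes e: "0 < e" and ae: "AE w in lborel. dist z w < e \<longrightarrow> m \<le> u w"
  shows "m \<le> moll e u z"
proof -
  interpret n: bounded_fun "\<lambda>w. - u w" by unfold_locales (auto simp: u_le_1)
  have "moll e (\<lambda>w. - u w) z \<le> - m" by (rule n.moll_mono_AE[OF e]) (use ae in auto)
  then show ?thesis by (simp add: moll_minus)
qed

lemma moll_abs_AE:
  assumes e: "0 < e" and ae: "AE w in lborel. dist z w < e \<longrightarrow> \<bar>u w\<bar> \<le> m"
  shows "\<bar>moll e u z\<bar> \<le> m"
proof -
  have "moll e u z \<le> m" by (rule moll_mono_AE[OF e]) (use ae in \<open>auto elim!: eventually_mono\<close>)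
  moreover have "- m \<le> moll e u z" by (rule moll_ge_AE[OF e]) (use ae in \<open>auto elim!: eventually_mono\<close>)
  ultimately show ?thesis by auto
qed

lemma moll_le_1: "0 < e \<Longrightarrow> \<bar>moll e u z\<bar> \<le> 1"
  by (rule moll_abs_AE) (auto simp: u_le_1)

text \<open>All differences fall on the kernel. For steps of length at most 1 the differences of the
  kernel live in a ball of radius \<open>e + 1\<close>, so the supremum bound times the volume
  suffices; longer steps use the bound 1 for the mollified function.\<close>

lemma moll_regular:
  assumes e: "0 < e"
  obtains C where "0 < C" "\<And>z y. \<bar>moll e u (z + y) + moll e u (z - y) - 2 * moll e u z\<bar> \<le> C * (norm y)\<^sup>2"
    "\<And>z y. norm y \<le> 1 \<Longrightarrow>
      \<bar>moll e u (z + y) - moll e u z - (\<integral>w. u w * (bump_deriv e y (z - w) / (\<integral>v. bump e (v :: 'b) \<partial>lborel)) \<partial>lborel)\<bar> \<le> C * (norm y)\<^sup>2"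
    "\<And>z y. norm y \<le> 1 \<Longrightarrow> \<bar>moll e u (z + y) - moll e u z\<bar> \<le> C * norm y"
proof -
  define m where "m = (\<integral>v. bump e (v :: 'b) \<partial>lborel)"
  obtain C where C: "0 < C" "\<And>w y :: 'b. \<bar>moll_kernel e (w + y) - moll_kernel e w - bump_deriv e y w / m\<bar> \<le> C * (norm y)\<^sup>2"
    "\<And>w y :: 'b. \<bar>bump_deriv e y w / m\<bar> \<le> C * norm y * indicator (cball 0 e) w"
    "\<And>w y :: 'b. \<bar>moll_kernel e (w + y) + moll_kernel e (w - y) - 2 * moll_kernel e w\<bar> \<le> C * (norm y)\<^sup>2"
    unfolding m_def by (rule moll_kernel_bounds[OF e, where ?'b = 'b]) blast
  define V where "V = measure lborel (cball (0::'b) (e + 1))"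
  have V: "measure lborel (cball z (e + 1)) = V" for z :: 'b
    unfolding V_def using content_cball[of "e + 1" z] content_cball[of "e + 1" "0::'b"] e by simp
  have V0: "0 \<le> V" by (simp add: V_def)
  \<comment> \<open>\<open>C * V\<close> appears twice because the Lipschitz bound adds the linear
    term and the Taylor remainder; 4 serves the steps longer than 1.\<close>
  define C' where "C' = 2 * C * V + 4"
  have C': "C' > 0" using C(1) V0 by (auto simp: C'_def intro: add_nonneg_pos)
  have far: "moll_kernel e w = 0" "moll_kernel e (w + y) = 0" "moll_kernel e (w - y) = 0" "bump_deriv e y w / m = 0"
    if "norm y \<le> 1" "norm w > e + 1" for w y :: 'b
  proof -
    have "norm (w + y) \<ge> e" "norm (w - y) \<ge> e" "norm w \<ge> e"
      using that norm_triangle_ineq4[of "w + y" y] norm_triangle_ineq[of "w - y" y] by auto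
    then show "moll_kernel e w = 0" "moll_kernel e (w + y) = 0" "moll_kernel e (w - y) = 0" by (auto simp: moll_kernel_eq_0 e)
    show "bump_deriv e y w / m = 0" using C(3)[of y w] that by auto
  qed
  have ind: "\<bar>X\<bar> \<le> c * indicator (cball z (e + 1)) w"
    if "\<bar>X\<bar> \<le> c" "norm (z - w) > e + 1 \<Longrightarrow> X = 0" for X c :: real and z w :: 'b
    using that by (cases "norm (z - w) > e + 1") (auto simp: dist_norm indicator_def)
  have int: "integrable lborel (\<lambda>w. u w * moll_kernel e (z - w))" for z by (rule moll_integrable[OF e])
  have intd: "integrable lborel (\<lambda>w. u w * (bump_deriv e y (z - w) / m))" for z y
  proof (rule bounded_support_integral(1)[where M = "C * norm y" and c = z and R = e])
    show "\<bar>bump_deriv e y (z - w) / m\<bar> \<le> C * norm y * indicator (cball z e) w" for w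
      using C(3)[of y "z - w"] by (simp add: indicator_def dist_norm norm_minus_commute)
  qed (auto simp: u_le_1)
  have taylor: "\<bar>moll e u (z + y) - moll e u z - (\<integral>w. u w * (bump_deriv e y (z - w) / m) \<partial>lborel)\<bar> \<le> C * V * (norm y)\<^sup>2"
    if y: "norm y \<le> 1" for z y
  proof -
    have "moll e u (z + y) - moll e u z - (\<integral>w. u w * (bump_deriv e y (z - w) / m) \<partial>lborel) =
      (\<integral>w. u w * (moll_kernel e (z - w + y) - moll_kernel e (z - w) - bump_deriv e y (z - w) / m) \<partial>lborel)"
      unfolding moll_def using int[of z] int[of "z + y"] intd[of y z]
      by (simp add: right_diff_distrib add_diff_eq diff_add_eq)
    also have "\<bar>\<dots>\<bar> \<le> C * (norm y)\<^sup>2 * measure lborel (cball z (e + 1))"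
      by (rule bounded_support_integral(2)) (auto simp: u_le_1 far[OF y] intro!: ind C)
    finally show ?thesis by (simp add: V mult_ac)
  qed
  show thesis
  proof (rule that[OF C'])
    fix z y :: 'b
    show "\<bar>moll e u (z + y) + moll e u (z - y) - 2 * moll e u z\<bar> \<le> C' * (norm y)\<^sup>2"
    proof (cases "norm y \<le> 1")
      case True
      have "moll e u (z + y) + moll e u (z - y) - 2 * moll e u z =
        (\<integral>w. u w * (moll_kernel e (z - w + y) + moll_kernel e (z - w - y) - 2 * moll_kernel e (z - w)) \<partial>lborel)"
      proof -
        have eq: "z - w + y = z + y - w" "z - w - y = z - y - w" for w by auto
        show ?thesis unfolding moll_def eq using int[of z] int[of "z + y"] int[of "z - y"]
          by (simp add: right_diff_distrib distrib_left mult.left_commute[of _ 2])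
      qed
      also have "\<bar>\<dots>\<bar> \<le> C * (norm y)\<^sup>2 * measure lborel (cball z (e + 1))"
        by (rule bounded_support_integral(2)) (auto simp: u_le_1 far[OF True] intro!: ind C)
      also have "\<dots> \<le> C' * (norm y)\<^sup>2"
        unfolding V C'_def using C(1) V0 by (simp add: algebra_simps)
      finally show ?thesis .
    next
      case False
      have "\<bar>moll e u (z + y) + moll e u (z - y) - 2 * moll e u z\<bar> \<le> 4 * 1\<^sup>2"
        using moll_le_1[OF e, of z] moll_le_1[OF e, of "z + y"] moll_le_1[OF e, of "z - y"] by (simp add: abs_le_iff)
      also have "\<dots> \<le> C' * (norm y)\<^sup>2"
        using False C(1) V0 by (intro mult_mono power_mono) (auto simp: C'_def)
      finally show ?thesis .
    qed
    assume y: "norm y \<le> 1"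
    show "\<bar>moll e u (z + y) - moll e u z - (\<integral>w. u w * (bump_deriv e y (z - w) / (\<integral>v. bump e (v :: 'b) \<partial>lborel)) \<partial>lborel)\<bar> \<le> C' * (norm y)\<^sup>2"
      unfolding m_def[symmetric] by (rule order_trans[OF taylor[OF y]])
        (use C(1) V0 in \<open>auto simp: C'_def intro!: mult_right_mono\<close>)
    have "\<bar>\<integral>w. u w * (bump_deriv e y (z - w) / m) \<partial>lborel\<bar> \<le> C * norm y * measure lborel (cball z (e + 1))"
    proof (rule bounded_support_integral(2))
      show "\<bar>bump_deriv e y (z - w) / m\<bar> \<le> C * norm y * indicator (cball z (e + 1)) w" for w
      proof -
        have "C * norm y * indicator (cball 0 e) (z - w) \<le> C * norm y * indicator (cball z (e + 1)) w"
          using C(1) by (intro mult_left_mono) (auto simp: indicator_def dist_norm norm_minus_commute)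
        then show ?thesis using C(3)[of y "z - w"] by linarith
      qed
    qed (auto simp: u_le_1)
    moreover have "C * V * (norm y)\<^sup>2 \<le> C * V * norm y"
      using y C(1) V0 by (intro mult_left_mono) (auto simp: power2_eq_square mult_left_le)
    ultimately show "\<bar>moll e u (z + y) - moll e u z\<bar> \<le> C' * norm y"
    proof -
      define I where "I = (\<integral>w. u w * (bump_deriv e y (z - w) / m) \<partial>lborel)"
      assume "\<bar>\<integral>w. u w * (bump_deriv e y (z - w) / m) \<partial>lborel\<bar> \<le> C * norm y * measure lborel (cball z (e + 1))"
      then have "\<bar>I\<bar> \<le> C * V * norm y" unfolding V I_def[symmetric] by (simp add: mult_ac)
      moreover assume "C * V * (norm y)\<^sup>2 \<le> C * V * norm y"
      moreover have "\<bar>moll e u (z + y) - moll e u z - I\<bar> \<le> C * V * (norm y)\<^sup>2"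
        unfolding I_def by (rule taylor[OF y])
      moreover have "C' * norm y = C * V * norm y + C * V * norm y + 4 * norm y"
        by (simp add: C'_def algebra_simps)
      ultimately show ?thesis using norm_ge_zero[of y] by linarith
    qed
  qed
qed

lemma moll_continuous: 
  assumes e: "0 < e" shows "continuous_on S (moll e u)"
proof (rule continuous_at_imp_continuous_on, rule ballI)
  fix z
  obtain C where C: "0 < C" "\<And>z y. norm y \<le> 1 \<Longrightarrow> \<bar>moll e u (z + y) - moll e u z\<bar> \<le> C * norm y"
    by (rule moll_regular[OF e]) blast
  have "(\<lambda>y. moll e u (z + y)) \<midarrow>0\<rightarrow> moll e u z"
  proof (rule LIM_zero_cancel, rule Lim_null_comparison)
    have "\<forall>\<^sub>F y in at 0. norm (y :: 'b) < 1"
      unfolding eventually_at by (intro exI[of _ 1]) simp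
    then show "\<forall>\<^sub>F y in at 0. norm (moll e u (z + y) - moll e u z) \<le> C * norm y"
      by eventually_elim (use C in auto)
    show "(\<lambda>y. C * norm y) \<midarrow>0\<rightarrow> 0" by (auto intro!: tendsto_eq_intros)
  qed
  then show "isCont (moll e u) z" by (simp add: isCont_iff)
qed

end

subsection \<open>The equation for the mollified solution\<close>

definition frac_weight :: "real \<Rightarrow> real \<Rightarrow> real" where
  "frac_weight s r = 1 / \<bar>r\<bar> powr (1 + 2 * s)"

lemma frac_weight_measurable [measurable]: "frac_weight s \<in> borel_measurable borel"
  unfolding frac_weight_def[abs_def] by measurable

lemma frac_weight_nonneg: "0 \<le> frac_weight s r" by (simp add: frac_weight_def)

lemma integrable_min_weight:
  assumes "0 < s" "s < 1"
  shows "integrable lborel (\<lambda>r. min 1 (r\<^sup>2) * frac_weight s r)"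
  using even_integral_half_line(1)[OF assms, of "\<lambda>r. min 1 (r\<^sup>2)" 1] by (simp add: frac_weight_def)

lemma integrable_min_weight_product:
  assumes s: "0 < s" "s < 1" and \<mu>: "finite_measure \<mu>"
  shows "integrable (\<mu> \<Otimes>\<^sub>M lborel) (\<lambda>(\<theta>, r). c * (min 1 (r\<^sup>2) * frac_weight s r))"
proof -
  interpret finite_measure \<mu> by fact
  interpret pair_sigma_finite \<mu> lborel ..
  show ?thesis
    by (rule Fubini_integrable) (use integrable_min_weight[OF s] in auto)
qed

text \<open>The nested integrals become one integral over pairs of direction and length, the form in
  which Fubini is applied when the operator is moved off the test function.\<close>

lemma stable_at_product:
  fixes v :: "'a::euclidean_space \<Rightarrow> real"
  assumes s: "0 < s" "s < 1" and mu: "spectral_measure s lam Lam \<mu>" "0 \<le> Lam" and v: "bdd_second_diff C v"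
  shows "stable_at s \<mu> v x =
    (\<integral>p. frac_weight s (snd p) * (v (x + snd p *\<^sub>R fst p) + v (x - snd p *\<^sub>R fst p) - 2 * v x) \<partial>(\<mu> \<Otimes>\<^sub>M (lborel :: real measure)))"
proof -
  note mu' = spectral_measureD[OF mu]
  interpret finite_measure \<mu> by (rule mu')
  interpret pair_sigma_finite \<mu> lborel ..
  have [measurable]: "v \<in> borel_measurable borel"
    using v by (auto simp: bdd_second_diff_def intro: borel_measurable_continuous_onI)
  have [measurable]: "(\<lambda>x. x) \<in> measurable \<mu> borel" by (rule mu')
  have C0: "0 \<le> C" using v unfolding bdd_second_diff_def by (meson abs_ge_zero order_trans)
  let ?f = "\<lambda>p. frac_weight s (snd p) * (v (x + snd p *\<^sub>R fst p) + v (x - snd p *\<^sub>R fst p) - 2 * v x)"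
  have b: "\<bar>v (x + y) + v (x - y) - 2 * v x\<bar> \<le> 4 * C * min 1 ((norm y)\<^sup>2)" for y
  proof -
    have "\<bar>v (x + y) + v (x - y) - 2 * v x\<bar> \<le> C * (norm y)\<^sup>2" "0 \<le> C * (norm y)\<^sup>2"
      using v C0 by (auto simp: bdd_second_diff_def)
    moreover have "\<bar>v y\<bar> \<le> C" for y using v by (auto simp: bdd_second_diff_def)
    note this[of x] this[of "x + y"] this[of "x - y"]
    ultimately show ?thesis by (auto simp: min_def)
  qed
  have "integrable (\<mu> \<Otimes>\<^sub>M lborel) ?f"
  proof (rule Bochner_Integration.integrable_bound[OF integrable_min_weight_product[OF s finite_measure_axioms, of "4 * C"]])
    show "AE p in \<mu> \<Otimes>\<^sub>M lborel. norm (?f p) \<le> norm (case p of (\<theta>, r) \<Rightarrow> 4 * C * (min 1 (r\<^sup>2) * frac_weight s r))"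
    proof (rule AE_I2)
      fix p assume "p \<in> space (\<mu> \<Otimes>\<^sub>M (lborel :: real measure))"
      then have "norm (fst p) = 1" by (auto simp: space_pair_measure mu'(1))
      then have "\<bar>v (x + snd p *\<^sub>R fst p) + v (x - snd p *\<^sub>R fst p) - 2 * v x\<bar> \<le> 4 * C * min 1 ((snd p)\<^sup>2)"
        using b[of "snd p *\<^sub>R fst p"] by simp
      then have "frac_weight s (snd p) * \<bar>v (x + snd p *\<^sub>R fst p) + v (x - snd p *\<^sub>R fst p) - 2 * v x\<bar> \<le>
          frac_weight s (snd p) * (4 * C * min 1 ((snd p)\<^sup>2))"
        using frac_weight_nonneg by (intro mult_left_mono) auto
      moreover have "0 \<le> 4 * C * (min 1 ((snd p)\<^sup>2) * frac_weight s (snd p))"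
        using C0 frac_weight_nonneg by auto
      ultimately show "norm (?f p) \<le> norm (case p of (\<theta>, r) \<Rightarrow> 4 * C * (min 1 (r\<^sup>2) * frac_weight s r))"
        using frac_weight_nonneg[of s "snd p"] C0 by (simp add: abs_mult split_beta mult_ac)
    qed
  qed measurable
  from integral_fst'[OF this] show ?thesis
    by (simp add: stable_at_def frac_weight_def)
qed

text \<open>The bound \<open>min 1 ((norm y)\<^sup>2)\<close> is precisely what the weight of the
  operator integrates; this is the absolute convergence behind the use of Fubini.\<close>

lemma moll_kernel_second_diff_L1:
  assumes e: "0 < e"
  obtains C where "0 < C"
    "\<And>z y :: 'b::euclidean_space. integrable lborel (\<lambda>w. moll_kernel e (w - z + y) + moll_kernel e (w - z - y) - 2 * moll_kernel e (w - z))"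
    "\<And>z y :: 'b. (\<integral>w. \<bar>moll_kernel e (w - z + y) + moll_kernel e (w - z - y) - 2 * moll_kernel e (w - z)\<bar> \<partial>lborel) \<le> C * min 1 ((norm y)\<^sup>2)"
proof -
  obtain C where C: "0 < C"
    "\<And>w y :: 'b. \<bar>moll_kernel e (w + y) + moll_kernel e (w - y) - 2 * moll_kernel e w\<bar> \<le> C * (norm y)\<^sup>2"
    by (rule moll_kernel_bounds[OF e, where ?'b = 'b]) blast
  define V where "V = measure lborel (cball (0::'b) (e + 1))"
  have V: "measure lborel (cball z (e + 1)) = V" for z :: 'b
    unfolding V_def using content_cball[of "e + 1" z] content_cball[of "e + 1" "0::'b"] e by simp
  have V0: "0 \<le> V" by (simp add: V_def)
  define C' where "C' = C * V + 4"
  have C': "C' > 0" using C(1) V0 by (auto simp: C'_def intro: add_nonneg_pos)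
  let ?S = "\<lambda>z y w. moll_kernel e (w - z + y) + moll_kernel e (w - z - y) - 2 * moll_kernel e (w - z) :: real"
  have ik: "integrable lborel (\<lambda>w::'b. moll_kernel e (w - z))" "(\<integral>w. moll_kernel e (w - z) \<partial>lborel) = 1" for z :: 'b
    using moll_kernel_integral[OF e, of z] by (simp_all add: moll_kernel_swap)
  have eq: "w - z + y = w - (z - y)" "w - z - y = w - (z + y)" for w z y :: 'b by auto
  have int: "integrable lborel (?S z y)" for z y :: 'b unfolding eq using ik by auto
  have bound: "(\<integral>w. \<bar>?S z y w\<bar> \<partial>lborel) \<le> C' * min 1 ((norm y)\<^sup>2)" for z y :: 'b
  proof (cases "norm y \<le> 1")
    case True
    have "\<bar>\<integral>w. 1 * \<bar>?S z y w\<bar> \<partial>lborel\<bar> \<le> C * (norm y)\<^sup>2 * measure lborel (cball z (e + 1))"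
    proof (rule bounded_support_integral(2))
      show "\<bar>\<bar>?S z y w\<bar>\<bar> \<le> C * (norm y)\<^sup>2 * indicator (cball z (e + 1)) w" for w
      proof (cases "norm (w - z) > e + 1")
        case far: True
        have "norm (w - z + y) \<ge> e" "norm (w - z - y) \<ge> e" "norm (w - z) \<ge> e"
          using far True norm_triangle_ineq4[of "w - z + y" y] norm_triangle_ineq[of "w - z - y" y] by auto
        then show ?thesis using far by (simp add: moll_kernel_eq_0[OF e] indicator_def dist_norm norm_minus_commute)
      next
        case False
        then show ?thesis using C(2)[of "w - z" y] by (simp add: indicator_def dist_norm norm_minus_commute)
      qed
    qed auto
    also have "\<dots> \<le> C' * (norm y)\<^sup>2" unfolding V C'_def by (simp add: algebra_simps)
    finally show ?thesis using True by (simp add: min_absorb2 power_le_one)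
  next
    case False
    have "(\<integral>w. \<bar>?S z y w\<bar> \<partial>lborel) \<le> (\<integral>w. moll_kernel e (w - (z - y)) + moll_kernel e (w - (z + y)) + 2 * moll_kernel e (w - z) \<partial>lborel)"
    proof (rule integral_mono)
      show "integrable lborel (\<lambda>w. \<bar>?S z y w\<bar>)" by (rule integrable_abs[OF int])
      show "\<bar>?S z y w\<bar> \<le> moll_kernel e (w - (z - y)) + moll_kernel e (w - (z + y)) + 2 * moll_kernel e (w - z)" for w
        unfolding eq using moll_kernel_nonneg[of e "w - (z - y)"] moll_kernel_nonneg[of e "w - (z + y)"] moll_kernel_nonneg[of e "w - z"]
        by linarith
    qed (use ik in auto)
    also have "\<dots> = 4" using ik by simp
    also have "\<dots> \<le> C'" using C(1) V0 by (simp add: C'_def)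
    also have "\<dots> = C' * min 1 ((norm y)\<^sup>2)" using False by (simp add: min_def power_le_one_iff)
    finally show ?thesis .
  qed
  show thesis by (rule that[OF C' int bound])
qed

text \<open>The normalised problem: Borel functions on all of space-time, bounded by 1 everywhere,
  so that mollification is defined without reference to the time interval.\<close>

definition core_solution ::
    "real \<Rightarrow> 'a::euclidean_space measure \<Rightarrow> 'a set \<Rightarrow> (real \<times> 'a \<Rightarrow> real) \<Rightarrow> (real \<times> 'a \<Rightarrow> real) \<Rightarrow> bool" where
  "core_solution s \<mu> D u f \<longleftrightarrow>
     u \<in> borel_measurable borel \<and> f \<in> borel_measurable borel \<and> (\<forall>z. \<bar>u z\<bar> \<le> 1) \<and> (\<forall>z. \<bar>f z\<bar> \<le> 1) \<and>
     (\<forall>\<eta>. test_function ({-1<..<0} \<times> D) \<eta> \<longrightarrow>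
        (\<integral>z. u z * (- time_deriv \<eta> z - stable_operator s \<mu> \<eta> z) \<partial>lebesgue) = (\<integral>z. f z * \<eta> z \<partial>lebesgue))"

lemma bounded_fun_core: "core_solution s \<mu> D u f \<Longrightarrow> bounded_fun u" "core_solution s \<mu> D u f \<Longrightarrow> bounded_fun f"
  by (auto simp: core_solution_def bounded_fun_def)

lemma moll_slice_bdd_second_diff:
  fixes u :: "real \<times> 'a::euclidean_space \<Rightarrow> real"
  assumes "bounded_fun u" "0 < e"
  obtains C where "\<And>t. bdd_second_diff C (\<lambda>x. moll e u (t, x))"
proof -
  interpret bounded_fun u by fact
  obtain C where C: "0 < C" "\<And>z y. \<bar>moll e u (z + y) + moll e u (z - y) - 2 * moll e u z\<bar> \<le> C * (norm y)\<^sup>2"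
    by (rule moll_regular[OF assms(2)]) blast
  have "bdd_second_diff (C + 1) (\<lambda>x. moll e u (t, x))" for t
    unfolding bdd_second_diff_def
  proof (intro conjI allI)
    show "continuous_on UNIV (\<lambda>x. moll e u (t, x))"
      by (intro continuous_on_compose2[OF moll_continuous[OF assms(2), of UNIV]] continuous_intros) auto
    show "\<bar>moll e u (t, x)\<bar> \<le> C + 1" for x using moll_le_1[OF assms(2), of "(t, x)"] C(1) by linarith
    show "\<bar>moll e u (t, x + y) + moll e u (t, x - y) - 2 * moll e u (t, x)\<bar> \<le> (C + 1) * (norm y)\<^sup>2" for x y
      using C(2)[of "(t, x)" "(0, y)"] by (simp add: norm_Pair algebra_simps) (smt (verit) zero_le_power2)
  qed
  then show thesis by (rule that)
qed

text \<open>The equation is tested with the kernel centred at \<open>(t, x)\<close>, whose support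
  is the closed ball of radius \<open>e\<close>. Fubini moves the operator from the kernel to the
  mollified function, and the error \<open>h\<close> is the mollified right-hand side.\<close>

lemma moll_equation:
  fixes u f :: "real \<times> 'a::euclidean_space \<Rightarrow> real"
  assumes s: "0 < s" "s < 1" and mu: "spectral_measure s lam Lam \<mu>" "0 \<le> Lam"
    and sol: "core_solution s \<mu> D u f" and e: "0 < e" and ball: "cball (t, x) e \<subseteq> {-1<..<0} \<times> D"
  shows "\<exists>h. \<bar>h\<bar> \<le> 1 \<and>
    ((\<lambda>\<tau>. moll e u (\<tau>, x)) has_real_derivative (stable_at s \<mu> (\<lambda>y. moll e u (t, y)) x + h)) (at t)"
proof -
  interpret u: bounded_fun u by (rule bounded_fun_core[OF sol])
  interpret f: bounded_fun f by (rule bounded_fun_core[OF sol])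
  note mu' = spectral_measureD[OF mu]
  interpret finite_measure \<mu> by (rule mu')
  interpret p: pair_sigma_finite \<mu> lborel ..
  interpret q: pair_sigma_finite "\<mu> \<Otimes>\<^sub>M lborel" "lborel :: (real \<times> 'a) measure" ..
  have [measurable]: "(\<lambda>x. x) \<in> measurable \<mu> borel" by (rule mu')
  have [measurable]: "u \<in> borel_measurable borel" "f \<in> borel_measurable borel"
    using sol by (auto simp: core_solution_def)
  define z0 where "z0 = (t, x)"
  define m where "m = (\<integral>v. bump e (v :: real \<times> 'a) \<partial>lborel)"
  define \<eta> where "\<eta> = (\<lambda>w. moll_kernel e (w - z0))"
  have m: "m > 0" unfolding m_def by (rule bump_mass_pos[OF e])
  have \<eta>_eq: "\<eta> = (\<lambda>w. (1 / m) * bump e (w - z0))" by (simp add: \<eta>_def moll_kernel_def m_def fun_eq_iff)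
  have supp: "{z. \<eta> z \<noteq> 0} = ball z0 e"
  proof -
    have "\<eta> z \<noteq> 0 \<longleftrightarrow> 0 < bump e (z - z0)" for z
      using m bump_nonneg[of e "z - z0"] by (auto simp: \<eta>_eq less_le)
    then show ?thesis by (auto simp: bump_pos_iff[OF e] dist_norm norm_minus_commute)
  qed
  have test: "test_function ({-1<..<0} \<times> D) \<eta>"
    unfolding test_function_def supp
  proof (intro conjI allI)
    have "smooth \<eta>" unfolding \<eta>_eq by (intro smooth_mult smooth_const smooth_bump)
    then show "C_k k \<eta>" for k by (rule smooth_imp_C_k)
  qed (use e ball in \<open>auto simp: z0_def\<close>)
  have weak: "(\<integral>z. u z * (- time_deriv \<eta> z - stable_operator s \<mu> \<eta> z) \<partial>lebesgue) = (\<integral>z. f z * \<eta> z \<partial>lebesgue)"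
    using sol test by (simp add: core_solution_def)
  obtain K where K: "0 < K" "\<And>w :: real \<times> 'a. moll_kernel e w \<le> K"
    "\<And>w y :: real \<times> 'a. \<bar>moll_kernel e (w + y) - moll_kernel e w - bump_deriv e y w / m\<bar> \<le> K * (norm y)\<^sup>2"
    "\<And>w y :: real \<times> 'a. \<bar>bump_deriv e y w / m\<bar> \<le> K * norm y * indicator (cball 0 e) w"
    "\<And>w y :: real \<times> 'a. \<bar>moll_kernel e (w + y) + moll_kernel e (w - y) - 2 * moll_kernel e w\<bar> \<le> K * (norm y)\<^sup>2"
    unfolding m_def by (rule moll_kernel_bounds[OF e, where ?'b = "real \<times> 'a"]) blast
  let ?d = "\<lambda>w. bump_deriv e (1, 0) (z0 - w) / m"
  have td: "time_deriv \<eta> w = - ?d w" for w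
  proof -
    obtain \<tau> y where w: "w = (\<tau>, y)" by (cases w)
    have "((\<lambda>\<tau>. \<eta> (\<tau>, y)) has_real_derivative bump_deriv e (1, 0) (w - z0) / m) (at \<tau>)"
      unfolding DERIV_def
    proof (rule LIM_zero_cancel, rule Lim_null_comparison)
      show "\<forall>\<^sub>F h in at 0. norm ((\<eta> (\<tau> + h, y) - \<eta> (\<tau>, y)) / h - bump_deriv e (1, 0) (w - z0) / m) \<le> K * \<bar>h\<bar>"
        unfolding eventually_at
      proof (intro exI[of _ 1] conjI ballI impI)
        fix h :: real assume h: "h \<noteq> 0 \<and> dist h 0 < 1"
        have "\<bar>moll_kernel e (w - z0 + (h, 0)) - moll_kernel e (w - z0) - bump_deriv e (h, 0) (w - z0) / m\<bar> \<le> K * h\<^sup>2"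
          using K(3)[of "w - z0" "(h, 0)"] by (simp add: norm_Pair)
        moreover have "bump_deriv e (h, 0) (w - z0) = h * bump_deriv e (1, 0) (w - z0)"
          by (simp add: bump_deriv_def inner_prod_def mult_ac)
        moreover have "w - z0 + (h, 0) = (\<tau> + h, y) - z0" by (simp add: w z0_def)
        then have "moll_kernel e (w - z0 + (h, 0)) = \<eta> (\<tau> + h, y)" by (simp only: \<eta>_def)
        moreover have "moll_kernel e (w - z0) = \<eta> (\<tau>, y)" by (simp add: \<eta>_def w)
        ultimately have "\<bar>\<eta> (\<tau> + h, y) - \<eta> (\<tau>, y) - h * (bump_deriv e (1, 0) (w - z0) / m)\<bar> \<le> K * h\<^sup>2"
          by simp
        then have "\<bar>\<eta> (\<tau> + h, y) - \<eta> (\<tau>, y) - h * (bump_deriv e (1, 0) (w - z0) / m)\<bar> / \<bar>h\<bar> \<le> K * h\<^sup>2 / \<bar>h\<bar>"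
          by (rule divide_right_mono) simp
        also have "K * h\<^sup>2 / \<bar>h\<bar> = K * \<bar>h\<bar>" using h by (simp add: power2_eq_square abs_if)
        also have "\<bar>\<eta> (\<tau> + h, y) - \<eta> (\<tau>, y) - h * (bump_deriv e (1, 0) (w - z0) / m)\<bar> / \<bar>h\<bar> =
          \<bar>(\<eta> (\<tau> + h, y) - \<eta> (\<tau>, y)) / h - bump_deriv e (1, 0) (w - z0) / m\<bar>"
          using h by (simp add: abs_divide[symmetric] diff_divide_distrib del: abs_divide)
        finally show "norm ((\<eta> (\<tau> + h, y) - \<eta> (\<tau>, y)) / h - bump_deriv e (1, 0) (w - z0) / m) \<le> K * \<bar>h\<bar>"
          by simp
      qed auto
      show "(\<lambda>h. K * \<bar>h\<bar>) \<midarrow>0\<rightarrow> 0" by (auto intro!: tendsto_eq_intros)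
    qed
    \<comment> \<open>The kernel is even, so its derivative is odd; this sign turns the time
      derivative of the test function into that of the mollified function.\<close>
    moreover have "bump_deriv e (1, 0) (w - z0) = - bump_deriv e (1, 0) (z0 - w)"
    proof -
      have "w - z0 = - (z0 - w)" by simp
      then show ?thesis unfolding bump_deriv_def by (simp only: inner_minus_left inner_minus_right) simp
    qed
    ultimately show ?thesis by (simp add: time_deriv_def w DERIV_imp_deriv)
  qed
  have deriv: "((\<lambda>\<tau>. moll e u (\<tau>, x)) has_real_derivative (\<integral>w. u w * ?d w \<partial>lborel)) (at t)"
  proof -
    obtain C where C: "0 < C" "\<And>z y. norm y \<le> 1 \<Longrightarrow>
      \<bar>moll e u (z + y) - moll e u z - (\<integral>w. u w * (bump_deriv e y (z - w) / m) \<partial>lborel)\<bar> \<le> C * (norm y)\<^sup>2"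
      unfolding m_def by (rule u.moll_regular[OF e]) blast
    show ?thesis
      unfolding DERIV_def
    proof (rule LIM_zero_cancel, rule Lim_null_comparison)
      show "\<forall>\<^sub>F h in at 0. norm ((moll e u (t + h, x) - moll e u (t, x)) / h - (\<integral>w. u w * ?d w \<partial>lborel)) \<le> C * \<bar>h\<bar>"
        unfolding eventually_at
      proof (intro exI[of _ 1] conjI ballI impI)
        fix h :: real assume h: "h \<noteq> 0 \<and> dist h 0 < 1"
        have lin: "bump_deriv e (h, 0) w = h * bump_deriv e (1, 0) w" for w :: "real \<times> 'a"
          by (simp add: bump_deriv_def inner_prod_def mult_ac)
        have "\<bar>moll e u (t + h, x) - moll e u (t, x) - h * (\<integral>w. u w * ?d w \<partial>lborel)\<bar> \<le> C * h\<^sup>2"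
          using C(2)[of "(h, 0)" z0] h by (simp add: norm_Pair z0_def lin mult.left_commute[of _ h])
        then have "\<bar>moll e u (t + h, x) - moll e u (t, x) - h * (\<integral>w. u w * ?d w \<partial>lborel)\<bar> / \<bar>h\<bar> \<le> C * h\<^sup>2 / \<bar>h\<bar>"
          by (rule divide_right_mono) simp
        also have "C * h\<^sup>2 / \<bar>h\<bar> = C * \<bar>h\<bar>" using h by (simp add: power2_eq_square abs_if)
        also have "\<bar>moll e u (t + h, x) - moll e u (t, x) - h * (\<integral>w. u w * ?d w \<partial>lborel)\<bar> / \<bar>h\<bar> =
          \<bar>(moll e u (t + h, x) - moll e u (t, x)) / h - (\<integral>w. u w * ?d w \<partial>lborel)\<bar>"
          using h by (simp add: abs_divide[symmetric] diff_divide_distrib del: abs_divide)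
        finally show "norm ((moll e u (t + h, x) - moll e u (t, x)) / h - (\<integral>w. u w * ?d w \<partial>lborel)) \<le> C * \<bar>h\<bar>"
          by simp
      qed auto
      show "(\<lambda>h. C * \<bar>h\<bar>) \<midarrow>0\<rightarrow> 0" by (auto intro!: tendsto_eq_intros)
    qed
  qed
  let ?y = "\<lambda>p :: 'a \<times> real. (0 :: real, snd p *\<^sub>R fst p)"
  let ?S = "\<lambda>p w. moll_kernel e (w - z0 + ?y p) + moll_kernel e (w - z0 - ?y p) - 2 * moll_kernel e (w - z0) :: real"
  obtain C where C: "0 < C"
    "\<And>z y :: real \<times> 'a. integrable lborel (\<lambda>w. moll_kernel e (w - z + y) + moll_kernel e (w - z - y) - 2 * moll_kernel e (w - z))"
    "\<And>z y :: real \<times> 'a. (\<integral>w. \<bar>moll_kernel e (w - z + y) + moll_kernel e (w - z - y) - 2 * moll_kernel e (w - z)\<bar> \<partial>lborel) \<le> C * min 1 ((norm y)\<^sup>2)"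
    by (rule moll_kernel_second_diff_L1[OF e, where ?'b = "real \<times> 'a"]) blast
  let ?F = "\<lambda>p w. u w * (frac_weight s (snd p) * ?S p w)"
  have iS: "integrable lborel (\<lambda>w. u w * ?S p w)" for p
    by (rule Bochner_Integration.integrable_bound[OF integrable_abs[OF C(2)[where z = z0 and y = "?y p"]]])
      (use u.u_le_1 in \<open>auto simp: abs_mult mult_left_le_one_le\<close>)
  have iF: "integrable ((\<mu> \<Otimes>\<^sub>M lborel) \<Otimes>\<^sub>M lborel) (\<lambda>(p, w). ?F p w)"
  proof (rule q.Fubini_integrable)
    show "(\<lambda>(p, w). ?F p w) \<in> borel_measurable ((\<mu> \<Otimes>\<^sub>M lborel) \<Otimes>\<^sub>M lborel)" by measurable
    show "AE p in \<mu> \<Otimes>\<^sub>M lborel. integrable lborel (\<lambda>w. case (p, w) of (p, w) \<Rightarrow> ?F p w)"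
      using iS by (intro AE_I2) (auto simp: mult.left_commute[of "u _"])
    show "integrable (\<mu> \<Otimes>\<^sub>M lborel) (\<lambda>p. \<integral>w. norm (case (p, w) of (p, w) \<Rightarrow> ?F p w) \<partial>lborel)"
    proof (rule Bochner_Integration.integrable_bound[OF integrable_min_weight_product[OF s finite_measure_axioms, of C]])
      show "(\<lambda>p. \<integral>w. norm (case (p, w) of (p, w) \<Rightarrow> ?F p w) \<partial>lborel) \<in> borel_measurable (\<mu> \<Otimes>\<^sub>M lborel)"
        by measurable
      show "AE p in \<mu> \<Otimes>\<^sub>M lborel. norm (\<integral>w. norm (case (p, w) of (p, w) \<Rightarrow> ?F p w) \<partial>lborel) \<le>
          norm (case p of (\<theta>, r) \<Rightarrow> C * (min 1 (r\<^sup>2) * frac_weight s r))"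
      proof (rule AE_I2)
        fix p assume "p \<in> space (\<mu> \<Otimes>\<^sub>M (lborel :: real measure))"
        then have np: "norm (fst p) = 1" by (auto simp: space_pair_measure mu'(1))
        have "(\<integral>w. norm (?F p w) \<partial>lborel) = frac_weight s (snd p) * (\<integral>w. \<bar>u w * ?S p w\<bar> \<partial>lborel)"
          using frac_weight_nonneg[of s "snd p"] by (simp add: abs_mult mult.left_commute[of "\<bar>u _\<bar>"])
        also have "\<dots> \<le> frac_weight s (snd p) * (\<integral>w. \<bar>?S p w\<bar> \<partial>lborel)"
        proof (intro mult_left_mono integral_mono integrable_abs iS C(2) frac_weight_nonneg)
          show "\<bar>u w * ?S p w\<bar> \<le> \<bar>?S p w\<bar>" for w
            using u.u_le_1[of w] by (simp add: abs_mult mult_left_le_one_le)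
        qed
        also have "\<dots> \<le> frac_weight s (snd p) * (C * min 1 ((snd p)\<^sup>2))"
          using C(3)[of z0 "?y p"] np by (intro mult_left_mono frac_weight_nonneg) (simp add: norm_Pair)
        finally show "norm (\<integral>w. norm (case (p, w) of (p, w) \<Rightarrow> ?F p w) \<partial>lborel) \<le>
          norm (case p of (\<theta>, r) \<Rightarrow> C * (min 1 (r\<^sup>2) * frac_weight s r))"
          using C(1) frac_weight_nonneg[of s "snd p"] by (simp add: split_beta abs_mult mult_ac)
      qed
    qed
  qed
  \<comment> \<open>Integrating in \<open>p\<close> first produces the operator applied to the test
    function, integrating in \<open>w\<close> first produces it applied to the mollified
    function.\<close>
  have fub: "(\<integral>w. (\<integral>p. ?F p w \<partial>(\<mu> \<Otimes>\<^sub>M lborel)) \<partial>lborel) = (\<integral>p. (\<integral>w. ?F p w \<partial>lborel) \<partial>(\<mu> \<Otimes>\<^sub>M lborel))"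
    by (rule q.Fubini_integral[OF iF])
  have L\<eta>: "stable_operator s \<mu> \<eta> w = (\<integral>p. frac_weight s (snd p) * ?S p w \<partial>(\<mu> \<Otimes>\<^sub>M lborel))" for w
  proof -
    obtain \<tau> y where w: "w = (\<tau>, y)" by (cases w)
    have "bdd_second_diff (K + 1) (\<lambda>y. \<eta> (\<tau>, y))"
      unfolding bdd_second_diff_def
    proof (intro conjI allI)
      show "continuous_on UNIV (\<lambda>y. \<eta> (\<tau>, y))"
        unfolding \<eta>_eq by (intro continuous_intros continuous_on_compose2[OF continuous_on_bump[of UNIV]]) auto
      show "\<bar>\<eta> (\<tau>, y)\<bar> \<le> K + 1" for y
        using K(2)[of "(\<tau>, y) - z0"] moll_kernel_nonneg[of e "(\<tau>, y) - z0"] by (simp add: \<eta>_def)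
      show "\<bar>\<eta> (\<tau>, y + v) + \<eta> (\<tau>, y - v) - 2 * \<eta> (\<tau>, y)\<bar> \<le> (K + 1) * (norm v)\<^sup>2" for y v
      proof -
        have eq: "(\<tau>, y + v) - z0 = (\<tau>, y) - z0 + (0, v)" "(\<tau>, y - v) - z0 = (\<tau>, y) - z0 - (0, v)"
          by (auto simp: z0_def)
        have "\<bar>\<eta> (\<tau>, y + v) + \<eta> (\<tau>, y - v) - 2 * \<eta> (\<tau>, y)\<bar> \<le> K * (norm v)\<^sup>2"
          using K(5)[of "(\<tau>, y) - z0" "(0, v)"] unfolding \<eta>_def eq norm_Pair by simp
        also have "\<dots> \<le> (K + 1) * (norm v)\<^sup>2" by (intro mult_right_mono) auto
        finally show ?thesis .
      qed
    qed
    note stable_at_product[OF s mu this, of y]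
    moreover have "\<eta> (\<tau>, y + snd p *\<^sub>R fst p) + \<eta> (\<tau>, y - snd p *\<^sub>R fst p) - 2 * \<eta> (\<tau>, y) = ?S p w" for p
    proof -
      have eq: "(\<tau>, y + snd p *\<^sub>R fst p) - z0 = w - z0 + ?y p" "(\<tau>, y - snd p *\<^sub>R fst p) - z0 = w - z0 - ?y p"
        by (auto simp: z0_def w)
      show ?thesis unfolding \<eta>_def eq by (simp add: w)
    qed
    ultimately show ?thesis by (simp add: stable_operator_eq w)
  qed
  have Lu: "stable_at s \<mu> (\<lambda>y. moll e u (t, y)) x = (\<integral>p. (\<integral>w. ?F p w \<partial>lborel) \<partial>(\<mu> \<Otimes>\<^sub>M lborel))"
  proof -
    obtain B where "\<And>t. bdd_second_diff B (\<lambda>x. moll e u (t, x))"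
      by (rule moll_slice_bdd_second_diff[OF u.bounded_fun_axioms e]) blast
    note stable_at_product[OF s mu this[of t], of x]
    moreover have "moll e u (t, x + snd p *\<^sub>R fst p) + moll e u (t, x - snd p *\<^sub>R fst p) - 2 * moll e u (t, x) =
        (\<integral>w. u w * ?S p w \<partial>lborel)" for p
    proof -
      have k: "moll e u z = (\<integral>w. u w * moll_kernel e (w - z) \<partial>lborel)" "integrable lborel (\<lambda>w. u w * moll_kernel e (w - z))" for z
        using u.moll_integrable[OF e, of z] by (simp_all add: moll_def moll_kernel_swap)
      have eq: "w - z0 + ?y p = w - (t, x - snd p *\<^sub>R fst p)" "w - z0 - ?y p = w - (t, x + snd p *\<^sub>R fst p)"
        "w - z0 = w - (t, x)" for w by (auto simp: z0_def prod_eq_iff)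
      show ?thesis unfolding eq(1,2) unfolding eq(3) k(1) using k(2)
        by (simp add: right_diff_distrib distrib_left mult.left_commute[of _ 2])
    qed
    ultimately show ?thesis by (simp add: mult.left_commute[of "u _"])
  qed
  have [measurable]: "\<eta> \<in> borel_measurable borel" unfolding \<eta>_def by measurable
  have iL: "integrable lborel (\<lambda>w. u w * stable_operator s \<mu> \<eta> w)"
    using q.integrable_snd[OF iF] by (simp add: L\<eta>)
  have id: "integrable lborel (\<lambda>w. u w * ?d w)"
  proof (rule bounded_support_integral(1)[where M = "K * norm (1::real, 0::'a)" and c = z0 and R = e])
    show "\<bar>?d w\<bar> \<le> K * norm (1::real, 0::'a) * indicator (cball z0 e) w" for w
      using K(4)[of "(1, 0)" "z0 - w"] by (simp add: indicator_def dist_norm norm_minus_commute)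
  qed (auto simp: u.u_le_1)
  have "(\<integral>z. f z * \<eta> z \<partial>lebesgue) = (\<integral>z. f z * \<eta> z \<partial>lborel)"
    by (rule integral_completion) measurable
  moreover have "(\<integral>z. u z * (- time_deriv \<eta> z - stable_operator s \<mu> \<eta> z) \<partial>lebesgue) =
      (\<integral>z. u z * ?d z - u z * stable_operator s \<mu> \<eta> z \<partial>lborel)"
    unfolding td minus_minus right_diff_distrib
    by (rule integral_completion) (use iL id in auto)
  ultimately have "(\<integral>w. u w * ?d w \<partial>lborel) = (\<integral>w. u w * stable_operator s \<mu> \<eta> w \<partial>lborel) + (\<integral>z. f z * \<eta> z \<partial>lborel)"
    using weak iL id by simp
  also have "(\<integral>w. u w * stable_operator s \<mu> \<eta> w \<partial>lborel) = stable_at s \<mu> (\<lambda>y. moll e u (t, y)) x"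
    unfolding Lu fub[symmetric] L\<eta> by simp
  also have "(\<integral>z. f z * \<eta> z \<partial>lborel) = moll e f z0"
    by (simp add: moll_def \<eta>_def moll_kernel_swap)
  finally have "((\<lambda>\<tau>. moll e u (\<tau>, x)) has_real_derivative
    (stable_at s \<mu> (\<lambda>y. moll e u (t, y)) x + moll e f z0)) (at t)" using deriv by simp
  then show ?thesis using f.moll_le_1[OF e, of z0] by blast
qed

subsection \<open>Convergence of the mollified functions\<close>

context bounded_fun
begin

text \<open>Continuous functions converging almost everywhere are clipped to [-1, 1]. This does not
  change the limit, and it provides the dominating function on the ball.\<close>

lemma approx_continuous:
  assumes "0 < d"
  obtains g where "bounded_fun g" "continuous_on UNIV g"
    "(\<integral>w. indicator (ball 0 R) w * \<bar>u w - g w\<bar> \<partial>lborel) < d"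
proof -
  have "u measurable_on UNIV"
    by (rule lebesgue_measurable_imp_measurable_on_real) (auto intro: measurable_completion)
  then obtain Z g where Z: "negligible Z" and g: "\<And>n. continuous_on UNIV (g n)"
    "\<And>x. x \<notin> Z \<Longrightarrow> (\<lambda>n. g n x) \<longlonglongrightarrow> u x"
    by (auto simp: measurable_on_def)
  define h where "h = (\<lambda>n x. max (- 1) (min 1 (g n x)))"
  have hc: "continuous_on UNIV (h n)" for n unfolding h_def by (intro continuous_intros g)
  have hb: "bounded_fun (h n)" for n
    by (rule bounded_fun.intro) (use hc in \<open>auto simp: h_def intro: borel_measurable_continuous_onI\<close>)
  note [measurable] = bounded_fun.u_measurable[OF hb]
  have fin: "integrable lborel (\<lambda>w::'b. 2 * indicator (ball 0 R) w :: real)"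
    using emeasure_bounded_finite[OF bounded_ball[of "0::'b" R]]
    by (intro integrable_mult_right integrable_real_indicator) auto
  have "(\<lambda>n. \<integral>w. indicator (ball 0 R) w * \<bar>u w - h n w\<bar> \<partial>lborel) \<longlonglongrightarrow> (\<integral>w. 0 \<partial>(lborel :: 'b measure))"
  proof (rule integral_dominated_convergence[OF _ _ fin])
    have "AE x in lebesgue. x \<notin> Z" using Z by (simp add: negligible_iff_null_sets AE_not_in)
    then have "AE x in lborel. x \<notin> Z" by (simp add: AE_completion_iff)
    then show "AE x in lborel. (\<lambda>n. indicator (ball 0 R) x * \<bar>u x - h n x\<bar>) \<longlonglongrightarrow> 0"
    proof eventually_elim
      case (elim x)
      have "(\<lambda>n. h n x) \<longlonglongrightarrow> max (- 1) (min 1 (u x))"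
        unfolding h_def by (intro tendsto_intros g elim)
      also have "max (- 1) (min 1 (u x)) = u x" using u_le_1[of x] by auto
      finally have "(\<lambda>n. indicator (ball 0 R) x * \<bar>u x - h n x\<bar>) \<longlonglongrightarrow> indicator (ball 0 R) x * \<bar>u x - u x\<bar>"
        by (intro tendsto_intros)
      then show ?case by simp
    qed
    show "AE x in lborel. norm (indicator (ball 0 R) x * \<bar>u x - h n x\<bar>) \<le> 2 * indicator (ball 0 R) x" for n
    proof (rule AE_I2)
      fix x
      show "norm (indicator (ball 0 R) x * \<bar>u x - h n x\<bar>) \<le> 2 * indicator (ball 0 R) x"
        using u_le_1[of x] bounded_fun.u_le_1[OF hb, of n x] by (auto simp: indicator_def abs_le_iff)
    qed
  qed (auto intro!: borel_measurable_times borel_measurable_indicator borel_measurable_abs borel_measurable_diff)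
  then have "\<forall>\<^sub>F n in sequentially. (\<integral>w. indicator (ball 0 R) w * \<bar>u w - h n w\<bar> \<partial>lborel) < d"
    using assms by (intro order_tendstoD(2)) auto
  then obtain n where "(\<integral>w. indicator (ball 0 R) w * \<bar>u w - h n w\<bar> \<partial>lborel) < d"
    by (auto simp: eventually_sequentially)
  then show thesis using that hb hc by blast
qed

text \<open>Averaging does not increase the integral of the absolute difference, by Tonelli and the
  unit mass of the kernel; the ball grows by 1 because the kernel reaches no farther than
  \<open>e \<le> 1\<close>.\<close>

lemma moll_diff_L1:
  assumes "bounded_fun g" and e: "0 < e" "e \<le> 1"
  shows "(\<integral>z. indicator (ball 0 R) z * \<bar>moll e u z - moll e g z\<bar> \<partial>lborel)
    \<le> (\<integral>w. indicator (ball 0 (R + 1)) w * \<bar>u w - g w\<bar> \<partial>lborel)"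
proof -
  interpret g: bounded_fun g by fact
  let ?k = "\<lambda>z w. indicator (ball 0 R) z * (\<bar>u w - g w\<bar> * moll_kernel e (z - w)) :: real"
  have [measurable]: "moll e u \<in> borel_measurable borel" "moll e g \<in> borel_measurable borel"
    using moll_continuous[OF e(1)] g.moll_continuous[OF e(1)] by (auto intro: borel_measurable_continuous_onI)
  have iw: "integrable lborel (\<lambda>w. \<bar>u w - g w\<bar> * moll_kernel e (z - w))" for z
  proof (rule Bochner_Integration.integrable_bound[OF integrable_mult_right[OF moll_kernel_integral(1)[OF e(1), of z], of 2]])
    show "AE w in lborel. norm (\<bar>u w - g w\<bar> * moll_kernel e (z - w)) \<le> norm (2 * moll_kernel e (z - w))"
    proof (rule AE_I2)
      fix w
      have "\<bar>u w - g w\<bar> \<le> 2" using u_le_1[of w] g.u_le_1[of w] by linarith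
      then show "norm (\<bar>u w - g w\<bar> * moll_kernel e (z - w)) \<le> norm (2 * moll_kernel e (z - w))"
        using moll_kernel_nonneg[of e "z - w"] by (simp add: abs_mult mult_right_mono)
    qed
  qed (auto intro!: borel_measurable_times borel_measurable_indicator borel_measurable_abs borel_measurable_diff)
  have le: "\<bar>moll e u z - moll e g z\<bar> \<le> (\<integral>w. \<bar>u w - g w\<bar> * moll_kernel e (z - w) \<partial>lborel)" for z
  proof -
    have "moll e u z - moll e g z = (\<integral>w. (u w - g w) * moll_kernel e (z - w) \<partial>lborel)"
      unfolding moll_def using moll_integrable[OF e(1)] g.moll_integrable[OF e(1)] by (simp add: left_diff_distrib)
    also have "\<bar>\<dots>\<bar> \<le> (\<integral>w. \<bar>(u w - g w) * moll_kernel e (z - w)\<bar> \<partial>lborel)" by (rule integral_abs_bound)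
    also have "\<dots> = (\<integral>w. \<bar>u w - g w\<bar> * moll_kernel e (z - w) \<partial>lborel)"
      by (simp add: abs_mult abs_of_nonneg[OF moll_kernel_nonneg])
    finally show ?thesis .
  qed
  have iR: "integrable lborel (\<lambda>z. indicator (ball 0 R) z * \<bar>moll e u z - moll e g z\<bar>)" (is "integrable _ ?A")
  proof (rule Bochner_Integration.integrable_bound)
    show "integrable lborel (\<lambda>w::'b. 2 * indicator (ball 0 R) w :: real)"
      using emeasure_bounded_finite[OF bounded_ball[of "0::'b" R]]
      by (intro integrable_mult_right integrable_real_indicator) auto
    show "AE z in lborel. norm (?A z) \<le> norm (2 * indicator (ball 0 R) z :: real)"
    proof (rule AE_I2)
      fix z show "norm (?A z) \<le> norm (2 * indicator (ball 0 R) z :: real)"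
        using moll_le_1[OF e(1), of z] g.moll_le_1[OF e(1), of z] by (auto simp: indicator_def abs_le_iff)
    qed
  qed (auto intro!: borel_measurable_times borel_measurable_indicator borel_measurable_abs borel_measurable_diff)
  have iR1: "integrable lborel (\<lambda>w. indicator (ball 0 (R + 1)) w * \<bar>u w - g w\<bar>)" (is "integrable _ ?B")
  proof (rule Bochner_Integration.integrable_bound)
    show "integrable lborel (\<lambda>w::'b. 2 * indicator (ball 0 (R + 1)) w :: real)"
      using emeasure_bounded_finite[OF bounded_ball[of "0::'b" "R + 1"]]
      by (intro integrable_mult_right integrable_real_indicator) auto
    show "AE z in lborel. norm (?B z) \<le> norm (2 * indicator (ball 0 (R + 1)) z :: real)"
    proof (rule AE_I2)
      fix z show "norm (?B z) \<le> norm (2 * indicator (ball 0 (R + 1)) z :: real)"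
        using u_le_1[of z] g.u_le_1[of z] by (auto simp: indicator_def abs_le_iff)
    qed
  qed (auto intro!: borel_measurable_times borel_measurable_indicator borel_measurable_abs borel_measurable_diff)
  have "ennreal (\<integral>z. ?A z \<partial>lborel) = (\<integral>\<^sup>+z. ennreal (?A z) \<partial>lborel)"
    by (rule nn_integral_eq_integral[symmetric, OF iR]) auto
  also have "\<dots> \<le> (\<integral>\<^sup>+z. (\<integral>\<^sup>+w. ennreal (?k z w) \<partial>lborel) \<partial>lborel)"
  proof (rule nn_integral_mono)
    fix z
    have "(\<integral>\<^sup>+w. ennreal (?k z w) \<partial>lborel) = ennreal (\<integral>w. ?k z w \<partial>lborel)"
      using iw[of z] by (intro nn_integral_eq_integral AE_I2 mult_nonneg_nonneg moll_kernel_nonneg) auto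
    also have "(\<integral>w. ?k z w \<partial>lborel) = indicator (ball 0 R) z * (\<integral>w. \<bar>u w - g w\<bar> * moll_kernel e (z - w) \<partial>lborel)"
      by simp
    finally show "ennreal (?A z) \<le> (\<integral>\<^sup>+w. ennreal (?k z w) \<partial>lborel)"
      using le[of z] by (auto intro!: ennreal_leI mult_left_mono)
  qed
  also have "\<dots> = (\<integral>\<^sup>+w. (\<integral>\<^sup>+z. ennreal (?k z w) \<partial>lborel) \<partial>lborel)"
  proof (rule lborel_pair.Fubini'[symmetric])
    have [measurable]: "ball (0::'b) R \<in> sets borel" by simp
    show "(\<lambda>(z, w). ennreal (?k z w)) \<in> borel_measurable (lborel \<Otimes>\<^sub>M lborel)" by measurable
  qed
  also have "\<dots> \<le> (\<integral>\<^sup>+w. ennreal (?B w) \<partial>lborel)"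
  proof (rule nn_integral_mono)
    fix w
    have "?k z w \<le> ?B w * moll_kernel e (w - z)" for z
    proof (cases "norm (z - w) < e")
      case True
      then have "norm z < R \<Longrightarrow> norm w < R + 1"
        using norm_triangle_ineq4[of z "z - w"] e by auto
      then show ?thesis using moll_kernel_nonneg[of e "z - w"] by (auto simp: indicator_def moll_kernel_swap[of e w z])
    next
      case False
      then show ?thesis using moll_kernel_nonneg[of e "w - z"] moll_kernel_eq_0[OF e(1), of "z - w"] by auto
    qed
    then have "(\<integral>\<^sup>+z. ennreal (?k z w) \<partial>lborel) \<le> (\<integral>\<^sup>+z. ennreal (?B w * moll_kernel e (w - z)) \<partial>lborel)"
      by (intro nn_integral_mono ennreal_leI) auto
    also have "\<dots> = ennreal (\<integral>z. ?B w * moll_kernel e (w - z) \<partial>lborel)"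
      using moll_kernel_integral[OF e(1), of w]
      by (intro nn_integral_eq_integral AE_I2 mult_nonneg_nonneg moll_kernel_nonneg) auto
    also have "(\<integral>z. ?B w * moll_kernel e (w - z) \<partial>lborel) = ?B w"
      using moll_kernel_integral[OF e(1), of w] by simp
    finally show "(\<integral>\<^sup>+z. ennreal (?k z w) \<partial>lborel) \<le> ennreal (?B w)" .
  qed
  also have "\<dots> = ennreal (\<integral>w. ?B w \<partial>lborel)"
    by (rule nn_integral_eq_integral[OF iR1]) auto
  finally show ?thesis by (subst (asm) ennreal_le_iff) auto
qed

text \<open>Convergence in mean on the ball is obtained by comparing with a continuous
  \<open>g\<close>, for which mollification converges uniformly on bounded sets. A subsequence then
  converges almost everywhere.\<close>

lemma moll_AE_limit:
  obtains e :: "nat \<Rightarrow> real" where "\<And>k. 0 < e k" "e \<longlonglongrightarrow> 0"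
    "AE z in lborel. norm z < R \<longrightarrow> (\<lambda>k. moll (e k) u z) \<longlonglongrightarrow> u z"
proof -
  define f where "f = (\<lambda>n z. indicator (ball 0 R) z * (moll (1 / real (Suc n)) u z - u z))"
  have [measurable]: "moll (1 / real (Suc n)) u \<in> borel_measurable borel" for n
    using moll_continuous[of "1 / real (Suc n)" UNIV] by (intro borel_measurable_continuous_onI) auto
  have fin: "integrable lborel (\<lambda>w::'b. c * indicator (ball 0 R) w :: real)" for c
    using emeasure_bounded_finite[OF bounded_ball[of "0::'b" R]]
    by (intro integrable_mult_right integrable_real_indicator) auto
  have intb: "integrable lborel (\<lambda>z. indicator (ball 0 R) z * h z)"
    if [measurable]: "h \<in> borel_measurable borel" and "\<And>z. \<bar>h z\<bar> \<le> 2" for h :: "'b \<Rightarrow> real"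
    by (rule Bochner_Integration.integrable_bound[OF fin[of 2]]) (use that in \<open>auto simp: indicator_def\<close>)
  have fi: "integrable lborel (f n)" for n
    unfolding f_def
  proof (rule intb)
    show "\<bar>moll (1 / real (Suc n)) u z - u z\<bar> \<le> 2" for z
      using moll_le_1[of "1 / real (Suc n)" z] u_le_1[of z] by simp
  qed measurable
  have "(\<lambda>n. \<integral>z. norm (f n z) \<partial>lborel) \<longlonglongrightarrow> 0"
  proof (rule LIMSEQ_I)
    fix r :: real assume r: "0 < r"
    define V where "V = measure lborel (ball (0::'b) R)"
    \<comment> \<open>One third of \<open>r\<close> is spread over the volume of the ball; the added
      1 keeps the denominator positive when \<open>V\<close> is 0.\<close>
    define d where "d = r / (3 * (V + 1))"
    have V: "0 \<le> V" by (simp add: V_def)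
    have d: "d > 0" using r V by (auto simp: d_def)
    have dV: "d * V \<le> r / 3" using r V by (simp add: d_def field_simps)
    obtain g where g: "bounded_fun g" "continuous_on UNIV g"
      "(\<integral>w. indicator (ball 0 (R + 1)) w * \<bar>u w - g w\<bar> \<partial>lborel) < r / 3"
      using approx_continuous[of "r / 3"] r by auto
    interpret g: bounded_fun g by fact
    have "uniformly_continuous_on (cball 0 (R + 1)) g"
      by (rule compact_uniformly_continuous[OF continuous_on_subset[OF g(2)]]) auto
    then obtain e0 where e0: "e0 > 0" "\<And>x y. x \<in> cball 0 (R + 1) \<Longrightarrow> y \<in> cball 0 (R + 1) \<Longrightarrow> dist y x < e0 \<Longrightarrow> dist (g y) (g x) < d"
      using d unfolding uniformly_continuous_on_def by metis
    obtain N where N: "1 / real (Suc N) < e0" using reals_Archimedean[OF e0(1)] by (auto simp: inverse_eq_divide)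
    show "\<exists>no. \<forall>n\<ge>no. norm ((\<integral>z. norm (f n z) \<partial>lborel) - 0) < r"
    proof (intro exI allI impI)
      fix n assume n: "N \<le> n"
      define e where "e = 1 / real (Suc n)"
      have e: "0 < e" "e \<le> 1" "e < e0"
      proof -
        have "e \<le> 1 / real (Suc N)" unfolding e_def using n by (intro divide_left_mono) auto
        then show "e < e0" using N by linarith
      qed (auto simp: e_def)
      have [measurable]: "moll e u \<in> borel_measurable borel" "moll e g \<in> borel_measurable borel"
        using moll_continuous[OF e(1)] g.moll_continuous[OF e(1)] by (auto intro: borel_measurable_continuous_onI)
      have gz: "\<bar>moll e g z - g z\<bar> \<le> d" if z: "norm z < R" for z
      proof -
        have near: "\<bar>g w - g z\<bar> < d" if "dist z w < e" for w
        proof -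
          have "norm w \<le> R + 1" using that z e norm_triangle_ineq3[of w z] by (simp add: dist_norm norm_minus_commute)
          then show ?thesis using e0(2)[of z w] that z e by (simp add: dist_commute dist_real_def)
        qed
        have "moll e g z \<le> g z + d"
          by (rule g.moll_mono_AE[OF e(1)]) (use near in \<open>fastforce intro!: AE_I2\<close>)
        moreover have "g z - d \<le> moll e g z"
          by (rule g.moll_ge_AE[OF e(1)]) (use near in \<open>fastforce intro!: AE_I2\<close>)
        ultimately show ?thesis by linarith
      qed
      let ?i = "indicator (ball (0::'b) R) :: 'b \<Rightarrow> real"
      have i1: "integrable lborel (\<lambda>z. ?i z * \<bar>moll e u z - moll e g z\<bar>)"
      proof (rule intb)
        show "\<bar>\<bar>moll e u z - moll e g z\<bar>\<bar> \<le> 2" for z using moll_le_1[OF e(1), of z] g.moll_le_1[OF e(1), of z] by linarith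
      qed measurable
      have i2: "integrable lborel (\<lambda>z. ?i z * \<bar>u z - g z\<bar>)"
      proof (rule intb)
        show "\<bar>\<bar>u z - g z\<bar>\<bar> \<le> 2" for z using u_le_1[of z] g.u_le_1[of z] by linarith
      qed measurable
      have i3: "integrable lborel (\<lambda>z. indicator (ball 0 (R + 1)) z * \<bar>u z - g z\<bar>)"
      proof (rule Bochner_Integration.integrable_bound)
        show "integrable lborel (\<lambda>w::'b. 2 * indicator (ball 0 (R + 1)) w :: real)"
          using emeasure_bounded_finite[OF bounded_ball[of "0::'b" "R + 1"]]
          by (intro integrable_mult_right integrable_real_indicator) auto
        show "AE z in lborel. norm (indicator (ball 0 (R + 1)) z * \<bar>u z - g z\<bar>) \<le> norm (2 * indicator (ball 0 (R + 1)) z :: real)"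
        proof (rule AE_I2)
          fix z show "norm (indicator (ball 0 (R + 1)) z * \<bar>u z - g z\<bar>) \<le> norm (2 * indicator (ball 0 (R + 1)) z :: real)"
            using u_le_1[of z] g.u_le_1[of z] by (auto simp: indicator_def abs_le_iff)
        qed
      qed (auto intro!: borel_measurable_times borel_measurable_indicator borel_measurable_abs borel_measurable_diff)
      have "(\<integral>z. norm (f n z) \<partial>lborel) \<le> (\<integral>z. ?i z * \<bar>moll e u z - moll e g z\<bar> + d * ?i z + ?i z * \<bar>u z - g z\<bar> \<partial>lborel)"
      proof (rule integral_mono)
        show "integrable lborel (\<lambda>z. norm (f n z))" by (rule integrable_norm[OF fi])
        show "norm (f n z) \<le> ?i z * \<bar>moll e u z - moll e g z\<bar> + d * ?i z + ?i z * \<bar>u z - g z\<bar>" for z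
        proof -
          have "f n z = ?i z * (moll e u z - u z)" by (simp only: f_def e_def)
          then show ?thesis using gz[of z] by (auto simp: indicator_def)
        qed
      qed (intro Bochner_Integration.integrable_add i1 i2 fin)
      also have "\<dots> = (\<integral>z. ?i z * \<bar>moll e u z - moll e g z\<bar> \<partial>lborel) + d * V + (\<integral>z. ?i z * \<bar>u z - g z\<bar> \<partial>lborel)"
        using i1 i2 fin[of d] by (simp add: V_def)
      also have "(\<integral>z. ?i z * \<bar>moll e u z - moll e g z\<bar> \<partial>lborel) \<le> (\<integral>w. indicator (ball 0 (R + 1)) w * \<bar>u w - g w\<bar> \<partial>lborel)"
        by (rule moll_diff_L1[OF g(1) e(1,2)])
      also have "(\<integral>z. ?i z * \<bar>u z - g z\<bar> \<partial>lborel) \<le> (\<integral>w. indicator (ball 0 (R + 1)) w * \<bar>u w - g w\<bar> \<partial>lborel)"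
        by (rule integral_mono[OF i2 i3]) (auto simp: indicator_def)
      finally have "(\<integral>z. norm (f n z) \<partial>lborel) < r" using g(3) dV by linarith
      moreover have "0 \<le> (\<integral>z. norm (f n z) \<partial>lborel)" by (rule Bochner_Integration.integral_nonneg) auto
      ultimately show "norm ((\<integral>z. norm (f n z) \<partial>lborel) - 0) < r" by simp
    qed
  qed
  from tendsto_L1_AE_subseq[OF fi this]
  obtain r where r: "strict_mono r" "AE x in lborel. (\<lambda>n. f (r n) x) \<longlonglongrightarrow> 0" by blast
  show thesis
  proof (rule that[of "\<lambda>k. 1 / real (Suc (r k))"])
    show "(\<lambda>k. 1 / real (Suc (r k))) \<longlonglongrightarrow> 0"
      using LIMSEQ_subseq_LIMSEQ[OF LIMSEQ_inverse_real_of_nat r(1)] by (simp add: o_def inverse_eq_divide)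
    show "AE z in lborel. norm z < R \<longrightarrow> (\<lambda>k. moll (1 / real (Suc (r k))) u z) \<longlonglongrightarrow> u z"
      using r(2)
    proof eventually_elim
      case (elim z)
      show ?case
      proof
        assume "norm z < R"
        then have "(\<lambda>n. moll (1 / real (Suc (r n))) u z - u z) \<longlonglongrightarrow> 0"
          using elim by (simp add: f_def)
        then show "(\<lambda>k. moll (1 / real (Suc (r k))) u z) \<longlonglongrightarrow> u z" by (rule LIM_zero_cancel)
      qed
    qed
  qed (auto intro!: borel_measurable_times borel_measurable_indicator borel_measurable_abs borel_measurable_diff)
qed

text \<open>The threshold \<open>e0\<close> may depend on the point and on the slack, since the
  passage to the limit is pointwise.\<close>

lemma AE_le_of_moll:
  assumes "\<And>z d. z \<in> Z \<Longrightarrow> 0 < d \<Longrightarrow> \<exists>e0>0. \<forall>e. 0 < e \<longrightarrow> e < e0 \<longrightarrow> moll e u z \<le> F z + d"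
    and R: "\<And>z. z \<in> Z \<Longrightarrow> norm z < R"
  shows "AE z in lborel. z \<in> Z \<longrightarrow> u z \<le> F z"
proof -
  obtain e :: "nat \<Rightarrow> real" where e: "\<And>k. 0 < e k" "e \<longlonglongrightarrow> 0"
    "AE z in lborel. norm z < R \<longrightarrow> (\<lambda>k. moll (e k) u z) \<longlonglongrightarrow> u z"
    by (rule moll_AE_limit) blast
  from e(3) show ?thesis
  proof eventually_elim
    case (elim z)
    show ?case
    proof
      assume z: "z \<in> Z"
      show "u z \<le> F z"
      proof (rule field_le_epsilon)
        fix d :: real assume "0 < d"
        then obtain e0 where e0: "e0 > 0" "\<And>e. 0 < e \<Longrightarrow> e < e0 \<Longrightarrow> moll e u z \<le> F z + d"
          using assms(1)[OF z] by blast
        have "\<forall>\<^sub>F k in sequentially. e k < e0" using order_tendstoD(2)[OF e(2) e0(1)] .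
        then have "\<forall>\<^sub>F k in sequentially. moll (e k) u z \<le> F z + d"
          by eventually_elim (use e0 e in auto)
        then show "u z \<le> F z + d"
          using elim R[OF z] by (intro tendsto_upperbound[where F = sequentially]) auto
      qed
    qed
  qed
qed

end

subsection \<open>Directions charged by the spectral measure\<close>

text \<open>Among all families in \<open>H\<close> take one with the largest determinant. By
  Cramer's rule each dual coordinate of an element of \<open>H\<close> is a quotient of two such
  determinants, hence at most 1 in absolute value. The spread condition, applied to the normalised
  dual vector, turns this into a bound for its norm.\<close>

lemma dual_basis_of_spread_set:
  fixes H :: "(real ^ 'n) set"
  assumes fin: "finite H" and \<kappa>: "0 < \<kappa>" and H: "\<And>\<nu>. norm \<nu> = 1 \<Longrightarrow> \<exists>\<theta>\<in>H. \<kappa> \<le> \<bar>\<nu> \<bullet> \<theta>\<bar>"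
  obtains \<theta> \<nu> :: "'n \<Rightarrow> real ^ 'n" where "\<And>k. \<theta> k \<in> H"
    "\<And>k j. \<nu> k \<bullet> \<theta> j = (if k = j then 1 else 0)" "\<And>z. z = (\<Sum>k\<in>UNIV. (\<nu> k \<bullet> z) *\<^sub>R \<theta> k)"
    "\<And>k. norm (\<nu> k) \<le> 1 / \<kappa>"
proof -
  define d where "d = (\<lambda>\<theta> :: 'n \<Rightarrow> real ^ 'n. \<bar>det (\<chi> i. \<theta> i)\<bar>)"
  \<comment> \<open>A unit vector orthogonal to the span would violate the spread condition.\<close>
  have "span H = UNIV"
  proof (rule ccontr)
    assume "span H \<noteq> UNIV"
    then obtain a where a: "a \<noteq> 0" "\<And>x. x \<in> span H \<Longrightarrow> a \<bullet> x = 0"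
      using span_not_UNIV_orthogonal by blast
    then obtain \<theta> where "\<theta> \<in> H" "\<kappa> \<le> \<bar>(a /\<^sub>R norm a) \<bullet> \<theta>\<bar>" using H[of "a /\<^sub>R norm a"] by auto
    then show False using a(2)[OF span_base] \<kappa> by simp
  qed
  obtain B where B: "B \<subseteq> H" "independent B" "H \<subseteq> span B"
    using maximal_independent_subset by blast
  have sB: "span B = UNIV"
    using \<open>span H = UNIV\<close> B(3) span_mono[OF B(3)] by (auto simp: span_span)
  have "card B = CARD('n)"
    using dim_eq_card_independent[OF B(2)] dim_span[of B] by (simp add: sB)
  moreover have "finite B" using fin B(1) by (rule finite_subset[rotated])
  ultimately obtain \<theta>0 :: "'n \<Rightarrow> real ^ 'n" where \<theta>0: "bij_betw \<theta>0 UNIV B"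
    using finite_same_card_bij[of "UNIV :: 'n set" B] by auto
  have "rows (\<chi> i. \<theta>0 i) = B"
    using \<theta>0 by (auto simp: rows_def row_def bij_betw_def image_def)
  then have "\<exists>C :: real ^ 'n ^ 'n. C ** (\<chi> i. \<theta>0 i) = mat 1"
    using sB by (simp add: matrix_left_invertible_span_rows)
  then have d0: "d \<theta>0 > 0"
    by (simp add: d_def invertible_left_inverse[symmetric] invertible_det_nz)
  let ?F = "UNIV \<rightarrow>\<^sub>E H :: ('n \<Rightarrow> real ^ 'n) set"
  have "finite ?F" using fin by (intro finite_PiE) auto
  moreover have "\<theta>0 \<in> ?F" using \<theta>0 B(1) by (auto simp: bij_betw_def)
  moreover from calculation have "Max (d ` ?F) \<in> d ` ?F" by (intro Max_in) auto
  ultimately obtain \<theta> where \<theta>: "\<theta> \<in> ?F" "\<And>\<theta>'. \<theta>' \<in> ?F \<Longrightarrow> d \<theta>' \<le> d \<theta>"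
    by (auto simp: image_iff) (metis Max_ge finite_imageI imageI)
  have dpos: "d \<theta> > 0" using \<theta>(2)[OF \<open>\<theta>0 \<in> ?F\<close>] d0 by linarith
  define A where "A = transpose (\<chi> i. \<theta> i)"
  have dA: "det A \<noteq> 0" using dpos by (simp add: A_def d_def det_transpose)
  then obtain C where C: "A ** C = mat 1" "C ** A = mat 1"
    by (metis invertible_def invertible_det_nz)
  define \<nu> where "\<nu> = (\<lambda>k. C $ k)"
  have \<nu>: "\<nu> k \<bullet> v = (C *v v) $ k" for k v by (simp add: \<nu>_def matrix_vector_mul_component)
  have colA: "column k A = \<theta> k" for k by (simp add: A_def column_def transpose_def vec_eq_iff)
  have 1: "\<nu> k \<bullet> \<theta> j = (if k = j then 1 else 0)" for k j
  proof -
    have "C *v \<theta> j = C *v (A *v axis j 1)" by (simp add: matrix_vector_mult_basis colA)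
    also have "\<dots> = axis j 1" by (simp add: matrix_vector_mul_assoc C)
    finally show ?thesis by (simp add: \<nu> axis_def)
  qed
  have 2: "z = (\<Sum>k\<in>UNIV. (\<nu> k \<bullet> z) *\<^sub>R \<theta> k)" for z
  proof -
    have "z = A *v (C *v z)" by (simp add: matrix_vector_mul_assoc C)
    also have "\<dots> = (\<Sum>k\<in>UNIV. ((C *v z) $ k) *\<^sub>R column k A)"
      by (simp add: matrix_mult_sum scalar_mult_eq_scaleR)
    finally show ?thesis by (simp add: \<nu> colA)
  qed
  have 3: "\<bar>\<nu> k \<bullet> v\<bar> \<le> 1" if v: "v \<in> H" for k v
  proof -
    have "A *v (C *v v) = v" by (simp add: matrix_vector_mul_assoc C)
    then have "C *v v = (\<chi> k. det (\<chi> i j. if j = k then v $ i else A $ i $ j) / det A)"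
      using cramer[OF dA] by blast
    then have "\<nu> k \<bullet> v = det (\<chi> i j. if j = k then v $ i else A $ i $ j) / det A" by (simp add: \<nu>)
    also have "(\<chi> i j. if j = k then v $ i else A $ i $ j) = transpose (\<chi> i. (\<theta>(k := v)) i)"
      by (simp add: A_def transpose_def vec_eq_iff)
    finally have "\<bar>\<nu> k \<bullet> v\<bar> = d (\<theta>(k := v)) / d \<theta>" by (simp add: d_def A_def det_transpose abs_divide fun_upd_def)
    moreover have "d (\<theta>(k := v)) \<le> d \<theta>" using \<theta> v by (intro \<theta>(2)) (auto simp: PiE_def Pi_def)
    ultimately show ?thesis using dpos by simp
  qed
  have "norm (\<nu> k) \<le> 1 / \<kappa>" for k
  proof (cases "\<nu> k = 0")
    case False
    then obtain v where v: "v \<in> H" "\<kappa> \<le> \<bar>(\<nu> k /\<^sub>R norm (\<nu> k)) \<bullet> v\<bar>" using H[of "\<nu> k /\<^sub>R norm (\<nu> k)"] by auto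
    then have "\<kappa> * norm (\<nu> k) \<le> \<bar>\<nu> k \<bullet> v\<bar>" using False by (simp add: abs_mult field_simps)
    also have "\<dots> \<le> 1" by (rule 3[OF v(1)])
    finally show ?thesis using \<kappa> by (simp add: field_simps)
  qed (use \<kappa> in auto)
  then show thesis using that[of \<theta> \<nu>] \<theta>(1) 1 2 by auto
qed

text \<open>Chebyshev's argument: directions with a small component along \<open>\<nu>\<close>
  contribute at most \<open>c powr (2 * s) * Lam\<close> to an integral that is at least
  \<open>lam\<close>, and elsewhere the integrand is at most 1.\<close>

lemma spectral_mass_transversal:
  fixes \<mu> :: "'a::euclidean_space measure"
  assumes s: "0 < s" and lam: "0 < lam" "lam \<le> Lam" and mu: "spectral_measure s lam Lam \<mu>" and \<nu>: "norm \<nu> = 1"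
    and c: "0 \<le> c" "c powr (2 * s) * Lam \<le> lam / 2"
  shows "{\<theta> \<in> sphere 0 1. c \<le> \<bar>\<nu> \<bullet> \<theta>\<bar>} \<in> sets \<mu>" "lam / 2 \<le> measure \<mu> {\<theta> \<in> sphere 0 1. c \<le> \<bar>\<nu> \<bullet> \<theta>\<bar>}"
proof -
  have Lam: "0 \<le> Lam" using lam by auto
  note mu' = spectral_measureD[OF mu Lam]
  interpret finite_measure \<mu> by (rule mu')
  have [measurable]: "(\<lambda>x. x) \<in> measurable \<mu> borel" by (rule mu')
  let ?T = "{\<theta> \<in> sphere 0 1. c \<le> \<bar>\<nu> \<bullet> \<theta>\<bar>}"
  have "{\<theta> \<in> space \<mu>. c \<le> \<bar>\<nu> \<bullet> \<theta>\<bar>} \<in> sets \<mu>" by measurable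
  then show T: "?T \<in> sets \<mu>" by (simp add: mu'(1))
  have "lam \<le> (\<integral>\<theta>. \<bar>\<nu> \<bullet> \<theta>\<bar> powr (2 * s) \<partial>\<mu>)" by (rule mu'(6)[OF s \<nu>])
  also have "\<dots> \<le> (\<integral>\<theta>. indicator ?T \<theta> + c powr (2 * s) \<partial>\<mu>)"
  proof (rule integral_mono)
    have b1: "\<bar>\<nu> \<bullet> \<theta>\<bar> \<le> 1" if "\<theta> \<in> space \<mu>" for \<theta>
      using Cauchy_Schwarz_ineq2[of \<nu> \<theta>] that \<nu> by (simp add: mu'(1))
    show "integrable \<mu> (\<lambda>\<theta>. \<bar>\<nu> \<bullet> \<theta>\<bar> powr (2 * s))"
    proof (rule integrable_const_bound[where B = 1])
      show "AE \<theta> in \<mu>. norm (\<bar>\<nu> \<bullet> \<theta>\<bar> powr (2 * s)) \<le> 1"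
        using b1 s by (intro AE_I2) (auto intro: powr_le1)
    qed measurable
    show "integrable \<mu> (\<lambda>\<theta>. indicator ?T \<theta> + c powr (2 * s) :: real)"
      using T by (intro Bochner_Integration.integrable_add integrable_real_indicator) (auto simp: less_top[symmetric])
    fix \<theta> assume th: "\<theta> \<in> space \<mu>"
    show "\<bar>\<nu> \<bullet> \<theta>\<bar> powr (2 * s) \<le> indicator ?T \<theta> + c powr (2 * s)"
    proof (cases "\<theta> \<in> ?T")
      case True
      have "\<bar>\<nu> \<bullet> \<theta>\<bar> powr (2 * s) \<le> 1" using b1[OF th] s by (intro powr_le1) auto
      then show ?thesis using True powr_ge_zero[of c "2 * s"] by (simp add: add_increasing2)
    next
      case False
      then have "\<bar>\<nu> \<bullet> \<theta>\<bar> \<le> c" using th by (auto simp: mu'(1))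
      then have "\<bar>\<nu> \<bullet> \<theta>\<bar> powr (2 * s) \<le> c powr (2 * s)" using s by (intro powr_mono2) auto
      then show ?thesis by (rule order_trans) (simp add: indicator_def)
    qed
  qed
  also have "\<dots> = measure \<mu> ?T + c powr (2 * s) * measure \<mu> (space \<mu>)"
  proof -
    have "integrable \<mu> (indicator ?T :: 'a \<Rightarrow> real)"
      using T by (intro integrable_real_indicator) (auto simp: less_top[symmetric])
    then have "(\<integral>\<theta>. indicator ?T \<theta> + c powr (2 * s) \<partial>\<mu>) = (\<integral>\<theta>. indicator ?T \<theta> \<partial>\<mu>) + (\<integral>\<theta>. c powr (2 * s) \<partial>\<mu>)"
      by (intro Bochner_Integration.integral_add) auto
    moreover have "?T \<inter> space \<mu> = ?T" by (auto simp: mu'(1))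
    ultimately show ?thesis by simp
  qed
  also have "c powr (2 * s) * measure \<mu> (space \<mu>) \<le> c powr (2 * s) * Lam"
    by (intro mult_left_mono mu') auto
  finally show "lam / 2 \<le> measure \<mu> ?T" using c by linarith
qed

text \<open>The finite net \<open>T\<close> of the sphere is fixed before the measure, so
  \<open>m\<close> does not depend on it; \<open>H\<close> consists of the net points whose balls
  have mass at least \<open>m\<close>. If all of them were almost orthogonal to
  \<open>\<nu>\<close>, the directions with component at least \<open>2 * \<kappa>\<close> would be
  covered by the other balls, of total mass at most \<open>lam / 4\<close>, although their mass is
  at least \<open>lam / 2\<close>.\<close>

lemma heavy_directions:
  fixes s lam Lam \<kappa> \<delta> :: real
  assumes s: "0 < s" and lam: "0 < lam" "lam \<le> Lam" and \<kappa>: "0 < \<kappa>" "(2 * \<kappa>) powr (2 * s) * Lam \<le> lam / 2"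
    and \<delta>: "0 < \<delta>" "\<delta> \<le> \<kappa>"
  obtains m where "0 < m" "\<And>\<mu> :: 'a::euclidean_space measure. spectral_measure s lam Lam \<mu> \<Longrightarrow>
    \<exists>H. finite H \<and> H \<subseteq> sphere 0 1 \<and> (\<forall>\<theta>\<in>H. m \<le> measure \<mu> (ball \<theta> \<delta> \<inter> sphere 0 1)) \<and>
      (\<forall>\<nu>. norm \<nu> = 1 \<longrightarrow> (\<exists>\<theta>\<in>H. \<kappa> \<le> \<bar>\<nu> \<bullet> \<theta>\<bar>))"
proof -
  have Lam: "0 \<le> Lam" using lam by auto
  obtain T :: "'a set" where T: "T \<subseteq> sphere 0 1" "finite T" "sphere 0 1 \<subseteq> (\<Union>t\<in>T. ball t \<delta>)"
  proof -
    have "sphere (0::'a) 1 \<subseteq> (\<Union>t\<in>sphere 0 1. ball t \<delta>)" using \<delta>(1) by force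
    then obtain C' where "C' \<subseteq> sphere 0 1" "finite C'" "sphere (0::'a) 1 \<subseteq> (\<Union>t\<in>C'. ball t \<delta>)"
      by (rule compactE_image[OF compact_sphere, rotated]) simp_all
    then show thesis by (rule that)
  qed
  have "(SOME b. b \<in> Basis) \<in> sphere (0::'a) 1" by (simp add: some_in_eq norm_Basis[OF someI_ex])
  then have Tne: "T \<noteq> {}" using T(3) by auto
  then have cT: "card T > 0" using T(2) by (simp add: card_gt_0_iff)
  define m where "m = lam / (4 * card T)"
  have m: "0 < m" using lam cT by (simp add: m_def)
  have "\<exists>H. finite H \<and> H \<subseteq> sphere 0 1 \<and> (\<forall>\<theta>\<in>H. m \<le> measure \<mu> (ball \<theta> \<delta> \<inter> sphere 0 1)) \<and>
      (\<forall>\<nu>. norm \<nu> = 1 \<longrightarrow> (\<exists>\<theta>\<in>H. \<kappa> \<le> \<bar>\<nu> \<bullet> \<theta>\<bar>))" if mu: "spectral_measure s lam Lam \<mu>" for \<mu> :: "'a measure"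
  proof -
    note mu' = spectral_measureD[OF mu Lam]
    interpret finite_measure \<mu> by (rule mu')
    have bs: "ball t \<delta> \<inter> sphere 0 1 \<in> sets \<mu>" for t by (rule mu'(5)) simp
    define H where "H = {t \<in> T. m \<le> measure \<mu> (ball t \<delta> \<inter> sphere 0 1)}"
    have "\<exists>\<theta>\<in>H. \<kappa> \<le> \<bar>\<nu> \<bullet> \<theta>\<bar>" if \<nu>: "norm \<nu> = 1" for \<nu>
    proof (rule ccontr)
      assume "\<not> (\<exists>\<theta>\<in>H. \<kappa> \<le> \<bar>\<nu> \<bullet> \<theta>\<bar>)"
      then have low: "\<And>t. t \<in> H \<Longrightarrow> \<bar>\<nu> \<bullet> t\<bar> < \<kappa>" by auto
      let ?A = "{\<theta> \<in> sphere 0 1. 2 * \<kappa> \<le> \<bar>\<nu> \<bullet> \<theta>\<bar>}"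
      have A: "?A \<subseteq> (\<Union>t\<in>T - H. ball t \<delta> \<inter> sphere 0 1)"
      proof
        fix \<theta> assume th: "\<theta> \<in> ?A"
        then obtain t where t: "t \<in> T" "\<theta> \<in> ball t \<delta>" using T(3) by auto
        have "t \<notin> H"
        proof
          assume "t \<in> H"
          have "\<bar>\<nu> \<bullet> \<theta>\<bar> \<le> \<bar>\<nu> \<bullet> t\<bar> + \<bar>\<nu> \<bullet> (\<theta> - t)\<bar>" by (simp add: inner_diff_right)
          also have "\<bar>\<nu> \<bullet> (\<theta> - t)\<bar> \<le> norm (\<theta> - t)" using Cauchy_Schwarz_ineq2[of \<nu> "\<theta> - t"] \<nu> by simp
          also have "norm (\<theta> - t) < \<delta>" using t by (simp add: dist_norm norm_minus_commute)
          finally show False using low[OF \<open>t \<in> H\<close>] th \<delta> by auto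
        qed
        then show "\<theta> \<in> (\<Union>t\<in>T - H. ball t \<delta> \<inter> sphere 0 1)" using t th by auto
      qed
      have "lam / 2 \<le> measure \<mu> ?A"
        by (rule spectral_mass_transversal(2)[OF s lam mu \<nu>]) (use \<kappa> in auto)
      also have "\<dots> \<le> measure \<mu> (\<Union>t\<in>T - H. ball t \<delta> \<inter> sphere 0 1)"
        using T bs by (intro finite_measure_mono[OF A] sets.finite_UN) auto
      also have "\<dots> \<le> (\<Sum>t\<in>T - H. measure \<mu> (ball t \<delta> \<inter> sphere 0 1))"
        by (rule finite_measure_subadditive_finite) (use T bs in auto)
      also have "\<dots> \<le> (\<Sum>t\<in>T - H. m)" by (rule sum_mono) (auto simp: H_def)
      also have "\<dots> \<le> (\<Sum>t\<in>T. m)" using T m by (intro sum_mono2) auto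
      also have "\<dots> = lam / 4" using cT by (simp add: m_def)
      finally show False using lam by simp
    qed
    moreover have "finite H" "H \<subseteq> sphere 0 1" using T by (auto simp: H_def)
    moreover have "\<forall>\<theta>\<in>H. m \<le> measure \<mu> (ball \<theta> \<delta> \<inter> sphere 0 1)" by (auto simp: H_def)
    ultimately show ?thesis by blast
  qed
  then show thesis using that m by blast
qed

subsection \<open>A distance adapted to the spectral measure\<close>

lemma power2_powr:
  fixes x :: real assumes "0 < x" shows "(x\<^sup>2) powr r = x powr (2 * r)"
  using assms by (simp add: powr_powr[symmetric])

text \<open>Made for powers of a quadratic form: with value \<open>P\<close> at the centre, its
  values at two opposite points are \<open>P + Y + c\<close> and \<open>P + Y - c\<close>. The
  increment \<open>Y\<close> common to both is estimated by the tangent, the antisymmetric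
  \<open>c\<close> by quantitative concavity.\<close>

lemma powr_second_difference_le:
  fixes P Y c q :: real
  assumes q: "0 < q" "q < 1" and P: "0 < P" and Y: "0 \<le> Y" and c: "\<bar>c\<bar> \<le> P + Y"
  shows "(P + Y + c) powr q + (P + Y - c) powr q
    \<le> 2 * P powr q + 2 * q * P powr (q - 1) * Y - q * (1 - q) * c\<^sup>2 * (P + Y) powr (q - 2)"
proof -
  define A where "A = P + Y"
  have A: "A > 0" using P Y by (simp add: A_def)
  have "(A + c) powr q + (A - c) powr q = A powr q * ((1 + c / A) powr q + (1 - c / A) powr q)"
  proof -
    have 1: "A + c = A * (1 + c / A)" and 2: "A - c = A * (1 - c / A)" using A by (auto simp: field_simps)
    have "(A + c) powr q = A powr q * (1 + c / A) powr q" by (subst 1) (rule powr_mult)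
    moreover have "(A - c) powr q = A powr q * (1 - c / A) powr q" by (subst 2) (rule powr_mult)
    ultimately show ?thesis by (simp only: distrib_left)
  qed
  also have "\<dots> \<le> A powr q * (2 - q * (1 - q) * (c / A)\<^sup>2)"
    by (intro mult_left_mono powr_symmetric_sum_le q) (use A c in \<open>auto simp: A_def field_simps\<close>)
  also have "\<dots> = 2 * A powr q - q * (1 - q) * c\<^sup>2 * (A powr q / A\<^sup>2)"
    by (simp add: power_divide right_diff_distrib[of "A powr q"])
  also have "A powr q / A\<^sup>2 = A powr (q - 2)" using A by (simp add: powr_diff)
  also have "A powr q \<le> P powr q + q * P powr (q - 1) * Y"
    unfolding A_def by (rule powr_add_le_tangent) (use P Y q in auto)
  finally show ?thesis by (simp add: A_def algebra_simps)
qed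

text \<open>
  The function \<open>\<phi>\<close> is the sum over \<open>k\<close> of the powers with exponent \<open>s / 2\<close> of
  \<open>(\<nu>\<^sub>k \<bullet> z)\<^sup>2 + \<eta>\<^sup>2 |z|\<^sup>2\<close>. The summand with the largest \<open>|\<nu>\<^sub>k \<bullet> z|\<close> is concave along \<open>\<theta>\<^sub>k\<close>,
  and for small \<open>\<eta>\<close> the convexity of the others does not spoil this.
\<close>

lemma coupling_function:
  fixes s K :: real
  assumes s: "0 < s" "s < 1" and K: "1 \<le> K"
  obtains \<eta> a A c :: real where "0 < \<eta>" "\<eta> \<le> 1" "0 < a" "0 < A" "0 < c"
    "\<And>(\<theta> :: 'n::finite \<Rightarrow> real ^ 'n) \<nu>. (\<And>k j. \<nu> k \<bullet> \<theta> j = (if k = j then 1 else 0)) \<Longrightarrow>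
      (\<And>z. z = (\<Sum>k\<in>UNIV. (\<nu> k \<bullet> z) *\<^sub>R \<theta> k)) \<Longrightarrow> (\<And>k. norm (\<theta> k) = 1) \<Longrightarrow> (\<And>k. norm (\<nu> k) \<le> K) \<Longrightarrow>
      \<exists>\<phi>. continuous_on UNIV \<phi> \<and> (\<forall>z. a * norm z powr s \<le> \<phi> z \<and> \<phi> z \<le> A * norm z powr s) \<and>
        (\<forall>z. z \<noteq> 0 \<longrightarrow> (\<exists>j. \<forall>v t. norm v = 1 \<longrightarrow> norm (v - \<theta> j) \<le> \<eta> / K \<longrightarrow> \<bar>t\<bar> \<le> \<eta> * norm z \<longrightarrow>
          \<phi> (z + t *\<^sub>R v) + \<phi> (z - t *\<^sub>R v) - 2 * \<phi> z \<le> - c * norm z powr (s - 2) * t\<^sup>2))"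
proof -
  define q where "q = s / 2"
  have q: "0 < q" "q < 1" "2 * q = s" using s by (auto simp: q_def)
  define n where "n = real CARD('n)"
  have n: "n \<ge> 1" by (simp add: n_def Suc_leI)
  \<comment> \<open>Up to a positive factor, \<open>f \<eta>\<close> bounds the second difference of
    the distinguished summand: the first two terms come from the growth of the quadratic form, the
    fraction from the concavity of the power. Its limit at 0 is
    \<open>1 - 2 * (1 - q) = s - 1\<close>, which is negative.\<close>
  define f where "f = (\<lambda>\<eta>. (1 + \<eta>)\<^sup>2 + \<eta>\<^sup>2 - 2 * (1 - q) * (1 - \<eta> - n * \<eta>\<^sup>2)\<^sup>2 / ((1 + \<eta>\<^sup>2 * n\<^sup>2) * (1 + 2 * \<eta>\<^sup>2 * n\<^sup>2)\<^sup>2))"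
  define c1 where "c1 = q * (1 - s) * (2 * K\<^sup>2) powr (q - 1)"
  have c1: "c1 > 0" unfolding c1_def using q s K by (intro mult_pos_pos) auto
  \<comment> \<open>The last condition keeps the convexity of all other summands together below half
    of the concave gain \<open>c1\<close>.\<close>
  have ev: "\<forall>\<^sub>F \<eta> in at_right 0. 0 < \<eta> \<and> \<eta> < 1 / 4 \<and> \<eta> + n * \<eta>\<^sup>2 < 1 \<and> f \<eta> < - (1 - s) / 2 \<and> n * (2 * s * \<eta> powr s) < c1 / 2"
  proof (intro eventually_conj)
    show "\<forall>\<^sub>F \<eta>::real in at_right 0. 0 < \<eta>" by (simp add: eventually_at_right_less)
    show "\<forall>\<^sub>F \<eta>::real in at_right 0. \<eta> < 1 / 4" by (rule order_tendstoD(2)[OF tendsto_ident_at]) simp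
    have "((\<lambda>\<eta>. \<eta> + n * \<eta>\<^sup>2) \<longlongrightarrow> 0 + n * 0\<^sup>2) (at_right 0)" by (intro tendsto_intros)
    then show "\<forall>\<^sub>F \<eta> in at_right 0. \<eta> + n * \<eta>\<^sup>2 < 1" by (rule order_tendstoD(2)) simp
    have "(f \<longlongrightarrow> (1 + 0)\<^sup>2 + 0\<^sup>2 - 2 * (1 - q) * (1 - 0 - n * 0\<^sup>2)\<^sup>2 / ((1 + 0\<^sup>2 * n\<^sup>2) * (1 + 2 * 0\<^sup>2 * n\<^sup>2)\<^sup>2)) (at_right 0)"
      unfolding f_def by (intro tendsto_intros) auto
    then show "\<forall>\<^sub>F \<eta> in at_right 0. f \<eta> < - (1 - s) / 2"
      by (rule order_tendstoD(2)) (use s in \<open>simp add: q_def\<close>)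
    have "((\<lambda>\<eta>. n * (2 * s * \<eta> powr s)) \<longlongrightarrow> n * (2 * s * 0)) (at_right 0)"
    proof (intro tendsto_intros)
      show "((\<lambda>\<eta>. \<eta> powr s) \<longlongrightarrow> 0) (at_right 0)" using s by real_asymp
    qed
    then show "\<forall>\<^sub>F \<eta> in at_right 0. n * (2 * s * \<eta> powr s) < c1 / 2"
      by (rule order_tendstoD(2)) (use c1 in simp)
  qed
  obtain \<eta> where \<eta>: "0 < \<eta>" "\<eta> < 1 / 4" "\<eta> + n * \<eta>\<^sup>2 < 1" "f \<eta> < - (1 - s) / 2" "n * (2 * s * \<eta> powr s) < c1 / 2"
    using eventually_happens'[OF _ ev] by (auto simp: trivial_limit_at_right_real)
  define a where "a = \<eta> powr s"
  define A where "A = n * (2 * K\<^sup>2) powr q"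
  have aA: "0 < a" "0 < A" using \<eta> n K by (auto simp: a_def A_def)
  have \<eta>K: "\<eta>\<^sup>2 \<le> K\<^sup>2" using \<eta> K by (intro power_mono) auto
  show thesis
  proof (rule that[of \<eta> a A "c1 / 2"])
    fix \<theta> \<nu> :: "'n \<Rightarrow> real ^ 'n"
    assume dual: "\<And>k j. \<nu> k \<bullet> \<theta> j = (if k = j then 1 else 0)"
      and expand: "\<And>z. z = (\<Sum>k\<in>UNIV. (\<nu> k \<bullet> z) *\<^sub>R \<theta> k)"
      and n\<theta>: "\<And>k. norm (\<theta> k) = 1" and n\<nu>: "\<And>k. norm (\<nu> k) \<le> K"
    define Q where "Q = (\<lambda>k z. (\<nu> k \<bullet> z)\<^sup>2 + \<eta>\<^sup>2 * (norm z)\<^sup>2)"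
    define \<phi> where "\<phi> = (\<lambda>z. \<Sum>k\<in>UNIV. Q k z powr q)"
    have Qlo: "\<eta>\<^sup>2 * (norm z)\<^sup>2 \<le> Q k z" and Q0: "0 \<le> Q k z" for k z by (auto simp: Q_def)
    have \<nu>z: "\<bar>\<nu> k \<bullet> z\<bar> \<le> K * norm z" for k z
      using Cauchy_Schwarz_ineq2[of "\<nu> k" z] mult_right_mono[OF n\<nu>[of k] norm_ge_zero[of z]] by linarith
    have Qhi: "Q k z \<le> 2 * K\<^sup>2 * (norm z)\<^sup>2" for k z
    proof -
      have "(\<nu> k \<bullet> z)\<^sup>2 \<le> K\<^sup>2 * (norm z)\<^sup>2"
        using power_mono[OF \<nu>z[of k z], of 2] by (simp add: power_mult_distrib)
      moreover have "\<eta>\<^sup>2 * (norm z)\<^sup>2 \<le> K\<^sup>2 * (norm z)\<^sup>2" using \<eta>K by (intro mult_right_mono) auto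
      ultimately show ?thesis by (simp add: Q_def)
    qed
    have Qpos: "0 < Q k z" if "z \<noteq> 0" for k z
      using Qlo[of z k] \<eta>(1) that by (smt (verit) mult_pos_pos zero_less_norm_iff zero_less_power)
    have norm_powr: "((norm z)\<^sup>2) powr q = norm z powr s" for z :: "real ^ 'n"
      using power2_powr[of "norm z" q] q by (cases "z = 0") auto
    have Qexp: "Q k (z + t *\<^sub>R v) = Q k z + t\<^sup>2 * Q k v + 2 * t * ((\<nu> k \<bullet> z) * (\<nu> k \<bullet> v) + \<eta>\<^sup>2 * (z \<bullet> v))"
      for k z t v
      unfolding Q_def power2_norm_eq_inner
      by (simp add: inner_add_right inner_add_left inner_commute[of v z] power2_eq_square algebra_simps)
    have Qexp': "Q k (z - t *\<^sub>R v) = Q k z + t\<^sup>2 * Q k v - 2 * t * ((\<nu> k \<bullet> z) * (\<nu> k \<bullet> v) + \<eta>\<^sup>2 * (z \<bullet> v))"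
      for k z t v
      using Qexp[of k z "- t" v] by simp
    have summand: "Q k (z + t *\<^sub>R v) powr q + Q k (z - t *\<^sub>R v) powr q \<le> 2 * Q k z powr q + 2 * q * Q k z powr (q - 1) * (t\<^sup>2 * Q k v)
        - q * (1 - q) * (2 * t * ((\<nu> k \<bullet> z) * (\<nu> k \<bullet> v) + \<eta>\<^sup>2 * (z \<bullet> v)))\<^sup>2 * (Q k z + t\<^sup>2 * Q k v) powr (q - 2)"
      if "z \<noteq> 0" for k z t v
      unfolding Qexp Qexp'
    proof (rule powr_second_difference_le)
      show "\<bar>2 * t * ((\<nu> k \<bullet> z) * (\<nu> k \<bullet> v) + \<eta>\<^sup>2 * (z \<bullet> v))\<bar> \<le> Q k z + t\<^sup>2 * Q k v"
        using Q0[of k "z + t *\<^sub>R v"] Q0[of k "z - t *\<^sub>R v"] unfolding Qexp Qexp' by linarith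
    qed (use q Qpos[OF that] Q0 in auto)
    have "continuous_on UNIV \<phi>"
      unfolding \<phi>_def Q_def using q
      by (intro continuous_intros continuous_on_powr') (auto simp: add_nonneg_nonneg)
    moreover have "a * norm z powr s \<le> \<phi> z" for z
    proof -
      obtain k0 :: 'n where True by auto
      have "a * norm z powr s = (\<eta>\<^sup>2 * (norm z)\<^sup>2) powr q"
        using \<eta>(1) by (simp add: powr_mult norm_powr a_def power2_powr q)
      also have "\<dots> \<le> Q k0 z powr q" using Qlo q by (intro powr_mono2) auto
      also have "\<dots> \<le> \<phi> z" unfolding \<phi>_def by (rule member_le_sum) auto
      finally show ?thesis .
    qed
    moreover have "\<phi> z \<le> A * norm z powr s" for z
    proof -
      have "Q k z powr q \<le> (2 * K\<^sup>2 * (norm z)\<^sup>2) powr q" for k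
        using Qhi Q0 q by (intro powr_mono2) auto
      then have "\<phi> z \<le> (\<Sum>k\<in>(UNIV::'n set). (2 * K\<^sup>2 * (norm z)\<^sup>2) powr q)" unfolding \<phi>_def by (intro sum_mono)
      also have "\<dots> = A * norm z powr s" using K by (simp add: A_def n_def powr_mult norm_powr)
      finally show ?thesis .
    qed
    moreover have "\<exists>j. \<forall>v t. norm v = 1 \<longrightarrow> norm (v - \<theta> j) \<le> \<eta> / K \<longrightarrow> \<bar>t\<bar> \<le> \<eta> * norm z \<longrightarrow>
          \<phi> (z + t *\<^sub>R v) + \<phi> (z - t *\<^sub>R v) - 2 * \<phi> z \<le> - (c1 / 2) * norm z powr (s - 2) * t\<^sup>2" if z: "z \<noteq> 0" for z
    proof -
      define N where "N = norm z"
      have N: "N > 0" using z by (simp add: N_def)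
      obtain j where j: "\<And>k. \<bar>\<nu> k \<bullet> z\<bar> \<le> \<bar>\<nu> j \<bullet> z\<bar>"
      proof -
        have "Max (range (\<lambda>k. \<bar>\<nu> k \<bullet> z\<bar>)) \<in> range (\<lambda>k. \<bar>\<nu> k \<bullet> z\<bar>)" by (intro Max_in) auto
        then obtain j where "Max (range (\<lambda>k. \<bar>\<nu> k \<bullet> z\<bar>)) = \<bar>\<nu> j \<bullet> z\<bar>" by (rule rangeE)
        then show thesis using that[of j] by (metis Max_ge finite finite_imageI rangeI)
      qed
      define L where "L = \<bar>\<nu> j \<bullet> z\<bar>"
      \<comment> \<open>The vectors \<open>\<theta> k\<close> have length 1, so the largest dual
        coordinate is comparable to the norm; this is why the distinguished summand carries a fixed
        share of the whole.\<close>
      have NL: "N \<le> n * L"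
      proof -
        have "N \<le> (\<Sum>k\<in>UNIV. norm ((\<nu> k \<bullet> z) *\<^sub>R \<theta> k))"
          unfolding N_def by (subst expand[of z]) (rule norm_sum)
        also have "\<dots> \<le> (\<Sum>k\<in>(UNIV::'n set). L)" by (rule sum_mono) (simp add: n\<theta> L_def j)
        finally show ?thesis by (simp add: n_def)
      qed
      have L: "L > 0" using NL N n by (smt (verit) mult_nonneg_nonpos)
      show ?thesis
      proof (rule exI[of _ j], intro allI impI)
        fix v t assume v: "norm v = 1" "norm (v - \<theta> j) \<le> \<eta> / K" and t: "\<bar>t\<bar> \<le> \<eta> * norm z"
        have \<nu>v: "\<bar>\<nu> k \<bullet> v - (if k = j then 1 else 0)\<bar> \<le> \<eta>" for k
        proof -
          have "\<bar>\<nu> k \<bullet> (v - \<theta> j)\<bar> \<le> K * (\<eta> / K)"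
            using \<nu>z[of k "v - \<theta> j"] mult_left_mono[OF v(2), of K] K by linarith
          then show ?thesis using K by (simp add: inner_diff_right dual)
        qed
        have t2: "t\<^sup>2 \<le> \<eta>\<^sup>2 * N\<^sup>2"
          using power_mono[OF t, of 2] by (simp add: power_mult_distrib N_def)
        \<comment> \<open>Here \<open>\<nu> k \<bullet> v\<close> is at most \<open>\<eta>\<close>
          in absolute value, so the form grows slowly along \<open>v\<close>, and its part
          \<open>\<eta>\<^sup>2 * (norm z)\<^sup>2\<close> keeps it away from 0. Together they leave
          the factor \<open>\<eta> powr s\<close>.\<close>
        have off: "Q k (z + t *\<^sub>R v) powr q + Q k (z - t *\<^sub>R v) powr q - 2 * Q k z powr q \<le> 2 * s * \<eta> powr s * (N powr (s - 2) * t\<^sup>2)"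
          if k: "k \<noteq> j" for k
        proof -
          have "(\<nu> k \<bullet> v)\<^sup>2 \<le> \<eta>\<^sup>2" using power_mono[OF \<nu>v[of k], of 2] k by simp
          then have Qv: "Q k v \<le> 2 * \<eta>\<^sup>2" using v by (simp add: Q_def)
          have Qz: "Q k z powr (q - 1) \<le> (\<eta>\<^sup>2 * N\<^sup>2) powr (q - 1)"
            using Qlo[of z k] \<eta>(1) N q by (intro powr_mono2') (auto simp: N_def)
          have "Q k (z + t *\<^sub>R v) powr q + Q k (z - t *\<^sub>R v) powr q - 2 * Q k z powr q \<le> 2 * q * Q k z powr (q - 1) * (t\<^sup>2 * Q k v)"
            using summand[OF z, of k t v] q by (smt (verit) mult_nonneg_nonneg powr_ge_zero zero_le_power2)
          also have "\<dots> \<le> 2 * q * (\<eta>\<^sup>2 * N\<^sup>2) powr (q - 1) * (t\<^sup>2 * (2 * \<eta>\<^sup>2))"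
            using q Qv Qz Q0 by (intro mult_mono mult_left_mono) auto
          also have "(\<eta>\<^sup>2 * N\<^sup>2) powr (q - 1) = \<eta> powr (s - 2) * N powr (s - 2)"
          proof -
            have "(\<eta>\<^sup>2 * N\<^sup>2) powr (q - 1) = \<eta> powr (2 * (q - 1)) * N powr (2 * (q - 1))"
              using \<eta>(1) N by (simp add: powr_mult power2_powr)
            moreover have "2 * (q - 1) = s - 2" using q by simp
            ultimately show ?thesis by simp
          qed
          also have "2 * q * (\<eta> powr (s - 2) * N powr (s - 2)) * (t\<^sup>2 * (2 * \<eta>\<^sup>2)) = 2 * s * (\<eta> powr (s - 2) * \<eta>\<^sup>2) * (N powr (s - 2) * t\<^sup>2)"
            unfolding q(3)[symmetric] by (simp add: mult_ac)
          also have "\<eta> powr (s - 2) * \<eta>\<^sup>2 = \<eta> powr s" using \<eta>(1) by (simp add: powr_diff)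
          finally show ?thesis .
        qed
        define P where "P = Q j z"
        define Y where "Y = Q j v"
        define g where "g = 1 - \<eta> - n * \<eta>\<^sup>2"
        have g: "0 < g" using \<eta> by (simp add: g_def)
        have P: "P > 0" using Qpos[OF z] by (simp add: P_def)
        have \<alpha>: "1 - \<eta> \<le> \<nu> j \<bullet> v" "\<nu> j \<bullet> v \<le> 1 + \<eta>" using \<nu>v[of j] by auto
        have Y: "0 \<le> Y" "Y \<le> (1 + \<eta>)\<^sup>2 + \<eta>\<^sup>2"
          using \<alpha> \<eta> v power_mono[OF \<alpha>(2), of 2] Q0 by (auto simp: Y_def Q_def)
        have Y2: "Y \<le> 2"
        proof -
          have "(1 + \<eta>)\<^sup>2 + \<eta>\<^sup>2 \<le> (1 + 1/4)\<^sup>2 + (1/4)\<^sup>2" using \<eta> by (intro add_mono power_mono) auto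
          then show ?thesis using Y by (simp add: power2_eq_square)
        qed
        have PL: "L\<^sup>2 \<le> P" by (simp add: P_def Q_def L_def)
        have N2: "N\<^sup>2 \<le> n\<^sup>2 * L\<^sup>2" using power_mono[OF NL, of 2] N by (simp add: power_mult_distrib)
        have "P = L\<^sup>2 + \<eta>\<^sup>2 * N\<^sup>2" by (simp add: P_def Q_def L_def N_def)
        also have "\<dots> \<le> L\<^sup>2 + \<eta>\<^sup>2 * (n\<^sup>2 * L\<^sup>2)" using N2 by (intro add_mono mult_left_mono) auto
        finally have PL': "P \<le> L\<^sup>2 * (1 + \<eta>\<^sup>2 * n\<^sup>2)" by (simp add: algebra_simps)
        define D where "D = 1 + \<eta>\<^sup>2 * n\<^sup>2"
        define E where "E = 1 + 2 * \<eta>\<^sup>2 * n\<^sup>2"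
        have DE: "D \<ge> 1" "E \<ge> 1" by (auto simp: D_def E_def)
        have PE: "P + t\<^sup>2 * Y \<le> P * E"
        proof -
          have "t\<^sup>2 * Y \<le> (\<eta>\<^sup>2 * N\<^sup>2) * 2" using t2 Y Y2 by (intro mult_mono) auto
          also have "\<dots> \<le> (\<eta>\<^sup>2 * (n\<^sup>2 * P)) * 2"
            using order_trans[OF N2 mult_left_mono[OF PL, of "n\<^sup>2"]] by (intro mult_right_mono mult_left_mono) auto
          finally show ?thesis by (simp add: E_def algebra_simps)
        qed
        \<comment> \<open>Since \<open>E \<ge> 1\<close>, the exponent \<open>q - 2\<close> of
          \<open>E\<close> may be lowered to -2.\<close>
        have AE: "P powr (q - 2) / E\<^sup>2 \<le> (P + t\<^sup>2 * Y) powr (q - 2)"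
        proof -
          have "P powr (q - 2) / E\<^sup>2 = P powr (q - 2) * E powr (- 2)"
            using DE by (simp add: powr_minus divide_inverse)
          also have "\<dots> \<le> P powr (q - 2) * E powr (q - 2)"
            using DE q by (intro mult_left_mono powr_mono) auto
          also have "\<dots> = (P * E) powr (q - 2)" using P DE by (simp add: powr_mult)
          also have "\<dots> \<le> (P + t\<^sup>2 * Y) powr (q - 2)"
            using PE P Y q by (intro powr_mono2') (auto intro: add_pos_nonneg)
          finally show ?thesis .
        qed
        define b where "b = (\<nu> j \<bullet> z) * (\<nu> j \<bullet> v) + \<eta>\<^sup>2 * (z \<bullet> v)"
        have b: "L * g \<le> \<bar>b\<bar>"
        proof -
          have "L * (1 - \<eta>) \<le> \<bar>(\<nu> j \<bullet> z) * (\<nu> j \<bullet> v)\<bar>"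
            unfolding abs_mult L_def using \<alpha> \<eta> by (intro mult_left_mono) auto
          moreover have "\<bar>\<eta>\<^sup>2 * (z \<bullet> v)\<bar> \<le> \<eta>\<^sup>2 * (n * L)"
          proof -
            have "\<bar>z \<bullet> v\<bar> \<le> n * L" using Cauchy_Schwarz_ineq2[of z v] v NL by (simp add: N_def)
            then show ?thesis unfolding abs_mult by (intro mult_mono) auto
          qed
          moreover have "L * g = L * (1 - \<eta>) - \<eta>\<^sup>2 * (n * L)" by (simp add: g_def algebra_simps)
          ultimately show ?thesis unfolding b_def by linarith
        qed
        have b2: "P / D * g\<^sup>2 \<le> b\<^sup>2"
        proof -
          have "P / D \<le> L\<^sup>2" using PL'[folded D_def] DE(1) by (simp add: divide_le_eq)
          then have "P / D * g\<^sup>2 \<le> L\<^sup>2 * g\<^sup>2" by (intro mult_right_mono) auto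
          also have "\<dots> = (L * g)\<^sup>2" by (simp add: power_mult_distrib)
          also have "\<dots> \<le> \<bar>b\<bar>\<^sup>2" using b L g by (intro power_mono) auto
          finally show ?thesis by simp
        qed
        have on: "Q j (z + t *\<^sub>R v) powr q + Q j (z - t *\<^sub>R v) powr q - 2 * Q j z powr q \<le> - c1 * (N powr (s - 2) * t\<^sup>2)"
        proof -
          have "Q j (z + t *\<^sub>R v) powr q + Q j (z - t *\<^sub>R v) powr q - 2 * Q j z powr q
            \<le> 2 * q * P powr (q - 1) * (t\<^sup>2 * Y) - q * (1 - q) * (2 * t * b)\<^sup>2 * (P + t\<^sup>2 * Y) powr (q - 2)"
            using summand[OF z, of j t v] by (simp add: P_def Y_def b_def)
          also have "\<dots> \<le> 2 * q * P powr (q - 1) * (t\<^sup>2 * ((1 + \<eta>)\<^sup>2 + \<eta>\<^sup>2)) -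
              q * (1 - q) * (4 * t\<^sup>2 * (P / D * g\<^sup>2)) * (P powr (q - 2) / E\<^sup>2)"
          proof (rule diff_mono)
            show "2 * q * P powr (q - 1) * (t\<^sup>2 * Y) \<le> 2 * q * P powr (q - 1) * (t\<^sup>2 * ((1 + \<eta>)\<^sup>2 + \<eta>\<^sup>2))"
              using q Y by (intro mult_left_mono) auto
            have "4 * t\<^sup>2 * (P / D * g\<^sup>2) \<le> 4 * t\<^sup>2 * b\<^sup>2" using b2 by (intro mult_left_mono) auto
            also have "\<dots> = (2 * t * b)\<^sup>2" by (simp add: power_mult_distrib)
            finally show "q * (1 - q) * (4 * t\<^sup>2 * (P / D * g\<^sup>2)) * (P powr (q - 2) / E\<^sup>2)
              \<le> q * (1 - q) * (2 * t * b)\<^sup>2 * (P + t\<^sup>2 * Y) powr (q - 2)"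
              using AE q by (intro mult_mono[OF _ AE] mult_left_mono) auto
          qed
          also have "\<dots> = 2 * q * P powr (q - 1) * t\<^sup>2 * f \<eta>"
          proof -
            have "P * P powr (q - 2) = P powr (q - 1)" using P by (simp add: powr_diff power2_eq_square field_simps)
            moreover have "q * (1 - q) * (4 * t\<^sup>2 * (P / D * g\<^sup>2)) * (W / E\<^sup>2) =
              2 * q * (P * W) * t\<^sup>2 * (2 * (1 - q) * g\<^sup>2 / (D * E\<^sup>2))" for W
              by (simp add: mult_ac)
            ultimately have "q * (1 - q) * (4 * t\<^sup>2 * (P / D * g\<^sup>2)) * (P powr (q - 2) / E\<^sup>2) =
              2 * q * P powr (q - 1) * t\<^sup>2 * (2 * (1 - q) * g\<^sup>2 / (D * E\<^sup>2))"
              by (simp only:)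
            then show ?thesis by (simp add: f_def D_def E_def g_def right_diff_distrib mult.assoc)
          qed
          also have "\<dots> \<le> 2 * q * P powr (q - 1) * t\<^sup>2 * (- (1 - s) / 2)"
            using \<eta>(4) q by (intro mult_left_mono) auto
          also have "\<dots> = - (q * (1 - s) * t\<^sup>2) * P powr (q - 1)" by (simp add: field_simps)
          also have "\<dots> \<le> - (q * (1 - s) * t\<^sup>2) * ((2 * K\<^sup>2) powr (q - 1) * N powr (s - 2))"
          proof (rule mult_left_mono_neg)
            have "(2 * K\<^sup>2) powr (q - 1) * N powr (s - 2) = (2 * K\<^sup>2) powr (q - 1) * N powr (2 * (q - 1))"
              using q by (simp add: right_diff_distrib)
            also have "\<dots> = (2 * K\<^sup>2 * N\<^sup>2) powr (q - 1)" using N K by (simp add: powr_mult power2_powr)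
            also have "\<dots> \<le> P powr (q - 1)"
              using Qhi[of j z] P q by (intro powr_mono2') (auto simp: P_def N_def)
            finally show "(2 * K\<^sup>2) powr (q - 1) * N powr (s - 2) \<le> P powr (q - 1)" .
          qed (use q s in auto)
          finally show ?thesis by (simp add: c1_def mult_ac)
        qed
        have "\<phi> (z + t *\<^sub>R v) + \<phi> (z - t *\<^sub>R v) - 2 * \<phi> z =
          (\<Sum>k\<in>UNIV. Q k (z + t *\<^sub>R v) powr q + Q k (z - t *\<^sub>R v) powr q - 2 * Q k z powr q)"
          by (simp add: \<phi>_def sum.distrib sum_subtractf sum_distrib_left)
        also have "\<dots> \<le> (\<Sum>k\<in>UNIV. 2 * s * \<eta> powr s * (N powr (s - 2) * t\<^sup>2) - (if k = j then c1 * (N powr (s - 2) * t\<^sup>2) else 0))"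
        proof (rule sum_mono)
          fix k
          have nn: "0 \<le> 2 * s * \<eta> powr s * (N powr (s - 2) * t\<^sup>2)" using s by auto
          show "Q k (z + t *\<^sub>R v) powr q + Q k (z - t *\<^sub>R v) powr q - 2 * Q k z powr q \<le>
            2 * s * \<eta> powr s * (N powr (s - 2) * t\<^sup>2) - (if k = j then c1 * (N powr (s - 2) * t\<^sup>2) else 0)"
          proof (cases "k = j")
            case True
            have "X \<le> - a * y \<Longrightarrow> 0 \<le> m \<Longrightarrow> X \<le> m - a * y" for X a y m :: real by simp
            from this[OF on nn] show ?thesis unfolding True by (simp only: refl if_True)
          qed (use off[of k] in auto)
        qed
        also have "\<dots> = (n * (2 * s * \<eta> powr s) - c1) * (N powr (s - 2) * t\<^sup>2)"
          by (simp add: sum_subtractf n_def left_diff_distrib)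
        also have "\<dots> \<le> (- (c1 / 2)) * (N powr (s - 2) * t\<^sup>2)"
          using \<eta>(5) by (intro mult_right_mono) auto
        finally show "\<phi> (z + t *\<^sub>R v) + \<phi> (z - t *\<^sub>R v) - 2 * \<phi> z \<le> - (c1 / 2) * norm z powr (s - 2) * t\<^sup>2"
          by (simp add: N_def mult.assoc)
      qed
    qed
    ultimately show "\<exists>\<phi>. continuous_on UNIV \<phi> \<and> (\<forall>z. a * norm z powr s \<le> \<phi> z \<and> \<phi> z \<le> A * norm z powr s) \<and>
        (\<forall>z. z \<noteq> 0 \<longrightarrow> (\<exists>j. \<forall>v t. norm v = 1 \<longrightarrow> norm (v - \<theta> j) \<le> \<eta> / K \<longrightarrow> \<bar>t\<bar> \<le> \<eta> * norm z \<longrightarrow>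
          \<phi> (z + t *\<^sub>R v) + \<phi> (z - t *\<^sub>R v) - 2 * \<phi> z \<le> - (c1 / 2) * norm z powr (s - 2) * t\<^sup>2))"
      by blast
  qed (use \<eta> aA c1 in auto)
qed

text \<open>The constants are fixed in the order \<open>\<kappa>\<close>, \<open>K\<close>,
  \<open>\<eta>\<close>, \<open>m\<close>, all before the measure; the measure only selects the
  basis from its heavy directions. The set \<open>S\<close> is the part of the sphere close to the
  concave direction, so it has positive mass even though that direction alone may have none.\<close>

lemma spectral_coupling:
  fixes s lam Lam :: real
  assumes s: "0 < s" "s < 1" and lam: "0 < lam" "lam \<le> Lam"
  obtains \<eta> a A c m :: real where "0 < \<eta>" "\<eta> \<le> 1" "0 < a" "0 < A" "0 < c" "0 < m"
    "\<And>\<mu> :: (real ^ 'n::finite) measure. spectral_measure s lam Lam \<mu> \<Longrightarrow>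
      \<exists>\<phi>. continuous_on UNIV \<phi> \<and> (\<forall>z. a * norm z powr s \<le> \<phi> z \<and> \<phi> z \<le> A * norm z powr s) \<and>
        (\<forall>z. z \<noteq> 0 \<longrightarrow> (\<exists>S\<in>sets \<mu>. m \<le> measure \<mu> S \<and> (\<forall>v t. v \<in> S \<longrightarrow> \<bar>t\<bar> \<le> \<eta> * norm z \<longrightarrow>
          \<phi> (z + t *\<^sub>R v) + \<phi> (z - t *\<^sub>R v) - 2 * \<phi> z \<le> - c * norm z powr (s - 2) * t\<^sup>2)))"
proof -
  have Lam: "0 < Lam" "0 \<le> Lam" using lam by auto
  define \<kappa> where "\<kappa> = min 1 ((lam / (2 * Lam)) powr (1 / (2 * s)) / 2)"
  have \<kappa>: "0 < \<kappa>" "\<kappa> \<le> 1" using lam Lam by (auto simp: \<kappa>_def)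
  have \<kappa>2: "(2 * \<kappa>) powr (2 * s) * Lam \<le> lam / 2"
  proof -
    have "(2 * \<kappa>) powr (2 * s) \<le> ((lam / (2 * Lam)) powr (1 / (2 * s))) powr (2 * s)"
      using s \<kappa> by (intro powr_mono2) (auto simp: \<kappa>_def)
    also have "\<dots> = lam / (2 * Lam)" using s lam Lam by (simp add: powr_powr)
    finally show ?thesis using Lam by (simp add: field_simps)
  qed
  define K where "K = 1 / \<kappa>"
  have K: "1 \<le> K" using \<kappa> by (simp add: K_def)
  obtain \<eta> a A c :: real where c: "0 < \<eta>" "\<eta> \<le> 1" "0 < a" "0 < A" "0 < c"
    and coupling: "\<And>(\<theta> :: 'n \<Rightarrow> real ^ 'n) \<nu>. (\<And>k j. \<nu> k \<bullet> \<theta> j = (if k = j then 1 else 0)) \<Longrightarrow>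
      (\<And>z. z = (\<Sum>k\<in>UNIV. (\<nu> k \<bullet> z) *\<^sub>R \<theta> k)) \<Longrightarrow> (\<And>k. norm (\<theta> k) = 1) \<Longrightarrow> (\<And>k. norm (\<nu> k) \<le> K) \<Longrightarrow>
      \<exists>\<phi>. continuous_on UNIV \<phi> \<and> (\<forall>z. a * norm z powr s \<le> \<phi> z \<and> \<phi> z \<le> A * norm z powr s) \<and>
        (\<forall>z. z \<noteq> 0 \<longrightarrow> (\<exists>j. \<forall>v t. norm v = 1 \<longrightarrow> norm (v - \<theta> j) \<le> \<eta> / K \<longrightarrow> \<bar>t\<bar> \<le> \<eta> * norm z \<longrightarrow>
          \<phi> (z + t *\<^sub>R v) + \<phi> (z - t *\<^sub>R v) - 2 * \<phi> z \<le> - c * norm z powr (s - 2) * t\<^sup>2))"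
    by (rule coupling_function[OF s K, where ?'n = 'n]) blast
  have \<delta>: "0 < \<eta> / K" "\<eta> / K \<le> \<kappa>" using c \<kappa> by (auto simp: K_def mult_le_cancel_right1)
  obtain m where m: "0 < m" "\<And>\<mu> :: (real ^ 'n) measure. spectral_measure s lam Lam \<mu> \<Longrightarrow>
    \<exists>H. finite H \<and> H \<subseteq> sphere 0 1 \<and> (\<forall>\<theta>\<in>H. m \<le> measure \<mu> (ball \<theta> (\<eta> / K) \<inter> sphere 0 1)) \<and>
      (\<forall>\<nu>. norm \<nu> = 1 \<longrightarrow> (\<exists>\<theta>\<in>H. \<kappa> \<le> \<bar>\<nu> \<bullet> \<theta>\<bar>))"
    by (rule heavy_directions[OF s(1) lam \<kappa>(1) \<kappa>2 \<delta>, where ?'a = "real ^ 'n"]) blast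
  show thesis
  proof (rule that[OF c m(1)])
    fix \<mu> :: "(real ^ 'n) measure" assume mu: "spectral_measure s lam Lam \<mu>"
    obtain H where H: "finite H" "H \<subseteq> sphere 0 1" "\<And>\<theta>. \<theta> \<in> H \<Longrightarrow> m \<le> measure \<mu> (ball \<theta> (\<eta> / K) \<inter> sphere 0 1)"
      "\<And>\<nu>. norm \<nu> = 1 \<Longrightarrow> \<exists>\<theta>\<in>H. \<kappa> \<le> \<bar>\<nu> \<bullet> \<theta>\<bar>" using m(2)[OF mu] by blast
    obtain \<theta> \<nu> :: "'n \<Rightarrow> real ^ 'n" where b: "\<And>k. \<theta> k \<in> H"
      "\<And>k j. \<nu> k \<bullet> \<theta> j = (if k = j then 1 else 0)" "\<And>z. z = (\<Sum>k\<in>UNIV. (\<nu> k \<bullet> z) *\<^sub>R \<theta> k)"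
      "\<And>k. norm (\<nu> k) \<le> 1 / \<kappa>"
      by (rule dual_basis_of_spread_set[OF H(1) \<kappa>(1) H(4)]) (assumption, rule that)
    have n\<theta>: "norm (\<theta> k) = 1" for k using b(1)[of k] H(2) by auto
    have n\<nu>: "norm (\<nu> k) \<le> K" for k using b(4)[of k] by (simp add: K_def)
    obtain \<phi> where \<phi>: "continuous_on UNIV \<phi>" "\<forall>z. a * norm z powr s \<le> \<phi> z \<and> \<phi> z \<le> A * norm z powr s"
      "\<And>z. z \<noteq> 0 \<Longrightarrow> (\<exists>j. \<forall>v t. norm v = 1 \<longrightarrow> norm (v - \<theta> j) \<le> \<eta> / K \<longrightarrow> \<bar>t\<bar> \<le> \<eta> * norm z \<longrightarrow>
          \<phi> (z + t *\<^sub>R v) + \<phi> (z - t *\<^sub>R v) - 2 * \<phi> z \<le> - c * norm z powr (s - 2) * t\<^sup>2)"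
      using coupling[OF b(2,3) n\<theta> n\<nu>] by blast
    have "\<exists>S\<in>sets \<mu>. m \<le> measure \<mu> S \<and> (\<forall>v t. v \<in> S \<longrightarrow> \<bar>t\<bar> \<le> \<eta> * norm z \<longrightarrow>
          \<phi> (z + t *\<^sub>R v) + \<phi> (z - t *\<^sub>R v) - 2 * \<phi> z \<le> - c * norm z powr (s - 2) * t\<^sup>2)" if "z \<noteq> 0" for z
    proof -
      obtain j where j: "\<And>v t. norm v = 1 \<Longrightarrow> norm (v - \<theta> j) \<le> \<eta> / K \<Longrightarrow> \<bar>t\<bar> \<le> \<eta> * norm z \<Longrightarrow>
          \<phi> (z + t *\<^sub>R v) + \<phi> (z - t *\<^sub>R v) - 2 * \<phi> z \<le> - c * norm z powr (s - 2) * t\<^sup>2"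
        using \<phi>(3)[OF \<open>z \<noteq> 0\<close>] by blast
      show ?thesis
      proof (intro bexI[of _ "ball (\<theta> j) (\<eta> / K) \<inter> sphere 0 1"] conjI allI impI)
        show "ball (\<theta> j) (\<eta> / K) \<inter> sphere 0 1 \<in> sets \<mu>"
          by (rule spectral_measureD(5)[OF mu Lam(2)]) simp
        show "m \<le> measure \<mu> (ball (\<theta> j) (\<eta> / K) \<inter> sphere 0 1)" by (rule H(3)[OF b(1)])
      qed (rule j, auto simp: dist_norm norm_minus_commute)
    qed
    then show "\<exists>\<phi>. continuous_on UNIV \<phi> \<and> (\<forall>z. a * norm z powr s \<le> \<phi> z \<and> \<phi> z \<le> A * norm z powr s) \<and>
        (\<forall>z. z \<noteq> 0 \<longrightarrow> (\<exists>S\<in>sets \<mu>. m \<le> measure \<mu> S \<and> (\<forall>v t. v \<in> S \<longrightarrow> \<bar>t\<bar> \<le> \<eta> * norm z \<longrightarrow>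
          \<phi> (z + t *\<^sub>R v) + \<phi> (z - t *\<^sub>R v) - 2 * \<phi> z \<le> - c * norm z powr (s - 2) * t\<^sup>2)))"
      using \<phi>(1,2) by blast
  qed
qed

subsection \<open>Regularity in space\<close>

lemma norm_parallelogram:
  fixes a b :: "'a::real_inner"
  shows "(norm (a + b))\<^sup>2 + (norm (a - b))\<^sup>2 = 2 * (norm a)\<^sup>2 + 2 * (norm b)\<^sup>2"
  by (simp add: power2_norm_eq_inner inner_add_left inner_add_right inner_diff_left inner_diff_right)

text \<open>Only earlier times are compared, because the maximum may be attained at the final time
  of the cylinder.\<close>

lemma deriv_nonneg_at_max:
  fixes f :: "real \<Rightarrow> real"
  assumes "(f has_real_derivative D) (at t)" "t0 < t" "\<And>\<tau>. t0 \<le> \<tau> \<Longrightarrow> \<tau> \<le> t \<Longrightarrow> f \<tau> \<le> f t"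
  shows "0 \<le> D"
proof (rule ccontr)
  assume "\<not> 0 \<le> D"
  then obtain d where d: "d > 0" "\<And>h. 0 < h \<Longrightarrow> h < d \<Longrightarrow> f t < f (t - h)"
    using DERIV_neg_dec_left[OF assms(1)] by auto
  define h where "h = min (d / 2) (t - t0)"
  have "0 < h" "h < d" "t0 \<le> t - h" using d(1) assms(2) by (auto simp: h_def min_def)
  then show False using d(2)[of h] assms(3)[of "t - h"] by auto
qed

lemma core_solution_minus:
  assumes "core_solution s \<mu> D u f" shows "core_solution s \<mu> D (\<lambda>z. - u z) (\<lambda>z. - f z)"
  using assms unfolding core_solution_def by simp

lemma stable_at_diff:
  fixes v :: "'a::euclidean_space \<Rightarrow> real"
  assumes s: "0 < s" "s < 1" and mu: "spectral_measure s lam Lam \<mu>" "0 \<le> Lam" and v: "bdd_second_diff C v"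
  shows "stable_at s \<mu> (\<lambda>\<xi>. v (x + \<xi>) - v (y + \<xi>)) 0 = stable_at s \<mu> v x - stable_at s \<mu> v y"
proof -
  note i = stable_at_integrable[OF s mu v]
  let ?I = "\<lambda>x \<theta>. \<integral>r. (v (x + r *\<^sub>R \<theta>) + v (x - r *\<^sub>R \<theta>) - 2 * v x) / \<bar>r\<bar> powr (1 + 2 * s) \<partial>lborel"
  have "stable_at s \<mu> v x - stable_at s \<mu> v y = (\<integral>\<theta>. ?I x \<theta> - ?I y \<theta> \<partial>\<mu>)"
    unfolding stable_at_def using i(2) by simp
  also have "\<dots> = stable_at s \<mu> (\<lambda>\<xi>. v (x + \<xi>) - v (y + \<xi>)) 0"
    unfolding stable_at_def
  proof (rule Bochner_Integration.integral_cong[OF refl])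
    fix \<theta> assume "\<theta> \<in> space \<mu>"
    then have th: "\<theta> \<in> sphere 0 1" by (simp add: spectral_measureD(1)[OF mu])
    have "?I x \<theta> - ?I y \<theta> = (\<integral>r. (v (x + r *\<^sub>R \<theta>) + v (x - r *\<^sub>R \<theta>) - 2 * v x) / \<bar>r\<bar> powr (1 + 2 * s) -
      (v (y + r *\<^sub>R \<theta>) + v (y - r *\<^sub>R \<theta>) - 2 * v y) / \<bar>r\<bar> powr (1 + 2 * s) \<partial>lborel)"
      using i(1)[OF th] by simp
    also have "\<dots> = (\<integral>r. (v (x + (0 + r *\<^sub>R \<theta>)) - v (y + (0 + r *\<^sub>R \<theta>)) + (v (x + (0 - r *\<^sub>R \<theta>)) - v (y + (0 - r *\<^sub>R \<theta>))) -
         2 * (v (x + 0) - v (y + 0))) / \<bar>r\<bar> powr (1 + 2 * s) \<partial>lborel)"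
      by (intro Bochner_Integration.integral_cong refl) (simp add: diff_divide_distrib[symmetric] algebra_simps)
    finally show "?I x \<theta> - ?I y \<theta> = (\<integral>r. (v (x + (0 + r *\<^sub>R \<theta>)) - v (y + (0 + r *\<^sub>R \<theta>)) + (v (x + (0 - r *\<^sub>R \<theta>)) - v (y + (0 - r *\<^sub>R \<theta>))) -
         2 * (v (x + 0) - v (y + 0))) / \<bar>r\<bar> powr (1 + 2 * s) \<partial>lborel)" .
  qed
  finally show ?thesis by simp
qed

lemma bdd_second_diff_diff:
  assumes v: "bdd_second_diff C v"
  shows "bdd_second_diff (2 * C) (\<lambda>\<xi>. v (x + \<xi>) - v (y + \<xi>))"
  unfolding bdd_second_diff_def
proof (intro conjI allI)
  have c: "continuous_on UNIV v" and b: "\<And>x. \<bar>v x\<bar> \<le> C"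
    and d: "\<And>x y. \<bar>v (x + y) + v (x - y) - 2 * v x\<bar> \<le> C * (norm y)\<^sup>2"
    using v by (auto simp: bdd_second_diff_def)
  show "continuous_on UNIV (\<lambda>\<xi>. v (x + \<xi>) - v (y + \<xi>))"
    by (intro continuous_intros continuous_on_compose2[OF c]) auto
  show "\<bar>v (x + \<xi>) - v (y + \<xi>)\<bar> \<le> 2 * C" for \<xi> using b[of "x + \<xi>"] b[of "y + \<xi>"] by linarith
  show "\<bar>v (x + (\<xi> + h)) - v (y + (\<xi> + h)) + (v (x + (\<xi> - h)) - v (y + (\<xi> - h))) - 2 * (v (x + \<xi>) - v (y + \<xi>))\<bar> \<le> 2 * C * (norm h)\<^sup>2" for \<xi> h
    using d[of "x + \<xi>" h] d[of "y + \<xi>" h] by (simp add: algebra_simps)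
qed

text \<open>
  Quantifying over the points of the complement of \<open>\<Omega>\<close>, rather than using the distance to it, covers
  an empty complement.
\<close>

definition boundary_decay :: "real \<Rightarrow> real \<Rightarrow> 'a::euclidean_space set \<Rightarrow> (real \<times> 'a \<Rightarrow> real) \<Rightarrow> bool" where
  "boundary_decay s C \<Omega> u \<longleftrightarrow>
     (AE w in lborel. fst w \<in> {-7/8<..<0} \<longrightarrow> norm (snd w) < 3/4 \<longrightarrow> (\<forall>y. y \<notin> \<Omega> \<longrightarrow> \<bar>u w\<bar> \<le> C * norm (snd w - y) powr s))"

lemma moll_boundary_decay:
  fixes u :: "real \<times> 'a::euclidean_space \<Rightarrow> real"
  assumes bu: "bounded_fun u" and bd: "boundary_decay s C \<Omega> u" and s: "0 < s" and C: "0 \<le> C" and e: "0 < e"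
    and t: "-7/8 + e \<le> t" "t + e \<le> 0" and x: "norm x + e \<le> 3/4" and y: "y \<notin> \<Omega>"
  shows "\<bar>moll e u (t, x)\<bar> \<le> C * (norm (x - y) + e) powr s"
proof (rule bounded_fun.moll_abs_AE[OF bu e])
  show "AE w in lborel. dist (t, x) w < e \<longrightarrow> \<bar>u w\<bar> \<le> C * (norm (x - y) + e) powr s"
    using bd[unfolded boundary_decay_def]
  proof eventually_elim
    case (elim w)
    show ?case
    proof
      assume d: "dist (t, x) w < e"
      have dt: "\<bar>t - fst w\<bar> < e" and dx: "norm (x - snd w) < e"
        using le_less_trans[OF dist_fst_le d] le_less_trans[OF dist_snd_le d] by (auto simp: dist_real_def dist_norm)
      have "norm (snd w) < 3/4" using dx x norm_triangle_ineq3[of "snd w" x] by (simp add: norm_minus_commute)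
      then have "\<bar>u w\<bar> \<le> C * norm (snd w - y) powr s" using elim dt t y by auto
      also have "\<dots> \<le> C * (norm (x - y) + e) powr s"
      proof (intro mult_left_mono powr_mono2 C)
        show "norm (snd w - y) \<le> norm (x - y) + e"
          using dx norm_triangle_ineq[of "snd w - x" "x - y"] by (simp add: norm_minus_commute)
      qed (use s in auto)
      finally show "\<bar>u w\<bar> \<le> C * (norm (x - y) + e) powr s" .
    qed
  qed
qed

lemma cball_Pair_subset:
  assumes "a < t - e" "t + e < b" "cball x e \<subseteq> D"
  shows "cball (t, x) e \<subseteq> {a<..<b} \<times> D"
proof
  fix w assume "w \<in> cball (t, x) e"
  then have "dist (t, x) w \<le> e" by simp
  then have "\<bar>t - fst w\<bar> \<le> e" "dist x (snd w) \<le> e"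
    using dist_fst_le[of "(t, x)" w] dist_snd_le[of "(t, x)" w] by (auto simp: dist_real_def)
  then show "w \<in> {a<..<b} \<times> D" using assms by (auto simp: mem_Times_iff subset_iff)
qed

lemma small_powr:
  fixes s C \<delta> :: real
  assumes "0 < s" "0 < \<delta>"
  obtains e0 where "0 < e0" "\<And>e. 0 < e \<Longrightarrow> e < e0 \<Longrightarrow> C * (2 * e) powr s \<le> \<delta>"
proof -
  have "((\<lambda>e::real. C * (2 * e) powr s) \<longlongrightarrow> C * 0) (at_right 0)"
  proof (intro tendsto_intros)
    show "((\<lambda>e::real. (2 * e) powr s) \<longlongrightarrow> 0) (at_right 0)" using assms(1) by real_asymp
  qed
  then have "\<forall>\<^sub>F e in at_right 0. C * (2 * e) powr s < \<delta>" using assms(2) by (intro order_tendstoD(2)) auto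
  then show thesis using that by (auto simp: eventually_at_right_field less_imp_le)
qed

text \<open>
  The maximum of \<open>u(t, x) - u(t, y) - M \<phi>(x - y)\<close> is tested with the jumps in \<open>x\<close> and \<open>y\<close> coupled:
  they are opposite for the short jumps in the directions in which \<open>\<phi>\<close> is concave, and equal otherwise.
\<close>

lemma space_regularity:
  fixes s lam Lam C0 :: real
  assumes s: "0 < s" "s < 1" and lam: "0 < lam" "lam \<le> Lam" and C0: "0 \<le> C0"
  obtains M where "0 < M"
    "\<And>(\<mu> :: (real ^ 'n::finite) measure) \<Omega> u f \<delta>. spectral_measure s lam Lam \<mu> \<Longrightarrow>
      core_solution s \<mu> (\<Omega> \<inter> ball 0 1) u f \<Longrightarrow> boundary_decay s C0 \<Omega> u \<Longrightarrow> 0 < \<delta> \<Longrightarrow>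
      \<exists>e0>0. \<forall>e t x y. 0 < e \<longrightarrow> e < e0 \<longrightarrow> -3/4 < t \<longrightarrow> t < - (2 * e) \<longrightarrow> norm x < 5/8 \<longrightarrow>
        moll e u (t, x) - moll e u (t, y) \<le> M * norm (x - y) powr s + \<delta>"
proof -
  have Lam: "0 < Lam" "0 \<le> Lam" using lam by auto
  obtain \<eta> a A c m :: real where k: "0 < \<eta>" "\<eta> \<le> 1" "0 < a" "0 < A" "0 < c" "0 < m"
    and coupling: "\<And>\<mu> :: (real ^ 'n::finite) measure. spectral_measure s lam Lam \<mu> \<Longrightarrow>
      \<exists>\<phi>. continuous_on UNIV \<phi> \<and> (\<forall>z. a * norm z powr s \<le> \<phi> z \<and> \<phi> z \<le> A * norm z powr s) \<and>
        (\<forall>z. z \<noteq> 0 \<longrightarrow> (\<exists>S\<in>sets \<mu>. m \<le> measure \<mu> S \<and> (\<forall>v t. v \<in> S \<longrightarrow> \<bar>t\<bar> \<le> \<eta> * norm z \<longrightarrow>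
          \<phi> (z + t *\<^sub>R v) + \<phi> (z - t *\<^sub>R v) - 2 * \<phi> z \<le> - c * norm z powr (s - 2) * t\<^sup>2)))"
    by (rule spectral_coupling[OF s lam, where ?'n = 'n]) blast
  \<comment> \<open>The costs: the penalty \<open>512 * (norm (x - x1))\<^sup>2\<close> has second
    difference \<open>1024 * r\<^sup>2\<close>, used for jumps shorter than 1; for the others 8
    bounds the second difference of a difference of two functions bounded by 1.\<close>
  define C1 where "C1 = 1024 * (1 / (2 - 2 * s)) + 8 * (1 / (2 * s))"
  \<comment> \<open>The gain per unit of \<open>M\<close>. Opposite jumps of length \<open>r\<close>
    change \<open>x - y\<close> by \<open>2 * r\<close>, whence the factor 4 and the halved range
    \<open>\<eta> / 2\<close>.\<close>
  define \<gamma> where "\<gamma> = 4 * c * ((\<eta> / 2) powr (2 - 2 * s) / (2 - 2 * s)) * m"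
  have \<gamma>: "\<gamma> > 0" using k s by (auto simp: \<gamma>_def)
  have C1: "C1 \<ge> 0" using s by (auto simp: C1_def)
  \<comment> \<open>Three demands: the gain outweighs the costs, \<open>M * \<phi>\<close> dominates
    the boundary decay, and the maximum is confined to nearby points.\<close>
  define M where "M = (Lam * C1 + 20) / \<gamma> + C0 / a + 64 / a"
  have M: "M > 0" "M * \<gamma> > Lam * C1 + 18" "M * a \<ge> C0" "M * a \<ge> 64"
  proof -
    have p: "(Lam * C1 + 20) / \<gamma> > 0" "C0 / a \<ge> 0" "64 / a > 0"
      using Lam C1 \<gamma> k C0 by (auto intro!: divide_pos_pos add_nonneg_pos)
    show "M > 0" using p unfolding M_def by linarith
    have "M * \<gamma> \<ge> (Lam * C1 + 20) / \<gamma> * \<gamma>" unfolding M_def using p \<gamma> by (intro mult_right_mono; linarith)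
    then show "M * \<gamma> > Lam * C1 + 18" using \<gamma> by simp
    have "M * a \<ge> (C0 / a) * a" unfolding M_def using p k by (intro mult_right_mono; linarith)
    then show "M * a \<ge> C0" using k by simp
    have "M * a \<ge> (64 / a) * a" unfolding M_def using p k by (intro mult_right_mono; linarith)
    then show "M * a \<ge> 64" using k by simp
  qed
  show thesis
  proof (rule that[of "M * A"])
    show "0 < M * A" using M k by simp
    fix \<mu> :: "(real ^ 'n) measure" and \<Omega> u f \<delta>
    assume mu: "spectral_measure s lam Lam \<mu>" and sol: "core_solution s \<mu> (\<Omega> \<inter> ball 0 1) u f"
      and bd: "boundary_decay s C0 \<Omega> u" and \<delta>: "0 < (\<delta>::real)"
    note mu' = spectral_measureD[OF mu Lam(2)]
    interpret finite_measure \<mu> by (rule mu')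
    have bu: "bounded_fun u" by (rule bounded_fun_core[OF sol])
    interpret bounded_fun u by (rule bu)
    obtain \<phi> where \<phi>c: "continuous_on UNIV \<phi>" and \<phi>: "\<And>z. a * norm z powr s \<le> \<phi> z" "\<And>z. \<phi> z \<le> A * norm z powr s"
      and \<phi>S: "\<And>z. z \<noteq> 0 \<Longrightarrow> (\<exists>S\<in>sets \<mu>. m \<le> measure \<mu> S \<and> (\<forall>v t. v \<in> S \<longrightarrow> \<bar>t\<bar> \<le> \<eta> * norm z \<longrightarrow>
          \<phi> (z + t *\<^sub>R v) + \<phi> (z - t *\<^sub>R v) - 2 * \<phi> z \<le> - c * norm z powr (s - 2) * t\<^sup>2))"
      using coupling[OF mu] by blast
    obtain e1 where e1: "0 < e1" "\<And>e. 0 < e \<Longrightarrow> e < e1 \<Longrightarrow> (2 * C0) * (2 * e) powr s \<le> \<delta>"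
      by (rule small_powr[OF s(1) \<delta>, of "2 * C0"]) blast
    show "\<exists>e0>0. \<forall>e t x y. 0 < e \<longrightarrow> e < e0 \<longrightarrow> -3/4 < t \<longrightarrow> t < - (2 * e) \<longrightarrow> norm x < 5/8 \<longrightarrow>
        moll e u (t, x) - moll e u (t, y) \<le> M * A * norm (x - y) powr s + \<delta>"
    proof (intro exI[of _ "min e1 (1/100)"] conjI allI impI)
      fix e t1 :: real and x1 y1 :: "real ^ 'n" assume e: "0 < e" "e < min e1 (1/100)" and t1: "-3/4 < t1" "t1 < - (2 * e)" and x1: "norm x1 < 5/8"
      define U where "U = moll e u"
      have Uc: "continuous_on S U" for S unfolding U_def by (rule moll_continuous[OF e(1)])
      have U1: "\<bar>U z\<bar> \<le> 1" for z unfolding U_def by (rule moll_le_1[OF e(1)])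
      have Ub: "- 1 \<le> U z" "U z \<le> 1" for z using U1[of z] by auto
      \<comment> \<open>Each penalty reaches 2, the largest possible value of the difference, at
        distance 1/16 from \<open>x1\<close> or at time \<open>t1 - 1/16\<close>. For
        \<open>y\<close> no penalty appears: \<open>M * a \<ge> 64\<close> keeps it within 1/32 of
        \<open>x\<close>.\<close>
      define \<Phi> where "\<Phi> = (\<lambda>t x y. U (t, x) - U (t, y) - M * \<phi> (x - y) - 512 * (norm (x - x1))\<^sup>2 - 32 * (t1 - t) - \<delta>)"
      have "\<Phi> t1 x1 y1 \<le> 0"
      proof (rule ccontr)
        assume "\<not> \<Phi> t1 x1 y1 \<le> 0"
        then have pos1: "\<Phi> t1 x1 y1 > 0" by simp
        define t0 where "t0 = (-13/16 :: real)"
        have le2: "\<Phi> t x y \<le> 2 - M * \<phi> (x - y) - 512 * (norm (x - x1))\<^sup>2 - 32 * (t1 - t) - \<delta>" for t x y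
          unfolding \<Phi>_def using U1[of "(t, x)"] U1[of "(t, y)"] by linarith
        have \<phi>0: "0 \<le> M * \<phi> z" for z
          using M k \<phi>(1)[of z] by (meson less_imp_le mult_nonneg_nonneg order_trans powr_ge_zero)
        have near: "norm (x - x1) < 1/16" "norm (x - y) < 1/32" "t0 < t" if p: "0 < \<Phi> t x y" "t \<le> t1" for t x y
        proof -
          have h: "0 < 2 - M * \<phi> (x - y) - 512 * (norm (x - x1))\<^sup>2 - 32 * (t1 - t)"
            using p(1) le2[of t x y] \<delta> by linarith
          show "norm (x - x1) < 1/16"
          proof (rule ccontr)
            assume "\<not> norm (x - x1) < 1/16"
            then have "(1/16)\<^sup>2 \<le> (norm (x - x1))\<^sup>2" by (intro power_mono) auto
            then show False using h \<phi>0[of "x - y"] p(2) by (simp add: power2_eq_square)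
          qed
          show "norm (x - y) < 1/32"
          proof (rule ccontr)
            assume "\<not> norm (x - y) < 1/32"
            then have "(1/32) powr s \<le> norm (x - y) powr s" using s by (intro powr_mono2) auto
            moreover have "1/32 \<le> (1/32::real) powr s" using powr_mono'[of s 1 "1/32::real"] s by simp
            ultimately have "1/32 \<le> norm (x - y) powr s" by linarith
            then have "64 * (1/32) \<le> (M * a) * norm (x - y) powr s" using M by (intro mult_mono) auto
            also have "\<dots> \<le> M * \<phi> (x - y)" using \<phi>(1)[of "x - y"] M(1) by (simp add: mult.assoc)
            finally have "2 \<le> M * \<phi> (x - y)" by simp
            moreover have "0 \<le> 512 * (norm (x - x1))\<^sup>2" "0 \<le> 32 * (t1 - t)" using p(2) by simp_all
            ultimately show False using h by linarith
          qed
          have "0 \<le> 512 * (norm (x - x1))\<^sup>2" by simp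
          then have "32 * (t1 - t) < 2" using h \<phi>0[of "x - y"] by linarith
          then show "t0 < t" using t1 by (simp add: t0_def)
        qed
        define K where "K = {t0..t1} \<times> cball x1 (1/16) \<times> cball x1 1"
        have cK: "compact K" unfolding K_def by (intro compact_Times compact_cball compact_Icc)
        have in1: "(t1, x1, y1) \<in> K"
          using near[OF pos1] by (auto simp: K_def dist_norm norm_minus_commute t0_def)
        have "continuous_on K (\<lambda>p. \<Phi> (fst p) (fst (snd p)) (snd (snd p)))"
          unfolding \<Phi>_def by (intro continuous_intros continuous_on_compose2[OF Uc[of UNIV]] continuous_on_compose2[OF \<phi>c]) auto
        then obtain P where P: "P \<in> K" "\<And>q. q \<in> K \<Longrightarrow> \<Phi> (fst q) (fst (snd q)) (snd (snd q)) \<le> \<Phi> (fst P) (fst (snd P)) (snd (snd P))"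
          using continuous_attains_sup[OF cK, of "\<lambda>p. \<Phi> (fst p) (fst (snd p)) (snd (snd p))"] in1 by blast
        obtain t x y where Peq: "P = (t, x, y)" by (cases P) auto
        have tt1: "t \<le> t1" using P(1) by (simp add: K_def Peq)
        have pos: "0 < \<Phi> t x y" using P(2)[OF in1] pos1 by (simp add: Peq)
        note nr = near[OF pos tt1]
        \<comment> \<open>Positive values of \<open>\<Phi>\<close> occur only in \<open>K\<close>,
          so the maximum over \<open>K\<close> is one over all pairs of points, and jumps of any
          length can be tested.\<close>
        have glob: "\<Phi> \<tau> x' y' \<le> \<Phi> t x y" if "t0 \<le> \<tau>" "\<tau> \<le> t1" for \<tau> x' y'
        proof (cases "0 < \<Phi> \<tau> x' y'")
          case True
          note n = near[OF True that(2)]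
          have "norm (y' - x1) \<le> norm (x' - y') + norm (x' - x1)"
            using norm_triangle_ineq4[of "x' - x1" "x' - y'"] by (simp add: algebra_simps)
          then have "(\<tau>, x', y') \<in> K" using n that by (auto simp: K_def dist_norm norm_minus_commute)
          from P(2)[OF this] show ?thesis by (simp add: Peq)
        qed (use pos in auto)
        define z where "z = x - y"
        have nx: "norm x < 11/16" using nr(1) x1 norm_triangle_ineq2[of x x1] by linarith
        have ny: "norm y < 23/32" using nr(2) nx norm_triangle_ineq2[of y x] by (simp add: norm_minus_commute)
        have z0: "z \<noteq> 0"
        proof
          assume "z = 0"
          then have "\<Phi> t x y = - M * \<phi> 0 - 512 * (norm (x - x1))\<^sup>2 - 32 * (t1 - t) - \<delta>" by (simp add: \<Phi>_def z_def)
          moreover have "0 \<le> 512 * (norm (x - x1))\<^sup>2" "0 \<le> 32 * (t1 - t)" using tt1 by simp_all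
          ultimately show False using pos \<phi>0[of 0] \<delta> by linarith
        qed
        have nz: "0 < norm z" "norm z < 1/32" using z0 nr(2) by (auto simp: z_def)
        have tr: "-7/8 + e \<le> t" "t + e \<le> 0" "-1 < t - e" "t + e < 0"
          using nr(3) tt1 t1 e by (auto simp: t0_def)
        have decay: "\<bar>U (t, x')\<bar> \<le> C0 * (norm (x' - p) + e) powr s" if "norm x' < 23/32" "p \<notin> \<Omega>" for x' p
          unfolding U_def by (rule moll_boundary_decay[OF bu bd s(1) C0 e(1)]) (use that e tr in auto)
        \<comment> \<open>If one point is within \<open>e\<close> of some \<open>p\<close> in the
          complement, the other is within \<open>norm z + e\<close> of it. Boundary decay then
          controls both values, and \<open>\<Phi>\<close> cannot be positive; so the equation holds
          at both points.\<close>
        have two: "\<bar>U (t, x')\<bar> + \<bar>U (t, y')\<bar> \<le> M * \<phi> z + \<delta>"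
          if "p \<notin> \<Omega>" "norm (x' - p) \<le> e" "norm x' < 23/32" "norm y' < 23/32" "norm (y' - x') = norm z" for p x' y'
        proof -
          have "\<bar>U (t, x')\<bar> \<le> C0 * (2 * e) powr s"
            by (rule order_trans[OF decay[OF that(3,1)]], intro mult_left_mono powr_mono2 C0) (use that s e in auto)
          moreover have "\<bar>U (t, y')\<bar> \<le> C0 * (norm z + 2 * e) powr s"
          proof (rule order_trans[OF decay[OF that(4,1)]], intro mult_left_mono powr_mono2 C0)
            show "norm (y' - p) + e \<le> norm z + 2 * e"
              using norm_triangle_ineq[of "y' - x'" "x' - p"] that by simp
          qed (use s e in auto)
          moreover have "C0 * (norm z + 2 * e) powr s \<le> C0 * (norm z powr s + (2 * e) powr s)"
            using C0 s e by (intro mult_left_mono powr_add_le) auto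
          moreover have "C0 * norm z powr s \<le> M * \<phi> z"
          proof -
            have "C0 * norm z powr s \<le> (M * a) * norm z powr s" using M by (intro mult_right_mono) auto
            also have "\<dots> \<le> M * \<phi> z" using \<phi>(1)[of z] M(1) by (simp add: mult.assoc)
            finally show ?thesis .
          qed
          moreover have "2 * C0 * (2 * e) powr s \<le> \<delta>" using e1(2) e by simp
          ultimately show ?thesis by (simp add: distrib_left)
        qed
        have \<Phi>le: "\<Phi> t x y \<le> \<bar>U (t, x)\<bar> + \<bar>U (t, y)\<bar> - M * \<phi> z - \<delta>"
        proof -
          have "0 \<le> 512 * (norm (x - x1))\<^sup>2" "0 \<le> 32 * (t1 - t)" using tt1 by simp_all
          then show ?thesis unfolding \<Phi>_def z_def by linarith
        qed
        have in\<Omega>: "cball x e \<subseteq> \<Omega>" "cball y e \<subseteq> \<Omega>"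
        proof -
          show "cball x e \<subseteq> \<Omega>"
          proof
            fix p assume "p \<in> cball x e"
            show "p \<in> \<Omega>"
            proof (rule ccontr)
              assume "p \<notin> \<Omega>"
              from two[OF this, of x y] show False
                using \<open>p \<in> cball x e\<close> nx ny pos \<Phi>le by (simp add: dist_norm z_def norm_minus_commute)
            qed
          qed
          show "cball y e \<subseteq> \<Omega>"
          proof
            fix p assume "p \<in> cball y e"
            show "p \<in> \<Omega>"
            proof (rule ccontr)
              assume "p \<notin> \<Omega>"
              from two[OF this, of y x] show False
                using \<open>p \<in> cball y e\<close> nx ny pos \<Phi>le by (simp add: dist_norm z_def)
            qed
          qed
        qed
        have b1: "cball x e \<subseteq> ball 0 1" "cball y e \<subseteq> ball 0 1"
        proof -
          have h: "p \<in> ball 0 1" if "norm x' < 23/32" "p \<in> cball x' e" for x' p :: "real ^ 'n"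
            using that e norm_triangle_ineq2[of p x'] by (simp add: dist_norm norm_minus_commute)
          have nx': "norm x < 23/32" using nx by simp
          show "cball x e \<subseteq> ball 0 1" by (intro subsetI h[OF nx'])
          show "cball y e \<subseteq> ball 0 1" by (intro subsetI h[OF ny])
        qed
        obtain hx where hx: "\<bar>hx\<bar> \<le> 1" "((\<lambda>\<tau>. U (\<tau>, x)) has_real_derivative (stable_at s \<mu> (\<lambda>y. U (t, y)) x + hx)) (at t)"
          using moll_equation[OF s mu Lam(2) sol e(1) cball_Pair_subset[OF tr(3,4)], of x] in\<Omega> b1 unfolding U_def by blast
        obtain hy where hy: "\<bar>hy\<bar> \<le> 1" "((\<lambda>\<tau>. U (\<tau>, y)) has_real_derivative (stable_at s \<mu> (\<lambda>y. U (t, y)) y + hy)) (at t)"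
          using moll_equation[OF s mu Lam(2) sol e(1) cball_Pair_subset[OF tr(3,4)], of y] in\<Omega> b1 unfolding U_def by blast
        have "((\<lambda>\<tau>. \<Phi> \<tau> x y) has_real_derivative ((stable_at s \<mu> (\<lambda>y. U (t, y)) x + hx) - (stable_at s \<mu> (\<lambda>y. U (t, y)) y + hy) + 32)) (at t)"
          unfolding \<Phi>_def by (rule derivative_eq_intros hx(2) hy(2) refl | simp)+
        then have "0 \<le> (stable_at s \<mu> (\<lambda>y. U (t, y)) x + hx) - (stable_at s \<mu> (\<lambda>y. U (t, y)) y + hy) + 32"
          by (rule deriv_nonneg_at_max[OF _ nr(3)]) (use glob tt1 in auto)
        \<comment> \<open>The time penalty contributes 32, the two right-hand sides 1 each.\<close>
        then have low: "- 34 \<le> stable_at s \<mu> (\<lambda>y. U (t, y)) x - stable_at s \<mu> (\<lambda>y. U (t, y)) y"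
          using hx(1) hy(1) by linarith
        obtain B where B: "\<And>t. bdd_second_diff B (\<lambda>x. U (t, x))"
          unfolding U_def by (rule moll_slice_bdd_second_diff[OF bu e(1)]) blast
        define V where "V = (\<lambda>\<xi>. U (t, x + \<xi>) - U (t, y + \<xi>))"
        have V: "bdd_second_diff (2 * B) V" unfolding V_def by (rule bdd_second_diff_diff[OF B])
        have LV: "stable_at s \<mu> V 0 = stable_at s \<mu> (\<lambda>y. U (t, y)) x - stable_at s \<mu> (\<lambda>y. U (t, y)) y"
          unfolding V_def by (rule stable_at_diff[OF s mu Lam(2) B])
        obtain S where S: "S \<in> sets \<mu>" "m \<le> measure \<mu> S" "\<And>v t. v \<in> S \<Longrightarrow> \<bar>t\<bar> \<le> \<eta> * norm z \<Longrightarrow>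
          \<phi> (z + t *\<^sub>R v) + \<phi> (z - t *\<^sub>R v) - 2 * \<phi> z \<le> - c * norm z powr (s - 2) * t\<^sup>2"
          using \<phi>S[OF z0] by blast
        define \<rho> where "\<rho> = \<eta> * norm z / 2"
        have \<rho>: "0 < \<rho>" "\<rho> < 1"
        proof -
          show "0 < \<rho>" using k nz by (simp add: \<rho>_def)
          have "\<eta> * norm z \<le> 1 * norm z" using k by (intro mult_right_mono) auto
          then show "\<rho> < 1" using nz unfolding \<rho>_def by linarith
        qed
        define G where "G = 4 * M * c * norm z powr (s - 2)"
        have G: "0 \<le> G" using M k by (simp add: G_def)
        define B1 where "B1 = (\<lambda>\<theta> r. 1024 * (indicator {0<..<1} r * r\<^sup>2) + 8 * indicator {1..} r + (- G * indicator S \<theta>) * (indicator {0<..<\<rho>} r * r\<^sup>2) :: real)"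
        define \<beta> where "\<beta> = (\<lambda>\<theta>. C1 + (- G * indicator S \<theta>) * (\<rho> powr (2 - 2 * s) / (2 - 2 * s)))"
        have fi: "frac_integral s (B1 \<theta>) (\<beta> \<theta>)" for \<theta>
        proof -
          have "frac_integral s (\<lambda>r. 1024 * (indicator {0<..<1} r * r\<^sup>2)) (1024 * (1 powr (2 - 2 * s) / (2 - 2 * s)))"
            by (intro frac_integral_cmult frac_integral_inner_square s) simp
          moreover have "frac_integral s (\<lambda>r. 8 * indicator {1..} r) (8 * (1 powr (- 2 * s) / (2 * s)))"
            by (intro frac_integral_cmult frac_integral_outer_const s) simp
          moreover have "frac_integral s (\<lambda>r. (- G * indicator S \<theta>) * (indicator {0<..<\<rho>} r * r\<^sup>2)) ((- G * indicator S \<theta>) * (\<rho> powr (2 - 2 * s) / (2 - 2 * s)))"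
            by (intro frac_integral_cmult frac_integral_inner_square s \<rho>)
          ultimately have "frac_integral s (B1 \<theta>) (1024 * (1 powr (2 - 2 * s) / (2 - 2 * s)) + 8 * (1 powr (- 2 * s) / (2 * s)) + (- G * indicator S \<theta>) * (\<rho> powr (2 - 2 * s) / (2 - 2 * s)))"
            unfolding B1_def by (intro frac_integral_add)
          then show ?thesis by (simp only: \<beta>_def C1_def powr_one_eq_one)
        qed
        have bound: "V (0 + r *\<^sub>R \<theta>) + V (0 - r *\<^sub>R \<theta>) - 2 * V 0 \<le> B1 \<theta> r" if th: "\<theta> \<in> sphere 0 1" and r: "0 < r" for \<theta> r
        proof -
          have Veq: "V (0 + r *\<^sub>R \<theta>) + V (0 - r *\<^sub>R \<theta>) - 2 * V 0 =
            U (t, x + r *\<^sub>R \<theta>) - U (t, y + r *\<^sub>R \<theta>) + (U (t, x - r *\<^sub>R \<theta>) - U (t, y - r *\<^sub>R \<theta>)) - (2 * U (t, x) - 2 * U (t, y))"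
            by (simp add: V_def)
          have par: "(norm (x + r *\<^sub>R \<theta> - x1))\<^sup>2 + (norm (x - r *\<^sub>R \<theta> - x1))\<^sup>2 = 2 * (norm (x - x1))\<^sup>2 + 2 * r\<^sup>2"
          proof -
            have "(norm (x - x1 + r *\<^sub>R \<theta>))\<^sup>2 + (norm (x - x1 - r *\<^sub>R \<theta>))\<^sup>2 = 2 * (norm (x - x1))\<^sup>2 + 2 * (norm (r *\<^sub>R \<theta>))\<^sup>2"
              by (rule norm_parallelogram)
            then show ?thesis using th by (simp add: algebra_simps)
          qed
          have t0t: "t0 \<le> t" using nr(3) by simp
          consider "1 \<le> r" | "r < 1" "\<theta> \<in> S" "r < \<rho>" | "r < 1" "\<theta> \<notin> S \<or> \<rho> \<le> r" by linarith
          then show ?thesis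
          proof cases
            case 1
            have "V (0 + r *\<^sub>R \<theta>) + V (0 - r *\<^sub>R \<theta>) - 2 * V 0 \<le> 8"
              unfolding Veq using Ub(2)[of "(t, x + r *\<^sub>R \<theta>)"] Ub(1)[of "(t, y + r *\<^sub>R \<theta>)"] Ub(2)[of "(t, x - r *\<^sub>R \<theta>)"]
                Ub(1)[of "(t, y - r *\<^sub>R \<theta>)"] Ub(1)[of "(t, x)"] Ub(2)[of "(t, y)"] by linarith
            also have "8 = B1 \<theta> r" using 1 \<rho> by (simp add: B1_def)
            finally show ?thesis .
          next
            case 2
            \<comment> \<open>The second difference of \<open>V\<close> contains the values of
              \<open>U\<close> at all four displaced points, so the forward jump of \<open>x\<close>
              may be paired with the backward jump of \<open>y\<close> without changing the
              sum.\<close>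
            have z': "x + r *\<^sub>R \<theta> - (y - r *\<^sub>R \<theta>) = z + (2 * r) *\<^sub>R \<theta>" "x - r *\<^sub>R \<theta> - (y + r *\<^sub>R \<theta>) = z - (2 * r) *\<^sub>R \<theta>"
              by (simp_all add: z_def scaleR_2 algebra_simps scaleR_add_left[symmetric] mult_2)
            have "\<phi> (z + (2 * r) *\<^sub>R \<theta>) + \<phi> (z - (2 * r) *\<^sub>R \<theta>) - 2 * \<phi> z \<le> - c * norm z powr (s - 2) * (2 * r)\<^sup>2"
              by (rule S(3)) (use 2 r in \<open>auto simp: \<rho>_def\<close>)
            then have "M * (\<phi> (z + (2 * r) *\<^sub>R \<theta>) + \<phi> (z - (2 * r) *\<^sub>R \<theta>) - 2 * \<phi> z) \<le> M * (- c * norm z powr (s - 2) * (2 * r)\<^sup>2)"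
              using M(1) by (intro mult_left_mono) auto
            also have "\<dots> = - G * r\<^sup>2" by (simp add: G_def power_mult_distrib)
            finally have "M * \<phi> (z + (2 * r) *\<^sub>R \<theta>) + M * \<phi> (z - (2 * r) *\<^sub>R \<theta>) - 2 * (M * \<phi> z) \<le> - G * r\<^sup>2"
              by (simp add: distrib_left right_diff_distrib mult.left_commute)
            moreover have "\<Phi> t (x + r *\<^sub>R \<theta>) (y - r *\<^sub>R \<theta>) \<le> \<Phi> t x y" "\<Phi> t (x - r *\<^sub>R \<theta>) (y + r *\<^sub>R \<theta>) \<le> \<Phi> t x y"
              by (rule glob[OF t0t tt1])+
            ultimately have "V (0 + r *\<^sub>R \<theta>) + V (0 - r *\<^sub>R \<theta>) - 2 * V 0 \<le> 1024 * r\<^sup>2 - G * r\<^sup>2"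
              unfolding Veq \<Phi>_def z' z_def[symmetric] using par by linarith
            also have "\<dots> = B1 \<theta> r" using 2 r by (simp add: B1_def)
            finally show ?thesis .
          next
            case 3
            have z': "x + r *\<^sub>R \<theta> - (y + r *\<^sub>R \<theta>) = z" "x - r *\<^sub>R \<theta> - (y - r *\<^sub>R \<theta>) = z" by (simp_all add: z_def)
            have "\<Phi> t (x + r *\<^sub>R \<theta>) (y + r *\<^sub>R \<theta>) \<le> \<Phi> t x y" "\<Phi> t (x - r *\<^sub>R \<theta>) (y - r *\<^sub>R \<theta>) \<le> \<Phi> t x y"
              by (rule glob[OF t0t tt1])+
            then have "V (0 + r *\<^sub>R \<theta>) + V (0 - r *\<^sub>R \<theta>) - 2 * V 0 \<le> 1024 * r\<^sup>2"
              unfolding Veq \<Phi>_def z' z_def[symmetric] using par by linarith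
            also have "\<dots> = B1 \<theta> r" using 3 r by (auto simp: B1_def)
            finally show ?thesis .
          qed
        qed
        have i\<beta>: "integrable \<mu> \<beta>"
          unfolding \<beta>_def using S(1) by (intro Bochner_Integration.integrable_add integrable_const integrable_mult_left integrable_mult_right integrable_real_indicator)
            (auto simp: less_top[symmetric])
        have "- 34 \<le> 2 * integral\<^sup>L \<mu> \<beta>"
          using stable_at_integrable(3)[OF s mu Lam(2) V, of 0 B1 \<beta>] bound fi i\<beta> low LV by fastforce
        moreover have "integral\<^sup>L \<mu> \<beta> = C1 * measure \<mu> (space \<mu>) - G * measure \<mu> S * (\<rho> powr (2 - 2 * s) / (2 - 2 * s))"
        proof -
          have iS: "integrable \<mu> (indicator S :: _ \<Rightarrow> real)"
            using S(1) by (intro integrable_real_indicator) (auto simp: less_top[symmetric])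
          have "S \<inter> space \<mu> = S" using S(1) sets.sets_into_space by blast
          then show ?thesis unfolding \<beta>_def using iS by (simp add: mult.commute)
        qed
        moreover have "C1 * measure \<mu> (space \<mu>) \<le> C1 * Lam" using mu'(3) C1 by (intro mult_left_mono)
        moreover have "M * \<gamma> \<le> G * measure \<mu> S * (\<rho> powr (2 - 2 * s) / (2 - 2 * s))"
        proof -
          have "\<rho> = (\<eta> / 2) * norm z" by (simp add: \<rho>_def)
          then have \<rho>p: "\<rho> powr (2 - 2 * s) = (\<eta> / 2) powr (2 - 2 * s) * norm z powr (2 - 2 * s)"
            using powr_mult[of "\<eta> / 2" "norm z" "2 - 2 * s"] by (simp only:)
          \<comment> \<open>The gain scales like \<open>norm z powr (- s)\<close>, which is at least
            1 for nearby points; this makes the contradiction uniform in \<open>z\<close>.\<close>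
          have "1 \<le> norm z powr (- s)"
            using powr_mono'[of "- s" 0 "norm z"] nz s by simp
          also have "norm z powr (- s) = norm z powr (s - 2) * norm z powr (2 - 2 * s)"
            by (simp add: powr_add[symmetric])
          finally have one: "1 \<le> norm z powr (s - 2) * norm z powr (2 - 2 * s)" .
          have "M * \<gamma> \<le> (4 * M * c * ((\<eta> / 2) powr (2 - 2 * s) / (2 - 2 * s)) * measure \<mu> S) * 1"
            unfolding \<gamma>_def using M(1) k s S(2) by (simp add: mult_ac) (intro mult_left_mono divide_right_mono; simp)
          also have "\<dots> \<le> (4 * M * c * ((\<eta> / 2) powr (2 - 2 * s) / (2 - 2 * s)) * measure \<mu> S) * (norm z powr (s - 2) * norm z powr (2 - 2 * s))"
            using M(1) k s one by (intro mult_left_mono) auto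
          also have "\<dots> = G * measure \<mu> S * (\<rho> powr (2 - 2 * s) / (2 - 2 * s))"
            unfolding G_def \<rho>p by (simp add: mult_ac)
          finally show ?thesis .
        qed
        ultimately show False using M(2) by (simp add: mult.commute)
      qed
      then have "moll e u (t1, x1) - moll e u (t1, y1) \<le> M * \<phi> (x1 - y1) + \<delta>"
        by (simp add: \<Phi>_def U_def)
      also have "M * \<phi> (x1 - y1) \<le> M * A * norm (x1 - y1) powr s"
        using \<phi>(2)[of "x1 - y1"] M(1) by (simp add: mult.assoc)
      finally show "moll e u (t1, x1) - moll e u (t1, y1) \<le> M * A * norm (x1 - y1) powr s + \<delta>" by simp
    qed (use e1(1) in auto)
  qed
qed

subsection \<open>Regularity in time\<close>

text \<open>Short steps profit from the regularisation, long ones see only the pure power. For the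
  first bound the concave term is dropped; for the second the tangent is taken at
  \<open>P + Y\<close>, where the linear terms \<open>c\<close> of the two points cancel.\<close>

lemma regularized_power_second_diff:
  fixes x y x0 :: "'a::real_inner"
  assumes s: "0 < s" "s < 1" and \<rho>: "0 < \<rho>"
  defines "\<omega> \<equiv> \<lambda>x. ((norm (x - x0))\<^sup>2 + \<rho>\<^sup>2) powr (s / 2)"
  shows "\<omega> (x + y) + \<omega> (x - y) - 2 * \<omega> x \<le> s * \<rho> powr (s - 2) * (norm y)\<^sup>2"
    "\<omega> (x + y) + \<omega> (x - y) - 2 * \<omega> x \<le> 2 * norm y powr s"
    "norm (x - x0) powr s \<le> \<omega> x" "\<omega> x0 = \<rho> powr s"
proof -
  define q where "q = s / 2"
  have q: "0 < q" "q < 1" "2 * q = s" using s by (auto simp: q_def)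
  define P where "P = (norm (x - x0))\<^sup>2 + \<rho>\<^sup>2"
  define Y where "Y = (norm y)\<^sup>2"
  define c where "c = 2 * ((x - x0) \<bullet> y)"
  have P: "0 < P" "\<rho>\<^sup>2 \<le> P" using \<rho> by (auto simp: P_def add_nonneg_pos)
  have Y: "0 \<le> Y" by (simp add: Y_def)
  have sq: "(norm (a + b))\<^sup>2 = (norm a)\<^sup>2 + (norm b)\<^sup>2 + 2 * (a \<bullet> b)" for a b :: 'a
    by (simp add: power2_norm_eq_inner inner_add_left inner_add_right inner_commute[of b a])
  have e1: "(norm (x + y - x0))\<^sup>2 + \<rho>\<^sup>2 = P + Y + c"
    using sq[of "x - x0" y] by (simp add: P_def Y_def c_def algebra_simps)
  have e2: "(norm (x - y - x0))\<^sup>2 + \<rho>\<^sup>2 = P + Y - c"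
    using sq[of "x - x0" "- y"] by (simp add: P_def Y_def c_def algebra_simps)
  have c: "\<bar>c\<bar> \<le> P + Y"
  proof -
    have "0 \<le> P + Y + c" "0 \<le> P + Y - c" by (simp_all add: e1[symmetric] e2[symmetric])
    then show ?thesis by linarith
  qed
  have \<omega>: "\<omega> (x + y) + \<omega> (x - y) = (P + Y + c) powr q + (P + Y - c) powr q" "\<omega> x = P powr q"
    unfolding \<omega>_def e1 e2 by (simp_all add: P_def q_def)
  have "(P + Y + c) powr q + (P + Y - c) powr q \<le> 2 * P powr q + 2 * q * P powr (q - 1) * Y - q * (1 - q) * c\<^sup>2 * (P + Y) powr (q - 2)"
    by (rule powr_second_difference_le) (use q P Y c in auto)
  moreover have "0 \<le> q * (1 - q) * c\<^sup>2 * (P + Y) powr (q - 2)" using q by auto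
  moreover have "2 * q * P powr (q - 1) * Y \<le> s * \<rho> powr (s - 2) * Y"
  proof -
    have "P powr (q - 1) \<le> (\<rho>\<^sup>2) powr (q - 1)" using P \<rho> q by (intro powr_mono2') auto
    also have "\<dots> = \<rho> powr (s - 2)" using \<rho> q by (simp add: power2_powr right_diff_distrib)
    finally show ?thesis unfolding q(3) using s Y by (intro mult_right_mono mult_left_mono) auto
  qed
  ultimately show "\<omega> (x + y) + \<omega> (x - y) - 2 * \<omega> x \<le> s * \<rho> powr (s - 2) * (norm y)\<^sup>2"
    unfolding \<omega> Y_def by linarith
  have "(P + Y + c) powr q \<le> (P + Y) powr q + q * (P + Y) powr (q - 1) * c"
    by (rule powr_add_le_tangent) (use P Y c q in auto)
  moreover have "(P + Y - c) powr q \<le> (P + Y) powr q - q * (P + Y) powr (q - 1) * c"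
    using powr_add_le_tangent[of "P + Y" "- c" q] P Y c q by simp
  moreover have "(P + Y) powr q \<le> P powr q + Y powr q" by (rule powr_add_le) (use P Y q in auto)
  moreover have "Y powr q = norm y powr s"
    unfolding Y_def using power2_powr[of "norm y" q] q by (cases "y = 0") auto
  ultimately show "\<omega> (x + y) + \<omega> (x - y) - 2 * \<omega> x \<le> 2 * norm y powr s"
    unfolding \<omega> by linarith
  have "norm (x - x0) powr s = ((norm (x - x0))\<^sup>2) powr q"
    using power2_powr[of "norm (x - x0)" q] q by (cases "x = x0") auto
  also have "\<dots> \<le> P powr q" unfolding P_def using q by (intro powr_mono2) auto
  finally show "norm (x - x0) powr s \<le> \<omega> x" by (simp add: \<omega>)
  show "\<omega> x0 = \<rho> powr s" using power2_powr[OF \<rho>, of q] q by (simp add: \<omega>_def q_def)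
qed

text \<open>By \<open>space\<close> the barrier starts above the mollified function at time
  \<open>t0\<close>, and it rises with speed \<open>N\<close>. A touching point is thus later than
  \<open>t0\<close>; it lies where the equation holds, and there the second differences of the
  barrier are too small to sustain the speed.\<close>

lemma time_regularity:
  fixes s lam Lam C0 C2 :: real and \<mu> :: "'a::euclidean_space measure"
  assumes s: "0 < s" "s < 1" and Lam: "0 \<le> Lam" and C0: "0 \<le> C0" and C2: "16 \<le> C2"
    and mu: "spectral_measure s lam Lam \<mu>" and sol: "core_solution s \<mu> (\<Omega> \<inter> ball 0 1) u f"
    and bd: "boundary_decay s C0 \<Omega> u" and e: "0 < e" "e < 1/100" and \<delta>: "2 * C0 * (2 * e) powr s \<le> \<delta>"
    and t: "-1/2 < t0" "t0 < t1" "t1 < - (2 * e)" and x0: "norm x0 < 1/2"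
    and space: "\<And>x. moll e u (t0, x) \<le> moll e u (t0, x0) + C2 * norm (x - x0) powr s + \<delta>"
  shows "moll e u (t1, x0) \<le> moll e u (t0, x0) +
    (C2 + 2 * Lam * C2 * (s / (2 - 2 * s) + 2 / s) + 2) * (t1 - t0) powr (1/2) + 2 * \<delta>"
proof -
  note mu' = spectral_measureD[OF mu Lam]
  interpret finite_measure \<mu> by (rule mu')
  have bu: "bounded_fun u" by (rule bounded_fun_core[OF sol])
  interpret bounded_fun u by (rule bu)
  define U where "U = moll e u"
  have Uc: "continuous_on S U" for S unfolding U_def by (rule moll_continuous[OF e(1)])
  have Ub: "- 1 \<le> U z" "U z \<le> 1" for z using moll_le_1[OF e(1), of z] by (auto simp: U_def)
  define h where "h = t1 - t0"
  have h: "0 < h" "h \<le> 1" using t e by (auto simp: h_def)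
  \<comment> \<open>The parabolic scale of the time step:
    \<open>\<rho> powr (2 * s) = h\<close>.\<close>
  define \<rho> where "\<rho> = h powr (1 / (2 * s))"
  have \<rho>: "0 < \<rho>" using h by (simp add: \<rho>_def)
  have \<rho>s: "\<rho> powr s = h powr (1/2)" "\<rho> powr (- s) * h = h powr (1/2)"
  proof -
    show "\<rho> powr s = h powr (1/2)" using s by (simp add: \<rho>_def powr_powr)
    have "\<rho> powr (- s) = h powr (- 1/2)" using s by (simp add: \<rho>_def powr_powr)
    then have "\<rho> powr (- s) * h = h powr (- 1/2) * h powr 1" using h by simp
    also have "\<dots> = h powr (1/2)" unfolding powr_add[symmetric] by simp
    finally show "\<rho> powr (- s) * h = h powr (1/2)" .
  qed
  define \<omega> where "\<omega> = (\<lambda>x. ((norm (x - x0))\<^sup>2 + \<rho>\<^sup>2) powr (s / 2))"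
  have \<omega>: "\<omega> (x + y) + \<omega> (x - y) - 2 * \<omega> x \<le> s * \<rho> powr (s - 2) * (norm y)\<^sup>2"
    "\<omega> (x + y) + \<omega> (x - y) - 2 * \<omega> x \<le> 2 * norm y powr s"
    "norm (x - x0) powr s \<le> \<omega> x" "\<omega> x0 = \<rho> powr s" for x y
    unfolding \<omega>_def by (rule regularized_power_second_diff[OF s \<rho>])+
  define k where "k = Lam * (C2 * (s / (2 - 2 * s) + 2 / s))"
  \<comment> \<open>The first term bounds the operator on \<open>C2 * \<omega>\<close>. Of the added
    2, one unit pays for the right-hand side and one makes the inequality strict.\<close>
  define N where "N = 2 * k * \<rho> powr (- s) + 2"
  have k: "0 \<le> k" using Lam C2 s by (auto simp: k_def)
  have N: "0 < N" using k by (auto simp: N_def add_nonneg_pos)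
  have \<delta>0: "0 \<le> \<delta>" using \<delta> C0 by (meson mult_nonneg_nonneg order_trans powr_ge_zero zero_le_numeral)
  define \<Phi> where "\<Phi> = (\<lambda>t x. U (t, x) - U (t0, x0) - 2 * \<delta> - C2 * \<omega> x - N * (t - t0))"
  have "\<Phi> t1 x0 \<le> 0"
  proof (rule ccontr)
    assume "\<not> \<Phi> t1 x0 \<le> 0"
    then have pos1: "0 < \<Phi> t1 x0" by simp
    have Nt: "0 \<le> N * (t - t0)" if "t0 \<le> t" for t using N that by simp
    have C\<omega>: "C2 * norm (x - x0) powr s \<le> C2 * \<omega> x" for x using \<omega>(3)[of x] C2 by (intro mult_left_mono) auto
    have near: "norm (x - x0) < 1/8" if p: "0 < \<Phi> t x" "t0 \<le> t" for t x
    proof (rule ccontr)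
      assume "\<not> norm (x - x0) < 1/8"
      then have "(1/8) powr s \<le> norm (x - x0) powr s" using s by (intro powr_mono2) auto
      moreover have "1/8 \<le> (1/8::real) powr s" using powr_mono'[of s 1 "1/8::real"] s by simp
      ultimately have "1/8 \<le> norm (x - x0) powr s" by linarith
      \<comment> \<open>Here \<open>C2 \<ge> 16\<close> enters: from distance 1/8 on, the barrier
        exceeds 2, the oscillation of \<open>U\<close>.\<close>
      then have "16 * (1/8) \<le> C2 * norm (x - x0) powr s" using C2 by (intro mult_mono) auto
      then have "2 \<le> C2 * \<omega> x" using C\<omega>[of x] by simp
      then show False using p(1) Nt[OF p(2)] \<delta>0 Ub(2)[of "(t, x)"] Ub(1)[of "(t0, x0)"] unfolding \<Phi>_def by linarith
    qed
    define K where "K = {t0..t1} \<times> cball x0 (1/8)"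
    have cK: "compact K" unfolding K_def by (intro compact_Times compact_cball compact_Icc)
    have in1: "(t1, x0) \<in> K" using t by (simp add: K_def)
    have "continuous_on K (\<lambda>p. \<Phi> (fst p) (snd p))"
      unfolding \<Phi>_def \<omega>_def using s
      by (intro continuous_intros continuous_on_powr' continuous_on_compose2[OF Uc[of UNIV]]) auto
    then obtain p where P: "p \<in> K" "\<And>q. q \<in> K \<Longrightarrow> \<Phi> (fst q) (snd q) \<le> \<Phi> (fst p) (snd p)"
      using continuous_attains_sup[OF cK, of "\<lambda>p. \<Phi> (fst p) (snd p)"] in1 by blast
    obtain t x where Peq: "p = (t, x)" by (cases p)
    have tt: "t0 \<le> t" "t \<le> t1" using P(1) by (auto simp: K_def Peq)
    have pos: "0 < \<Phi> t x" using P(2)[OF in1] pos1 by (simp add: Peq)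
    have nx0: "norm (x - x0) < 1/8" by (rule near[OF pos tt(1)])
    have nx: "norm x < 5/8" using nx0 x0 norm_triangle_ineq2[of x x0] by linarith
    have glob: "\<Phi> \<tau> x' \<le> \<Phi> t x" if "t0 \<le> \<tau>" "\<tau> \<le> t1" for \<tau> x'
    proof (cases "0 < \<Phi> \<tau> x'")
      case True
      then have "(\<tau>, x') \<in> K" using near[OF True that(1)] that by (auto simp: K_def dist_norm norm_minus_commute)
      from P(2)[OF this] show ?thesis by (simp add: Peq)
    qed (use pos in auto)
    have sp: "U (t0, x) \<le> U (t0, x0) + C2 * norm (x - x0) powr s + \<delta>" unfolding U_def by (rule space)
    have t0t: "t0 < t"
    proof (rule ccontr)
      assume "\<not> t0 < t"
      then have "t = t0" using tt by simp
      then show False using pos sp C\<omega>[of x] \<delta>0 by (simp add: \<Phi>_def)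
    qed
    have in\<Omega>: "cball x e \<subseteq> \<Omega>"
    proof
      fix p assume p: "p \<in> cball x e"
      show "p \<in> \<Omega>"
      proof (rule ccontr)
        assume np: "p \<notin> \<Omega>"
        have b: "\<bar>U (\<tau>, x)\<bar> \<le> C0 * (2 * e) powr s" if "t0 \<le> \<tau>" "\<tau> \<le> t1" for \<tau>
        proof -
          have "\<bar>U (\<tau>, x)\<bar> \<le> C0 * (norm (x - p) + e) powr s"
            unfolding U_def by (rule moll_boundary_decay[OF bu bd s(1) C0 e(1)]) (use that e t nx np in auto)
          also have "\<dots> \<le> C0 * (2 * e) powr s"
            using p s e by (intro mult_left_mono powr_mono2 C0) (auto simp: dist_norm)
          finally show ?thesis .
        qed
        \<comment> \<open>Next to the complement the values at both times are small, so
          \<open>U (t, x)\<close> hardly exceeds \<open>U (t0, x)\<close>, which the initial datum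
          already dominates.\<close>
        have "U (t, x) \<le> C0 * (2 * e) powr s" "- U (t0, x) \<le> C0 * (2 * e) powr s"
          using b[of t] b[of t0] tt t by (auto simp: abs_le_iff)
        then have "U (t, x) \<le> U (t0, x) + \<delta>" using \<delta> by (simp add: mult.assoc)
        then show False using pos sp C\<omega>[of x] Nt[OF tt(1)] unfolding \<Phi>_def by linarith
      qed
    qed
    have b1: "cball x e \<subseteq> ball 0 1"
    proof
      fix p assume "p \<in> cball x e"
      then show "p \<in> ball 0 1" using nx e norm_triangle_ineq2[of p x] by (simp add: dist_norm norm_minus_commute)
    qed
    have tr: "-1 < t - e" "t + e < 0" using tt t e by auto
    obtain hx where hx: "\<bar>hx\<bar> \<le> 1" "((\<lambda>\<tau>. U (\<tau>, x)) has_real_derivative (stable_at s \<mu> (\<lambda>y. U (t, y)) x + hx)) (at t)"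
      using moll_equation[OF s mu Lam sol e(1) cball_Pair_subset[OF tr], of x] in\<Omega> b1 unfolding U_def by blast
    have "((\<lambda>\<tau>. \<Phi> \<tau> x) has_real_derivative (stable_at s \<mu> (\<lambda>y. U (t, y)) x + hx - N)) (at t)"
      unfolding \<Phi>_def by (rule derivative_eq_intros hx(2) refl | simp)+
    then have "0 \<le> stable_at s \<mu> (\<lambda>y. U (t, y)) x + hx - N"
      by (rule deriv_nonneg_at_max[OF _ t0t]) (use glob tt in auto)
    then have low: "N - 1 \<le> stable_at s \<mu> (\<lambda>y. U (t, y)) x" using hx(1) by linarith
    obtain B where B: "\<And>t. bdd_second_diff B (\<lambda>x. U (t, x))"
      unfolding U_def by (rule moll_slice_bdd_second_diff[OF bu e(1)]) blast
    define B1 where "B1 = (\<lambda>\<theta>::'a. \<lambda>r. (C2 * (s * \<rho> powr (s - 2))) * (indicator {0<..<\<rho>} r * r\<^sup>2) + (C2 * 2) * (indicator {\<rho>..} r * r powr s) :: real)"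
    define \<beta> where "\<beta> = C2 * (s / (2 - 2 * s) + 2 / s) * \<rho> powr (- s)"
    have fi: "frac_integral s (B1 \<theta>) \<beta>" for \<theta>
    proof -
      have "frac_integral s (B1 \<theta>) ((C2 * (s * \<rho> powr (s - 2))) * (\<rho> powr (2 - 2 * s) / (2 - 2 * s)) + (C2 * 2) * (\<rho> powr (s - 2 * s) / (2 * s - s)))"
        unfolding B1_def
        by (intro frac_integral_add frac_integral_cmult frac_integral_inner_square frac_integral_outer s \<rho>) (use s in auto)
      moreover have "(C2 * (s * \<rho> powr (s - 2))) * (\<rho> powr (2 - 2 * s) / (2 - 2 * s)) = C2 * (s / (2 - 2 * s)) * \<rho> powr (- s)"
      proof -
        have p: "\<rho> powr (s - 2) * \<rho> powr (2 - 2 * s) = \<rho> powr (- s)" by (simp add: powr_add[symmetric])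
        have "(C2 * (s * X)) * (Y / d) = C2 * (s / d) * (X * Y)" for X Y d by (simp add: mult_ac)
        from this[of "\<rho> powr (s - 2)" "\<rho> powr (2 - 2 * s)" "2 - 2 * s"] show ?thesis by (simp only: p)
      qed
      moreover have "(C2 * 2) * (\<rho> powr (s - 2 * s) / (2 * s - s)) = C2 * (2 / s) * \<rho> powr (- s)" by simp
      ultimately show ?thesis by (simp only: \<beta>_def distrib_left distrib_right)
    qed
    have bound: "U (t, x + r *\<^sub>R \<theta>) + U (t, x - r *\<^sub>R \<theta>) - 2 * U (t, x) \<le> B1 \<theta> r" if th: "\<theta> \<in> sphere 0 1" and r: "0 < r" for \<theta> r
    proof -
      have "\<Phi> t (x + r *\<^sub>R \<theta>) \<le> \<Phi> t x" "\<Phi> t (x - r *\<^sub>R \<theta>) \<le> \<Phi> t x" by (rule glob[OF tt])+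
      then have le: "U (t, x + r *\<^sub>R \<theta>) + U (t, x - r *\<^sub>R \<theta>) - 2 * U (t, x) \<le> C2 * (\<omega> (x + r *\<^sub>R \<theta>) + \<omega> (x - r *\<^sub>R \<theta>) - 2 * \<omega> x)"
        unfolding \<Phi>_def by (simp add: algebra_simps)
      show ?thesis
      proof (cases "r < \<rho>")
        case True
        have "C2 * (\<omega> (x + r *\<^sub>R \<theta>) + \<omega> (x - r *\<^sub>R \<theta>) - 2 * \<omega> x) \<le> C2 * (s * \<rho> powr (s - 2) * r\<^sup>2)"
          using \<omega>(1)[of x "r *\<^sub>R \<theta>"] th C2 by (intro mult_left_mono) auto
        then show ?thesis using le True r by (simp add: B1_def)
      next
        case False
        have "C2 * (\<omega> (x + r *\<^sub>R \<theta>) + \<omega> (x - r *\<^sub>R \<theta>) - 2 * \<omega> x) \<le> C2 * (2 * r powr s)"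
          using \<omega>(2)[of x "r *\<^sub>R \<theta>"] th C2 r by (intro mult_left_mono) auto
        then show ?thesis using le False r by (simp add: B1_def)
      qed
    qed
    have "stable_at s \<mu> (\<lambda>y. U (t, y)) x \<le> 2 * integral\<^sup>L \<mu> (\<lambda>_. \<beta>)"
      by (rule stable_at_integrable(3)[OF s mu Lam B, of t x B1]) (use bound fi in auto)
    also have "\<dots> = 2 * (\<beta> * measure \<mu> (space \<mu>))" by simp
    also have "\<dots> \<le> 2 * (\<beta> * Lam)"
      using mu'(3) C2 s by (intro mult_left_mono) (auto simp: \<beta>_def)
    also have "\<dots> = N - 2" by (simp add: N_def k_def \<beta>_def)
    finally show False using low by simp
  qed
  then have "U (t1, x0) \<le> U (t0, x0) + 2 * \<delta> + C2 * \<rho> powr s + N * h"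
    by (simp add: \<Phi>_def \<omega>(4) h_def)
  also have "N * h = 2 * k * (\<rho> powr (- s) * h) + 2 * h" by (simp add: N_def algebra_simps)
  also have "\<dots> \<le> 2 * k * h powr (1/2) + 2 * h powr (1/2)"
  proof -
    have "h \<le> h powr (1/2)" using powr_mono'[of "1/2" 1 h] h by simp
    then show ?thesis unfolding \<rho>s by simp
  qed
  finally show ?thesis unfolding \<rho>s U_def by (simp add: h_def k_def algebra_simps)
qed

text \<open>The set \<open>G\<close> consists of the points where a fixed sequence of mollified
  functions converges to \<open>u\<close>. The slack in the estimates has a threshold for
  \<open>e\<close> depending on the two points, so for each pair in \<open>G\<close> the limit gives
  the bound without slack.\<close>

lemma regularity_of_boundary_decay:
  fixes s lam Lam C0 :: real
  assumes s: "0 < s" "s < 1" and lam: "0 < lam" "lam \<le> Lam" and C0: "0 \<le> C0"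
  obtains C where "0 < C"
    "\<And>(\<mu> :: (real ^ 'n::finite) measure) \<Omega> u f. spectral_measure s lam Lam \<mu> \<Longrightarrow>
      core_solution s \<mu> (\<Omega> \<inter> ball 0 1) u f \<Longrightarrow> boundary_decay s C0 \<Omega> u \<Longrightarrow>
      \<exists>G. (AE w in lborel. w \<in> {-1/2<..<0} \<times> ball 0 (1/2) \<longrightarrow> w \<in> G) \<and>
        (\<forall>w\<in>G. \<forall>w'\<in>G. \<bar>u w - u w'\<bar> \<le> C * (\<bar>fst w - fst w'\<bar> powr (1/2) + norm (snd w - snd w') powr s))"
proof -
  have Lam: "0 \<le> Lam" using lam by auto
  obtain M where M: "0 < M"
    "\<And>(\<mu> :: (real ^ 'n::finite) measure) \<Omega> u f \<delta>. spectral_measure s lam Lam \<mu> \<Longrightarrow>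
      core_solution s \<mu> (\<Omega> \<inter> ball 0 1) u f \<Longrightarrow> boundary_decay s C0 \<Omega> u \<Longrightarrow> 0 < \<delta> \<Longrightarrow>
      \<exists>e0>0. \<forall>e t x y. 0 < e \<longrightarrow> e < e0 \<longrightarrow> -3/4 < t \<longrightarrow> t < - (2 * e) \<longrightarrow> norm x < 5/8 \<longrightarrow>
        moll e u (t, x) - moll e u (t, y) \<le> M * norm (x - y) powr s + \<delta>"
    by (rule space_regularity[OF s lam C0, where ?'n = 'n]) blast
  define C2 where "C2 = M + 16"
  have C2: "16 \<le> C2" "M \<le> C2" using M by (auto simp: C2_def)
  define N where "N = C2 + 2 * Lam * C2 * (s / (2 - 2 * s) + 2 / s) + 2"
  have N: "C2 \<le> N" using Lam C2 s by (auto simp: N_def)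
  show thesis
  proof (rule that[of N])
    show "0 < N" using N C2 by simp
    fix \<mu> :: "(real ^ 'n) measure" and \<Omega> u f
    assume mu: "spectral_measure s lam Lam \<mu>" and sol: "core_solution s \<mu> (\<Omega> \<inter> ball 0 1) u f"
      and bd: "boundary_decay s C0 \<Omega> u"
    have sol': "core_solution s \<mu> (\<Omega> \<inter> ball 0 1) (\<lambda>z. - u z) (\<lambda>z. - f z)" by (rule core_solution_minus[OF sol])
    have bd': "boundary_decay s C0 \<Omega> (\<lambda>z. - u z)" using bd by (simp add: boundary_decay_def)
    interpret bounded_fun u by (rule bounded_fun_core[OF sol])
    have est: "\<exists>e0>0. \<forall>e. 0 < e \<longrightarrow> e < e0 \<longrightarrow>
        \<bar>moll e u (t1, x1) - moll e u (t0, x0)\<bar> \<le> N * (\<bar>t1 - t0\<bar> powr (1/2) + norm (x1 - x0) powr s) + 3 * \<delta>"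
      if \<delta>: "0 < \<delta>" and t: "-1/2 < t0" "t0 \<le> t1" "t1 < 0" and x: "norm x0 < 1/2" "norm x1 < 1/2" for \<delta> t0 t1 x0 x1
    proof -
      obtain e1 where e1: "0 < e1" "\<And>e t x y. 0 < e \<Longrightarrow> e < e1 \<Longrightarrow> -3/4 < t \<Longrightarrow> t < - (2 * e) \<Longrightarrow> norm x < 5/8 \<Longrightarrow>
        moll e u (t, x) - moll e u (t, y) \<le> M * norm (x - y) powr s + \<delta>"
        using M(2)[OF mu sol bd \<delta>] by blast
      obtain e2 where e2: "0 < e2" "\<And>e t x y. 0 < e \<Longrightarrow> e < e2 \<Longrightarrow> -3/4 < t \<Longrightarrow> t < - (2 * e) \<Longrightarrow> norm x < 5/8 \<Longrightarrow>
        moll e (\<lambda>z. - u z) (t, x) - moll e (\<lambda>z. - u z) (t, y) \<le> M * norm (x - y) powr s + \<delta>"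
        using M(2)[OF mu sol' bd' \<delta>] by blast
      obtain e3 where e3: "0 < e3" "\<And>e. 0 < e \<Longrightarrow> e < e3 \<Longrightarrow> 2 * C0 * (2 * e) powr s \<le> \<delta>"
        by (rule small_powr[OF s(1) \<delta>, of "2 * C0"]) blast
      define e0 where "e0 = min (min e1 e2) (min e3 (min (1/100) (- t1 / 2)))"
      have e0: "0 < e0" using e1 e2 e3 t by (auto simp: e0_def)
      show ?thesis
      proof (intro exI[of _ e0] conjI allI impI e0)
        fix e assume e: "0 < e" "e < e0"
        then have ee: "e < e1" "e < e2" "e < e3" "e < 1/100" "t1 < - (2 * e)" by (auto simp: e0_def)
        define U where "U = moll e u"
        have MC: "M * norm z powr s \<le> C2 * norm z powr s" for z :: "real ^ 'n" using C2 by (intro mult_right_mono) auto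
        have sp: "\<bar>U (t, x) - U (t, y)\<bar> \<le> C2 * norm (x - y) powr s + \<delta>" if "-1/2 < t" "t \<le> t1" "norm x < 1/2" for t x y
          using e1(2)[OF e(1) ee(1), of t x y] e2(2)[OF e(1) ee(2), of t x y] that ee MC[of "x - y"]
          by (simp add: moll_minus U_def abs_le_iff)
        have tm: "\<bar>U (t1, x0) - U (t0, x0)\<bar> \<le> N * (t1 - t0) powr (1/2) + 2 * \<delta>"
        proof (cases "t0 = t1")
          case False
          then have tt: "t0 < t1" using t by simp
          have "U (t1, x0) \<le> U (t0, x0) + N * (t1 - t0) powr (1/2) + 2 * \<delta>"
            unfolding U_def N_def
          proof (rule time_regularity[OF s Lam C0 C2(1) mu sol bd e(1) ee(4) e3(2)[OF e(1) ee(3)] t(1) tt ee(5) x(1)])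
            show "moll e u (t0, y) \<le> moll e u (t0, x0) + C2 * norm (y - x0) powr s + \<delta>" for y
              using sp[of t0 x0 y] t x by (simp add: U_def abs_le_iff norm_minus_commute)
          qed
          moreover have "moll e (\<lambda>z. - u z) (t1, x0) \<le> moll e (\<lambda>z. - u z) (t0, x0) + N * (t1 - t0) powr (1/2) + 2 * \<delta>"
            unfolding N_def
          proof (rule time_regularity[OF s Lam C0 C2(1) mu sol' bd' e(1) ee(4) e3(2)[OF e(1) ee(3)] t(1) tt ee(5) x(1)])
            show "moll e (\<lambda>z. - u z) (t0, y) \<le> moll e (\<lambda>z. - u z) (t0, x0) + C2 * norm (y - x0) powr s + \<delta>" for y
              using sp[of t0 x0 y] t x by (simp add: U_def abs_le_iff norm_minus_commute moll_minus)
          qed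
          ultimately show ?thesis by (simp add: moll_minus U_def abs_le_iff)
        qed (use \<delta> in auto)
        have "\<bar>U (t1, x1) - U (t1, x0)\<bar> \<le> C2 * norm (x1 - x0) powr s + \<delta>" by (rule sp) (use t x in auto)
        also have "\<dots> \<le> N * norm (x1 - x0) powr s + \<delta>" using N by (intro add_mono mult_right_mono) auto
        finally have "\<bar>U (t1, x1) - U (t0, x0)\<bar> \<le> N * norm (x1 - x0) powr s + N * (t1 - t0) powr (1/2) + 3 * \<delta>"
          using tm by linarith
        then show "\<bar>moll e u (t1, x1) - moll e u (t0, x0)\<bar> \<le> N * (\<bar>t1 - t0\<bar> powr (1/2) + norm (x1 - x0) powr s) + 3 * \<delta>"
          using t by (simp add: U_def algebra_simps)
      qed
    qed
    obtain ek :: "nat \<Rightarrow> real" where ek: "\<And>k. 0 < ek k" "ek \<longlonglongrightarrow> 0"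
      "AE z in lborel. norm z < 2 \<longrightarrow> (\<lambda>k. moll (ek k) u z) \<longlonglongrightarrow> u z"
      by (rule moll_AE_limit[of 2]) blast
    define G where "G = {w \<in> {-1/2<..<0} \<times> ball 0 (1/2). (\<lambda>k. moll (ek k) u w) \<longlonglongrightarrow> u w}"
    have pair: "\<bar>u (t1, x1) - u (t0, x0)\<bar> \<le> N * (\<bar>t1 - t0\<bar> powr (1/2) + norm (x1 - x0) powr s)"
      if g: "(t1, x1) \<in> G" "(t0, x0) \<in> G" and le: "t0 \<le> t1" for t0 t1 x0 x1
    proof (rule field_le_epsilon)
      fix d :: real assume "0 < d"
      then obtain e0 where e0: "0 < e0" "\<And>e. 0 < e \<Longrightarrow> e < e0 \<Longrightarrow>
        \<bar>moll e u (t1, x1) - moll e u (t0, x0)\<bar> \<le> N * (\<bar>t1 - t0\<bar> powr (1/2) + norm (x1 - x0) powr s) + 3 * (d / 3)"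
        using est[of "d / 3" t0 t1 x0 x1] g le by (auto simp: G_def)
      have "\<forall>\<^sub>F k in sequentially. ek k < e0" using order_tendstoD(2)[OF ek(2) e0(1)] .
      then have ev: "\<forall>\<^sub>F k in sequentially. \<bar>moll (ek k) u (t1, x1) - moll (ek k) u (t0, x0)\<bar> \<le>
          N * (\<bar>t1 - t0\<bar> powr (1/2) + norm (x1 - x0) powr s) + d"
        by eventually_elim (use e0(2) ek(1) in auto)
      have "(\<lambda>k. \<bar>moll (ek k) u (t1, x1) - moll (ek k) u (t0, x0)\<bar>) \<longlonglongrightarrow> \<bar>u (t1, x1) - u (t0, x0)\<bar>"
        using g by (intro tendsto_intros) (auto simp: G_def)
      then show "\<bar>u (t1, x1) - u (t0, x0)\<bar> \<le> N * (\<bar>t1 - t0\<bar> powr (1/2) + norm (x1 - x0) powr s) + d"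
        by (rule tendsto_upperbound[OF _ ev]) simp
    qed
    show "\<exists>G. (AE w in lborel. w \<in> {-1/2<..<0} \<times> ball 0 (1/2) \<longrightarrow> w \<in> G) \<and>
        (\<forall>w\<in>G. \<forall>w'\<in>G. \<bar>u w - u w'\<bar> \<le> N * (\<bar>fst w - fst w'\<bar> powr (1/2) + norm (snd w - snd w') powr s))"
    proof (intro exI[of _ G] conjI ballI)
      show "AE w in lborel. w \<in> {-1/2<..<0} \<times> ball 0 (1/2) \<longrightarrow> w \<in> G"
        using ek(3)
      proof eventually_elim
        case (elim w)
        show ?case
        proof
          assume w: "w \<in> {-1/2<..<0} \<times> ball (0::real ^ 'n) (1/2)"
          then have "norm w < 2" using norm_Pair_le[of "fst w" "snd w"] by (auto simp: mem_Times_iff)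
          then show "w \<in> G" using elim w by (simp add: G_def)
        qed
      qed
      fix w w' assume w: "w \<in> G" "w' \<in> G"
      show "\<bar>u w - u w'\<bar> \<le> N * (\<bar>fst w - fst w'\<bar> powr (1/2) + norm (snd w - snd w') powr s)"
        using pair[of "fst w" "snd w" "fst w'" "snd w'"] pair[of "fst w'" "snd w'" "fst w" "snd w"] w
        by (cases "fst w' \<le> fst w") (simp_all add: abs_minus_commute norm_minus_commute)
    qed
  qed
qed

subsection \<open>Boundary charts\<close>

text \<open>Here \<open>g\<close> stands in for the signed distance to the boundary. The sign, the
  upper bound for the gradient and the Lipschitz bound hold on a ball larger than the cylinders used
  below, which leaves room for short jumps and for the mollification radius.\<close>

definition chart ::
    "'a::euclidean_space set \<Rightarrow> 'a \<Rightarrow> real \<Rightarrow> real \<Rightarrow> real \<Rightarrow> ('a \<Rightarrow> real) \<Rightarrow> ('a \<Rightarrow> 'a) \<Rightarrow> bool" where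
  "chart \<Omega> x0 \<rho> K G g dg \<longleftrightarrow> 0 < \<rho> \<and> \<rho> \<le> 1 \<and> ball x0 (2 * \<rho>) \<subseteq> ball 0 1 \<and> 1 \<le> K \<and> 1 \<le> G \<and>
     (\<forall>x y. \<bar>g (x + y) - g x - dg x \<bullet> y\<bar> \<le> K * (norm y)\<^sup>2) \<and> (\<forall>x. 1 \<le> norm (dg x)) \<and>
     (\<forall>x\<in>ball x0 (2 * \<rho>). (x \<in> \<Omega> \<longleftrightarrow> 0 < g x) \<and> norm (dg x) \<le> G \<and>
       (\<forall>y\<in>ball x0 (2 * \<rho>). \<bar>g x - g y\<bar> \<le> G * norm (x - y)))"

text \<open>The mean value inequality for \<open>\<gamma>\<close> minus its linear part at
  \<open>a\<close>, whose derivative is at most \<open>K * norm b\<close> on the ball of radius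
  \<open>norm b\<close>.\<close>

lemma lipschitz_gradient_taylor:
  fixes \<gamma> :: "'a::euclidean_space \<Rightarrow> real"
  assumes d: "\<And>y. (\<gamma> has_derivative (\<lambda>h. D y \<bullet> h)) (at y)" and L: "K-lipschitz_on UNIV D"
  shows "\<bar>\<gamma> (a + b) - \<gamma> a - D a \<bullet> b\<bar> \<le> K * (norm b)\<^sup>2"
proof -
  define f where "f = (\<lambda>y. \<gamma> y - D a \<bullet> y)"
  have "norm (f (a + b) - f a) \<le> (K * norm b) * norm (a + b - a)"
  proof (rule differentiable_bound[of "cball a (norm b)"])
    show "(f has_derivative (\<lambda>h. D y \<bullet> h - D a \<bullet> h)) (at y within cball a (norm b))" for y
      unfolding f_def by (auto intro!: derivative_eq_intros has_derivative_at_withinI[OF d])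
    show "onorm (\<lambda>h. D y \<bullet> h - D a \<bullet> h) \<le> K * norm b" if "y \<in> cball a (norm b)" for y
    proof (rule onorm_bound)
      have "norm (D y - D a) \<le> K * norm (y - a)"
        using lipschitz_onD[OF L, of y a] by (simp add: dist_norm)
      also have "\<dots> \<le> K * norm b"
        using that lipschitz_on_nonneg[OF L] by (intro mult_left_mono) (auto simp: dist_norm norm_minus_commute)
      finally have n: "norm (D y - D a) \<le> K * norm b" .
      show "norm (D y \<bullet> h - D a \<bullet> h) \<le> K * norm b * norm h" for h
        using Cauchy_Schwarz_ineq2[of "D y - D a" h] mult_right_mono[OF n, of "norm h"]
        by (simp add: inner_diff_left)
    qed (use lipschitz_on_nonneg[OF L] in auto)
  qed (auto simp: dist_norm)
  then show ?thesis by (simp add: f_def inner_add_right power2_eq_square algebra_simps)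
qed

text \<open>Take for \<open>g\<close> the vertical height above the graph. Since
  \<open>\<gamma>\<close> is composed with the projection \<open>\<pi>\<close>, the component of the
  gradient along \<open>e\<close> is 1, which gives the lower bound for its norm everywhere.\<close>

lemma C11_chart:
  fixes \<Omega> :: "'a::euclidean_space set"
  assumes \<Omega>: "C11_domain \<Omega>" and x0: "x0 \<in> frontier \<Omega>" "norm x0 < 1"
  obtains \<rho> K G g dg where "chart \<Omega> x0 \<rho> K G g dg"
proof -
  obtain r e \<gamma> where r: "0 < r" and e: "norm e = 1" and \<gamma>: "C11_function \<gamma>"
    and gr: "\<Omega> \<inter> ball x0 r = {x \<in> ball x0 r. x \<bullet> e > \<gamma> (x - (x \<bullet> e) *\<^sub>R e)}"
    using \<Omega> x0 unfolding C11_domain_def by blast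
  obtain D K0 where D: "\<And>y. (\<gamma> has_derivative (\<lambda>h. D y \<bullet> h)) (at y)" and L: "K0-lipschitz_on UNIV D"
    using \<gamma> unfolding C11_function_def by blast
  have K0: "0 \<le> K0" by (rule lipschitz_on_nonneg[OF L])
  define \<pi> where "\<pi> = (\<lambda>x. x - (x \<bullet> e) *\<^sub>R e)"
  have \<pi>_add: "\<pi> (x + y) = \<pi> x + \<pi> y" for x y by (simp add: \<pi>_def inner_add_left scaleR_add_left)
  have \<pi>_diff: "\<pi> (x - y) = \<pi> x - \<pi> y" for x y by (simp add: \<pi>_def inner_diff_left scaleR_diff_left)
  have \<pi>_norm: "norm (\<pi> x) \<le> 2 * norm x" for x
    unfolding \<pi>_def using norm_triangle_ineq4[of x "(x \<bullet> e) *\<^sub>R e"] Cauchy_Schwarz_ineq2[of x e] e by simp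
  have ee: "e \<bullet> e = 1" using e by (simp add: dot_square_norm)
  define g where "g = (\<lambda>x. x \<bullet> e - \<gamma> (\<pi> x))"
  define dg where "dg = (\<lambda>x. e - \<pi> (D (\<pi> x)))"
  have dgy: "dg x \<bullet> y = y \<bullet> e - D (\<pi> x) \<bullet> \<pi> y" for x y
    by (simp add: dg_def \<pi>_def inner_diff_left inner_diff_right inner_commute[of e] mult.commute)
  \<comment> \<open>The bound for \<open>\<pi>\<close> doubles norms, hence the 4 in the quadratic
    term; the added 1 secures \<open>1 \<le> K\<close>.\<close>
  define K where "K = 4 * K0 + 1"
  have taylor: "\<bar>g (x + y) - g x - dg x \<bullet> y\<bar> \<le> K * (norm y)\<^sup>2" for x y
  proof -
    have "\<bar>\<gamma> (\<pi> x + \<pi> y) - \<gamma> (\<pi> x) - D (\<pi> x) \<bullet> \<pi> y\<bar> \<le> K0 * (norm (\<pi> y))\<^sup>2"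
      by (rule lipschitz_gradient_taylor[OF D L])
    also have "\<dots> \<le> K0 * (2 * norm y)\<^sup>2" using K0 \<pi>_norm by (intro mult_left_mono power_mono) auto
    also have "\<dots> \<le> K * (norm y)\<^sup>2" using zero_le_power2[of "norm y"] by (simp add: K_def power_mult_distrib distrib_right)
    finally show ?thesis unfolding dgy g_def \<pi>_add inner_add_left by linarith
  qed
  have dg1: "1 \<le> norm (dg x)" for x
  proof -
    have "dg x \<bullet> e = 1" unfolding dgy by (simp add: \<pi>_def ee)
    then show ?thesis using Cauchy_Schwarz_ineq2[of "dg x" e] e by simp
  qed
  define \<rho> where "\<rho> = min 1 (min (r / 2) ((1 - norm x0) / 2))"
  have \<rho>: "0 < \<rho>" "\<rho> \<le> 1" "2 * \<rho> \<le> r" "2 * \<rho> \<le> 1 - norm x0"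
  proof -
    have "\<rho> \<le> r / 2" unfolding \<rho>_def by (intro min.coboundedI2 min.coboundedI1 order_refl)
    moreover have "\<rho> \<le> (1 - norm x0) / 2" unfolding \<rho>_def by (intro min.coboundedI2 order_refl)
    ultimately show "2 * \<rho> \<le> r" "2 * \<rho> \<le> 1 - norm x0" by (simp_all add: field_simps)
  qed (use r x0 in \<open>auto simp: \<rho>_def\<close>)
  define G1 where "G1 = 1 + 2 * (norm (D (\<pi> x0)) + 4 * K0)"
  have dgG: "norm (dg x) \<le> G1" if x: "x \<in> ball x0 (2 * \<rho>)" for x
  proof -
    have d2: "norm (x - x0) \<le> 2" using x \<rho> by (simp add: dist_norm norm_minus_commute)
    have "norm (D (\<pi> x) - D (\<pi> x0)) \<le> K0 * norm (\<pi> (x - x0))"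
      using lipschitz_onD[OF L, of "\<pi> x" "\<pi> x0"] by (simp add: dist_norm \<pi>_diff)
    also have "\<dots> \<le> K0 * 4" using K0 \<pi>_norm[of "x - x0"] d2 by (intro mult_left_mono) auto
    finally have "norm (D (\<pi> x)) \<le> norm (D (\<pi> x0)) + 4 * K0"
      using norm_triangle_ineq2[of "D (\<pi> x)" "D (\<pi> x0)"] by simp
    then show ?thesis unfolding dg_def G1_def
      using norm_triangle_ineq4[of e "\<pi> (D (\<pi> x))"] \<pi>_norm[of "D (\<pi> x)"] e by simp
  qed
  \<comment> \<open>Two points of the ball are at distance at most 4, which turns the quadratic
    remainder into a linear one.\<close>
  define G where "G = G1 + 4 * K"
  have KG: "1 \<le> K" "1 \<le> G" "G1 \<le> G" using K0 by (auto simp: K_def G_def G1_def)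
  have lip: "\<bar>g x - g y\<bar> \<le> G * norm (x - y)" if xy: "x \<in> ball x0 (2 * \<rho>)" "y \<in> ball x0 (2 * \<rho>)" for x y
  proof -
    have d4: "norm (x - y) \<le> 4"
      using xy \<rho> norm_triangle_ineq4[of "x - x0" "y - x0"] by (simp add: dist_norm norm_minus_commute)
    have "\<bar>g x - g y\<bar> \<le> \<bar>dg y \<bullet> (x - y)\<bar> + K * (norm (x - y))\<^sup>2"
      using taylor[of y "x - y"] by simp
    also have "\<bar>dg y \<bullet> (x - y)\<bar> \<le> G1 * norm (x - y)"
      using Cauchy_Schwarz_ineq2[of "dg y" "x - y"] mult_right_mono[OF dgG[OF xy(2)], of "norm (x - y)"] by simp
    also have "K * (norm (x - y))\<^sup>2 \<le> K * (4 * norm (x - y))"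
      using KG d4 by (intro mult_left_mono) (auto simp: power2_eq_square intro: mult_right_mono)
    finally show ?thesis by (simp add: G_def algebra_simps)
  qed
  have mem: "x \<in> \<Omega> \<longleftrightarrow> 0 < g x" if "x \<in> ball x0 (2 * \<rho>)" for x
  proof -
    have "x \<in> ball x0 r" using that \<rho> by auto
    then have "x \<in> \<Omega> \<longleftrightarrow> x \<in> {x \<in> ball x0 r. x \<bullet> e > \<gamma> (x - (x \<bullet> e) *\<^sub>R e)}" unfolding gr[symmetric] by blast
    then show ?thesis using \<open>x \<in> ball x0 r\<close> by (simp add: g_def \<pi>_def)
  qed
  have "ball x0 (2 * \<rho>) \<subseteq> ball 0 1"
  proof
    fix x assume "x \<in> ball x0 (2 * \<rho>)"
    then show "x \<in> ball 0 1" using \<rho>(4) norm_triangle_ineq2[of x x0] by (simp add: dist_norm norm_minus_commute)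
  qed
  then have "chart \<Omega> x0 \<rho> K G g dg"
    unfolding chart_def using \<rho> KG taylor dg1 mem lip dgG by (auto intro: order_trans[OF dgG KG(3)])
  then show thesis by (rule that)
qed

subsection \<open>Vanishing at the boundary\<close>

definition admissible ::
    "real \<Rightarrow> real \<Rightarrow> real \<Rightarrow> 'a::euclidean_space set \<Rightarrow> 'a measure \<Rightarrow> (real \<times> 'a \<Rightarrow> real) \<Rightarrow> (real \<times> 'a \<Rightarrow> real) \<Rightarrow> bool" where
  "admissible s lam Lam \<Omega> \<mu> u f \<longleftrightarrow> spectral_measure s lam Lam \<mu> \<and> core_solution s \<mu> (\<Omega> \<inter> ball 0 1) u f \<and>
     (AE w in lborel. fst w \<in> {-1<..<0} \<longrightarrow> snd w \<in> ball 0 1 - \<Omega> \<longrightarrow> u w = 0)"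

lemma admissible_minus: "admissible s lam Lam \<Omega> \<mu> u f \<Longrightarrow> admissible s lam Lam \<Omega> \<mu> (\<lambda>w. - u w) (\<lambda>w. - f w)"
  by (auto simp: admissible_def core_solution_minus)

text \<open>One-sided: lower bounds come from \<open>- u\<close>, which is admissible as well. The
  region \<open>g < h\<close> includes the exterior of the domain, so mollification across the
  boundary stays inside it.\<close>

definition bounded_near ::
    "'a::euclidean_space \<Rightarrow> ('a \<Rightarrow> real) \<Rightarrow> real \<Rightarrow> real \<Rightarrow> real \<Rightarrow> real \<Rightarrow> (real \<times> 'a \<Rightarrow> real) \<Rightarrow> bool" where
  "bounded_near x0 g T r h m u \<longleftrightarrow>
     (AE w in lborel. fst w \<in> {-T<..<0} \<longrightarrow> norm (snd w - x0) < r \<longrightarrow> g (snd w) < h \<longrightarrow> u w \<le> m)"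

lemma moll_bounded_near:
  assumes bu: "bounded_fun u" and ch: "chart \<Omega> x0 \<rho> K G g dg" and bn: "bounded_near x0 g T r h m u"
    and e: "0 < e" and r: "r \<le> \<rho>" and t: "-T \<le> t - e" "t + e \<le> 0" and x: "norm (x - x0) + e \<le> r" "g x + G * e \<le> h"
  shows "moll e u (t, x) \<le> m"
proof (rule bounded_fun.moll_mono_AE[OF bu e])
  show "AE w in lborel. dist (t, x) w < e \<longrightarrow> u w \<le> m"
    using bn[unfolded bounded_near_def]
  proof eventually_elim
    case (elim w)
    show ?case
    proof
      assume d: "dist (t, x) w < e"
      have dt: "\<bar>t - fst w\<bar> < e" and dx: "norm (x - snd w) < e"
        using le_less_trans[OF dist_fst_le d] le_less_trans[OF dist_snd_le d] by (auto simp: dist_real_def dist_norm)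
      have nw: "norm (snd w - x0) < r"
        using dx x norm_triangle_ineq4[of "x - x0" "x - snd w"] by simp
      have \<rho>: "0 < \<rho>" and G: "1 \<le> G" using ch by (auto simp: chart_def)
      have "x \<in> ball x0 (2 * \<rho>)" "snd w \<in> ball x0 (2 * \<rho>)"
        using x e r nw \<rho> by (auto simp: dist_norm norm_minus_commute)
      then have "\<bar>g (snd w) - g x\<bar> \<le> G * norm (snd w - x)" using ch by (simp add: chart_def)
      also have "\<dots> < G * e" using dx G by (simp add: norm_minus_commute)
      finally have "g (snd w) < h" using x by linarith
      then show "u w \<le> m" using elim nw dt t by auto
    qed
  qed
qed

lemma moll_zero_outside:
  assumes bu: "bounded_fun u" and zero: "AE w in lborel. fst w \<in> {-1<..<0} \<longrightarrow> snd w \<in> ball 0 1 - \<Omega> \<longrightarrow> u w = 0"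
    and e: "0 < e" and t: "-1 \<le> t - e" "t + e \<le> 0" and x: "ball x e \<subseteq> ball 0 1 - \<Omega>"
  shows "moll e u (t, x) = 0"
proof -
  have "\<bar>moll e u (t, x)\<bar> \<le> 0"
  proof (rule bounded_fun.moll_abs_AE[OF bu e])
    show "AE w in lborel. dist (t, x) w < e \<longrightarrow> \<bar>u w\<bar> \<le> 0"
      using zero
    proof eventually_elim
      case (elim w)
      show ?case
      proof
        assume d: "dist (t, x) w < e"
        have "\<bar>t - fst w\<bar> < e" "dist x (snd w) < e"
          using le_less_trans[OF dist_fst_le d] le_less_trans[OF dist_snd_le d] by (auto simp: dist_real_def)
        then show "\<bar>u w\<bar> \<le> 0" using elim t x by (auto simp: subset_iff)
      qed
    qed
  qed
  then show ?thesis by simp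
qed

text \<open>
  At height \<open>a\<close> above the boundary the jumps that leave \<open>\<Omega>\<close>, where \<open>u\<close> vanishes, contribute a
  negative term of order \<open>a\<^sup>-\<^sup>2\<^sup>s\<close>, which beats everything else if \<open>a\<close> is small.
\<close>

lemma boundary_growth:
  fixes \<Omega> :: "'a::euclidean_space set" and s lam Lam \<rho> K G :: real
  assumes s: "0 < s" "s < 1" and lam: "0 < lam" "lam \<le> Lam" and ch: "chart \<Omega> x0 \<rho> K G g dg"
  obtains \<kappa> where "0 < \<kappa>" "\<kappa> < 1"
    "\<And>m r1 r2 T1 T2 h. 0 < m \<Longrightarrow> m \<le> 1 \<Longrightarrow> r2 < r1 \<Longrightarrow> r1 \<le> \<rho> \<Longrightarrow> T2 < T1 \<Longrightarrow> T1 \<le> 1 \<Longrightarrow> 0 < h \<Longrightarrow>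
      \<exists>h'>0. \<forall>\<mu> u f. admissible s lam Lam \<Omega> \<mu> u f \<longrightarrow> bounded_near x0 g T1 r1 h m u \<longrightarrow>
        bounded_near x0 g T2 r2 h' ((1 - \<kappa>) * m) u"
proof -
  have Lam: "0 < Lam" "0 \<le> Lam" using lam by auto
  have \<rho>: "0 < \<rho>" "\<rho> \<le> 1" and b1: "ball x0 (2 * \<rho>) \<subseteq> ball 0 1" and KG: "1 \<le> K" "1 \<le> G"
    and taylor: "\<And>x y. \<bar>g (x + y) - g x - dg x \<bullet> y\<bar> \<le> K * (norm y)\<^sup>2" and dg1: "\<And>x. 1 \<le> norm (dg x)"
    and mem: "\<And>x. x \<in> ball x0 (2 * \<rho>) \<Longrightarrow> x \<in> \<Omega> \<longleftrightarrow> 0 < g x"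
    and lip: "\<And>x y. x \<in> ball x0 (2 * \<rho>) \<Longrightarrow> y \<in> ball x0 (2 * \<rho>) \<Longrightarrow> \<bar>g x - g y\<bar> \<le> G * norm (x - y)"
    using ch by (auto simp: chart_def)
  define \<kappa>0 where "\<kappa>0 = min 1 ((lam / (2 * Lam)) powr (1 / (2 * s)))"
  have \<kappa>0: "0 < \<kappa>0" "\<kappa>0 \<le> 1" using lam Lam by (auto simp: \<kappa>0_def)
  have \<kappa>02: "\<kappa>0 powr (2 * s) * Lam \<le> lam / 2"
  proof -
    have "\<kappa>0 powr (2 * s) \<le> ((lam / (2 * Lam)) powr (1 / (2 * s))) powr (2 * s)"
      using s \<kappa>0 by (intro powr_mono2) (auto simp: \<kappa>0_def)
    also have "\<dots> = lam / (2 * Lam)" using s lam Lam by (simp add: powr_powr)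
    finally show ?thesis using Lam by (simp add: field_simps)
  qed
  \<comment> \<open>The comparison takes place in a ball of radius \<open>c1 * a\<close>, on which
    \<open>g\<close> differs from its value \<open>a\<close> at the centre by at most
    \<open>a / 4\<close>.\<close>
  define c1 where "c1 = 1 / (4 * G)"
  have c1: "0 < c1" "c1 \<le> 1/4" "G * c1 = 1/4" using KG by (auto simp: c1_def field_simps)
  \<comment> \<open>The jump lengths between \<open>q\<close> and \<open>2 * q\<close> have weight
    \<open>q powr (- 2 * s) * \<gamma>0\<close>.\<close>
  define \<gamma>0 where "\<gamma>0 = (1 - 2 powr (- 2 * s)) / (2 * s)"
  have "2 powr (- 2 * s) < (1::real)" using s powr_less_mono[of "- 2 * s" 0 2] by simp
  then have \<gamma>0: "0 < \<gamma>0" using s by (simp add: \<gamma>0_def)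
  define E where "E = (lam / 2) * ((8 / \<kappa>0) powr (- 2 * s) * \<gamma>0)"
  have E: "0 < E" using lam \<gamma>0 \<kappa>0 by (simp add: E_def)
  define C3 where "C3 = 2 / (2 - 2 * s) + 2 / (2 * s)"
  have C3: "0 \<le> C3" using s by (simp add: C3_def)
  define A where "A = c1 powr (- 2 * s) * (1 + 2 * Lam * C3)"
  have A: "0 < A" unfolding A_def using c1 Lam C3 by (intro mult_pos_pos) (auto intro: add_pos_nonneg)
  \<comment> \<open>Penalties of height \<open>k\<close> cost
    \<open>k * A * a powr (- 2 * s)\<close> and the exits gain
    \<open>m * E * a powr (- 2 * s)\<close>. Both scale alike in \<open>a\<close>, so
    \<open>k = \<kappa> * m\<close> works at every height; this makes the factor
    \<open>1 - \<kappa>\<close> independent of the cylinders and lets the lemma be iterated.\<close>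
  define \<kappa> where "\<kappa> = min (1/4) (E / (2 * A))"
  have \<kappa>: "0 < \<kappa>" "\<kappa> \<le> 1/4" "\<kappa> * A \<le> E / 2"
  proof -
    show "0 < \<kappa>" "\<kappa> \<le> 1/4" using E A by (auto simp: \<kappa>_def)
    have "\<kappa> * A \<le> E / (2 * A) * A" unfolding \<kappa>_def using A by (intro mult_right_mono) auto
    then show "\<kappa> * A \<le> E / 2" using A by simp
  qed
  show thesis
  proof (rule that[of \<kappa>])
    show "0 < \<kappa>" "\<kappa> < 1" using \<kappa> by auto
    fix m r1 r2 T1 T2 h :: real
    assume m: "0 < m" "m \<le> 1" and r: "r2 < r1" "r1 \<le> \<rho>" and T: "T2 < T1" "T1 \<le> 1" and h: "0 < h"
    define R0 where "R0 = min ((r1 - r2) / 2) (h / (4 * G))"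
    have R0: "0 < R0" using r h KG by (simp add: R0_def)
    have R0r: "R0 \<le> (r1 - r2) / 2" and R0h: "G * R0 \<le> h / 4"
    proof -
      show "R0 \<le> (r1 - r2) / 2" unfolding R0_def by (rule min.cobounded1)
      have "G * R0 \<le> G * (h / (4 * G))" unfolding R0_def using KG by (intro mult_left_mono) auto
      then show "G * R0 \<le> h / 4" using KG by simp
    qed
    \<comment> \<open>Jumps longer than \<open>R0\<close> may leave the region where
      \<open>u \<le> m\<close>; they are estimated by the global bound and cost an amount
      independent of \<open>a\<close>.\<close>
    define C4 where "C4 = 4 * (R0 powr (- 2 * s) / (2 * s))"
    have C4: "0 \<le> C4" using s by (simp add: C4_def)
    have "\<forall>\<^sub>F a in at_right 0. a < h / 4 \<and> c1 * a < (r1 - r2) / 4 \<and> (c1 * a) powr (2 * s) < (T1 - T2) / 2 \<and>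
        256 * K * a < 5 * \<kappa>0\<^sup>2 \<and> 16 * a < \<kappa>0 * R0 \<and> 1 + 2 * Lam * C4 < m * (E / 2) * a powr (- 2 * s)"
    proof (intro eventually_conj)
      have lin: "\<forall>\<^sub>F a in at_right (0::real). c * a < b" if "0 < b" for b c
      proof -
        have "((\<lambda>a. c * a) \<longlongrightarrow> c * 0) (at_right 0)" by (intro tendsto_intros)
        then show ?thesis using that by (intro order_tendstoD(2)) auto
      qed
      show "\<forall>\<^sub>F a in at_right 0. a < h / 4" using lin[of "h / 4" 1] h by simp
      show "\<forall>\<^sub>F a in at_right 0. c1 * a < (r1 - r2) / 4" by (rule lin) (use r in simp)
      show "\<forall>\<^sub>F a in at_right 0. 256 * K * a < 5 * \<kappa>0\<^sup>2" by (rule lin) (use \<kappa>0 in simp)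
      show "\<forall>\<^sub>F a in at_right 0. 16 * a < \<kappa>0 * R0" by (rule lin) (use \<kappa>0 R0 in simp)
      have "((\<lambda>a. (c1 * a) powr (2 * s)) \<longlongrightarrow> 0) (at_right 0)" using s c1(1) by real_asymp
      then show "\<forall>\<^sub>F a in at_right 0. (c1 * a) powr (2 * s) < (T1 - T2) / 2"
        using T by (intro order_tendstoD(2)) auto
      have "filterlim (\<lambda>a::real. m * (E / 2) * a powr (- 2 * s)) at_top (at_right 0)"
        using s m(1) E by real_asymp
      then show "\<forall>\<^sub>F a in at_right 0. 1 + 2 * Lam * C4 < m * (E / 2) * a powr (- 2 * s)"
        unfolding filterlim_at_top_dense by blast
    qed
    then obtain h' where h': "0 < h'" and small: "\<And>a. 0 < a \<Longrightarrow> a < h' \<Longrightarrow> a < h / 4 \<and> c1 * a < (r1 - r2) / 4 \<and>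
        (c1 * a) powr (2 * s) < (T1 - T2) / 2 \<and> 256 * K * a < 5 * \<kappa>0\<^sup>2 \<and> 16 * a < \<kappa>0 * R0 \<and>
        1 + 2 * Lam * C4 < m * (E / 2) * a powr (- 2 * s)"
      by (auto simp: eventually_at_right_field)
    show "\<exists>h'>0. \<forall>\<mu> u f. admissible s lam Lam \<Omega> \<mu> u f \<longrightarrow> bounded_near x0 g T1 r1 h m u \<longrightarrow>
        bounded_near x0 g T2 r2 h' ((1 - \<kappa>) * m) u"
    proof (intro exI[of _ h'] conjI allI impI h')
      fix \<mu> u f assume adm: "admissible s lam Lam \<Omega> \<mu> u f" and bn: "bounded_near x0 g T1 r1 h m u"
      have mu: "spectral_measure s lam Lam \<mu>" and sol: "core_solution s \<mu> (\<Omega> \<inter> ball 0 1) u f"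
        and zero: "AE w in lborel. fst w \<in> {-1<..<0} \<longrightarrow> snd w \<in> ball 0 1 - \<Omega> \<longrightarrow> u w = 0"
        using adm by (auto simp: admissible_def)
      note mu' = spectral_measureD[OF mu Lam(2)]
      interpret finite_measure \<mu> by (rule mu')
      have bu: "bounded_fun u" by (rule bounded_fun_core[OF sol])
      interpret bounded_fun u by (rule bu)
      define Z where "Z = {w. fst w \<in> {-T2<..<0} \<and> norm (snd w - x0) < r2 \<and> 0 < g (snd w) \<and> g (snd w) < h'}"
      have "AE w in lborel. w \<in> Z \<longrightarrow> u w \<le> (1 - \<kappa>) * m"
      proof (rule AE_le_of_moll[where R = 4])
        fix z assume "z \<in> Z"
        then obtain t1 x1 where z: "z = (t1, x1)" and t1: "-T2 < t1" "t1 < 0" and x1: "norm (x1 - x0) < r2"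
          and a0: "0 < g x1" "g x1 < h'" by (cases z) (auto simp: Z_def)
        have "norm x1 < 1"
        proof -
          have "x1 \<in> ball x0 (2 * \<rho>)" using x1 r \<rho> by (simp add: dist_norm norm_minus_commute)
          then show ?thesis using b1 by auto
        qed
        then show "norm z < 4" using norm_Pair_le[of t1 x1] t1 T by (simp add: z)
        fix d :: real assume d: "0 < d"
        define a where "a = g x1"
        have a: "0 < a" "a < h / 4" "c1 * a < (r1 - r2) / 4" "(c1 * a) powr (2 * s) < (T1 - T2) / 2"
          "256 * K * a < 5 * \<kappa>0\<^sup>2" "16 * a < \<kappa>0 * R0" "1 + 2 * Lam * C4 < m * (E / 2) * a powr (- 2 * s)"
          using small[OF a0] a0 by (auto simp: a_def)
        define e0 where "e0 = min (min ((r1 - r2) / 4) ((T1 - T2) / 2)) (min (- t1) (min (a / (2 * G)) (h / (8 * G))))"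
        have e0: "0 < e0" using r T t1 a h KG by (simp add: e0_def)
        show "\<exists>e0>0. \<forall>e. 0 < e \<longrightarrow> e < e0 \<longrightarrow> moll e u z \<le> (1 - \<kappa>) * m + d"
        proof (intro exI[of _ e0] conjI allI impI e0)
          fix e assume e: "0 < e" "e < e0"
          have ee: "e < (r1 - r2) / 4" "e < (T1 - T2) / 2" "e < - t1" "G * e < a / 2" "G * e < h / 8"
            using e KG by (auto simp: e0_def field_simps)
          define U where "U = moll e u"
          have Uc: "continuous_on S U" for S unfolding U_def by (rule moll_continuous[OF e(1)])
          have Ub: "- 1 \<le> U z" "U z \<le> 1" for z using moll_le_1[OF e(1), of z] by (auto simp: U_def)
          have "U (t1, x1) \<le> (1 - \<kappa>) * m"
          proof (rule ccontr)
            assume "\<not> U (t1, x1) \<le> (1 - \<kappa>) * m"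
            then have big: "(1 - \<kappa>) * m < U (t1, x1)" by simp
            define h1 where "h1 = c1 * a"
            define \<tau> where "\<tau> = h1 powr (2 * s)"
            have h1: "0 < h1" "h1 < (r1 - r2) / 4" "G * h1 = a / 4" "h1 \<le> a"
            proof -
              show "0 < h1" "h1 < (r1 - r2) / 4" using c1 a by (auto simp: h1_def)
              show "G * h1 = a / 4" using c1(3) by (simp add: h1_def mult.assoc[symmetric])
              have "c1 * a \<le> 1 * a" using c1 a by (intro mult_right_mono) auto
              then show "h1 \<le> a" by (simp add: h1_def)
            qed
            have \<tau>: "0 < \<tau>" "\<tau> < (T1 - T2) / 2" using h1 a by (auto simp: \<tau>_def h1_def)
            define pen where "pen = (\<lambda>x. (norm (x - x1))\<^sup>2 / h1\<^sup>2)"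
            have pen0: "0 \<le> pen x" for x by (simp add: pen_def)
            define k where "k = \<kappa> * m"
            have k: "0 < k" "k \<le> m / 4"
            proof -
              show "0 < k" using \<kappa> m by (simp add: k_def)
              show "k \<le> m / 4" using mult_right_mono[OF \<kappa>(2), of m] m by (simp add: k_def)
            qed
            have bigk: "m - k < U (t1, x1)" using big by (simp add: k_def left_diff_distrib)
            \<comment> \<open>Each penalty reaches \<open>k\<close> on its part of the boundary of
              the cylinder, where \<open>\<Phi>\<close> is therefore at most \<open>m - k\<close>,
              less than its value at \<open>(t1, x1)\<close>.\<close>
            define \<Phi> where "\<Phi> = (\<lambda>t x. U (t, x) - k * pen x - k * ((t1 - t) / \<tau>))"
            define Q where "Q = {t1 - \<tau>..t1} \<times> cball x1 h1"
            have cQ: "compact Q" unfolding Q_def by (intro compact_Times compact_cball compact_Icc)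
            have in1: "(t1, x1) \<in> Q" using h1 \<tau> by (simp add: Q_def)
            have "continuous_on Q (\<lambda>p. \<Phi> (fst p) (snd p))"
              unfolding \<Phi>_def pen_def using \<tau> h1
              by (intro continuous_intros continuous_on_compose2[OF Uc[of UNIV]]) auto
            then obtain p where P: "p \<in> Q" "\<And>q. q \<in> Q \<Longrightarrow> \<Phi> (fst q) (snd q) \<le> \<Phi> (fst p) (snd p)"
              using continuous_attains_sup[OF cQ, of "\<lambda>p. \<Phi> (fst p) (snd p)"] in1 by blast
            obtain t x where Peq: "p = (t, x)" by (cases p)
            have tx: "t1 - \<tau> \<le> t" "t \<le> t1" "norm (x - x1) \<le> h1"
              using P(1) by (auto simp: Q_def Peq dist_norm norm_minus_commute)
            have \<Phi>big: "m - k < \<Phi> t x"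
            proof -
              have "\<Phi> t1 x1 = U (t1, x1)" by (simp add: \<Phi>_def pen_def)
              then show ?thesis using P(2)[OF in1] bigk by (simp add: Peq)
            qed
            have kt: "0 \<le> k * ((t1 - t) / \<tau>)" using k \<tau> tx by simp
            have kp: "0 \<le> k * pen x" using k pen0 by simp
            have Ubig: "m - k < U (t, x)" using \<Phi>big kt kp by (simp add: \<Phi>_def)
            have tr: "- T1 \<le> t - e" "t + e \<le> 0" "-1 < t - e" "t + e < 0"
            proof -
              show "- T1 \<le> t - e" using tx \<tau> ee t1 T by simp
              have "- T1 < t - e" using tx \<tau> ee t1 by (simp add: field_simps)
              then show "-1 < t - e" using T by simp
              show "t + e \<le> 0" "t + e < 0" using tx ee by auto
            qed
            have xin: "x \<in> ball x0 (2 * \<rho>)" "x1 \<in> ball x0 (2 * \<rho>)" and nxx0: "norm (x - x0) < r2 + h1"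
            proof -
              show n: "norm (x - x0) < r2 + h1" using norm_triangle_ineq[of "x - x1" "x1 - x0"] tx x1 by simp
              show "x \<in> ball x0 (2 * \<rho>)" "x1 \<in> ball x0 (2 * \<rho>)"
                using n x1 h1 r \<rho> by (auto simp: dist_norm norm_minus_commute field_simps)
            qed
            have gx: "3 * a / 4 \<le> g x" "g x \<le> 5 * a / 4"
            proof -
              have "\<bar>g x - g x1\<bar> \<le> G * norm (x - x1)" by (rule lip[OF xin])
              also have "\<dots> \<le> G * h1" using tx KG by (intro mult_left_mono) auto
              finally have "\<bar>g x - a\<bar> \<le> a / 4" using h1 by (simp add: a_def)
              then show "3 * a / 4 \<le> g x" "g x \<le> 5 * a / 4" by linarith+
            qed
            have nearin: "x + y \<in> ball x0 (2 * \<rho>)" "norm (x + y - x0) + e \<le> r1" "ball (x + y) e \<subseteq> ball x0 (2 * \<rho>)"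
              if y: "norm y \<le> R0" for y
            proof -
              have "norm (x + y - x0) \<le> norm (x - x0) + norm y"
                using norm_triangle_ineq[of "x - x0" y] by (simp add: algebra_simps)
              then show n: "norm (x + y - x0) + e \<le> r1" using nxx0 y R0r h1 ee by (simp add: field_simps)
              show "x + y \<in> ball x0 (2 * \<rho>)" using n e r \<rho> by (simp add: dist_norm norm_minus_commute)
              show "ball (x + y) e \<subseteq> ball x0 (2 * \<rho>)"
              proof
                fix w assume "w \<in> ball (x + y) e"
                then have "norm (w - x0) < e + norm (x + y - x0)"
                  using norm_triangle_ineq[of "w - (x + y)" "x + y - x0"] by (simp add: dist_norm norm_minus_commute)
                then show "w \<in> ball x0 (2 * \<rho>)" using n r \<rho> by (simp add: dist_norm norm_minus_commute)
              qed
            qed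
            have Um: "U (t, x + y) \<le> m" if y: "norm y \<le> R0" for y
              unfolding U_def
            proof (rule moll_bounded_near[OF bu ch bn e(1) r(2) tr(1,2)])
              show "norm (x + y - x0) + e \<le> r1" by (rule nearin[OF y])
              have "\<bar>g (x + y) - g x\<bar> \<le> G * norm y" using lip[OF nearin(1)[OF y] xin(1)] by simp
              also have "\<dots> \<le> G * R0" using y KG by (intro mult_left_mono) auto
              finally show "g (x + y) + G * e \<le> h" using gx R0h ee a by linarith
            qed
            have diffm: "U (t, x + y) - U (t, x) \<le> k" if "norm y \<le> R0" for y using Um[OF that] Ubig by linarith
            \<comment> \<open>Outside the small ball the point \<open>x + y\<close> was no
              competitor, but there the penalty is at least \<open>k\<close> and the inequality
              persists because \<open>U \<le> m\<close>.\<close>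
            have diffp: "U (t, x + y) - U (t, x) \<le> k * pen (x + y) - k * pen x" if y: "norm y \<le> R0" for y
            proof (cases "norm (x + y - x1) \<le> h1")
              case True
              then have "(t, x + y) \<in> Q" using tx by (auto simp: Q_def dist_norm norm_minus_commute)
              from P(2)[OF this] show ?thesis by (simp add: Peq \<Phi>_def)
            next
              case False
              then have "1 \<le> pen (x + y)" using h1 by (simp add: pen_def power_mono)
              then have "k * 1 \<le> k * pen (x + y)" using k by (intro mult_left_mono) auto
              then show ?thesis using Um[OF y] \<Phi>big kt by (simp add: \<Phi>_def)
            qed
            have t0t: "t1 - \<tau> < t"
            proof (rule ccontr)
              assume "\<not> t1 - \<tau> < t"
              then have "t1 - t = \<tau>" using tx by simp
              then have "k * ((t1 - t) / \<tau>) = k" using \<tau> by simp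
              then show False using \<Phi>big kp Um[of 0] R0 by (simp add: \<Phi>_def)
            qed
            have cb: "cball x e \<subseteq> \<Omega> \<inter> ball 0 1"
            proof
              fix w assume w: "w \<in> cball x e"
              have "norm (w - x0) \<le> e + norm (x - x0)"
                using norm_triangle_ineq[of "w - x" "x - x0"] w by (simp add: dist_norm norm_minus_commute)
              then have win: "w \<in> ball x0 (2 * \<rho>)"
                using nxx0 h1 ee r \<rho> by (simp add: dist_norm norm_minus_commute field_simps)
              have "\<bar>g w - g x\<bar> \<le> G * norm (w - x)" by (rule lip[OF win xin(1)])
              also have "\<dots> \<le> G * e" using w KG by (intro mult_left_mono) (auto simp: dist_norm norm_minus_commute)
              finally have "0 < g w" using gx ee a by linarith
              then show "w \<in> \<Omega> \<inter> ball 0 1" using mem[OF win] win b1 by auto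
            qed
            obtain hx where hx: "\<bar>hx\<bar> \<le> 1" "((\<lambda>\<tau>. U (\<tau>, x)) has_real_derivative (stable_at s \<mu> (\<lambda>y. U (t, y)) x + hx)) (at t)"
              using moll_equation[OF s mu Lam(2) sol e(1) cball_Pair_subset[OF tr(3,4) cb]] unfolding U_def by blast
            have "((\<lambda>\<tau>'. \<Phi> \<tau>' x) has_real_derivative (stable_at s \<mu> (\<lambda>y. U (t, y)) x + hx + k / \<tau>)) (at t)"
              unfolding \<Phi>_def using \<tau> by (auto intro!: derivative_eq_intros hx(2))
            then have "0 \<le> stable_at s \<mu> (\<lambda>y. U (t, y)) x + hx + k / \<tau>"
            proof (rule deriv_nonneg_at_max[OF _ t0t])
              fix \<tau>' assume "t1 - \<tau> \<le> \<tau>'" "\<tau>' \<le> t"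
              then have "(\<tau>', x) \<in> Q" using tx by (auto simp: Q_def dist_norm norm_minus_commute)
              from P(2)[OF this] show "\<Phi> \<tau>' x \<le> \<Phi> t x" by (simp add: Peq)
            qed
            then have low: "- 1 - k / \<tau> \<le> stable_at s \<mu> (\<lambda>y. U (t, y)) x" using hx(1) by linarith
            obtain B where B: "\<And>t. bdd_second_diff B (\<lambda>x. U (t, x))"
              unfolding U_def by (rule moll_slice_bdd_second_diff[OF bu e(1)]) blast
            define \<nu> where "\<nu> = dg x /\<^sub>R norm (dg x)"
            have "norm (dg x) \<noteq> 0" using dg1[of x] by auto
            then have \<nu>: "norm \<nu> = 1" by (simp add: \<nu>_def)
            define S where "S = {\<theta> \<in> sphere 0 1. \<kappa>0 \<le> \<bar>\<nu> \<bullet> \<theta>\<bar>}"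
            have S: "S \<in> sets \<mu>" "lam / 2 \<le> measure \<mu> S"
              unfolding S_def using spectral_mass_transversal[OF s(1) lam mu \<nu> less_imp_le[OF \<kappa>0(1)] \<kappa>02] by auto
            \<comment> \<open>A transversal jump of length at least \<open>q\<close> changes the
              linear part of \<open>g\<close> by at least \<open>8 * a\<close>, enough to cross the
              boundary in spite of the curvature.\<close>
            define q where "q = 8 * a / \<kappa>0"
            have q: "0 < q" "h1 \<le> q" "2 * q \<le> R0" "K * q < 5 * \<kappa>0 / 32" "\<kappa>0 * q = 8 * a"
            proof -
              show "0 < q" using a \<kappa>0 by (simp add: q_def)
              have "a * 1 \<le> a * (8 / \<kappa>0)" using a \<kappa>0 by (intro mult_left_mono) auto
              then show "h1 \<le> q" using h1(4) by (simp add: q_def mult.commute)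
              show "2 * q \<le> R0" using a(6) \<kappa>0 by (simp add: q_def field_simps)
              have "256 * K * a / (32 * \<kappa>0) < 5 * \<kappa>0\<^sup>2 / (32 * \<kappa>0)" using a(5) \<kappa>0 by (intro divide_strict_right_mono) auto
              then show "K * q < 5 * \<kappa>0 / 32" using \<kappa>0 by (simp add: q_def power2_eq_square)
              show "\<kappa>0 * q = 8 * a" using \<kappa>0 by (simp add: q_def)
            qed
            \<comment> \<open>The landing height is at most \<open>- a\<close> and
              \<open>G * e < a / 2\<close>, so the whole ball of mollification lies outside the
              domain.\<close>
            have exit: "U (t, x + y) = 0" if y: "norm y \<le> R0" "dg x \<bullet> y \<le> - \<kappa>0 * norm y" "q \<le> norm y" "norm y \<le> 2 * q" for y
            proof -
              have "K * (norm y)\<^sup>2 \<le> K * (norm y * (2 * q))"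
                using y KG by (intro mult_left_mono) (auto simp: power2_eq_square intro: mult_left_mono)
              also have "\<dots> = (K * q) * (2 * norm y)" by simp
              also have "\<dots> \<le> (5 * \<kappa>0 / 32) * (2 * norm y)" using q(4) by (intro mult_right_mono) auto
              finally have "g (x + y) \<le> g x - \<kappa>0 * norm y + 5/16 * (\<kappa>0 * norm y)"
                using taylor[of x y] y(2) by simp
              moreover have "8 * a \<le> \<kappa>0 * norm y" using mult_left_mono[OF y(3), of \<kappa>0] \<kappa>0 q(5) by simp
              ultimately have gy: "g (x + y) \<le> - a" using gx a by linarith
              have "ball (x + y) e \<subseteq> ball 0 1 - \<Omega>"
              proof
                fix w assume w: "w \<in> ball (x + y) e"
                have win: "w \<in> ball x0 (2 * \<rho>)" using nearin(3)[OF y(1)] w by blast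
                have "\<bar>g w - g (x + y)\<bar> \<le> G * norm (w - (x + y))" by (rule lip[OF win nearin(1)[OF y(1)]])
                also have "\<dots> \<le> G * e" using w KG by (intro mult_left_mono) (auto simp: dist_norm norm_minus_commute)
                finally have "\<not> 0 < g w" using gy ee a by linarith
                then show "w \<in> ball 0 1 - \<Omega>" using mem[OF win] win b1 by auto
              qed
              then show ?thesis unfolding U_def by (intro moll_zero_outside[OF bu zero e(1)]) (use tr in auto)
            qed
            \<comment> \<open>The last two terms together are \<open>- m / 2\<close> on the lengths
              from \<open>q\<close> to \<open>2 * q\<close>, written as a difference of two tails
              whose integrals are known.\<close>
            define B1 where "B1 = (\<lambda>\<theta> r. (2 * k / h1\<^sup>2) * (indicator {0<..<h1} r * r\<^sup>2) + (2 * k) * indicator {h1..} r + 4 * indicator {R0..} r +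
              ((- (m / 2) * indicator S \<theta>) * indicator {q..} r + ((m / 2) * indicator S \<theta>) * indicator {2 * q..} r) :: real)"
            define \<beta> where "\<beta> = (\<lambda>\<theta>. (k * C3 * h1 powr (- 2 * s) + C4) - (m / 2 * (q powr (- 2 * s) * \<gamma>0)) * indicator S \<theta>)"
            have fi: "frac_integral s (B1 \<theta>) (\<beta> \<theta>)" for \<theta>
            proof -
              have "frac_integral s (B1 \<theta>) ((2 * k / h1\<^sup>2) * (h1 powr (2 - 2 * s) / (2 - 2 * s)) + (2 * k) * (h1 powr (- 2 * s) / (2 * s)) +
                4 * (R0 powr (- 2 * s) / (2 * s)) + ((- (m / 2) * indicator S \<theta>) * (q powr (- 2 * s) / (2 * s)) +
                 ((m / 2) * indicator S \<theta>) * ((2 * q) powr (- 2 * s) / (2 * s))))"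
                unfolding B1_def
                by (intro frac_integral_add frac_integral_cmult frac_integral_inner_square frac_integral_outer_const s h1(1) R0) (use q in auto)
              moreover have "(2 * k / h1\<^sup>2) * (h1 powr (2 - 2 * s) / (2 - 2 * s)) = k * (2 / (2 - 2 * s)) * h1 powr (- 2 * s)"
              proof -
                have "h1 powr (2 - 2 * s) = h1\<^sup>2 * h1 powr (- 2 * s)"
                  using h1 powr_add[of h1 2 "- 2 * s"] by simp
                then show ?thesis using h1(1) by simp
              qed
              moreover have "(2 * q) powr (- 2 * s) = 2 powr (- 2 * s) * q powr (- 2 * s)" by (rule powr_mult)
              ultimately show ?thesis
                by (simp add: \<beta>_def C3_def C4_def \<gamma>0_def distrib_left distrib_right diff_divide_distrib algebra_simps)
            qed
            have bound: "U (t, x + r *\<^sub>R \<theta>) + U (t, x - r *\<^sub>R \<theta>) - 2 * U (t, x) \<le> B1 \<theta> r"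
              if th: "\<theta> \<in> sphere 0 1" and r0: "0 < r" for \<theta> r
            proof -
              define y where "y = r *\<^sub>R \<theta>"
              have ny: "norm y = r" using th r0 by (simp add: y_def)
              have eq: "x + r *\<^sub>R \<theta> = x + y" "x - r *\<^sub>R \<theta> = x + (- y)" by (simp_all add: y_def)
              have nm: "norm (- y) = r" using ny by simp
              consider "R0 \<le> r" | "r < R0" "r < h1" | "r < R0" "h1 \<le> r" "\<theta> \<in> S" "q \<le> r" "r < 2 * q"
                | "r < R0" "h1 \<le> r" "\<theta> \<notin> S \<or> r < q \<or> 2 * q \<le> r" by linarith
              then show ?thesis
              proof cases
                case 1
                have "U (t, x + y) + U (t, x + (- y)) - 2 * U (t, x) \<le> 4"
                  using Ub(2)[of "(t, x + y)"] Ub(2)[of "(t, x + (- y))"] Ub(1)[of "(t, x)"] by linarith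
                also have "4 \<le> B1 \<theta> r" using 1 h1 q k R0 by (auto simp: B1_def indicator_def)
                finally show ?thesis unfolding eq .
              next
                case 2
                have "pen (x + y) + pen (x + (- y)) = 2 * pen x + 2 * r\<^sup>2 / h1\<^sup>2"
                proof -
                  have "(norm (x - x1 + y))\<^sup>2 + (norm (x - x1 - y))\<^sup>2 = 2 * (norm (x - x1))\<^sup>2 + 2 * r\<^sup>2"
                    using norm_parallelogram[of "x - x1" y] ny by simp
                  moreover have "x + y - x1 = x - x1 + y" "x + (- y) - x1 = x - x1 - y" by auto
                  ultimately show ?thesis unfolding pen_def by (simp only: add_divide_distrib[symmetric] times_divide_eq_right)
                qed
                then have "k * pen (x + y) + k * pen (x + (- y)) = 2 * (k * pen x) + (2 * k / h1\<^sup>2) * r\<^sup>2"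
                  by (simp add: distrib_left[symmetric]) (simp add: algebra_simps)
                then have "U (t, x + y) + U (t, x + (- y)) - 2 * U (t, x) \<le> (2 * k / h1\<^sup>2) * r\<^sup>2"
                  using diffp[of y] diffp[of "- y"] 2 ny nm by linarith
                also have "\<dots> = B1 \<theta> r" using 2 r0 q by (simp add: B1_def)
                finally show ?thesis unfolding eq .
              next
                case 3
                have "\<kappa>0 \<le> \<bar>\<nu> \<bullet> \<theta>\<bar>" using 3 by (simp add: S_def)
                also have "\<dots> = \<bar>dg x \<bullet> \<theta>\<bar> / norm (dg x)" by (simp add: \<nu>_def abs_mult divide_inverse mult.commute)
                also have "\<dots> \<le> \<bar>dg x \<bullet> \<theta>\<bar>" using frac_le[of "\<bar>dg x \<bullet> \<theta>\<bar>" "\<bar>dg x \<bullet> \<theta>\<bar>" 1 "norm (dg x)"] dg1[of x] by simp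
                finally have "r * \<kappa>0 \<le> r * \<bar>dg x \<bullet> \<theta>\<bar>" using r0 by (intro mult_left_mono) auto
                then have bdy: "\<kappa>0 * norm y \<le> \<bar>dg x \<bullet> y\<bar>" using r0 ny by (simp add: y_def abs_mult mult.commute)
                \<comment> \<open>One of the two opposite jumps lands where \<open>U\<close>
                  vanishes, while \<open>U (t, x)\<close> exceeds \<open>m - k\<close>.\<close>
                have "U (t, x + y) + U (t, x + (- y)) - 2 * U (t, x) \<le> 2 * k - m / 2"
                proof (cases "dg x \<bullet> y \<le> 0")
                  case True
                  have "U (t, x + y) = 0" by (rule exit) (use True bdy 3 ny in auto)
                  then show ?thesis using diffm[of "- y"] Ubig k 3 nm by simp
                next
                  case False
                  have "U (t, x + (- y)) = 0" by (rule exit) (use False bdy 3 ny in auto)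
                  then show ?thesis using diffm[of y] Ubig k 3 ny by simp
                qed
                also have "\<dots> = B1 \<theta> r" using 3 r0 by (simp add: B1_def)
                finally show ?thesis unfolding eq .
              next
                case 4
                have "U (t, x + y) + U (t, x + (- y)) - 2 * U (t, x) \<le> 2 * k"
                  using diffm[of y] diffm[of "- y"] 4 ny nm by simp
                also have "\<dots> \<le> B1 \<theta> r" using 4 r0 m q by (auto simp: B1_def indicator_def)
                finally show ?thesis unfolding eq .
              qed
            qed
            have iS: "integrable \<mu> (indicator S :: _ \<Rightarrow> real)"
              using S(1) by (intro integrable_real_indicator) (auto simp: less_top[symmetric])
            have i\<beta>: "integrable \<mu> \<beta>" unfolding \<beta>_def using iS by simp
            have "stable_at s \<mu> (\<lambda>y. U (t, y)) x \<le> 2 * integral\<^sup>L \<mu> \<beta>"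
              by (rule stable_at_integrable(3)[OF s mu Lam(2) B, of t x B1]) (use bound fi i\<beta> in auto)
            also have "integral\<^sup>L \<mu> \<beta> = (k * C3 * h1 powr (- 2 * s) + C4) * measure \<mu> (space \<mu>) - (m / 2 * (q powr (- 2 * s) * \<gamma>0)) * measure \<mu> S"
            proof -
              have "S \<inter> space \<mu> = S" using S(1) sets.sets_into_space by blast
              then show ?thesis unfolding \<beta>_def using iS by (simp add: mult.commute)
            qed
            also have "\<dots> \<le> (k * C3 * h1 powr (- 2 * s) + C4) * Lam - (m / 2 * (q powr (- 2 * s) * \<gamma>0)) * (lam / 2)"
              using mu'(3) S(2) k C3 C4 m \<gamma>0 by (intro diff_mono mult_left_mono) auto
            finally have up: "stable_at s \<mu> (\<lambda>y. U (t, y)) x \<le>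
              2 * ((k * C3 * h1 powr (- 2 * s) + C4) * Lam - (m / 2 * (q powr (- 2 * s) * \<gamma>0)) * (lam / 2))" by simp
            define W where "W = a powr (- 2 * s)"
            have W1: "h1 powr (- 2 * s) = c1 powr (- 2 * s) * W" unfolding h1_def W_def by (rule powr_mult)
            have W2: "q powr (- 2 * s) = (8 / \<kappa>0) powr (- 2 * s) * W"
            proof -
              have "q = (8 / \<kappa>0) * a" by (simp add: q_def)
              then show ?thesis unfolding W_def by (simp only: powr_mult)
            qed
            have W3: "k / \<tau> = k * (c1 powr (- 2 * s) * W)"
            proof -
              have "\<tau> = h1 powr (2 * s)" "h1 powr (- 2 * s) = 1 / h1 powr (2 * s)"
                using powr_minus_divide[of h1 "2 * s"] by (simp_all add: \<tau>_def)
              then show ?thesis unfolding W1[symmetric] by simp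
            qed
            have "0 \<le> 1 + 2 * Lam * C4 + k * (c1 powr (- 2 * s) * W) + 2 * (k * C3 * (c1 powr (- 2 * s) * W)) * Lam
                - m * (((8 / \<kappa>0) powr (- 2 * s) * W) * \<gamma>0) * (lam / 2)"
              using low up unfolding W1 W2 W3 by (simp add: algebra_simps)
            also have "\<dots> = 1 + 2 * Lam * C4 + m * W * (\<kappa> * A) - m * W * E"
              by (simp add: A_def E_def k_def algebra_simps)
            also have "m * W * (\<kappa> * A) \<le> m * W * (E / 2)"
              using \<kappa>(3) m by (intro mult_left_mono) (auto simp: W_def)
            finally have "m * W * (E / 2) \<le> 1 + 2 * Lam * C4" by (simp add: algebra_simps)
            then show False using a(7) by (simp add: W_def mult_ac)
          qed
          then show "moll e u z \<le> (1 - \<kappa>) * m + d" using d by (simp add: U_def z)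
        qed
      qed
      then show "bounded_near x0 g T2 r2 h' ((1 - \<kappa>) * m) u"
        unfolding bounded_near_def using zero
      proof eventually_elim
        case (elim w)
        show ?case
        proof (intro impI)
          assume w: "fst w \<in> {- T2<..<0}" "norm (snd w - x0) < r2" "g (snd w) < h'"
          have win: "snd w \<in> ball x0 (2 * \<rho>)" using w r \<rho> by (simp add: dist_norm norm_minus_commute)
          show "u w \<le> (1 - \<kappa>) * m"
          proof (cases "0 < g (snd w)")
            case True
            then show ?thesis using elim w by (auto simp: Z_def)
          next
            case False
            then have "snd w \<in> ball 0 1 - \<Omega>" using mem[OF win] win b1 by auto
            then have "u w = 0" using elim w T by auto
            then show ?thesis using \<kappa> m by simp
          qed
        qed
      qed
    qed
  qed
qed

text \<open>Iteration of \<open>boundary_growth\<close>: each step multiplies the bound by the same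
  factor \<open>1 - \<kappa>\<close> at the price of a smaller cylinder and a smaller height. No
  rate is extracted, since nothing is known about how fast the heights shrink.\<close>

lemma vanishing_at_boundary:
  fixes \<Omega> :: "'a::euclidean_space set" and s lam Lam \<rho> K G \<delta> r T :: real
  assumes s: "0 < s" "s < 1" and lam: "0 < lam" "lam \<le> Lam" and ch: "chart \<Omega> x0 \<rho> K G g dg"
    and \<delta>: "0 < \<delta>" and r: "r < \<rho>" and T: "T < 1"
  obtains h where "0 < h" "\<And>\<mu> u f. admissible s lam Lam \<Omega> \<mu> u f \<Longrightarrow> bounded_near x0 g T r h \<delta> u"
proof -
  obtain \<kappa> where \<kappa>: "0 < \<kappa>" "\<kappa> < 1" and step: "\<And>m r1 r2 T1 T2 h. 0 < m \<Longrightarrow> m \<le> 1 \<Longrightarrow> r2 < r1 \<Longrightarrow> r1 \<le> \<rho> \<Longrightarrow> T2 < T1 \<Longrightarrow> T1 \<le> 1 \<Longrightarrow> 0 < h \<Longrightarrow>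
      \<exists>h'>0. \<forall>\<mu> u f. admissible s lam Lam \<Omega> \<mu> u f \<longrightarrow> bounded_near x0 g T1 r1 h m u \<longrightarrow>
        bounded_near x0 g T2 r2 h' ((1 - \<kappa>) * m) u"
    by (rule boundary_growth[OF s lam ch]) blast
  have iter: "\<exists>h>0. \<forall>\<mu> u f. admissible s lam Lam \<Omega> \<mu> u f \<longrightarrow> bounded_near x0 g T r h ((1 - \<kappa>) ^ k) u"
    if "r < \<rho>" "T < 1" for k r T
    using that
  proof (induction k arbitrary: r T)
    case 0
    have "bounded_near x0 g T r 1 1 u" if "admissible s lam Lam \<Omega> \<mu> u f" for \<mu> u f
    proof -
      have "\<bar>u w\<bar> \<le> 1" for w using that unfolding admissible_def core_solution_def by blast
      then show ?thesis unfolding bounded_near_def by (auto simp: abs_le_iff)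
    qed
    then show ?case by (intro exI[of _ 1]) auto
  next
    case (Suc k)
    \<comment> \<open>The hypothesis is used on a cylinder halfway between the given one and the
      largest, so that any number of steps fits in between.\<close>
    obtain h where h: "0 < h" "\<And>\<mu> u f. admissible s lam Lam \<Omega> \<mu> u f \<Longrightarrow> bounded_near x0 g ((T + 1) / 2) ((r + \<rho>) / 2) h ((1 - \<kappa>) ^ k) u"
      using Suc.IH[of "(r + \<rho>) / 2" "(T + 1) / 2"] Suc.prems by auto
    have "\<exists>h'>0. \<forall>\<mu> u f. admissible s lam Lam \<Omega> \<mu> u f \<longrightarrow> bounded_near x0 g ((T + 1) / 2) ((r + \<rho>) / 2) h ((1 - \<kappa>) ^ k) u \<longrightarrow>
        bounded_near x0 g T r h' ((1 - \<kappa>) * (1 - \<kappa>) ^ k) u"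
      by (rule step) (use Suc.prems h \<kappa> in \<open>auto simp: power_le_one\<close>)
    then show ?case using h(2) by auto
  qed
  obtain k where k: "(1 - \<kappa>) ^ k < \<delta>" using real_arch_pow_inv[OF \<delta>, of "1 - \<kappa>"] \<kappa> by auto
  obtain h where h: "0 < h" "\<And>\<mu> u f. admissible s lam Lam \<Omega> \<mu> u f \<Longrightarrow> bounded_near x0 g T r h ((1 - \<kappa>) ^ k) u"
    using iter[OF r T, of k] by auto
  have "bounded_near x0 g T r h \<delta> u" if "admissible s lam Lam \<Omega> \<mu> u f" for \<mu> u f
    using h(2)[OF that] k unfolding bounded_near_def by (auto elim!: eventually_mono)
  with h(1) show thesis by (rule that)
qed

subsection \<open>The barrier\<close>

lemma frac_integral_scale:
  assumes B: "frac_integral s B I" and c: "0 < c"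
  shows "frac_integral s (\<lambda>r. B (c * r)) (c powr (2 * s) * I)"
proof -
  define F where "F = (\<lambda>r. indicator {0<..} r * (B r * r powr (- 1 - 2 * s)))"
  have "has_bochner_integral lborel (\<lambda>r. F (0 + c * r)) (I /\<^sub>R \<bar>c\<bar>)"
    using B c lborel_has_bochner_integral_real_affine_iff[of c F I 0] by (simp add: frac_integral_def F_def)
  then have "has_bochner_integral lborel (\<lambda>r. c powr (1 + 2 * s) * F (0 + c * r)) (c powr (1 + 2 * s) * (I /\<^sub>R \<bar>c\<bar>))"
    by (intro has_bochner_integral_mult_right)
  moreover have "c powr (1 + 2 * s) * F (0 + c * r) = indicator {0<..} r * (B (c * r) * r powr (- 1 - 2 * s))" for r
  proof (cases "0 < r")
    case True
    have "c powr (1 + 2 * s) * (c * r) powr (- 1 - 2 * s) = c powr (1 + 2 * s) * c powr (- 1 - 2 * s) * r powr (- 1 - 2 * s)"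
      by (simp only: powr_mult mult.assoc)
    also have "c powr (1 + 2 * s) * c powr (- 1 - 2 * s) = 1"
      using c by (simp only: powr_add[symmetric]) simp
    finally show ?thesis using True c by (simp add: F_def mult.left_commute[of "c powr (1 + 2 * s)"])
  next
    case False
    then have "\<not> 0 < c * r" using c by (simp add: zero_less_mult_iff)
    then show ?thesis using False by (simp add: F_def)
  qed
  moreover have eq: "c powr (1 + 2 * s) * (I /\<^sub>R \<bar>c\<bar>) = c powr (2 * s) * I"
    using c powr_add[of c 1 "2 * s"] by (simp add: field_simps)
  ultimately show ?thesis unfolding frac_integral_def eq by simp
qed

text \<open>Homogeneity: along a line on which the height is \<open>a\<close> with slope
  \<open>b\<close>, the one-sided power is a dilation of the standard one. For \<open>b = 0\<close>
  both sides vanish.\<close>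

lemma frac_integral_scaled_pow_diff:
  assumes p: "0 < p" "p \<le> 1" "p < 2 * s" and s: "0 < s" "s < 1" and a: "0 < a" and b: "0 \<le> b"
  shows "frac_integral s (\<lambda>r. a powr p * pow_diff p (b * r / a)) (a powr (p - 2 * s) * (b powr (2 * s) * pow_const s p))"
proof (cases "b = 0")
  case True
  have "frac_integral s (\<lambda>r. 0 * pow_diff p r) (0 * pow_const s p)"
    by (intro frac_integral_cmult frac_integral_pow_diff p s)
  then show ?thesis using True by (simp add: pow_diff_def)
next
  case False
  then have ba: "0 < b / a" using a b by simp
  have "frac_integral s (\<lambda>r. a powr p * pow_diff p ((b / a) * r)) (a powr p * ((b / a) powr (2 * s) * pow_const s p))"
    by (intro frac_integral_cmult frac_integral_scale frac_integral_pow_diff p s ba)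
  moreover have "a powr p * ((b / a) powr (2 * s) * pow_const s p) = a powr (p - 2 * s) * (b powr (2 * s) * pow_const s p)"
    using a b by (simp add: powr_divide powr_diff)
  ultimately show ?thesis by simp
qed

lemma pow_diff_scaled:
  fixes a d q :: real
  assumes a: "0 < a"
  shows "(max 0 (a + d)) powr q + (max 0 (a - d)) powr q - 2 * a powr q = a powr q * pow_diff q (\<bar>d\<bar> / a)"
proof -
  have "(max 0 (a + \<bar>d\<bar>)) powr q = a powr q * (1 + \<bar>d\<bar> / a) powr q"
  proof -
    have "max 0 (a + \<bar>d\<bar>) = a * (1 + \<bar>d\<bar> / a)" using a by (simp add: field_simps)
    then show ?thesis by (simp only: powr_mult)
  qed
  moreover have "(max 0 (a - \<bar>d\<bar>)) powr q = a powr q * (max 0 (1 - \<bar>d\<bar> / a)) powr q"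
  proof -
    have "max 0 (a - \<bar>d\<bar>) = a * max 0 (1 - \<bar>d\<bar> / a)" using a by (simp add: max_def field_simps)
    then show ?thesis by (simp only: powr_mult)
  qed
  moreover have "(max 0 (a + d)) powr q + (max 0 (a - d)) powr q = (max 0 (a + \<bar>d\<bar>)) powr q + (max 0 (a - \<bar>d\<bar>)) powr q"
    by (cases "0 \<le> d") auto
  ultimately show ?thesis by (simp add: pow_diff_def right_diff_distrib distrib_left)
qed

section \<open>Powers of positive parts under perturbation\<close>

lemma powr_diff_le:
  fixes x y m q :: real
  assumes "0 < m" "m \<le> x" "m \<le> y" "0 \<le> q" "q \<le> 1"
  shows "\<bar>x powr q - y powr q\<bar> \<le> m powr (q - 1) * \<bar>x - y\<bar>"
proof -
  have *: "x powr q - y powr q \<le> m powr (q - 1) * \<bar>x - y\<bar>" if "m \<le> x" "m \<le> y" for x y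
  proof (cases "y \<le> x")
    case True
    have "x powr q \<le> y powr q + q * y powr (q - 1) * (x - y)"
      using powr_add_le_tangent[of y "x - y" q] assms that True by simp
    also have "q * y powr (q - 1) * (x - y) \<le> (1 * m powr (q - 1)) * (x - y)"
      using assms that True powr_mono2'[of "q - 1" m y] by (intro mult_right_mono mult_mono) auto
    finally show ?thesis using True by simp
  next
    case False
    then have "x powr q \<le> y powr q" using assms that by (intro powr_mono2) auto
    then show ?thesis using powr_ge_zero[of m "q - 1"] by (smt (verit) mult_nonneg_nonneg abs_ge_zero)
  qed
  show ?thesis using *[of x y] *[of y x] assms by (simp add: abs_le_iff abs_minus_commute)
qed

lemma pos_part_powr_diff_le:
  fixes x y q :: real
  assumes "0 \<le> q" "q \<le> 1"
  shows "\<bar>(max 0 x) powr q - (max 0 y) powr q\<bar> \<le> \<bar>x - y\<bar> powr q"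
proof -
  have *: "(max 0 x) powr q - (max 0 y) powr q \<le> \<bar>x - y\<bar> powr q" for x y :: real
  proof -
    have "(max 0 x) powr q \<le> (max 0 y + \<bar>x - y\<bar>) powr q" using assms by (intro powr_mono2) auto
    also have "\<dots> \<le> (max 0 y) powr q + \<bar>x - y\<bar> powr q" using assms by (intro powr_add_le) auto
    finally show ?thesis by simp
  qed
  show ?thesis using *[of x y] *[of y x] by (simp add: abs_le_iff abs_minus_commute)
qed

text \<open>
  Below, \<open>d\<close> and \<open>e\<close> are the first order term and the remainder of the expansion of \<open>g\<close> at a point at
  height \<open>a\<close>. The error is integrable against the kernel and of lower order in \<open>a\<close> than the gain
  \<open>a\<^sup>p\<^sup>-\<^sup>2\<^sup>s\<close> of the barrier.
\<close>

lemma pos_part_powr_expansion: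
  fixes s \<sigma> q a d e r K G :: real
  assumes s: "0 < s" "s < 1" and \<sigma>: "0 \<le> \<sigma>" "\<sigma> \<le> 1" "2 * s + \<sigma> \<le> 2" and q: "s \<le> q" "q \<le> 1"
    and a: "0 < a" "a \<le> 1" and r: "0 < r" "r \<le> 1" and KG: "1 \<le> K" "1 \<le> G"
    and d: "\<bar>d\<bar> \<le> G * r" and e: "\<bar>e\<bar> \<le> K * r\<^sup>2"
  shows "\<bar>(max 0 (a + d + e)) powr q - (max 0 (a + d)) powr q\<bar> \<le> 4 * K * (G + K) * (a powr - \<sigma> * r powr (2 * s + \<sigma>))"
proof -
  define M where "M = 4 * (G + K)"
  have M: "8 \<le> M" using KG by (simp add: M_def)
  show ?thesis
  \<comment> \<open>Short steps stay above half the height, where the power is Lipschitz. For longer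
    ones its Hoelder continuity suffices, because \<open>r > a / M\<close> converts
    \<open>r powr - \<sigma>\<close> into a multiple of \<open>a powr - \<sigma>\<close>.\<close>
  proof (cases "r \<le> a / M")
    case True
    then have rM: "4 * (G * r) + 4 * (K * r) \<le> a" using M by (simp add: field_simps M_def)
    have ra: "r \<le> a" using True frac_le[of a a 1 M] M a by simp
    have "K * r\<^sup>2 \<le> K * r" using KG r by (simp add: power2_eq_square mult_left_le)
    then have big: "a / 2 \<le> a + d + e" "a / 2 \<le> a + d"
      using d e rM mult_pos_pos[of G r] mult_pos_pos[of K r] KG r a by linarith+
    have "\<bar>(max 0 (a + d + e)) powr q - (max 0 (a + d)) powr q\<bar> = \<bar>(a + d + e) powr q - (a + d) powr q\<bar>"
      using big a by (simp add: max_def)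
    also have "\<dots> \<le> (a / 2) powr (q - 1) * \<bar>(a + d + e) - (a + d)\<bar>"
      using big a s q by (intro powr_diff_le) auto
    also have "\<dots> \<le> (2 * a powr (s - 1)) * (K * r\<^sup>2)"
    proof (intro mult_mono)
      have "(a / 2) powr (q - 1) = (1 / 2) powr (q - 1) * a powr (q - 1)"
        using powr_mult[of "1 / 2" a "q - 1"] by simp
      also have "\<dots> \<le> 2 * a powr (s - 1)"
      proof (intro mult_mono)
        show "(1 / 2) powr (q - 1) \<le> (2::real)"
          using powr_mono'[of "-1" "q - 1" "1 / 2 :: real"] s q by (simp add: powr_minus)
        show "a powr (q - 1) \<le> a powr (s - 1)" using a q by (intro powr_mono') auto
      qed auto
      finally show "(a / 2) powr (q - 1) \<le> 2 * a powr (s - 1)" .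
    qed (use e in auto)
    also have "r\<^sup>2 = r powr (2 - 2 * s - \<sigma>) * r powr (2 * s + \<sigma>)"
      using r by (simp add: powr_add[symmetric])
    also have "(2 * a powr (s - 1)) * (K * (r powr (2 - 2 * s - \<sigma>) * r powr (2 * s + \<sigma>)))
        \<le> (2 * a powr (s - 1)) * (K * (a powr (2 - 2 * s - \<sigma>) * r powr (2 * s + \<sigma>)))"
      using ra r \<sigma> KG by (intro mult_left_mono mult_right_mono powr_mono2) auto
    also have "\<dots> = 2 * K * (a powr (1 - s) * (a powr - \<sigma> * r powr (2 * s + \<sigma>)))"
    proof -
      have "a powr (s - 1) * a powr (2 - 2 * s - \<sigma>) = a powr (1 - s) * a powr - \<sigma>"
        unfolding powr_add[symmetric] by (rule arg_cong[where f = "(powr) a"]) simp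
      then show ?thesis by simp
    qed
    also have "\<dots> \<le> 2 * K * (1 * (a powr - \<sigma> * r powr (2 * s + \<sigma>)))"
      using a s KG by (intro mult_left_mono mult_right_mono powr_le1) auto
    also have "\<dots> \<le> (4 * K * (G + K)) * (a powr - \<sigma> * r powr (2 * s + \<sigma>))"
    proof -
      have "2 * K * 1 \<le> 4 * K * (G + K)" using KG by (intro mult_mono) auto
      then have "2 * K * (a powr - \<sigma> * r powr (2 * s + \<sigma>)) \<le> 4 * K * (G + K) * (a powr - \<sigma> * r powr (2 * s + \<sigma>))"
        by (intro mult_right_mono) auto
      then show ?thesis by simp
    qed
    finally show ?thesis .
  next
    case False
    have "\<bar>(max 0 (a + d + e)) powr q - (max 0 (a + d)) powr q\<bar> \<le> \<bar>(a + d + e) - (a + d)\<bar> powr q"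
      using s q by (intro pos_part_powr_diff_le) auto
    also have "\<dots> \<le> (K * r\<^sup>2) powr q" using e s q by (intro powr_mono2) auto
    also have "\<dots> = K powr q * r\<^sup>2 powr q" by (rule powr_mult)
    also have "\<dots> \<le> K powr 1 * (r powr (2 * s))"
    proof (intro mult_mono)
      show "K powr q \<le> K powr 1" using KG q by (intro powr_mono) auto
      have "r\<^sup>2 powr q = r powr (2 * q)" using r powr_powr[of r 2 q] by simp
      also have "\<dots> \<le> r powr (2 * s)" using r q by (intro powr_mono') auto
      finally show "r\<^sup>2 powr q \<le> r powr (2 * s)" .
    qed auto
    also have "r powr (2 * s) = r powr - \<sigma> * r powr (2 * s + \<sigma>)"
      unfolding powr_add[symmetric] by simp
    also have "K powr 1 * (r powr - \<sigma> * r powr (2 * s + \<sigma>)) \<le> K * ((M * a powr - \<sigma>) * r powr (2 * s + \<sigma>))"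
    proof -
      have "r powr - \<sigma> \<le> (a / M) powr - \<sigma>" using False a M \<sigma> by (intro powr_mono2') auto
      also have "\<dots> = M powr \<sigma> * a powr - \<sigma>" using a M by (simp add: powr_divide powr_minus_divide)
      also have "\<dots> \<le> M powr 1 * a powr - \<sigma>" using M \<sigma> by (intro mult_right_mono powr_mono) auto
      finally have "r powr - \<sigma> \<le> M * a powr - \<sigma>" using M by simp
      then have "K * (r powr - \<sigma> * r powr (2 * s + \<sigma>)) \<le> K * ((M * a powr - \<sigma>) * r powr (2 * s + \<sigma>))"
        using KG by (intro mult_left_mono mult_right_mono) auto
      then show ?thesis using KG by simp
    qed
    finally show ?thesis by (simp add: M_def mult_ac)
  qed
qed

text \<open>The slopes of \<open>g\<close> along the lines enter the gain with the power
  \<open>2 * s\<close>, whose integral over the directions is at least \<open>lam\<close>. The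
  constant \<open>A\<close> is chosen before the slack \<open>d\<close>; the vanishing at the
  boundary serves only to keep the touching point above a strip that depends on
  \<open>d\<close>.\<close>

lemma boundary_barrier:
  fixes \<Omega> :: "'a::euclidean_space set" and s lam Lam \<rho> K G :: real
  assumes s: "0 < s" "s < 1" and lam: "0 < lam" "lam \<le> Lam" and ch: "chart \<Omega> x0 \<rho> K G g dg"
  obtains A where "0 < A"
    "\<And>\<mu> u f. admissible s lam Lam \<Omega> \<mu> u f \<Longrightarrow>
      AE w in lborel. fst w \<in> {-7/8<..<0} \<longrightarrow> norm (snd w - x0) < \<rho> / 4 \<longrightarrow> 0 < g (snd w) \<longrightarrow>
        u w \<le> A * g (snd w) powr s"
proof -
  have Lam: "0 < Lam" "0 \<le> Lam" using lam by auto
  have \<rho>: "0 < \<rho>" "\<rho> \<le> 1" and b1: "ball x0 (2 * \<rho>) \<subseteq> ball 0 1" and KG: "1 \<le> K" "1 \<le> G"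
    and taylor: "\<And>x y. \<bar>g (x + y) - g x - dg x \<bullet> y\<bar> \<le> K * (norm y)\<^sup>2" and dg1: "\<And>x. 1 \<le> norm (dg x)"
    and mem: "\<And>x. x \<in> ball x0 (2 * \<rho>) \<Longrightarrow> x \<in> \<Omega> \<longleftrightarrow> 0 < g x"
    and dgG: "\<And>x. x \<in> ball x0 (2 * \<rho>) \<Longrightarrow> norm (dg x) \<le> G"
    and lip: "\<And>x y. x \<in> ball x0 (2 * \<rho>) \<Longrightarrow> y \<in> ball x0 (2 * \<rho>) \<Longrightarrow> \<bar>g x - g y\<bar> \<le> G * norm (x - y)"
    using ch by (auto simp: chart_def)
  \<comment> \<open>Small enough for \<open>p \<le> 1\<close>, \<open>p < 2 * s\<close> and
    \<open>2 * s + \<sigma> \<le> 2\<close>, and for \<open>2 * \<sigma> < s\<close>, by which the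
    gain is of larger order than the error.\<close>
  define \<sigma> where "\<sigma> = s * (1 - s) / 4"
  define p where "p = s + \<sigma>"
  have \<sigma>: "0 < \<sigma>" "4 * \<sigma> \<le> s" "4 * \<sigma> \<le> 1 - s"
    using s by (auto simp: \<sigma>_def mult_left_le mult_left_le_one_le)
  have p: "0 < p" "s \<le> p" "p \<le> 1" "p < 2 * s" "s < p" using s \<sigma> by (auto simp: p_def)
  define cp where "cp = pow_const s p"
  have cp: "0 < cp" unfolding cp_def by (rule pow_const_pos[OF s]) (use p in auto)
  \<comment> \<open>Up to this height the subtracted power is at most half of
    \<open>y powr s\<close>.\<close>
  define \<tau>0 where "\<tau>0 = (1 / 2 :: real) powr (1 / \<sigma>)"
  have \<tau>0: "0 < \<tau>0" "\<tau>0 \<le> 1" "\<tau>0 powr \<sigma> = 1 / 2"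
    using \<sigma> by (auto simp: \<tau>0_def powr_powr intro: powr_le1)
  define H where "H = (\<lambda>y. (max 0 y) powr s - (max 0 y) powr p)"
  have Hc: "continuous_on UNIV H"
    unfolding H_def using s p
    by (intro continuous_on_diff continuous_on_powr' continuous_on_max continuous_on_const continuous_on_id) auto
  have H0: "0 \<le> H y" if "y \<le> 1" for y
    using that p by (cases "0 < y") (auto simp: H_def intro: powr_mono')
  have Hs: "H y \<le> y powr s" if "0 < y" for y using that by (simp add: H_def)
  have Hlow: "y powr s / 2 \<le> H y" if "0 < y" "y \<le> \<tau>0" for y
  proof -
    have "y powr \<sigma> \<le> 1 / 2" using powr_mono2[of \<sigma> y \<tau>0] \<sigma> that \<tau>0 by simp
    then have "y powr s * y powr \<sigma> \<le> y powr s * (1 / 2)" by (intro mult_left_mono) auto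
    then show ?thesis using that by (simp add: H_def p_def powr_add)
  qed
  \<comment> \<open>Jumps shorter than \<open>R\<close> stay in the chart and raise the height by at
    most \<open>\<tau>0 / 2\<close>, hence from below \<open>\<tau>\<close> to no more than
    \<open>\<tau>0\<close>.\<close>
  define R where "R = min (\<rho> / 4) (\<tau>0 / (2 * G))"
  have R: "0 < R" "R \<le> \<rho> / 4" "G * R \<le> \<tau>0 / 2" "R \<le> 1"
  proof -
    show "0 < R" using \<rho> \<tau>0 KG by (simp add: R_def)
    show *: "R \<le> \<rho> / 4" unfolding R_def by (rule min.cobounded1)
    have "G * R \<le> G * (\<tau>0 / (2 * G))" unfolding R_def using KG by (intro mult_left_mono min.cobounded2) auto
    then show "G * R \<le> \<tau>0 / 2" using KG by simp
    show "R \<le> 1" using * \<rho> by simp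
  qed
  define C1 where "C1 = 4 * (4 * K * (G + K))"
  define E1 where "E1 = R powr (2 * s + \<sigma> - 2 * s) / (2 * s + \<sigma> - 2 * s)"
  define E2 where "E2 = R powr (- 2 * s) / (2 * s)"
  define E3 where "E3 = R powr (p - 2 * s) / (2 * s - p)"
  define E4 where "E4 = R powr (2 - 2 * s) / (2 - 2 * s)"
  have C1: "0 \<le> C1" using KG by (simp add: C1_def)
  have E: "0 \<le> E1" "0 \<le> E2" "0 \<le> E3" "0 \<le> E4" using s \<sigma> p by (auto simp: E1_def E2_def E3_def E4_def)
  have F1: "frac_integral s (\<lambda>r. indicator {0<..<R} r * r powr (2 * s + \<sigma>)) E1"
    unfolding E1_def by (rule frac_integral_inner) (use \<sigma> R in auto)
  have F2: "frac_integral s (indicator {R..}) E2"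
    unfolding E2_def by (rule frac_integral_outer_const) (use s R in auto)
  have F3: "frac_integral s (\<lambda>r. indicator {R..} r * r powr p) E3"
    unfolding E3_def by (rule frac_integral_outer) (use p R in auto)
  have F4: "frac_integral s (\<lambda>r. indicator {0<..<R} r * r\<^sup>2) E4"
    unfolding E4_def by (rule frac_integral_inner_square) (use s R in auto)
  \<comment> \<open>\<open>M0\<close> collects the errors proportional to \<open>A\<close>,
    \<open>C5\<close> further down those that are not. The former are absorbed by small heights, the
    latter by a large \<open>A\<close>.\<close>
  define M0 where "M0 = 2 * Lam * (C1 * E1 + 2 * E2 + G powr p * E3)"
  have "filterlim (\<lambda>a::real. cp * lam * a powr - (s - 2 * \<sigma>)) at_top (at_right 0)"
  proof -
    have "0 < cp * lam" "0 < s - 2 * \<sigma>" using cp lam \<sigma> s by auto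
    then show ?thesis by real_asymp
  qed
  then have "\<forall>\<^sub>F a in at_right 0. M0 < cp * lam * a powr - (s - 2 * \<sigma>)" unfolding filterlim_at_top_dense by blast
  then obtain \<tau>1 where \<tau>1: "0 < \<tau>1" "\<And>a. 0 < a \<Longrightarrow> a < \<tau>1 \<Longrightarrow> M0 < cp * lam * a powr - (s - 2 * \<sigma>)"
    by (auto simp: eventually_at_right_field)
  define \<tau> where "\<tau> = min (\<tau>0 / 2) (\<tau>1 / 2)"
  have \<tau>: "0 < \<tau>" "\<tau> \<le> \<tau>0 / 2" "\<tau> < \<tau>1"
  proof -
    show "0 < \<tau>" "\<tau> \<le> \<tau>0 / 2" using \<tau>0 \<tau>1 by (auto simp: \<tau>_def)
    have "\<tau> \<le> \<tau>1 / 2" unfolding \<tau>_def by (rule min.cobounded2)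
    then show "\<tau> < \<tau>1" using \<tau>1(1) by simp
  qed
  define N1 where "N1 = 1 / (\<rho> / 4)\<^sup>2"
  have N1: "0 < N1" "N1 * (\<rho> / 4)\<^sup>2 = 1" using \<rho> by (auto simp: N1_def)
  define C5 where "C5 = 2 * Lam * (4 * E2 + 2 * N1 * E4)"
  have C5: "0 \<le> C5" using Lam E N1 by (simp add: C5_def)
  \<comment> \<open>The first bound lifts the barrier to at least 1 between the heights
    \<open>\<tau>\<close> and \<open>\<tau>0\<close>. The second beats \<open>C5\<close> and the 17
    from the time penalty and the right-hand side, with one unit to spare.\<close>
  define A where "A = max (2 / \<tau> powr s) ((C5 + 18) / (cp * lam))"
  have A: "0 < A" "2 \<le> A * \<tau> powr s" "C5 + 18 \<le> A * (cp * lam)"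
  proof -
    have "0 < 2 / \<tau> powr s" using \<tau> by simp
    then show "0 < A" unfolding A_def by (rule less_le_trans) (rule max.cobounded1)
    have "2 / \<tau> powr s \<le> A" by (simp add: A_def)
    then show "2 \<le> A * \<tau> powr s" using \<tau> by (simp add: pos_divide_le_eq)
    have "(C5 + 18) / (cp * lam) \<le> A" by (simp add: A_def)
    then show "C5 + 18 \<le> A * (cp * lam)" using cp lam by (simp add: pos_divide_le_eq)
  qed
  have AH: "1 \<le> A * H y" if "\<tau> \<le> y" "y \<le> \<tau>0" for y
  proof -
    have "\<tau> powr s \<le> y powr s" using that \<tau> s by (intro powr_mono2) auto
    then have "\<tau> powr s / 2 \<le> H y" using Hlow[of y] that \<tau> by simp
    then have "A * (\<tau> powr s / 2) \<le> A * H y" using A by (intro mult_left_mono) auto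
    moreover have "A * (\<tau> powr s / 2) = A * \<tau> powr s / 2" by simp
    ultimately show ?thesis using A(2) by linarith
  qed
  show thesis
  proof (rule that[OF A(1)])
    fix \<mu> u f assume adm: "admissible s lam Lam \<Omega> \<mu> u f"
    have mu: "spectral_measure s lam Lam \<mu>" and sol: "core_solution s \<mu> (\<Omega> \<inter> ball 0 1) u f"
      using adm by (auto simp: admissible_def)
    have u1: "\<bar>u w\<bar> \<le> 1" for w :: "real \<times> 'a" using sol unfolding core_solution_def by blast
    note mu' = spectral_measureD[OF mu Lam(2)]
    interpret finite_measure \<mu> by (rule mu')
    have bu: "bounded_fun u" by (rule bounded_fun_core[OF sol])
    interpret bounded_fun u by (rule bu)
    have [measurable]: "(\<lambda>x. x) \<in> measurable \<mu> borel" by (rule mu')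
    define Z where "Z = {w :: real \<times> 'a. fst w \<in> {-7/8<..<0} \<and> norm (snd w - x0) < \<rho> / 4 \<and> 0 < g (snd w) \<and> g (snd w) < \<tau>}"
    have "AE w in lborel. w \<in> Z \<longrightarrow> u w \<le> A * g (snd w) powr s"
    proof (rule AE_le_of_moll[where R = 4])
      fix z assume "z \<in> Z"
      then obtain t1 x1 where z: "z = (t1, x1)" and t1: "-7/8 < t1" "t1 < 0" and x1: "norm (x1 - x0) < \<rho> / 4"
        and g1: "0 < g x1" "g x1 < \<tau>" by (cases z) (auto simp: Z_def)
      have "norm x1 < 1"
      proof -
        have "x1 \<in> ball x0 (2 * \<rho>)" using x1 \<rho> by (simp add: dist_norm norm_minus_commute)
        then show ?thesis using b1 by auto
      qed
      then show "norm z < 4" using norm_Pair_le[of t1 x1] t1 by (simp add: z)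
      fix d :: real assume d: "0 < d"
      \<comment> \<open>The height \<open>h\<close> depends on \<open>d\<close>, and through
        \<open>e0\<close> so does the admissible range of \<open>e\<close>; the constant
        \<open>A\<close> does not.\<close>
      obtain h where h: "0 < h" and near: "\<And>\<mu> u f. admissible s lam Lam \<Omega> \<mu> u f \<Longrightarrow> bounded_near x0 g (31/32) (3 * \<rho> / 4) h d u"
        by (rule vanishing_at_boundary[OF s lam ch d, of "3 * \<rho> / 4" "31/32"]) (use \<rho> in auto)
      define e0 where "e0 = min (min (1/64) (\<rho> / 4)) (min (- t1) (h / (3 * G)))"
      have e0: "0 < e0" using \<rho> t1 h KG by (simp add: e0_def)
      show "\<exists>e0>0. \<forall>e. 0 < e \<longrightarrow> e < e0 \<longrightarrow> moll e u z \<le> A * g (snd z) powr s + d"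
      proof (intro exI[of _ e0] conjI allI impI e0)
        fix e assume e: "0 < e" "e < e0"
        have ee: "e < 1/64" "e < \<rho> / 4" "e < - t1" "3 * (G * e) < h"
          using e KG by (auto simp: e0_def field_simps)
        have Ge: "0 < G * e" using e KG by simp
        define U where "U = moll e u"
        have Uc: "continuous_on S U" for S unfolding U_def by (rule moll_continuous[OF e(1)])
        have Ub: "- 1 \<le> U z" "U z \<le> 1" for z using moll_le_1[OF e(1), of z] by (auto simp: U_def)
        have "U (t1, x1) \<le> A * H (g x1) + d"
        proof (rule ccontr)
          assume "\<not> U (t1, x1) \<le> A * H (g x1) + d"
          then have big: "A * H (g x1) + d < U (t1, x1)" by simp
          define pen where "pen = (\<lambda>x. N1 * (norm (x - x1))\<^sup>2)"
          have pen0: "0 \<le> pen x" for x using N1 by (simp add: pen_def)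
          have pen1: "1 \<le> pen x" if "\<rho> / 4 \<le> norm (x - x1)" for x
          proof -
            have "N1 * (\<rho> / 4)\<^sup>2 \<le> pen x" unfolding pen_def using that N1 \<rho> by (intro mult_left_mono power_mono) auto
            then show ?thesis using N1 by simp
          qed
          \<comment> \<open>The penalties reach 1, the bound of \<open>U\<close>, at distance
            \<open>\<rho> / 4\<close> from \<open>x1\<close> and at time
            \<open>t1 - 1/16\<close>.\<close>
          define \<Phi> where "\<Phi> = (\<lambda>t x. U (t, x) - A * H (g x) - pen x - 16 * (t1 - t))"
          define D where "D = {x \<in> cball x1 (\<rho> / 4). g x \<le> \<tau>}"
          have Din: "cball x1 (\<rho> / 4) \<subseteq> ball x0 (2 * \<rho>)"
          proof
            fix x assume "x \<in> cball x1 (\<rho> / 4)"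
            then show "x \<in> ball x0 (2 * \<rho>)"
              using norm_triangle_ineq[of "x - x1" "x1 - x0"] x1 \<rho> by (simp add: dist_norm norm_minus_commute)
          qed
          have gcont: "continuous_on (cball x1 (\<rho> / 4)) g"
          proof (rule lipschitz_on_continuous_on)
            show "G-lipschitz_on (cball x1 (\<rho> / 4)) g"
            proof (rule lipschitz_onI)
              fix x y assume "x \<in> cball x1 (\<rho> / 4)" "y \<in> cball x1 (\<rho> / 4)"
              then have "x \<in> ball x0 (2 * \<rho>)" "y \<in> ball x0 (2 * \<rho>)" using Din by blast+
              then show "dist (g x) (g y) \<le> G * dist x y" using lip[of x y] by (simp add: dist_norm)
            qed (use KG in simp)
          qed
          have cD: "compact D"
          proof -
            have "closedin (top_of_set (cball x1 (\<rho> / 4))) (cball x1 (\<rho> / 4) \<inter> g -` {..\<tau>})"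
              by (intro continuous_closedin_preimage gcont) auto
            then have "compact (cball x1 (\<rho> / 4) \<inter> g -` {..\<tau>})" by (rule closedin_compact[OF compact_cball])
            moreover have "cball x1 (\<rho> / 4) \<inter> g -` {..\<tau>} = D" by (auto simp: D_def)
            ultimately show ?thesis by simp
          qed
          define Q where "Q = {t1 - 1/16..t1} \<times> D"
          have cQ: "compact Q" unfolding Q_def by (intro compact_Times cD compact_Icc)
          have in1: "(t1, x1) \<in> Q" using \<rho> g1 by (simp add: Q_def D_def)
          have gQ: "continuous_on Q (\<lambda>p. g (snd p))"
            by (rule continuous_on_compose2[OF gcont continuous_on_snd]) (auto simp: Q_def D_def intro: continuous_intros)
          have "continuous_on Q (\<lambda>p. \<Phi> (fst p) (snd p))"
            unfolding \<Phi>_def pen_def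
            by (intro continuous_intros continuous_on_compose2[OF Uc[of UNIV]] continuous_on_compose2[OF Hc gQ]) auto
          then obtain P where P: "P \<in> Q" "\<And>q. q \<in> Q \<Longrightarrow> \<Phi> (fst q) (snd q) \<le> \<Phi> (fst P) (snd P)"
            using continuous_attains_sup[OF cQ, of "\<lambda>p. \<Phi> (fst p) (snd p)"] in1 by blast
          obtain t x where Peq: "P = (t, x)" by (cases P)
          have tx: "t1 - 1/16 \<le> t" "t \<le> t1" "norm (x - x1) \<le> \<rho> / 4" "g x \<le> \<tau>"
            using P(1) by (auto simp: Q_def D_def Peq dist_norm norm_minus_commute)
          have \<Phi>big: "d < \<Phi> t x"
          proof -
            have "\<Phi> t1 x1 = U (t1, x1) - A * H (g x1)" by (simp add: \<Phi>_def pen_def)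
            then show ?thesis using P(2)[OF in1] big by (simp add: Peq)
          qed
          define a where "a = g x"
          have AH0: "0 \<le> A * H y" if "y \<le> 1" for y using H0[OF that] A by simp
          have a1: "a \<le> 1" using tx \<tau> \<tau>0 by (simp add: a_def)
          have Ubig: "d < U (t, x)" using \<Phi>big AH0[OF a1] pen0[of x] tx by (simp add: \<Phi>_def a_def)
          have tr: "- (31/32) \<le> t - e" "t + e \<le> 0" "-1 < t - e" "t + e < 0"
            using tx ee t1 by auto
          have nxx0: "norm (x - x0) < \<rho> / 2"
            using norm_triangle_ineq[of "x - x1" "x1 - x0"] tx x1 by simp
          then have xin: "x \<in> ball x0 (2 * \<rho>)" using \<rho> by (simp add: dist_norm norm_minus_commute)
          \<comment> \<open>At lower heights the vanishing at the boundary gives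
            \<open>U \<le> d\<close>, against the positivity at the touching point. Hence the ball
            of radius \<open>e\<close> around it lies in the domain.\<close>
          have aGe: "2 * (G * e) < a"
          proof (rule ccontr)
            assume "\<not> 2 * (G * e) < a"
            then have "U (t, x) \<le> d" unfolding U_def
              by (intro moll_bounded_near[OF bu ch near[OF adm] e(1) _ tr(1,2)]) (use nxx0 ee \<rho> in \<open>auto simp: a_def\<close>)
            then show False using Ubig by simp
          qed
          have a: "0 < a" "a \<le> \<tau>" "a < \<tau>1" using aGe Ge tx \<tau> by (auto simp: a_def)
          have nearin: "x + y \<in> ball x0 (2 * \<rho>)" if y: "norm y \<le> R" for y
          proof -
            have "norm (x + y - x0) \<le> norm (x - x0) + norm y"
              using norm_triangle_ineq[of "x - x0" y] by (simp add: algebra_simps)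
            then show ?thesis using nxx0 y R \<rho> by (simp add: dist_norm norm_minus_commute)
          qed
          \<comment> \<open>Points outside the compact set are no competitors, but there barrier and
            penalty together are at least 1 and dominate \<open>U\<close>.\<close>
          have diffp: "U (t, x + y) - U (t, x) \<le> A * H (g (x + y)) - A * H a + pen (x + y) - pen x" if y: "norm y \<le> R" for y
          proof -
            have "\<bar>g (x + y) - g x\<bar> \<le> G * norm y" using lip[OF nearin[OF y] xin] by simp
            also have "\<dots> \<le> G * R" using y KG by (intro mult_left_mono) auto
            finally have gy: "g (x + y) \<le> \<tau>0" using a R \<tau> by (simp add: a_def)
            have out: ?thesis if "1 \<le> A * H (g (x + y)) + pen (x + y)"
              using that \<Phi>big Ub(2)[of "(t, x + y)"] d tx by (simp add: \<Phi>_def a_def)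
            show ?thesis
            proof (cases "norm (x + y - x1) \<le> \<rho> / 4")
              case True
              show ?thesis
              proof (cases "g (x + y) \<le> \<tau>")
                case g: True
                have "(t, x + y) \<in> Q" using tx True g by (auto simp: Q_def D_def dist_norm norm_minus_commute)
                from P(2)[OF this] show ?thesis by (simp add: Peq \<Phi>_def a_def)
              next
                case False
                show ?thesis by (rule out) (use AH[of "g (x + y)"] False gy pen0[of "x + y"] in auto)
              qed
            next
              case False
              show ?thesis by (rule out) (use pen1[of "x + y"] False AH0[of "g (x + y)"] gy \<tau>0 in auto)
            qed
          qed
          have t0t: "t1 - 1/16 < t"
          proof (rule ccontr)
            assume "\<not> t1 - 1/16 < t"
            then have "16 * (t1 - t) = 1" using tx by simp
            then show False using \<Phi>big pen0[of x] AH0[OF a1] Ub(2)[of "(t, x)"] d by (simp add: \<Phi>_def a_def)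
          qed
          have cb: "cball x e \<subseteq> \<Omega> \<inter> ball 0 1"
          proof
            fix w assume w: "w \<in> cball x e"
            have "norm (w - x0) \<le> e + norm (x - x0)"
              using norm_triangle_ineq[of "w - x" "x - x0"] w by (simp add: dist_norm norm_minus_commute)
            then have win: "w \<in> ball x0 (2 * \<rho>)"
              using nxx0 ee \<rho> by (simp add: dist_norm norm_minus_commute)
            have "\<bar>g w - g x\<bar> \<le> G * norm (w - x)" by (rule lip[OF win xin])
            also have "\<dots> \<le> G * e" using w KG by (intro mult_left_mono) (auto simp: dist_norm norm_minus_commute)
            finally have "0 < g w" using aGe Ge by (simp add: a_def)
            then show "w \<in> \<Omega> \<inter> ball 0 1" using mem[OF win] win b1 by auto
          qed
          obtain hx where hx: "\<bar>hx\<bar> \<le> 1" "((\<lambda>\<tau>. U (\<tau>, x)) has_real_derivative (stable_at s \<mu> (\<lambda>y. U (t, y)) x + hx)) (at t)"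
            using moll_equation[OF s mu Lam(2) sol e(1) cball_Pair_subset[OF tr(3,4) cb]] unfolding U_def by blast
          have "((\<lambda>\<tau>'. \<Phi> \<tau>' x) has_real_derivative (stable_at s \<mu> (\<lambda>y. U (t, y)) x + hx + 16)) (at t)"
            unfolding \<Phi>_def by (auto intro!: derivative_eq_intros hx(2))
          then have "0 \<le> stable_at s \<mu> (\<lambda>y. U (t, y)) x + hx + 16"
          proof (rule deriv_nonneg_at_max[OF _ t0t])
            fix \<tau>' assume "t1 - 1/16 \<le> \<tau>'" "\<tau>' \<le> t"
            then have "(\<tau>', x) \<in> Q" using tx by (auto simp: Q_def D_def dist_norm norm_minus_commute)
            from P(2)[OF this] show "\<Phi> \<tau>' x \<le> \<Phi> t x" by (simp add: Peq)
          qed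
          then have low: "- 17 \<le> stable_at s \<mu> (\<lambda>y. U (t, y)) x" using hx(1) by linarith
          obtain B where B: "\<And>t. bdd_second_diff B (\<lambda>x. U (t, x))"
            unfolding U_def by (rule moll_slice_bdd_second_diff[OF bu e(1)]) blast
          define b where "b = (\<lambda>\<theta>. \<bar>dg x \<bullet> \<theta>\<bar>)"
          \<comment> \<open>The first two terms are the second differences of the barrier for the
            linearised height, kept for all \<open>r\<close> so that their integrals are the known
            constants. The others correct this: curvature and penalty for \<open>r < R\<close>, and
            for longer jumps the crude bound 4 together with a compensation for the first two
            terms.\<close>
          define B1 where "B1 = (\<lambda>\<theta> r. A * (a powr s * pow_diff s (b \<theta> * r / a)) + (- A) * (a powr p * pow_diff p (b \<theta> * r / a)) +
            (A * C1 * a powr - \<sigma>) * (indicator {0<..<R} r * r powr (2 * s + \<sigma>)) + (2 * A * a powr s + 4) * indicator {R..} r +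
            (A * G powr p) * (indicator {R..} r * r powr p) + (2 * N1) * (indicator {0<..<R} r * r\<^sup>2))"
          define Z0 where "Z0 = (A * C1 * a powr - \<sigma>) * E1 + (2 * A * a powr s + 4) * E2 + (A * G powr p) * E3 + (2 * N1) * E4"
          define \<beta> where "\<beta> = (\<lambda>\<theta>. Z0 - (A * cp * a powr (p - 2 * s)) * b \<theta> powr (2 * s))"
          have bG: "b \<theta> \<le> G" if "\<theta> \<in> sphere 0 1" for \<theta>
            using Cauchy_Schwarz_ineq2[of "dg x" \<theta>] dgG[OF xin] that by (simp add: b_def)
          have b0: "0 \<le> b \<theta>" for \<theta> by (simp add: b_def)
          have alg: "A * (k0 * (k2 * 0)) + (- A) * (k1 * (k2 * k3)) + X1 + X2 + X3 + X4 = X1 + X2 + X3 + X4 - A * k3 * k1 * k2"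
            for k0 k1 k2 k3 X1 X2 X3 X4 :: real by (simp add: algebra_simps)
          have fi: "frac_integral s (B1 \<theta>) (\<beta> \<theta>)" for \<theta>
          proof -
            have "frac_integral s (B1 \<theta>) (A * (a powr (s - 2 * s) * (b \<theta> powr (2 * s) * pow_const s s)) +
                (- A) * (a powr (p - 2 * s) * (b \<theta> powr (2 * s) * pow_const s p)) + (A * C1 * a powr - \<sigma>) * E1 +
                (2 * A * a powr s + 4) * E2 + (A * G powr p) * E3 + (2 * N1) * E4)"
              unfolding B1_def
              by (intro frac_integral_add frac_integral_cmult frac_integral_scaled_pow_diff F1 F2 F3 F4 s p a(1) b0) (use s in auto)
            moreover have "A * (a powr (s - 2 * s) * (b \<theta> powr (2 * s) * pow_const s s)) +
                (- A) * (a powr (p - 2 * s) * (b \<theta> powr (2 * s) * pow_const s p)) + (A * C1 * a powr - \<sigma>) * E1 +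
                (2 * A * a powr s + 4) * E2 + (A * G powr p) * E3 + (2 * N1) * E4 = \<beta> \<theta>"
              unfolding pow_const_self[OF s] \<beta>_def Z0_def cp_def by (rule alg)
            ultimately show ?thesis by simp
          qed
          have bound: "U (t, x + r *\<^sub>R \<theta>) + U (t, x - r *\<^sub>R \<theta>) - 2 * U (t, x) \<le> B1 \<theta> r"
            if th: "\<theta> \<in> sphere 0 1" and r0: "0 < r" for \<theta> r
          proof -
            define y where "y = r *\<^sub>R \<theta>"
            have ny: "norm y = r" using th r0 by (simp add: y_def)
            have eq: "x + r *\<^sub>R \<theta> = x + y" "x - r *\<^sub>R \<theta> = x + (- y)" by (simp_all add: y_def)
            have nm: "norm (- y) = r" using ny by simp
            have br: "0 \<le> b \<theta> * r / a" using b0 r0 a by simp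
            show ?thesis
            proof (cases "r < R")
              case False
              have s2: "- 2 * A * a powr s \<le> A * (a powr s * pow_diff s (b \<theta> * r / a))"
              proof -
                have "(A * a powr s) * (- 2) \<le> (A * a powr s) * pow_diff s (b \<theta> * r / a)"
                  using A s br pow_diff_bounds(4)[of s "b \<theta> * r / a"] by (intro mult_left_mono) auto
                then show ?thesis by simp
              qed
              have p2: "a powr p * pow_diff p (b \<theta> * r / a) \<le> G powr p * r powr p"
              proof (cases "b \<theta> * r / a \<le> 1")
                case True
                then have "a powr p * pow_diff p (b \<theta> * r / a) \<le> a powr p * 0"
                  using pow_diff_bounds(1)[of p "b \<theta> * r / a"] p br by (intro mult_left_mono) auto
                also have "\<dots> \<le> G powr p * r powr p" by simp
                finally show ?thesis .
              next
                case False
                then have "a powr p * pow_diff p (b \<theta> * r / a) \<le> a powr p * (b \<theta> * r / a) powr p"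
                  using pow_diff_bounds(3)[of p "b \<theta> * r / a"] p br by (intro mult_left_mono) auto
                also have "\<dots> = (b \<theta> * r) powr p"
                  unfolding powr_mult[symmetric] using a by simp
                also have "\<dots> \<le> (G * r) powr p"
                  using bG[OF th] b0 r0 p by (intro powr_mono2 mult_right_mono) auto
                finally show ?thesis by (simp only: powr_mult)
              qed
              have "(- A) * (a powr p * pow_diff p (b \<theta> * r / a)) \<ge> (- A) * (G powr p * r powr p)"
                using mult_left_mono[OF p2, of A] A by simp
              then have "4 \<le> B1 \<theta> r" using s2 False r0 by (simp add: B1_def mult.assoc)
              moreover have "U (t, x + y) + U (t, x + (- y)) - 2 * U (t, x) \<le> 4"
                using Ub(2)[of "(t, x + y)"] Ub(2)[of "(t, x + (- y))"] Ub(1)[of "(t, x)"] by linarith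
              ultimately show ?thesis unfolding eq by simp
            next
              case True
              define err where "err = 4 * K * (G + K) * (a powr - \<sigma> * r powr (2 * s + \<sigma>))"
              define dd where "dd = dg x \<bullet> y"
              have dd: "\<bar>dd\<bar> = b \<theta> * r" using r0 by (simp add: dd_def y_def b_def abs_mult)
              have gexp: "\<bar>(max 0 (g (x + y'))) powr q - (max 0 (a + dg x \<bullet> y')) powr q\<bar> \<le> err"
                if q: "s \<le> q" "q \<le> 1" and y': "norm y' = r" "\<bar>dg x \<bullet> y'\<bar> = b \<theta> * r" for q y'
              proof -
                have "\<bar>(max 0 (a + dg x \<bullet> y' + (g (x + y') - g x - dg x \<bullet> y'))) powr q - (max 0 (a + dg x \<bullet> y')) powr q\<bar> \<le> err"
                  unfolding err_def
                proof (rule pos_part_powr_expansion[OF s _ _ _ q a(1) a1 r0 _ KG])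
                  show "\<bar>dg x \<bullet> y'\<bar> \<le> G * r" using y' bG[OF th] r0 by (simp add: mult_right_mono)
                  show "\<bar>g (x + y') - g x - dg x \<bullet> y'\<bar> \<le> K * r\<^sup>2" using taylor[of x y'] y' by simp
                qed (use \<sigma> s True R in auto)
                then show ?thesis by (simp add: a_def)
              qed
              have both: "\<bar>((max 0 (g (x + y))) powr q + (max 0 (g (x + (- y)))) powr q - 2 * a powr q) - a powr q * pow_diff q (b \<theta> * r / a)\<bar> \<le> 2 * err"
                if q: "s \<le> q" "q \<le> 1" for q
              proof -
                have "(max 0 (a + dd)) powr q + (max 0 (a - dd)) powr q - 2 * a powr q = a powr q * pow_diff q (b \<theta> * r / a)"
                  using pow_diff_scaled[OF a(1), of dd q] dd by simp
                moreover have "\<bar>(max 0 (g (x + y))) powr q - (max 0 (a + dd)) powr q\<bar> \<le> err"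
                  using gexp[OF q ny] dd by (simp add: dd_def)
                moreover have "\<bar>(max 0 (g (x + (- y)))) powr q - (max 0 (a - dd)) powr q\<bar> \<le> err"
                  using gexp[OF q nm] dd by (simp add: dd_def)
                ultimately show ?thesis by linarith
              qed
              have "H (g (x + y)) + H (g (x + (- y))) - 2 * H a \<le>
                  a powr s * pow_diff s (b \<theta> * r / a) - a powr p * pow_diff p (b \<theta> * r / a) + 4 * err"
                using both[of s] both[of p] p s a by (simp add: H_def abs_le_iff)
              then have "A * (H (g (x + y)) + H (g (x + (- y))) - 2 * H a) \<le>
                  A * (a powr s * pow_diff s (b \<theta> * r / a) - a powr p * pow_diff p (b \<theta> * r / a) + 4 * err)"
                using A by (intro mult_left_mono) auto
              then have HH: "A * H (g (x + y)) + A * H (g (x + (- y))) - 2 * (A * H a) \<le>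
                  A * (a powr s * pow_diff s (b \<theta> * r / a)) - A * (a powr p * pow_diff p (b \<theta> * r / a)) + A * (4 * err)"
                by (simp add: algebra_simps)
              have pp: "pen (x + y) + pen (x + (- y)) = 2 * pen x + 2 * N1 * r\<^sup>2"
              proof -
                have "(norm (x - x1 + y))\<^sup>2 + (norm (x - x1 - y))\<^sup>2 = 2 * (norm (x - x1))\<^sup>2 + 2 * r\<^sup>2"
                  using norm_parallelogram[of "x - x1" y] ny by simp
                moreover have "x + y - x1 = x - x1 + y" "x + (- y) - x1 = x - x1 - y" by auto
                ultimately have "(norm (x + y - x1))\<^sup>2 + (norm (x + (- y) - x1))\<^sup>2 = 2 * (norm (x - x1))\<^sup>2 + 2 * r\<^sup>2"
                  by (simp only:)
                then have "N1 * ((norm (x + y - x1))\<^sup>2 + (norm (x + (- y) - x1))\<^sup>2) = N1 * (2 * (norm (x - x1))\<^sup>2 + 2 * r\<^sup>2)"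
                  by simp
                then show ?thesis unfolding pen_def by (simp add: algebra_simps)
              qed
              have "U (t, x + y) + U (t, x + (- y)) - 2 * U (t, x) \<le>
                  A * (a powr s * pow_diff s (b \<theta> * r / a)) - A * (a powr p * pow_diff p (b \<theta> * r / a)) + A * (4 * err) + 2 * N1 * r\<^sup>2"
                using diffp[of y] diffp[of "- y"] HH pp True ny nm by linarith
              also have "\<dots> = B1 \<theta> r" using True r0 by (simp add: B1_def err_def C1_def)
              finally show ?thesis unfolding eq .
            qed
          qed
          have ib: "integrable \<mu> (\<lambda>\<theta>. b \<theta> powr (2 * s))"
          proof (rule integrable_const_bound[where B = "G powr (2 * s)"])
            show "AE \<theta> in \<mu>. norm (b \<theta> powr (2 * s)) \<le> G powr (2 * s)"
              using bG b0 s by (intro AE_I2) (auto simp: mu'(1) intro: powr_mono2)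
          qed (unfold b_def, measurable)
          \<comment> \<open>The slopes \<open>b \<theta>\<close> may vanish in many directions; only
            their integral is bounded below, because the gradient has norm at least 1.\<close>
          have lamb: "lam \<le> (\<integral>\<theta>. b \<theta> powr (2 * s) \<partial>\<mu>)"
          proof -
            define \<nu> where "\<nu> = dg x /\<^sub>R norm (dg x)"
            have dn: "norm (dg x) \<noteq> 0" using dg1[of x] by auto
            then have \<nu>: "norm \<nu> = 1" by (simp add: \<nu>_def)
            have \<nu>b: "\<bar>\<nu> \<bullet> \<theta>\<bar> \<le> b \<theta>" for \<theta>
            proof -
              have "\<bar>\<nu> \<bullet> \<theta>\<bar> = \<bar>dg x \<bullet> \<theta>\<bar> / norm (dg x)" by (simp add: \<nu>_def abs_mult divide_inverse mult.commute)
              also have "\<dots> \<le> b \<theta>" unfolding b_def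
                using frac_le[of "\<bar>dg x \<bullet> \<theta>\<bar>" "\<bar>dg x \<bullet> \<theta>\<bar>" 1 "norm (dg x)"] dg1[of x] by simp
              finally show ?thesis .
            qed
            have "lam \<le> (\<integral>\<theta>. \<bar>\<nu> \<bullet> \<theta>\<bar> powr (2 * s) \<partial>\<mu>)" by (rule mu'(6)[OF s(1) \<nu>])
            also have "\<dots> \<le> (\<integral>\<theta>. b \<theta> powr (2 * s) \<partial>\<mu>)"
              using \<nu>b s by (intro integral_mono' ib powr_mono2) auto
            finally show ?thesis .
          qed
          have "stable_at s \<mu> (\<lambda>y. U (t, y)) x \<le> 2 * integral\<^sup>L \<mu> \<beta>"
            by (rule stable_at_integrable(3)[OF s mu Lam(2) B, of t x B1]) (use bound fi ib in \<open>auto simp: \<beta>_def\<close>)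
          also have "integral\<^sup>L \<mu> \<beta> = Z0 * measure \<mu> (space \<mu>) - (A * cp * a powr (p - 2 * s)) * (\<integral>\<theta>. b \<theta> powr (2 * s) \<partial>\<mu>)"
            unfolding \<beta>_def using ib by (simp add: mult.commute)
          also have "\<dots> \<le> Z0 * Lam - (A * cp * a powr (p - 2 * s)) * lam"
            using mu'(3) lamb A cp E C1 N1 by (intro diff_mono mult_left_mono) (auto simp: Z0_def intro!: add_nonneg_nonneg)
          finally have up: "stable_at s \<mu> (\<lambda>y. U (t, y)) x \<le> 2 * (Z0 * Lam - (A * cp * a powr (p - 2 * s)) * lam)" by simp
          define w where "w = a powr - \<sigma>"
          have w1: "1 \<le> w" using powr_mono'[of "- \<sigma>" 0 a] a a1 \<sigma> by (simp add: w_def)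
          have as: "a powr s \<le> 1" using a a1 s by (intro powr_le1) auto
          have ap: "a powr (p - 2 * s) = w * a powr - (s - 2 * \<sigma>)"
            unfolding w_def powr_add[symmetric] by (rule arg_cong[where f = "(powr) a"]) (simp add: p_def)
          have ap1: "1 \<le> a powr (p - 2 * s)" using powr_mono'[of "p - 2 * s" 0 a] a a1 p by simp
          have G0: "0 \<le> G powr p * E3" using E by simp
          have "Z0 \<le> A * w * (C1 * E1 + 2 * E2 + G powr p * E3) + (4 * E2 + 2 * N1 * E4)"
          proof -
            have "a powr s * E2 \<le> w * E2" using as w1 E by (intro mult_right_mono) auto
            then have 1: "A * (2 * (a powr s * E2)) \<le> A * (2 * (w * E2))" using A by (intro mult_left_mono) auto
            have "1 * (G powr p * E3) \<le> w * (G powr p * E3)" using w1 G0 by (intro mult_right_mono) auto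
            then have 2: "A * (G powr p * E3) \<le> A * (w * (G powr p * E3))" using A by (intro mult_left_mono) auto
            show ?thesis using 1 2 by (simp add: Z0_def w_def algebra_simps)
          qed
          then have "2 * (Z0 * Lam) \<le> 2 * Lam * (A * w * (C1 * E1 + 2 * E2 + G powr p * E3) + (4 * E2 + 2 * N1 * E4))"
            using Lam by simp
          also have "\<dots> = A * w * M0 + C5" by (simp add: M0_def C5_def algebra_simps)
          also have "A * w * M0 \<le> A * w * (cp * lam * a powr - (s - 2 * \<sigma>))"
            using \<tau>1(2)[OF a(1,3)] A w1 by (intro mult_left_mono) auto
          also have "\<dots> = A * (cp * lam) * a powr (p - 2 * s)" by (simp add: ap)
          finally have "2 * (Z0 * Lam) \<le> A * (cp * lam) * a powr (p - 2 * s) + C5" by simp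
          moreover have "A * (cp * lam) * 1 \<le> A * (cp * lam) * a powr (p - 2 * s)"
            using ap1 A cp lam by (intro mult_left_mono) auto
          moreover have "2 * (Z0 * Lam - (A * cp * a powr (p - 2 * s)) * lam) = 2 * (Z0 * Lam) - 2 * (A * (cp * lam) * a powr (p - 2 * s))"
            by simp
          ultimately show False using low up A(3) by linarith
        qed
        moreover have "A * H (g x1) \<le> A * g x1 powr s" using Hs[OF g1(1)] A by (intro mult_left_mono) auto
        ultimately show "moll e u z \<le> A * g (snd z) powr s + d" by (simp add: U_def z)
      qed
    qed
    then show "AE w in lborel. fst w \<in> {-7/8<..<0} \<longrightarrow> norm (snd w - x0) < \<rho> / 4 \<longrightarrow> 0 < g (snd w) \<longrightarrow>
        u w \<le> A * g (snd w) powr s"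
    proof eventually_elim
      case (elim w)
      show ?case
      proof (intro impI)
        assume w: "fst w \<in> {-7/8<..<0}" "norm (snd w - x0) < \<rho> / 4" "0 < g (snd w)"
        show "u w \<le> A * g (snd w) powr s"
        proof (cases "g (snd w) < \<tau>")
          case True
          then show ?thesis using elim w by (auto simp: Z_def)
        next
          case False
          have "A * \<tau> powr s \<le> A * g (snd w) powr s"
            using False \<tau> s A by (intro mult_left_mono powr_mono2) auto
          then show ?thesis using A(2) u1[of w] by (simp add: abs_le_iff)
        qed
      qed
    qed
  qed
qed

text \<open>A point \<open>y\<close> of the complement has \<open>g y \<le> 0\<close>, so the height
  of a nearby point is at most \<open>G\<close> times its distance to \<open>y\<close>. Applying the
  barrier to \<open>- u\<close> as well gives the absolute value.\<close>

lemma local_boundary_decay: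
  fixes \<Omega> :: "'a::euclidean_space set" and s lam Lam :: real
  assumes s: "0 < s" "s < 1" and lam: "0 < lam" "lam \<le> Lam" and \<Omega>: "C11_domain \<Omega>"
    and x0: "x0 \<in> frontier \<Omega>" "norm x0 < 1"
  obtains r C where "0 < r" "0 \<le> C"
    "\<And>\<mu> u f. admissible s lam Lam \<Omega> \<mu> u f \<Longrightarrow>
      AE w in lborel. fst w \<in> {-7/8<..<0} \<longrightarrow> norm (snd w - x0) < r \<longrightarrow>
        (\<forall>y\<in>ball x0 r - \<Omega>. \<bar>u w\<bar> \<le> C * norm (snd w - y) powr s)"
proof -
  obtain \<rho> K G g dg where ch: "chart \<Omega> x0 \<rho> K G g dg"
    by (rule C11_chart[OF \<Omega> x0])
  have \<rho>: "0 < \<rho>" and b1: "ball x0 (2 * \<rho>) \<subseteq> ball 0 1" and G: "1 \<le> G"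
    and mem: "\<And>x. x \<in> ball x0 (2 * \<rho>) \<Longrightarrow> x \<in> \<Omega> \<longleftrightarrow> 0 < g x"
    and lip: "\<And>x y. x \<in> ball x0 (2 * \<rho>) \<Longrightarrow> y \<in> ball x0 (2 * \<rho>) \<Longrightarrow> \<bar>g x - g y\<bar> \<le> G * norm (x - y)"
    using ch by (auto simp: chart_def)
  obtain A where A: "0 < A" and bar: "\<And>\<mu> u f. admissible s lam Lam \<Omega> \<mu> u f \<Longrightarrow>
      AE w in lborel. fst w \<in> {-7/8<..<0} \<longrightarrow> norm (snd w - x0) < \<rho> / 4 \<longrightarrow> 0 < g (snd w) \<longrightarrow>
        u w \<le> A * g (snd w) powr s"
    by (rule boundary_barrier[OF s lam ch]) blast
  show thesis
  proof (rule that[of "\<rho> / 4" "A * G powr s"])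
    fix \<mu> u f assume adm: "admissible s lam Lam \<Omega> \<mu> u f"
    then have "AE w in lborel. fst w \<in> {-1<..<0} \<longrightarrow> snd w \<in> ball 0 1 - \<Omega> \<longrightarrow> u w = 0"
      by (simp add: admissible_def)
    with bar[OF adm] bar[OF admissible_minus[OF adm]]
    show "AE w in lborel. fst w \<in> {-7/8<..<0} \<longrightarrow> norm (snd w - x0) < \<rho> / 4 \<longrightarrow>
        (\<forall>y\<in>ball x0 (\<rho> / 4) - \<Omega>. \<bar>u w\<bar> \<le> A * G powr s * norm (snd w - y) powr s)"
    proof eventually_elim
      case (elim w)
      show ?case
      proof (intro impI ballI)
        fix y assume w: "fst w \<in> {-7/8<..<0}" "norm (snd w - x0) < \<rho> / 4" and y: "y \<in> ball x0 (\<rho> / 4) - \<Omega>"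
        have inb: "snd w \<in> ball x0 (2 * \<rho>)" "y \<in> ball x0 (2 * \<rho>)"
          using w y \<rho> by (auto simp: dist_norm norm_minus_commute)
        show "\<bar>u w\<bar> \<le> A * G powr s * norm (snd w - y) powr s"
        proof (cases "0 < g (snd w)")
          case True
          have "\<not> 0 < g y" using mem[OF inb(2)] y by blast
          then have "g (snd w) \<le> G * norm (snd w - y)" using lip[OF inb] by linarith
          then have "g (snd w) powr s \<le> (G * norm (snd w - y)) powr s"
            using True s by (intro powr_mono2) auto
          also have "\<dots> = G powr s * norm (snd w - y) powr s" by (rule powr_mult)
          finally have "A * g (snd w) powr s \<le> A * (G powr s * norm (snd w - y) powr s)"
            using A by (intro mult_left_mono) auto
          moreover have "\<bar>u w\<bar> \<le> A * g (snd w) powr s"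
            using elim(1,2) w True by (simp add: abs_le_iff)
          ultimately show ?thesis by simp
        next
          case False
          then have "snd w \<in> ball 0 1 - \<Omega>" using mem[OF inb(1)] inb(1) b1 by blast
          then have "u w = 0" using elim(3) w by auto
          then show ?thesis using A by simp
        qed
      qed
    qed
  qed (use \<rho> A in auto)
qed

text \<open>Compactness of the part of the frontier in the ball of radius 7/8. Points at distance at
  least \<open>\<delta>\<close> from \<open>y\<close> need only the bound 1; for the others
  \<open>\<delta> \<le> 1/8\<close> keeps the nearby frontier point in that ball, as
  \<open>norm x < 3/4\<close>.\<close>

lemma uniform_boundary_decay:
  fixes \<Omega> :: "'a::euclidean_space set" and s lam Lam :: real
  assumes s: "0 < s" "s < 1" and lam: "0 < lam" "lam \<le> Lam" and \<Omega>: "C11_domain \<Omega>"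
  obtains C where "0 \<le> C" "\<And>\<mu> u f. admissible s lam Lam \<Omega> \<mu> u f \<Longrightarrow> boundary_decay s C \<Omega> u"
proof -
  define F where "F = frontier \<Omega> \<inter> cball 0 (7/8)"
  have cF: "compact F" unfolding F_def by (intro closed_Int_compact frontier_closed compact_cball)
  define P where "P = (\<lambda>x0 r C. \<forall>\<mu> u f. admissible s lam Lam \<Omega> \<mu> u f \<longrightarrow>
      (AE w in lborel. fst w \<in> {-7/8<..<0} \<longrightarrow> norm (snd w - x0) < r \<longrightarrow>
        (\<forall>y\<in>ball x0 r - \<Omega>. \<bar>u w\<bar> \<le> C * norm (snd w - y) powr s)))"
  have "\<exists>r C. 0 < r \<and> 0 \<le> C \<and> P x0 r C" if "x0 \<in> F" for x0
  proof -
    have x0: "x0 \<in> frontier \<Omega>" "norm x0 < 1" using that by (auto simp: F_def)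
    obtain r C where "0 < r" "0 \<le> C" and rC: "\<And>\<mu> u f. admissible s lam Lam \<Omega> \<mu> u f \<Longrightarrow>
      AE w in lborel. fst w \<in> {-7/8<..<0} \<longrightarrow> norm (snd w - x0) < r \<longrightarrow>
        (\<forall>y\<in>ball x0 r - \<Omega>. \<bar>u w\<bar> \<le> C * norm (snd w - y) powr s)"
      by (rule local_boundary_decay[OF s lam \<Omega> x0]) blast
    moreover have "P x0 r C" unfolding P_def by (intro allI impI rC)
    ultimately show ?thesis by blast
  qed
  then obtain r C where rCP: "\<And>x0. x0 \<in> F \<Longrightarrow> 0 < r x0 \<and> 0 \<le> C x0 \<and> P x0 (r x0) (C x0)" by metis
  then have r: "\<And>x0. x0 \<in> F \<Longrightarrow> 0 < r x0" and C: "\<And>x0. x0 \<in> F \<Longrightarrow> 0 \<le> C x0" by blast+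
  have loc: "AE w in lborel. fst w \<in> {-7/8<..<0} \<longrightarrow> norm (snd w - x0) < r x0 \<longrightarrow>
        (\<forall>y\<in>ball x0 (r x0) - \<Omega>. \<bar>u w\<bar> \<le> C x0 * norm (snd w - y) powr s)"
    if "x0 \<in> F" "admissible s lam Lam \<Omega> \<mu> u f" for x0 \<mu> u f
  proof -
    have "P x0 (r x0) (C x0)" using rCP[OF that(1)] by simp
    then show ?thesis unfolding P_def using that(2) by (elim allE impE) assumption+
  qed
  have "F \<subseteq> (\<Union>x0\<in>F. ball x0 (r x0 / 2))" using r by force
  then obtain S where S: "S \<subseteq> F" "finite S" "F \<subseteq> (\<Union>x0\<in>S. ball x0 (r x0 / 2))"
    by (rule compactE_image[OF cF, of F "\<lambda>x0. ball x0 (r x0 / 2)", OF open_ball])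
  define \<delta> where "\<delta> = Min (insert (1/8) ((\<lambda>x0. r x0 / 2) ` S))"
  have \<delta>: "0 < \<delta>" "\<delta> \<le> 1/8" "\<And>x0. x0 \<in> S \<Longrightarrow> \<delta> \<le> r x0 / 2"
  proof -
    show "0 < \<delta>" using S r by (auto simp: \<delta>_def)
    show "\<delta> \<le> 1/8" unfolding \<delta>_def using S(2) by (intro Min_le) auto
    show "\<delta> \<le> r x0 / 2" if "x0 \<in> S" for x0 unfolding \<delta>_def using S(2) that by (intro Min_le) auto
  qed
  define C0 where "C0 = \<delta> powr - s + (\<Sum>x0\<in>S. C x0)"
  have sum: "0 \<le> (\<Sum>x0\<in>S. C x0)" using C S by (intro sum_nonneg) auto
  have C0: "0 \<le> C0" "\<delta> powr - s \<le> C0" "\<And>x0. x0 \<in> S \<Longrightarrow> C x0 \<le> C0"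
  proof -
    show "0 \<le> C0" "\<delta> powr - s \<le> C0" using sum by (auto simp: C0_def)
    fix x0 assume "x0 \<in> S"
    then have "C x0 \<le> (\<Sum>x0\<in>S. C x0)" using C S by (intro member_le_sum) auto
    then show "C x0 \<le> C0" unfolding C0_def by (rule add_increasing[rotated]) simp
  qed
  show thesis
  proof (rule that[OF C0(1)])
    fix \<mu> u f assume adm: "admissible s lam Lam \<Omega> \<mu> u f"
    have u1: "\<bar>u w\<bar> \<le> 1" for w :: "real \<times> 'a" using adm unfolding admissible_def core_solution_def by blast
    have zero: "AE w in lborel. fst w \<in> {-1<..<0} \<longrightarrow> snd w \<in> ball 0 1 - \<Omega> \<longrightarrow> u w = 0"
      using adm by (simp add: admissible_def)
    have "AE w in lborel. \<forall>x0\<in>S. fst w \<in> {-7/8<..<0} \<longrightarrow> norm (snd w - x0) < r x0 \<longrightarrow>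
        (\<forall>y\<in>ball x0 (r x0) - \<Omega>. \<bar>u w\<bar> \<le> C x0 * norm (snd w - y) powr s)"
      using S loc[OF _ adm] by (intro AE_finite_allI) auto
    with zero show "boundary_decay s C0 \<Omega> u"
      unfolding boundary_decay_def
    proof eventually_elim
      case (elim w)
      show ?case
      proof (intro impI allI)
        fix y assume w: "fst w \<in> {-7/8<..<0}" "norm (snd w) < 3/4" and y: "y \<notin> \<Omega>"
        define x where "x = snd w"
        show "\<bar>u w\<bar> \<le> C0 * norm (snd w - y) powr s"
        proof (cases "x \<in> \<Omega>")
          case False
          then have "u w = 0" using elim(1) w by (auto simp: x_def)
          then show ?thesis using C0 by simp
        next
          case True
          show ?thesis
          proof (cases "norm (x - y) < \<delta>")
            case False
            have "1 = \<delta> powr - s * \<delta> powr s" using \<delta> by (simp add: powr_add[symmetric])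
            also have "\<dots> \<le> C0 * norm (x - y) powr s"
              using False \<delta> s C0 by (intro mult_mono powr_mono2) auto
            finally show ?thesis using u1[of w] by (simp add: x_def)
          next
            case d: True
            \<comment> \<open>The segment leaves the domain through the frontier. The crossing point
              selects the chart, and since \<open>\<delta>\<close> is at most half of every radius,
              both end points lie in the ball of that chart.\<close>
            have "closed_segment x y \<inter> frontier \<Omega> \<noteq> {}"
              using True y by (intro connected_Int_frontier) auto
            then obtain z where z: "z \<in> closed_segment x y" "z \<in> frontier \<Omega>" by blast
            have zx: "norm (x - z) \<le> norm (x - y)" "norm (y - z) \<le> norm (x - y)"
              using dist_in_closed_segment[OF z(1)] by (simp_all add: dist_norm norm_minus_commute)
            have "norm z \<le> norm x + norm (x - z)" using norm_triangle_ineq2[of z x] by (simp add: norm_minus_commute)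
            then have "z \<in> F" using z zx d \<delta> w by (simp add: F_def x_def)
            then obtain x0 where x0: "x0 \<in> S" "z \<in> ball x0 (r x0 / 2)" using S(3) by blast
            have "norm (x - x0) < r x0" "norm (y - x0) < r x0"
              using norm_triangle_ineq[of "x - z" "z - x0"] norm_triangle_ineq[of "y - z" "z - x0"] zx d \<delta>(3)[OF x0(1)] x0(2)
              by (simp_all add: dist_norm norm_minus_commute)
            then have "\<bar>u w\<bar> \<le> C x0 * norm (x - y) powr s"
              using elim(2) x0(1) w y by (auto simp: x_def dist_norm norm_minus_commute)
            also have "\<dots> \<le> C0 * norm (x - y) powr s" using C0(3)[OF x0(1)] by (intro mult_right_mono) auto
            finally show ?thesis by (simp add: x_def)
          qed
        qed
      qed
    qed
  qed
qed

subsection \<open>From weak solutions to the normalised problem and back\<close>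

lemma lebesgue_open: "open S \<Longrightarrow> S \<in> sets lebesgue"
  by (rule sets_completionI_sets) simp

lemma AE_le_Linfty_norm: "AE z in lebesgue_on S. ennreal \<bar>g z\<bar> \<le> Linfty_norm S g"
  unfolding Linfty_norm_def by (rule esssup_AE)

text \<open>Dividing by \<open>F\<close> and clipping give the bound 1 at every point; the extension
  by 0 outside \<open>S\<close> turns integrals over \<open>S\<close> into integrals over the whole
  space.\<close>

lemma clipped_borel_representative:
  fixes g :: "'b::euclidean_space \<Rightarrow> real"
  assumes S: "S \<in> sets lebesgue" and g: "g \<in> borel_measurable (lebesgue_on S)"
    and F: "0 < F" and le: "AE z in lebesgue_on S. \<bar>g z\<bar> \<le> F"
  obtains g' where "g' \<in> borel_measurable borel" "\<And>z. \<bar>g' z\<bar> \<le> 1" "AE z in lebesgue. indicator S z * g z = F * g' z"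
proof -
  have "(\<lambda>z. indicator S z *\<^sub>R g z) \<in> borel_measurable lebesgue"
    using g S by (subst (asm) borel_measurable_restrict_space_iff) auto
  then have "(\<lambda>z. indicator S z * g z / F) \<in> borel_measurable lebesgue" by simp
  then obtain h where h: "h \<in> borel_measurable borel" "AE z in lborel. indicator S z * g z / F = h z"
    using completion_ex_borel_measurable_real[of "\<lambda>z. indicator S z * g z / F" lborel] by auto
  define g' where "g' = (\<lambda>z. max (- 1) (min 1 (h z)))"
  have "AE z in lebesgue. z \<in> S \<longrightarrow> \<bar>g z\<bar> \<le> F"
    using le S by (subst (asm) AE_restrict_space_iff) auto
  moreover have "AE z in lebesgue. indicator S z * g z / F = h z" using h(2) by (rule AE_completion)
  ultimately have "AE z in lebesgue. indicator S z * g z = F * g' z"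
  proof eventually_elim
    case (elim z)
    have eq: "indicator S z * g z = F * h z" using elim(2) F by (simp add: field_simps)
    have "\<bar>F * h z\<bar> \<le> F" unfolding eq[symmetric] using elim(1) F by (cases "z \<in> S") auto
    then have "\<bar>h z\<bar> \<le> 1" using F by (simp add: abs_mult)
    then show ?case unfolding eq by (simp add: g'_def)
  qed
  moreover have "g' \<in> borel_measurable borel" unfolding g'_def using h(1) by measurable
  moreover have "\<bar>g' z\<bar> \<le> 1" for z by (simp add: g'_def)
  ultimately show thesis using that by blast
qed

lemma weak_solution_imp_core:
  fixes u f :: "real \<times> 'a::euclidean_space \<Rightarrow> real"
  assumes sol: "weak_solution s \<mu> {-1<..<0} D u f" and D: "open D" and F: "0 < F"
    and u: "AE z in lebesgue_on ({-1<..<0} \<times> UNIV). \<bar>u z\<bar> \<le> F" and f: "AE z in lebesgue_on ({-1<..<0} \<times> D). \<bar>f z\<bar> \<le> F"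
  obtains u' f' where "core_solution s \<mu> D u' f'" "AE z in lebesgue. z \<in> {-1<..<0} \<times> UNIV \<longrightarrow> u z = F * u' z"
proof -
  let ?I = "{-1<..<0::real}"
  have S: "?I \<times> (UNIV :: 'a set) \<in> sets lebesgue" "?I \<times> D \<in> sets lebesgue"
    using D by (auto intro!: lebesgue_open open_Times)
  have um: "u \<in> borel_measurable (lebesgue_on (?I \<times> UNIV))" and fm: "f \<in> borel_measurable (lebesgue_on (?I \<times> D))"
    using sol by (auto simp: weak_solution_def)
  obtain u' where u': "u' \<in> borel_measurable borel" "\<And>z. \<bar>u' z\<bar> \<le> 1"
    "AE z in lebesgue. indicator (?I \<times> UNIV) z * u z = F * u' z"
    by (rule clipped_borel_representative[OF S(1) um F u]) blast
  obtain f' where f': "f' \<in> borel_measurable borel" "\<And>z. \<bar>f' z\<bar> \<le> 1"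
    "AE z in lebesgue. indicator (?I \<times> D) z * f z = F * f' z"
    by (rule clipped_borel_representative[OF S(2) fm F f]) blast
  have transfer: "(\<integral>z. g z * k z \<partial>lebesgue_on S) = F * (\<integral>z. g' z * k z \<partial>lebesgue)"
    if S: "S \<in> sets lebesgue" and int: "integrable (lebesgue_on S) (\<lambda>z. g z * k z)"
      and ae: "AE z in lebesgue. indicator S z * g z = F * g' z" for S and g g' k :: "real \<times> 'a \<Rightarrow> real"
  proof -
    have ae': "AE z in lebesgue. indicator S z *\<^sub>R (g z * k z) = F * (g' z * k z)"
      using ae by eventually_elim (simp add: mult.assoc[symmetric])
    have m: "(\<lambda>z. indicator S z *\<^sub>R (g z * k z)) \<in> borel_measurable lebesgue"
      using int S by (subst (asm) integrable_restrict_space) auto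
    have "(\<integral>z. g z * k z \<partial>lebesgue_on S) = (\<integral>z. indicator S z *\<^sub>R (g z * k z) \<partial>lebesgue)"
      using S by (intro integral_restrict_space) simp
    \<comment> \<open>Measurability of the new integrand is inherited through equality almost
      everywhere, as nothing is assumed about \<open>k\<close> on its own.\<close>
    also have "\<dots> = (\<integral>z. F * (g' z * k z) \<partial>lebesgue)"
      by (rule integral_cong_AE[OF m borel_measurable_AE[OF m ae'] ae'])
    finally show ?thesis by simp
  qed
  have "core_solution s \<mu> D u' f'"
    unfolding core_solution_def
  proof (intro conjI allI impI u' f')
    fix \<eta> assume "test_function (?I \<times> D) \<eta>"
    then have i: "integrable (lebesgue_on (?I \<times> UNIV)) (\<lambda>z. u z * (- time_deriv \<eta> z - stable_operator s \<mu> \<eta> z))"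
      "integrable (lebesgue_on (?I \<times> D)) (\<lambda>z. f z * \<eta> z)"
      and eq: "(\<integral>z. u z * (- time_deriv \<eta> z - stable_operator s \<mu> \<eta> z) \<partial>lebesgue_on (?I \<times> UNIV)) = (\<integral>z. f z * \<eta> z \<partial>lebesgue_on (?I \<times> D))"
      using sol unfolding weak_solution_def by blast+
    show "(\<integral>z. u' z * (- time_deriv \<eta> z - stable_operator s \<mu> \<eta> z) \<partial>lebesgue) = (\<integral>z. f' z * \<eta> z \<partial>lebesgue)"
      using eq transfer[OF S(1) i(1) u'(3)] transfer[OF S(2) i(2) f'(3)] F by simp
  qed
  moreover have "AE z in lebesgue. z \<in> ?I \<times> UNIV \<longrightarrow> u z = F * u' z"
    using u'(3) by eventually_elim (auto simp: indicator_def)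
  ultimately show thesis by (rule that)
qed

section \<open>Extension with the parabolic modulus of continuity\<close>

definition parabolic_dist :: "real \<Rightarrow> real \<times> 'a::real_normed_vector \<Rightarrow> real \<times> 'a \<Rightarrow> real" where
  "parabolic_dist s w w' = \<bar>fst w - fst w'\<bar> powr (1/2) + norm (snd w - snd w') powr s"

lemma parabolic_dist_triangle:
  assumes s: "0 < s" "s < 1"
  shows "parabolic_dist s w w'' \<le> parabolic_dist s w w' + parabolic_dist s w' w''"
proof -
  have "\<bar>fst w - fst w''\<bar> powr (1/2) \<le> (\<bar>fst w - fst w'\<bar> + \<bar>fst w' - fst w''\<bar>) powr (1/2)"
    by (intro powr_mono2) auto
  also have "\<dots> \<le> \<bar>fst w - fst w'\<bar> powr (1/2) + \<bar>fst w' - fst w''\<bar> powr (1/2)"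
    by (intro powr_add_le) auto
  finally have 1: "\<bar>fst w - fst w''\<bar> powr (1/2) \<le> \<bar>fst w - fst w'\<bar> powr (1/2) + \<bar>fst w' - fst w''\<bar> powr (1/2)" .
  have "norm (snd w - snd w'') powr s \<le> (norm (snd w - snd w') + norm (snd w' - snd w'')) powr s"
    using s norm_triangle_ineq[of "snd w - snd w'" "snd w' - snd w''"] by (intro powr_mono2) auto
  also have "\<dots> \<le> norm (snd w - snd w') powr s + norm (snd w' - snd w'') powr s"
    using s by (intro powr_add_le) auto
  finally show ?thesis using 1 by (simp add: parabolic_dist_def)
qed

text \<open>The infimum of the cones of slope \<open>C\<close> over the points of \<open>G\<close>.
  The triangle inequality makes it finite and regular everywhere, and the bound for \<open>u\<close>
  on \<open>G\<close> makes it agree with \<open>u\<close> there.\<close>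

lemma McShane_extension:
  fixes u :: "'b \<Rightarrow> real" and d :: "'b \<Rightarrow> 'b \<Rightarrow> real"
  assumes u: "\<And>w w'. w \<in> G \<Longrightarrow> w' \<in> G \<Longrightarrow> \<bar>u w - u w'\<bar> \<le> C * d w w'" and C: "0 \<le> C"
    and d: "\<And>w. d w w = 0" "\<And>w w'. d w w' = d w' w" "\<And>w w' w''. d w w'' \<le> d w w' + d w' w''"
  obtains v where "\<And>w. w \<in> G \<Longrightarrow> v w = u w" "\<And>w w'. \<bar>v w - v w'\<bar> \<le> C * d w w'"
proof (cases "G = {}")
  case True
  have "0 \<le> d w w'" for w w' using d(1)[of w] d(2)[of w w'] d(3)[of w w w'] d(3)[of w w' w] by linarith
  then show thesis using that[of "\<lambda>_. 0"] True C by simp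
next
  case False
  then obtain w0 where w0: "w0 \<in> G" by blast
  define v where "v = (\<lambda>z. INF w\<in>G. u w + C * d z w)"
  have tri: "C * d w w'' \<le> C * d w w' + C * d w' w''" for w w' w''
    using mult_left_mono[OF d(3)[of w w'' w'] C] by (simp add: distrib_left)
  have bdd: "bdd_below ((\<lambda>w. u w + C * d z w) ` G)" for z
  proof (rule bdd_belowI2)
    fix w assume "w \<in> G"
    then show "u w0 - C * d z w0 \<le> u w + C * d z w"
      using u[OF w0, of w] tri[of w0 w z] d(2)[of w0 z] d(2)[of z w] by (simp add: abs_le_iff)
  qed
  show thesis
  proof (rule that[of v])
    fix w assume w: "w \<in> G"
    show "v w = u w"
    proof (rule antisym)
      show "v w \<le> u w" unfolding v_def using cINF_lower[OF bdd w, of w] d(1)[of w] by simp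
      show "u w \<le> v w" unfolding v_def
      proof (rule cINF_greatest[OF False])
        fix w' assume "w' \<in> G"
        then show "u w \<le> u w' + C * d w w'" using u[OF w, of w'] by (simp add: abs_le_iff)
      qed
    qed
  next
    fix z z'
    have *: "v z - C * d z z' \<le> v z'" for z z'
      unfolding v_def
    proof (rule cINF_greatest[OF False])
      fix w assume w: "w \<in> G"
      show "(INF w\<in>G. u w + C * d z w) - C * d z z' \<le> u w + C * d z' w"
        using cINF_lower[OF bdd w, of z] tri[of z w z'] by simp
    qed
    show "\<bar>v z - v z'\<bar> \<le> C * d z z'" using *[of z z'] *[of z' z] d(2)[of z z'] by (simp add: abs_le_iff)
  qed
qed

lemma Hoelder_seminorm_le:
  assumes C: "0 \<le> C" and le: "\<And>p q. p \<in> Q \<Longrightarrow> q \<in> Q \<Longrightarrow> \<bar>v p - v q\<bar> \<le> C * parabolic_dist s p q"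
  shows "Hoelder_seminorm (1/2) s Q v \<le> ennreal C"
  unfolding Hoelder_seminorm_def
proof (rule SUP_least)
  fix pq assume "pq \<in> {(p, q). p \<in> Q \<and> q \<in> Q \<and> p \<noteq> q}"
  then obtain p q where pq: "pq = (p, q)" "p \<in> Q" "q \<in> Q" by auto
  \<comment> \<open>For \<open>D = 0\<close> the quotient is 0 by the convention on
    division.\<close>
  have div: "a / D \<le> C" if "a \<le> C * D" "0 \<le> D" for a D :: real
    using that C by (cases "D = 0") (auto simp: pos_divide_le_eq)
  have "\<bar>v p - v q\<bar> / (\<bar>fst p - fst q\<bar> powr (1/2) + norm (snd p - snd q) powr s) \<le> C"
    by (rule div[OF le[OF pq(2,3), unfolded parabolic_dist_def]]) simp
  then show "(case pq of (p, q) \<Rightarrow> ennreal (\<bar>v p - v q\<bar> / (\<bar>fst p - fst q\<bar> powr (1/2) + norm (snd p - snd q) powr s))) \<le> ennreal C"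
    unfolding pq(1) prod.case by (rule ennreal_leI)
qed

text \<open>Bounding \<open>esssup\<close> from above asks for measurability, and \<open>v\<close>
  will come from an infimum of functions; the Borel function \<open>w\<close>, equal to it almost
  everywhere, supplies it.\<close>

lemma Linfty_norm_le:
  fixes v w :: "'b::euclidean_space \<Rightarrow> real"
  assumes Q: "Q \<in> sets lebesgue" and w: "w \<in> borel_measurable borel" and vw: "AE z in lebesgue. z \<in> Q \<longrightarrow> v z = w z"
    and le: "AE z in lebesgue. z \<in> Q \<longrightarrow> ennreal \<bar>v z\<bar> \<le> N"
  shows "Linfty_norm Q v \<le> N"
  unfolding Linfty_norm_def
proof (rule esssup_I)
  have "(\<lambda>z. indicator Q z *\<^sub>R v z) \<in> borel_measurable lebesgue"
  proof (rule borel_measurable_AE)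
    have "w \<in> borel_measurable lebesgue" by (rule measurable_completion) (use w in simp)
    then show "(\<lambda>z. indicator Q z *\<^sub>R w z) \<in> borel_measurable lebesgue"
      by (intro borel_measurable_scaleR borel_measurable_indicator Q)
    show "AE z in lebesgue. indicator Q z *\<^sub>R w z = indicator Q z *\<^sub>R v z"
      using vw by eventually_elim (auto simp: indicator_def)
  qed
  then have "v \<in> borel_measurable (lebesgue_on Q)"
    using Q by (subst borel_measurable_restrict_space_iff) auto
  then have "(\<lambda>z. \<bar>v z\<bar>) \<in> borel_measurable (lebesgue_on Q)" by (rule borel_measurable_abs)
  then show "(\<lambda>z. ennreal \<bar>v z\<bar>) \<in> borel_measurable (lebesgue_on Q)"
    by (rule measurable_compose[OF _ measurable_ennreal])
  show "AE z in lebesgue_on Q. ennreal \<bar>v z\<bar> \<le> N" using le Q by (subst AE_restrict_space_iff) auto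
qed

theorem proposition1p4:
  fixes s lam Lam :: real and \<Omega> :: "(real ^ 'n) set"
  assumes "0 < s" and "s < 1"
    and "0 < lam" and "lam \<le> Lam"
    and "C11_domain \<Omega>"
  shows "\<exists>C > 0. \<forall>(\<mu> :: (real ^ 'n) measure) (u :: real \<times> (real ^ 'n) \<Rightarrow> real)
             (f :: real \<times> (real ^ 'n) \<Rightarrow> real).
           spectral_measure s lam Lam \<mu> \<longrightarrow>
           weak_solution s \<mu> {-1<..<0} (\<Omega> \<inter> ball 0 1) u f \<longrightarrow>
           (AE z in lebesgue_on ({-1<..<0} \<times> (ball 0 1 - \<Omega>)). u z = 0) \<longrightarrow>
           (\<exists>v. (AE z in lebesgue_on ({-1<..<0} \<times> UNIV). v z = u z) \<and>
                Hoelder_norm (1/2) s ({-1/2<..<0} \<times> ball 0 (1/2)) v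
                  \<le> ennreal C * (Linfty_norm ({-1<..<0} \<times> (\<Omega> \<inter> ball 0 1)) f
                               + Linfty_norm ({-1<..<0} \<times> UNIV) u))"
proof -
  have s: "0 < s" "s < 1" and lam: "0 < lam" "lam \<le> Lam" and \<Omega>: "C11_domain \<Omega>" using assms by auto
  have open\<Omega>: "open \<Omega>" using \<Omega> by (simp add: C11_domain_def)
  obtain C0 where C0: "0 \<le> C0" "\<And>\<mu> u f. admissible s lam Lam \<Omega> \<mu> u f \<Longrightarrow> boundary_decay s C0 \<Omega> u"
    by (rule uniform_boundary_decay[OF s lam \<Omega>]) blast
  obtain C where C: "0 < C" and reg: "\<And>(\<mu> :: (real ^ 'n) measure) \<Omega> u f. spectral_measure s lam Lam \<mu> \<Longrightarrow>
      core_solution s \<mu> (\<Omega> \<inter> ball 0 1) u f \<Longrightarrow> boundary_decay s C0 \<Omega> u \<Longrightarrow>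
      \<exists>G. (AE w in lborel. w \<in> {-1/2<..<0} \<times> ball 0 (1/2) \<longrightarrow> w \<in> G) \<and>
        (\<forall>w\<in>G. \<forall>w'\<in>G. \<bar>u w - u w'\<bar> \<le> C * (\<bar>fst w - fst w'\<bar> powr (1/2) + norm (snd w - snd w') powr s))"
    by (rule regularity_of_boundary_decay[OF s lam C0(1)]) blast
  show ?thesis
  \<comment> \<open>\<open>C\<close> bounds the seminorm, the added 1 the supremum part of the
    norm.\<close>
  proof (intro exI[of _ "C + 1"] conjI allI impI)
    show "0 < C + 1" using C by simp
    fix \<mu> :: "(real ^ 'n) measure" and u f :: "real \<times> (real ^ 'n) \<Rightarrow> real"
    assume mu: "spectral_measure s lam Lam \<mu>" and sol: "weak_solution s \<mu> {-1<..<0} (\<Omega> \<inter> ball 0 1) u f"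
      and zero: "AE z in lebesgue_on ({-1<..<0} \<times> (ball 0 1 - \<Omega>)). u z = 0"
    define I where "I = {-1<..<0::real}"
    define Q where "Q = {-1/2<..<0::real} \<times> (ball 0 (1/2) :: (real ^ 'n) set)"
    define Nf where "Nf = Linfty_norm (I \<times> (\<Omega> \<inter> ball 0 1)) f"
    define Nu where "Nu = Linfty_norm (I \<times> UNIV) u"
    have Qm: "Q \<in> sets lebesgue" unfolding Q_def by (intro lebesgue_open open_Times) auto
    have Im: "I \<times> (UNIV :: (real ^ 'n) set) \<in> sets lebesgue" unfolding I_def by (intro lebesgue_open open_Times) auto
    have QI: "Q \<subseteq> I \<times> UNIV" by (auto simp: Q_def I_def)
    have leu: "AE z in lebesgue_on (I \<times> UNIV). ennreal \<bar>u z\<bar> \<le> Nu"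
      and lef: "AE z in lebesgue_on (I \<times> (\<Omega> \<inter> ball 0 1)). ennreal \<bar>f z\<bar> \<le> Nf"
      unfolding Nu_def Nf_def by (rule AE_le_Linfty_norm)+
    have "\<exists>v. (AE z in lebesgue_on (I \<times> UNIV). v z = u z) \<and> Hoelder_norm (1/2) s Q v \<le> ennreal (C + 1) * (Nf + Nu)"
    \<comment> \<open>Norms take values in \<open>ennreal\<close>; if the right-hand side is
      infinite, \<open>u\<close> itself will do.\<close>
    proof (cases "Nf + Nu = \<top>")
      case True
      have "ennreal (C + 1) * (Nf + Nu) = \<top>" unfolding True ennreal_mult_top using C by simp
      then show ?thesis by (intro exI[of _ u]) simp
    next
      case False
      define F where "F = enn2real (Nf + Nu)"
      have F: "ennreal F = Nf + Nu" "0 \<le> F" using False by (auto simp: F_def less_top)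
      have NF: "Nf \<le> ennreal F" "Nu \<le> ennreal F" unfolding F(1) by auto
      have boundu: "AE z in lebesgue_on (I \<times> UNIV). \<bar>u z\<bar> \<le> F"
        using leu
      proof eventually_elim
        case (elim z)
        then have "ennreal \<bar>u z\<bar> \<le> ennreal F" using NF(2) by (rule order_trans)
        then show ?case using F(2) by simp
      qed
      have boundf: "AE z in lebesgue_on (I \<times> (\<Omega> \<inter> ball 0 1)). \<bar>f z\<bar> \<le> F"
        using lef
      proof eventually_elim
        case (elim z)
        then have "ennreal \<bar>f z\<bar> \<le> ennreal F" using NF(1) by (rule order_trans)
        then show ?case using F(2) by simp
      qed
      show ?thesis
      \<comment> \<open>The normalisation divides by \<open>F\<close>; if it is 0, then
        \<open>u\<close> vanishes almost everywhere and the zero function is the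
        modification.\<close>
      proof (cases "F = 0")
        case True
        have "AE z in lebesgue_on (I \<times> UNIV). 0 = u z" using boundu by eventually_elim (simp add: True)
        moreover have "Hoelder_seminorm (1/2) s Q (\<lambda>_. 0) \<le> ennreal 0" by (rule Hoelder_seminorm_le) auto
        moreover have "Linfty_norm Q (\<lambda>_. 0) \<le> 0"
          by (rule Linfty_norm_le[OF Qm, of "\<lambda>_. 0"]) auto
        ultimately show ?thesis by (intro exI[of _ "\<lambda>_. 0"]) (simp add: Hoelder_norm_def)
      next
        case False
        then have F0: "0 < F" using F by simp
        obtain u' f' where core: "core_solution s \<mu> (\<Omega> \<inter> ball 0 1) u' f'"
          and uu'0: "AE z in lebesgue. z \<in> {-1<..<0} \<times> UNIV \<longrightarrow> u z = F * u' z"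
          by (rule weak_solution_imp_core[OF sol open_Int[OF open\<Omega> open_ball] F0 boundu[unfolded I_def] boundf[unfolded I_def]])
        have uu': "AE z in lebesgue. z \<in> I \<times> UNIV \<longrightarrow> u z = F * u' z"
          using uu'0 by (simp only: I_def)
        have "AE w in lborel. fst w \<in> {-1<..<0} \<longrightarrow> snd w \<in> ball 0 1 - \<Omega> \<longrightarrow> u' w = 0"
        proof -
          have "I \<times> (ball 0 1 - \<Omega>) \<in> sets borel"
            unfolding I_def using open\<Omega> by (intro borel_Times) auto
          then have "AE z in lebesgue. z \<in> I \<times> (ball 0 1 - \<Omega>) \<longrightarrow> u z = 0"
            using zero unfolding I_def by (subst (asm) AE_restrict_space_iff) auto
          with uu' have "AE w in lebesgue. fst w \<in> {-1<..<0} \<longrightarrow> snd w \<in> ball 0 1 - \<Omega> \<longrightarrow> u' w = 0"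
          proof eventually_elim
            case (elim w)
            then show ?case using F0 by (cases w) (auto simp: I_def)
          qed
          then show ?thesis by (simp only: AE_completion_iff)
        qed
        then have adm: "admissible s lam Lam \<Omega> \<mu> u' f'" using mu core by (simp add: admissible_def)
        obtain G where G0: "(AE w in lborel. w \<in> Q \<longrightarrow> w \<in> G) \<and>
          (\<forall>w\<in>G. \<forall>w'\<in>G. \<bar>u' w - u' w'\<bar> \<le> C * (\<bar>fst w - fst w'\<bar> powr (1/2) + norm (snd w - snd w') powr s))"
          using reg[OF mu core C0(2)[OF adm]] unfolding Q_def ..
        have G: "AE w in lborel. w \<in> Q \<longrightarrow> w \<in> G"
          "\<And>w w'. w \<in> G \<Longrightarrow> w' \<in> G \<Longrightarrow> \<bar>u' w - u' w'\<bar> \<le> C * (\<bar>fst w - fst w'\<bar> powr (1/2) + norm (snd w - snd w') powr s)"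
          using conjunct1[OF G0] bspec[OF bspec[OF conjunct2[OF G0]]] by simp_all
        obtain v1 where v1: "\<And>w. w \<in> G \<Longrightarrow> v1 w = u' w" "\<And>w w'. \<bar>v1 w - v1 w'\<bar> \<le> C * parabolic_dist s w w'"
        proof (rule McShane_extension[of G u' C "parabolic_dist s"])
          show "\<bar>u' w - u' w'\<bar> \<le> C * parabolic_dist s w w'" if "w \<in> G" "w' \<in> G" for w w'
            using G(2)[OF that] by (simp add: parabolic_dist_def)
          show "parabolic_dist s w w'' \<le> parabolic_dist s w w' + parabolic_dist s w' w''" for w w' w'' :: "real \<times> (real ^ 'n)"
            by (rule parabolic_dist_triangle[OF s])
        qed (use C in \<open>auto simp: parabolic_dist_def norm_minus_commute abs_minus_commute\<close>)
        \<comment> \<open>Inside \<open>Q\<close> the extension from the set \<open>G\<close> of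
          full measure is used; elsewhere \<open>v\<close> has to agree with \<open>u\<close>, about
          whose regularity nothing is claimed there.\<close>
        define v where "v = (\<lambda>z. if z \<in> Q then F * v1 z else u z)"
        have vu': "AE z in lebesgue. z \<in> Q \<longrightarrow> v z = F * u' z"
          using AE_completion[OF G(1)] by eventually_elim (auto simp: v_def v1)
        have vu: "AE z in lebesgue. z \<in> I \<times> UNIV \<longrightarrow> v z = u z"
          using vu' uu'
        proof eventually_elim
          case (elim z)
          then show ?case by (cases "z \<in> Q") (auto simp: v_def)
        qed
        have "Linfty_norm Q v \<le> Nu"
        proof (rule Linfty_norm_le[OF Qm _ vu'])
          have "u' \<in> borel_measurable borel" using core unfolding core_solution_def by (rule conjunct1)
          then show "(\<lambda>z. F * u' z) \<in> borel_measurable borel" by (intro borel_measurable_times borel_measurable_const)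
          have "AE z in lebesgue. z \<in> I \<times> UNIV \<longrightarrow> ennreal \<bar>u z\<bar> \<le> Nu"
            using leu Im by (subst (asm) AE_restrict_space_iff) auto
          with vu show "AE z in lebesgue. z \<in> Q \<longrightarrow> ennreal \<bar>v z\<bar> \<le> Nu"
          proof eventually_elim
            case (elim z)
            then show ?case using QI by auto
          qed
        qed
        moreover have "Hoelder_seminorm (1/2) s Q v \<le> ennreal (F * C)"
        proof (rule Hoelder_seminorm_le)
          fix p q assume "p \<in> Q" "q \<in> Q"
          then have "\<bar>v p - v q\<bar> = F * \<bar>v1 p - v1 q\<bar>"
            using F0 by (simp add: v_def right_diff_distrib[symmetric] abs_mult)
          also have "\<dots> \<le> F * (C * parabolic_dist s p q)" using v1(2)[of p q] F0 by (intro mult_left_mono) auto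
          finally show "\<bar>v p - v q\<bar> \<le> F * C * parabolic_dist s p q" by simp
        qed (use F0 C in simp)
        ultimately have "Hoelder_norm (1/2) s Q v \<le> Nu + ennreal (F * C)"
          unfolding Hoelder_norm_def by (rule add_mono)
        also have "\<dots> \<le> ennreal F + ennreal (F * C)" using NF by (intro add_right_mono)
        also have "\<dots> = ennreal (F + F * C)" using F(2) C by (intro ennreal_plus[symmetric]) auto
        also have "F + F * C = (C + 1) * F" by (simp add: algebra_simps)
        also have "ennreal ((C + 1) * F) = ennreal (C + 1) * (Nf + Nu)"
          unfolding F(1)[symmetric] using F(2) C by (intro ennreal_mult) auto
        finally have "Hoelder_norm (1/2) s Q v \<le> ennreal (C + 1) * (Nf + Nu)" .
        moreover have "AE z in lebesgue_on (I \<times> UNIV). v z = u z"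
          using vu Im by (subst AE_restrict_space_iff) auto
        ultimately show ?thesis by blast
      qed
    qed
    then show "\<exists>v. (AE z in lebesgue_on ({-1<..<0} \<times> UNIV). v z = u z) \<and>
        Hoelder_norm (1/2) s ({-1/2<..<0} \<times> ball 0 (1/2)) v
          \<le> ennreal (C + 1) * (Linfty_norm ({-1<..<0} \<times> (\<Omega> \<inter> ball 0 1)) f + Linfty_norm ({-1<..<0} \<times> UNIV) u)"
      unfolding I_def Q_def Nf_def Nu_def .
  qed
qed

end
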